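(* Let $(K,\delta)$ be a differential field of characteristic zero and let $X/K$ be a smooth variety. An element $\omega\in H^0(X,\Omega^1_{X/K})$ lifts to an element of $H^0(X,\Omega^{\tau}_{X/K})$ (under $\lambda\colon\Omega^{\tau}_{X/K}\to\Omega^1_{X/K}$) if and only if $\mathrm{KS}_X(\delta)\smile\omega=0$ in $H^1(X,\mathcal{O}_X)$.
   Context: $\Omega^{\tau}_{X/K}$ is the sheaf of Kodaira–Spencer forms: locally generated over $\mathcal{O}_X$ by $1$ and symbols $d^{\tau}a$ subject to $d^{\tau}(ab)=d^{\tau}(a)b+a\,d^{\tau}(b)$, $d^{\tau}(a+b)=d^{\tau}(a)+d^{\tau}(b)$, $d^{\tau}(c)=\delta(c)\cdot1$ for $c\in K$; $\lambda(d^{\tau}a)=da$, $\lambda(1)=0$, giving an exact sequence $0\to\mathcal{O}_X\to\Omega^{\tau}_{X/K}\to\Omega^1_{X/K}\to0$. $\mathrm{KS}_X(\delta)\in H^1(X,T_{X/K})$ is the Kodaira–Spencer class: the Čech class of $(\delta_i-\delta_j)$ where $\delta_i$ are derivations on an affine open cover $(V_i)$ extending $\delta$; $\smile$ denotes the cup product pairing $H^1(X,T_{X/K})\times H^0(X,\Omega^1_{X/K})\to H^1(X,\mathcal{O}_X)$. *)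

theory Defs
  imports
    "HOL-Algebra.QuotRing"
    "HOL-Algebra.Module"
    "HOL-Algebra.Generated_Rings"
    "HOL-Analysis.Abstract_Topology"
    "HOL-Library.Poly_Mapping"
begin

section \<open>The base field\<close>

text \<open>The base field is a type \<open>'k\<close> of class \<^class>\<open>field_char_0\<close>; \<open>K_ring\<close> is the same field as an
  object of HOL-Algebra, so that structure maps of \<open>K\<close>-algebras are elements of \<^const>\<open>ring_hom\<close>.\<close>

definition K_ring :: "'k::field_char_0 ring" where
  "K_ring = \<lparr>carrier = UNIV, mult = (*), one = 1, zero = 0, add = (+)\<rparr>"

definition field_derivation :: "('k::field_char_0 \<Rightarrow> 'k) \<Rightarrow> bool" where
  "field_derivation \<delta> \<longleftrightarrow>
     (\<forall>a b. \<delta> (a + b) = \<delta> a + \<delta> b) \<and> (\<forall>a b. \<delta> (a * b) = \<delta> a * b + a * \<delta> b)"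


section \<open>Presheaves and ringed spaces over \<open>K\<close>\<close>

text \<open>Only the values at open sets are meaningful. For sheaves of abelian groups the fields
  \<^const>\<open>mult\<close> and \<^const>\<open>one\<close> of the section records are ignored.\<close>

record ('p, 'a) presheaf =
  Sec :: "'p set \<Rightarrow> 'a ring"
  Res :: "'p set \<Rightarrow> 'p set \<Rightarrow> 'a \<Rightarrow> 'a"

definition ring_sheaf :: "'p topology \<Rightarrow> ('p, 'a) presheaf \<Rightarrow> bool" where
  "ring_sheaf T F \<longleftrightarrow>
     (\<forall>U. openin T U \<longrightarrow> cring (Sec F U)) \<and>
     (\<forall>U V. openin T U \<and> openin T V \<and> V \<subseteq> U \<longrightarrow> Res F U V \<in> ring_hom (Sec F U) (Sec F V)) \<and>
     (\<forall>U. openin T U \<longrightarrow> (\<forall>s\<in>carrier (Sec F U). Res F U U s = s)) \<and>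
     (\<forall>U V W. openin T U \<and> openin T V \<and> openin T W \<and> V \<subseteq> U \<and> W \<subseteq> V \<longrightarrow>
        (\<forall>s\<in>carrier (Sec F U). Res F V W (Res F U V s) = Res F U W s)) \<and>
     (\<forall>\<U> s. (\<forall>U\<in>\<U>. openin T U \<and> s U \<in> carrier (Sec F U)) \<and>
        (\<forall>U\<in>\<U>. \<forall>V\<in>\<U>. Res F U (U \<inter> V) (s U) = Res F V (U \<inter> V) (s V)) \<longrightarrow>
        (\<exists>!t. t \<in> carrier (Sec F (\<Union>\<U>)) \<and> (\<forall>U\<in>\<U>. Res F (\<Union>\<U>) U t = s U)))"

text \<open>A morphism to \<open>Spec K\<close> is encoded as the corresponding ring homomorphism \<open>cst\<close> from \<open>K\<close> to
  the ring of global sections.\<close>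

record ('p, 'a, 'k) kspace =
  topo :: "'p topology"
  Str :: "('p, 'a) presheaf"
  cst :: "'k \<Rightarrow> 'a"

abbreviation pts :: "('p, 'a, 'k) kspace \<Rightarrow> 'p set" where
  "pts X \<equiv> topspace (topo X)"

abbreviation Sect :: "('p, 'a, 'k) kspace \<Rightarrow> 'p set \<Rightarrow> 'a ring" where
  "Sect X \<equiv> Sec (Str X)"

abbreviation Rest :: "('p, 'a, 'k) kspace \<Rightarrow> 'p set \<Rightarrow> 'p set \<Rightarrow> 'a \<Rightarrow> 'a" where
  "Rest X \<equiv> Res (Str X)"

definition cst_on :: "('p, 'a, 'k) kspace \<Rightarrow> 'p set \<Rightarrow> 'k \<Rightarrow> 'a" where
  "cst_on X U c = Rest X (pts X) U (cst X c)"

definition ringed_space_over_K :: "('p, 'a, 'k::field_char_0) kspace \<Rightarrow> bool" where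
  "ringed_space_over_K X \<longleftrightarrow>
     ring_sheaf (topo X) (Str X) \<and> cst X \<in> ring_hom K_ring (Sect X (pts X))"

definition open_subspace :: "('p, 'a, 'k) kspace \<Rightarrow> 'p set \<Rightarrow> ('p, 'a, 'k) kspace" where
  "open_subspace X U = \<lparr>topo = subtopology (topo X) U, Str = Str X, cst = cst_on X U\<rparr>"

definition iso_over_K :: "('p, 'a, 'k) kspace \<Rightarrow> ('q, 'b, 'k) kspace \<Rightarrow> bool" where
  "iso_over_K X Y \<longleftrightarrow> (\<exists>f \<phi>. homeomorphic_map (topo X) (topo Y) f \<and>
     (let pre = (\<lambda>V. {x \<in> pts X. f x \<in> V}) in
       (\<forall>V. openin (topo Y) V \<longrightarrow> \<phi> V \<in> ring_iso (Sect Y V) (Sect X (pre V))) \<and>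
       (\<forall>V W. openin (topo Y) V \<and> openin (topo Y) W \<and> W \<subseteq> V \<longrightarrow>
          (\<forall>s\<in>carrier (Sect Y V). \<phi> W (Rest Y V W s) = Rest X (pre V) (pre W) (\<phi> V s))) \<and>
       (\<forall>c. \<phi> (pts Y) (cst Y c) = cst X c)))"


section \<open>The spectrum of a \<open>K\<close>-algebra\<close>

definition Spec_pts :: "'a ring \<Rightarrow> 'a set set" where
  "Spec_pts R = {P. primeideal P R}"

definition Zariski :: "'a ring \<Rightarrow> 'a set topology" where
  "Zariski R = topology_generated_by {{P \<in> Spec_pts R. f \<notin> P} | f. f \<in> carrier R}"

text \<open>The fraction \<open>a / s\<close> in the local ring at the prime \<open>P\<close>, as an equivalence class.\<close>

definition frac :: "'a ring \<Rightarrow> 'a set \<Rightarrow> 'a \<Rightarrow> 'a \<Rightarrow> ('a \<times> 'a) set" where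
  "frac R P a s = {(b, t). b \<in> carrier R \<and> t \<in> carrier R - P \<and>
     (\<exists>u\<in>carrier R - P. u \<otimes>\<^bsub>R\<^esub> (a \<otimes>\<^bsub>R\<^esub> t \<ominus>\<^bsub>R\<^esub> b \<otimes>\<^bsub>R\<^esub> s) = \<zero>\<^bsub>R\<^esub>)}"

definition Spec_sec :: "'a ring \<Rightarrow> 'a set set \<Rightarrow> ('a set \<Rightarrow> ('a \<times> 'a) set) ring" where
  "Spec_sec R U =
     \<lparr>carrier = {\<sigma> \<in> extensional U. \<forall>P\<in>U. \<exists>V. openin (Zariski R) V \<and> P \<in> V \<and> V \<subseteq> U \<and>
        (\<exists>a\<in>carrier R. \<exists>s\<in>carrier R. \<forall>Q\<in>V. s \<notin> Q \<and> \<sigma> Q = frac R Q a s)},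
      mult = (\<lambda>\<sigma> \<tau>. \<lambda>P\<in>U. \<Union>(a, s)\<in>\<sigma> P. \<Union>(b, t)\<in>\<tau> P. frac R P (a \<otimes>\<^bsub>R\<^esub> b) (s \<otimes>\<^bsub>R\<^esub> t)),
      one = (\<lambda>P\<in>U. frac R P \<one>\<^bsub>R\<^esub> \<one>\<^bsub>R\<^esub>),
      zero = (\<lambda>P\<in>U. frac R P \<zero>\<^bsub>R\<^esub> \<one>\<^bsub>R\<^esub>),
      add = (\<lambda>\<sigma> \<tau>. \<lambda>P\<in>U. \<Union>(a, s)\<in>\<sigma> P. \<Union>(b, t)\<in>\<tau> P.
        frac R P (a \<otimes>\<^bsub>R\<^esub> t \<oplus>\<^bsub>R\<^esub> b \<otimes>\<^bsub>R\<^esub> s) (s \<otimes>\<^bsub>R\<^esub> t))\<rparr>"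

definition Spec :: "'a ring \<Rightarrow> ('k \<Rightarrow> 'a) \<Rightarrow> ('a set, 'a set \<Rightarrow> ('a \<times> 'a) set, 'k) kspace" where
  "Spec R \<iota> =
     \<lparr>topo = Zariski R,
      Str = \<lparr>Sec = Spec_sec R, Res = (\<lambda>U V \<sigma>. restrict \<sigma> V)\<rparr>,
      cst = (\<lambda>c. \<lambda>P\<in>Spec_pts R. frac R P (\<iota> c) \<one>\<^bsub>R\<^esub>)\<rparr>"

text \<open>In \<open>affine_chart X U R \<iota>\<close> the coordinate ring \<open>R\<close> lives in the type of the sections of \<open>X\<close>.
  This is no restriction, since \<open>R\<close> is isomorphic to the ring of sections over \<open>U\<close>.\<close>

definition affine_chart ::
    "('p, 'a, 'k::field_char_0) kspace \<Rightarrow> 'p set \<Rightarrow> 'a ring \<Rightarrow> ('k \<Rightarrow> 'a) \<Rightarrow> bool" where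
  "affine_chart X U R \<iota> \<longleftrightarrow> openin (topo X) U \<and> cring R \<and> \<iota> \<in> ring_hom K_ring R \<and>
     iso_over_K (open_subspace X U) (Spec R \<iota>)"

definition affine_open :: "('p, 'a, 'k::field_char_0) kspace \<Rightarrow> 'p set \<Rightarrow> bool" where
  "affine_open X U \<longleftrightarrow> (\<exists>R \<iota>. affine_chart X U R \<iota>)"

text \<open>A ringed space that is locally isomorphic to spectra is automatically locally ringed.\<close>

definition scheme_over_K :: "('p, 'a, 'k::field_char_0) kspace \<Rightarrow> bool" where
  "scheme_over_K X \<longleftrightarrow> ringed_space_over_K X \<and> (\<forall>x\<in>pts X. \<exists>U. affine_open X U \<and> x \<in> U)"


section \<open>Smooth varieties\<close>

definition integral_scheme :: "('p, 'a, 'k) kspace \<Rightarrow> bool" where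
  "integral_scheme X \<longleftrightarrow> pts X \<noteq> {} \<and> (\<forall>U. openin (topo X) U \<and> U \<noteq> {} \<longrightarrow> domain (Sect X U))"

definition finite_type :: "('p, 'a, 'k::field_char_0) kspace \<Rightarrow> bool" where
  "finite_type X \<longleftrightarrow> (\<exists>\<U>. finite \<U> \<and> \<Union>\<U> = pts X \<and>
     (\<forall>U\<in>\<U>. affine_open X U \<and>
        (\<exists>S. finite S \<and> S \<subseteq> carrier (Sect X U) \<and>
           generate_ring (Sect X U) (range (cst_on X U) \<union> S) = carrier (Sect X U))))"

text \<open>The products of two affine opens \<open>U\<close>, \<open>V\<close> cover the fibre square of \<open>X\<close>, and the diagonal
  restricts over such a product to the morphism from \<open>U \<inter> V\<close> to the spectrum of the tensor product of the
  rings of sections over \<open>U\<close> and \<open>V\<close>. So the diagonal is a closed immersion iff every \<open>U \<inter> V\<close> is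
  affine and every map from the tensor product to the sections over \<open>U \<inter> V\<close> is surjective.\<close>

definition separated :: "('p, 'a, 'k::field_char_0) kspace \<Rightarrow> bool" where
  "separated X \<longleftrightarrow> (\<forall>U V. affine_open X U \<and> affine_open X V \<longrightarrow>
     affine_open X (U \<inter> V) \<and>
     generate_ring (Sect X (U \<inter> V))
       (Rest X U (U \<inter> V) ` carrier (Sect X U) \<union> Rest X V (U \<inter> V) ` carrier (Sect X V))
       = carrier (Sect X (U \<inter> V)))"

definition variety :: "('p, 'a, 'k::field_char_0) kspace \<Rightarrow> bool" where
  "variety X \<longleftrightarrow> scheme_over_K X \<and> integral_scheme X \<and> separated X \<and> finite_type X"

type_synonym 'k mpoly = "(nat \<Rightarrow>\<^sub>0 nat) \<Rightarrow>\<^sub>0 'k"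

definition mpolys :: "nat \<Rightarrow> ('k::field_char_0) mpoly set" where
  "mpolys n = {p. \<forall>m\<in>Poly_Mapping.keys p. Poly_Mapping.keys m \<subseteq> {..<n}}"

definition mpoly_deriv :: "nat \<Rightarrow> ('k::field_char_0) mpoly \<Rightarrow> 'k mpoly" where
  "mpoly_deriv j p = (\<Sum>m\<in>Poly_Mapping.keys p.
     Poly_Mapping.single (m - Poly_Mapping.single j 1)
       (of_nat (Poly_Mapping.lookup m j) * Poly_Mapping.lookup p m))"

definition mpoly_eval ::
    "'a ring \<Rightarrow> ('k::field_char_0 \<Rightarrow> 'a) \<Rightarrow> (nat \<Rightarrow> 'a) \<Rightarrow> 'k mpoly \<Rightarrow> 'a" where
  "mpoly_eval R \<iota> x p = (\<Oplus>\<^bsub>R\<^esub>m\<in>Poly_Mapping.keys p. \<iota> (Poly_Mapping.lookup p m) \<otimes>\<^bsub>R\<^esub>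
     (\<Otimes>\<^bsub>R\<^esub>j\<in>Poly_Mapping.keys m. x j [^]\<^bsub>R\<^esub> Poly_Mapping.lookup m j))"

text \<open>A standard smooth algebra is one of the form \<open>K[x\<^sub>0, \<dots>, x\<^sub>n\<^sub>-\<^sub>1] / (f\<^sub>0, \<dots>, f\<^sub>c\<^sub>-\<^sub>1)\<close> in which the
  Jacobian matrix of the \<open>f\<^sub>i\<close> with respect to the first \<open>c\<close> variables is invertible.\<close>

definition standard_smooth :: "'a ring \<Rightarrow> ('k::field_char_0 \<Rightarrow> 'a) \<Rightarrow> bool" where
  "standard_smooth R \<iota> \<longleftrightarrow> (\<exists>n c (f :: nat \<Rightarrow> 'k mpoly) x.
     c \<le> n \<and> (\<forall>i<c. f i \<in> mpolys n) \<and> (\<forall>j<n. x j \<in> carrier R) \<and>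
     mpoly_eval R \<iota> x ` mpolys n = carrier R \<and>
     (\<forall>p\<in>mpolys n. mpoly_eval R \<iota> x p = \<zero>\<^bsub>R\<^esub> \<longleftrightarrow>
        (\<exists>g. (\<forall>i<c. g i \<in> mpolys n) \<and> p = (\<Sum>i<c. g i * f i))) \<and>
     (\<exists>B. (\<forall>i<c. \<forall>j<c. B i j \<in> carrier R) \<and>
        (let J = (\<lambda>i j. mpoly_eval R \<iota> x (mpoly_deriv j (f i))) in
          (\<forall>i<c. \<forall>k<c. (\<Oplus>\<^bsub>R\<^esub>j\<in>{..<c}. J i j \<otimes>\<^bsub>R\<^esub> B j k) = (if i = k then \<one>\<^bsub>R\<^esub> else \<zero>\<^bsub>R\<^esub>)) \<and>
          (\<forall>i<c. \<forall>k<c. (\<Oplus>\<^bsub>R\<^esub>j\<in>{..<c}. B i j \<otimes>\<^bsub>R\<^esub> J j k) = (if i = k then \<one>\<^bsub>R\<^esub> else \<zero>\<^bsub>R\<^esub>)))))"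

definition smooth :: "('p, 'a, 'k::field_char_0) kspace \<Rightarrow> bool" where
  "smooth X \<longleftrightarrow> (\<forall>x\<in>pts X. \<exists>U R \<iota>. x \<in> U \<and> affine_chart X U R \<iota> \<and> standard_smooth R \<iota>)"


section \<open>Kaehler differentials and Kodaira--Spencer forms\<close>

subsection \<open>Sheafification\<close>

definition germ :: "'p topology \<Rightarrow> ('p set \<Rightarrow> 's set) \<Rightarrow> ('p set \<Rightarrow> 'p set \<Rightarrow> 's \<Rightarrow> 's) \<Rightarrow>
    'p \<Rightarrow> 'p set \<times> 's \<Rightarrow> ('p set \<times> 's) set" where
  "germ T F r p = (\<lambda>(U, s). {(V, t). openin T V \<and> p \<in> V \<and> t \<in> F V \<and>
     (\<exists>W. openin T W \<and> p \<in> W \<and> W \<subseteq> U \<inter> V \<and> r U W s = r V W t)})"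

definition sheafify :: "'p topology \<Rightarrow> ('p set \<Rightarrow> 's set) \<Rightarrow> ('p set \<Rightarrow> 'p set \<Rightarrow> 's \<Rightarrow> 's) \<Rightarrow>
    'p set \<Rightarrow> ('p \<Rightarrow> ('p set \<times> 's) set) set" where
  "sheafify T F r U = {\<sigma> \<in> extensional U. \<forall>p\<in>U. \<exists>V. openin T V \<and> p \<in> V \<and> V \<subseteq> U \<and>
     (\<exists>s\<in>F V. \<forall>q\<in>V. \<sigma> q = germ T F r q (V, s))}"

subsection \<open>Modules by generators and relations\<close>

definition free_mod :: "'a ring \<Rightarrow> 'g set \<Rightarrow> ('a, 'g \<Rightarrow> 'a) module" where
  "free_mod R B =
     \<lparr>carrier = {v. (\<forall>b. v b \<in> carrier R) \<and> finite {b. v b \<noteq> \<zero>\<^bsub>R\<^esub>} \<and> {b. v b \<noteq> \<zero>\<^bsub>R\<^esub>} \<subseteq> B},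
      mult = undefined, one = undefined,
      zero = (\<lambda>_. \<zero>\<^bsub>R\<^esub>), add = (\<lambda>v w b. v b \<oplus>\<^bsub>R\<^esub> w b),
      smult = (\<lambda>r v b. r \<otimes>\<^bsub>R\<^esub> v b)\<rparr>"

definition gen :: "'a ring \<Rightarrow> 'g \<Rightarrow> 'g \<Rightarrow> 'a" where
  "gen R b = (\<lambda>x. if x = b then \<one>\<^bsub>R\<^esub> else \<zero>\<^bsub>R\<^esub>)"

definition submodule_span ::
    "'a ring \<Rightarrow> ('a, 'v) module \<Rightarrow> 'v set \<Rightarrow> 'v set" where
  "submodule_span R M S = \<Inter>{N. submodule N R M \<and> S \<subseteq> N}"

text \<open>The map of free modules along a ring homomorphism \<open>\<rho>\<close> from \<open>R\<close> to \<open>S\<close> that sends the basis element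
  \<open>b\<close> to \<open>g b\<close>.\<close>

definition push :: "'a ring \<Rightarrow> 'a ring \<Rightarrow> ('a \<Rightarrow> 'a) \<Rightarrow> ('g \<Rightarrow> 'g) \<Rightarrow> ('g \<Rightarrow> 'a) \<Rightarrow> 'g \<Rightarrow> 'a" where
  "push R S \<rho> g v = (\<lambda>c. \<Oplus>\<^bsub>S\<^esub>b\<in>{b. v b \<noteq> \<zero>\<^bsub>R\<^esub> \<and> g b = c}. \<rho> (v b))"

subsection \<open>The sheaf of Kaehler differentials\<close>

text \<open>The generator of \<open>kaehler_free R\<close> indexed by \<open>a\<close> stands for \<open>d a\<close>.\<close>

definition kaehler_free :: "'a ring \<Rightarrow> ('a, 'a \<Rightarrow> 'a) module" where
  "kaehler_free R = free_mod R (carrier R)"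

definition kaehler_rels :: "'a ring \<Rightarrow> ('k \<Rightarrow> 'a) \<Rightarrow> ('a \<Rightarrow> 'a) set" where
  "kaehler_rels R \<iota> = (let M = kaehler_free R; d = gen R in submodule_span R M
     ({d (a \<otimes>\<^bsub>R\<^esub> b) \<ominus>\<^bsub>M\<^esub> (b \<odot>\<^bsub>M\<^esub> d a \<oplus>\<^bsub>M\<^esub> a \<odot>\<^bsub>M\<^esub> d b) | a b. a \<in> carrier R \<and> b \<in> carrier R} \<union>
      {d (a \<oplus>\<^bsub>R\<^esub> b) \<ominus>\<^bsub>M\<^esub> (d a \<oplus>\<^bsub>M\<^esub> d b) | a b. a \<in> carrier R \<and> b \<in> carrier R} \<union>
      {d (\<iota> c) | c. True}))"

definition kaehler_sec :: "('p, 'a, 'k) kspace \<Rightarrow> 'p set \<Rightarrow> ('a \<Rightarrow> 'a) set set" where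
  "kaehler_sec X U =
     a_rcosets\<^bsub>kaehler_free (Sect X U)\<^esub> (kaehler_rels (Sect X U) (cst_on X U))"

definition kaehler_res ::
    "('p, 'a, 'k) kspace \<Rightarrow> 'p set \<Rightarrow> 'p set \<Rightarrow> ('a \<Rightarrow> 'a) set \<Rightarrow> ('a \<Rightarrow> 'a) set" where
  "kaehler_res X U V C = (\<Union>v\<in>C. kaehler_rels (Sect X V) (cst_on X V) +>\<^bsub>kaehler_free (Sect X V)\<^esub>
     push (Sect X U) (Sect X V) (Rest X U V) (Rest X U V) v)"

definition Omega ::
    "('p, 'a, 'k) kspace \<Rightarrow> 'p set \<Rightarrow> ('p \<Rightarrow> ('p set \<times> ('a \<Rightarrow> 'a) set) set) set" where
  "Omega X = sheafify (topo X) (kaehler_sec X) (kaehler_res X)"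

subsection \<open>The sheaf of Kodaira--Spencer forms\<close>

text \<open>The generator of \<open>ks_free R\<close> indexed by \<^const>\<open>None\<close> stands for \<open>1\<close>, the one indexed by \<open>Some a\<close>
  for \<open>d\<^sup>\<tau> a\<close>.\<close>

definition ks_free :: "'a ring \<Rightarrow> ('a, 'a option \<Rightarrow> 'a) module" where
  "ks_free R = free_mod R (insert None (Some ` carrier R))"

definition ks_rels :: "'a ring \<Rightarrow> ('k \<Rightarrow> 'a) \<Rightarrow> ('k \<Rightarrow> 'k) \<Rightarrow> ('a option \<Rightarrow> 'a) set" where
  "ks_rels R \<iota> \<delta> = (let M = ks_free R; e = gen R None; d = (\<lambda>a. gen R (Some a)) in
     submodule_span R M
     ({d (a \<otimes>\<^bsub>R\<^esub> b) \<ominus>\<^bsub>M\<^esub> (b \<odot>\<^bsub>M\<^esub> d a \<oplus>\<^bsub>M\<^esub> a \<odot>\<^bsub>M\<^esub> d b) | a b. a \<in> carrier R \<and> b \<in> carrier R} \<union>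
      {d (a \<oplus>\<^bsub>R\<^esub> b) \<ominus>\<^bsub>M\<^esub> (d a \<oplus>\<^bsub>M\<^esub> d b) | a b. a \<in> carrier R \<and> b \<in> carrier R} \<union>
      {d (\<iota> c) \<ominus>\<^bsub>M\<^esub> \<iota> (\<delta> c) \<odot>\<^bsub>M\<^esub> e | c. True}))"

definition ks_sec ::
    "('p, 'a, 'k) kspace \<Rightarrow> ('k \<Rightarrow> 'k) \<Rightarrow> 'p set \<Rightarrow> ('a option \<Rightarrow> 'a) set set" where
  "ks_sec X \<delta> U = a_rcosets\<^bsub>ks_free (Sect X U)\<^esub> (ks_rels (Sect X U) (cst_on X U) \<delta>)"

definition ks_res :: "('p, 'a, 'k) kspace \<Rightarrow> ('k \<Rightarrow> 'k) \<Rightarrow> 'p set \<Rightarrow> 'p set \<Rightarrow>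
    ('a option \<Rightarrow> 'a) set \<Rightarrow> ('a option \<Rightarrow> 'a) set" where
  "ks_res X \<delta> U V C = (\<Union>v\<in>C. ks_rels (Sect X V) (cst_on X V) \<delta> +>\<^bsub>ks_free (Sect X V)\<^esub>
     push (Sect X U) (Sect X V) (Rest X U V) (map_option (Rest X U V)) v)"

definition Omega_tau :: "('p, 'a, 'k) kspace \<Rightarrow> ('k \<Rightarrow> 'k) \<Rightarrow> 'p set \<Rightarrow>
    ('p \<Rightarrow> ('p set \<times> ('a option \<Rightarrow> 'a) set) set) set" where
  "Omega_tau X \<delta> = sheafify (topo X) (ks_sec X \<delta>) (ks_res X \<delta>)"

definition lambda_pre ::
    "('p, 'a, 'k) kspace \<Rightarrow> 'p set \<Rightarrow> ('a option \<Rightarrow> 'a) set \<Rightarrow> ('a \<Rightarrow> 'a) set" where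
  "lambda_pre X U C = (\<Union>v\<in>C. kaehler_rels (Sect X U) (cst_on X U) +>\<^bsub>kaehler_free (Sect X U)\<^esub>
     (\<lambda>a. v (Some a)))"

definition lambda :: "('p, 'a, 'k) kspace \<Rightarrow> 'p set \<Rightarrow>
    ('p \<Rightarrow> ('p set \<times> ('a option \<Rightarrow> 'a) set) set) \<Rightarrow> ('p \<Rightarrow> ('p set \<times> ('a \<Rightarrow> 'a) set) set)" where
  "lambda X U \<eta> = (\<lambda>p\<in>U. \<Union>(V, C)\<in>\<eta> p.
     germ (topo X) (kaehler_sec X) (kaehler_res X) p (V, lambda_pre X V C))"


section \<open>Derivations and the tangent sheaf\<close>

definition on_opens ::
    "('p, 'a, 'k) kspace \<Rightarrow> 'p set \<Rightarrow> ('p set \<Rightarrow> 'a \<Rightarrow> 'a) \<Rightarrow> ('p set \<Rightarrow> 'a \<Rightarrow> 'a)" where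
  "on_opens X U D = (\<lambda>W a. if openin (topo X) W \<and> W \<subseteq> U \<and> a \<in> carrier (Sect X W)
     then D W a else undefined)"

text \<open>Derivations of the structure sheaf of the open subspace \<open>U\<close> into itself that extend \<open>\<delta>\<close>.\<close>

definition derivs ::
    "('p, 'a, 'k) kspace \<Rightarrow> ('k \<Rightarrow> 'k) \<Rightarrow> 'p set \<Rightarrow> ('p set \<Rightarrow> 'a \<Rightarrow> 'a) set" where
  "derivs X \<delta> U = {D. on_opens X U D = D \<and>
     (\<forall>W. openin (topo X) W \<and> W \<subseteq> U \<longrightarrow> (let R = Sect X W in
        D W \<in> carrier R \<rightarrow> carrier R \<and>
        (\<forall>a\<in>carrier R. \<forall>b\<in>carrier R. D W (a \<oplus>\<^bsub>R\<^esub> b) = D W a \<oplus>\<^bsub>R\<^esub> D W b) \<and>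
        (\<forall>a\<in>carrier R. \<forall>b\<in>carrier R.
           D W (a \<otimes>\<^bsub>R\<^esub> b) = D W a \<otimes>\<^bsub>R\<^esub> b \<oplus>\<^bsub>R\<^esub> a \<otimes>\<^bsub>R\<^esub> D W b) \<and>
        (\<forall>c. D W (cst_on X W c) = cst_on X W (\<delta> c)))) \<and>
     (\<forall>V W. openin (topo X) V \<and> openin (topo X) W \<and> V \<subseteq> U \<and> W \<subseteq> V \<longrightarrow>
        (\<forall>a\<in>carrier (Sect X V). D W (Rest X V W a) = Rest X V W (D V a)))}"

text \<open>A derivation is \<open>K\<close>-linear iff it vanishes on \<open>K\<close>, i.e. extends the zero derivation.\<close>

definition tangent_sheaf ::
    "('p, 'a, 'k::field_char_0) kspace \<Rightarrow> ('p, 'p set \<Rightarrow> 'a \<Rightarrow> 'a) presheaf" where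
  "tangent_sheaf X =
     \<lparr>Sec = (\<lambda>U. \<lparr>carrier = derivs X (\<lambda>_. 0) U, mult = undefined, one = undefined,
        zero = on_opens X U (\<lambda>W _. \<zero>\<^bsub>Sect X W\<^esub>),
        add = (\<lambda>D E. on_opens X U (\<lambda>W a. D W a \<oplus>\<^bsub>Sect X W\<^esub> E W a))\<rparr>),
      Res = (\<lambda>U V D. on_opens X V D)\<rparr>"


section \<open>First cohomology\<close>

text \<open>First cohomology is Cech cohomology: the colimit of the first Cech cohomology groups over all
  open covers, which in degree one agrees with derived functor cohomology. A representative is a
  cover together with a 1-cocycle on it.\<close>

definition open_cover :: "'p topology \<Rightarrow> 'p set set \<Rightarrow> bool" where
  "open_cover T \<U> \<longleftrightarrow> (\<forall>U\<in>\<U>. openin T U) \<and> \<Union>\<U> = topspace T"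

type_synonym ('p, 's) cocycle = "'p set set \<times> ('p set \<Rightarrow> 'p set \<Rightarrow> 's)"

definition cocycles :: "'p topology \<Rightarrow> ('p, 's) presheaf \<Rightarrow> ('p, 's) cocycle set" where
  "cocycles T F = {(\<U>, c). open_cover T \<U> \<and>
     (\<forall>U\<in>\<U>. \<forall>V\<in>\<U>. c U V \<in> carrier (Sec F (U \<inter> V))) \<and>
     (\<forall>U\<in>\<U>. \<forall>V\<in>\<U>. \<forall>W\<in>\<U>. Res F (U \<inter> W) (U \<inter> V \<inter> W) (c U W) =
        Res F (U \<inter> V) (U \<inter> V \<inter> W) (c U V) \<oplus>\<^bsub>Sec F (U \<inter> V \<inter> W)\<^esub>
        Res F (V \<inter> W) (U \<inter> V \<inter> W) (c V W))}"

definition cohomologous ::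
    "'p topology \<Rightarrow> ('p, 's) presheaf \<Rightarrow> (('p, 's) cocycle \<times> ('p, 's) cocycle) set" where
  "cohomologous T F = {((\<U>, c), (\<V>, d)). (\<U>, c) \<in> cocycles T F \<and> (\<V>, d) \<in> cocycles T F \<and>
     (\<exists>\<W> r s b. open_cover T \<W> \<and>
        (\<forall>W\<in>\<W>. r W \<in> \<U> \<and> W \<subseteq> r W \<and> s W \<in> \<V> \<and> W \<subseteq> s W \<and> b W \<in> carrier (Sec F W)) \<and>
        (\<forall>W\<in>\<W>. \<forall>W'\<in>\<W>.
           Res F (r W \<inter> r W') (W \<inter> W') (c (r W) (r W')) \<ominus>\<^bsub>Sec F (W \<inter> W')\<^esub>
           Res F (s W \<inter> s W') (W \<inter> W') (d (s W) (s W')) =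
           Res F W (W \<inter> W') (b W) \<ominus>\<^bsub>Sec F (W \<inter> W')\<^esub> Res F W' (W \<inter> W') (b W')))}"

definition cech_class ::
    "'p topology \<Rightarrow> ('p, 's) presheaf \<Rightarrow> ('p, 's) cocycle \<Rightarrow> ('p, 's) cocycle set" where
  "cech_class T F z = cohomologous T F `` {z}"

definition H1 :: "'p topology \<Rightarrow> ('p, 's) presheaf \<Rightarrow> ('p, 's) cocycle set ring" where
  "H1 T F =
     \<lparr>carrier = cocycles T F // cohomologous T F, mult = undefined, one = undefined,
      zero = cech_class T F ({topspace T}, \<lambda>U V. \<zero>\<^bsub>Sec F (U \<inter> V)\<^esub>),
      add = (\<lambda>\<xi> \<zeta>. \<Union>(\<U>, c)\<in>\<xi>. \<Union>d\<in>{d. (\<U>, d) \<in> \<zeta>}.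
        cech_class T F (\<U>, \<lambda>U V. c U V \<oplus>\<^bsub>Sec F (U \<inter> V)\<^esub> d U V))\<rparr>"

definition H0 :: "('p, 'a, 'k) kspace \<Rightarrow> ('p set \<Rightarrow> 's) \<Rightarrow> 's" where
  "H0 X F = F (pts X)"


section \<open>The Kodaira--Spencer class and the cup product\<close>

definition KS_class :: "('p, 'a, 'k::field_char_0) kspace \<Rightarrow> ('k \<Rightarrow> 'k) \<Rightarrow>
    ('p, 'p set \<Rightarrow> 'a \<Rightarrow> 'a) cocycle set" where
  "KS_class X \<delta> = (THE \<xi>. \<exists>\<V> D. open_cover (topo X) \<V> \<and>
     (\<forall>V\<in>\<V>. affine_open X V \<and> D V \<in> derivs X \<delta> V) \<and>
     \<xi> = cech_class (topo X) (tangent_sheaf X)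
       (\<V>, \<lambda>U V. on_opens X (U \<inter> V) (\<lambda>W a. D U W a \<ominus>\<^bsub>Sect X W\<^esub> D V W a)))"

text \<open>The contraction of a vector field \<open>D\<close> on \<open>U\<close> with a differential form \<open>\<omega>\<close> on \<open>U\<close>: the function
  that is given locally by \<open>\<Sum> a\<^sub>i D(b\<^sub>i)\<close> wherever \<open>\<omega>\<close> is given by \<open>\<Sum> a\<^sub>i db\<^sub>i\<close>.\<close>

definition contract :: "('p, 'a, 'k) kspace \<Rightarrow> 'p set \<Rightarrow> ('p set \<Rightarrow> 'a \<Rightarrow> 'a) \<Rightarrow>
    ('p \<Rightarrow> ('p set \<times> ('a \<Rightarrow> 'a) set) set) \<Rightarrow> 'a" where
  "contract X U D \<omega> = (THE f. f \<in> carrier (Sect X U) \<and>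
     (\<forall>p\<in>U. \<forall>(W, C)\<in>\<omega> p. \<forall>v\<in>C. W \<subseteq> U \<longrightarrow>
        (\<exists>W'. openin (topo X) W' \<and> p \<in> W' \<and> W' \<subseteq> W \<and>
           Rest X U W' f = Rest X W W'
             (\<Oplus>\<^bsub>Sect X W\<^esub>b\<in>{b. v b \<noteq> \<zero>\<^bsub>Sect X W\<^esub>}. v b \<otimes>\<^bsub>Sect X W\<^esub> D W b))))"

definition cup :: "('p, 'a, 'k::field_char_0) kspace \<Rightarrow> ('p, 'p set \<Rightarrow> 'a \<Rightarrow> 'a) cocycle set \<Rightarrow>
    ('p \<Rightarrow> ('p set \<times> ('a \<Rightarrow> 'a) set) set) \<Rightarrow> ('p, 'a) cocycle set" where
  "cup X \<xi> \<omega> = (\<Union>(\<U>, c)\<in>\<xi>. cech_class (topo X) (Str X)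
     (\<U>, \<lambda>U V. contract X (U \<inter> V) (c U V) (restrict \<omega> (U \<inter> V))))"

end

theory Submission
  imports Defs
begin

text \<open>A derivation \<open>D\<close> of the structure sheaf over \<open>V\<close> that extends \<open>\<delta>\<close> is the same as a splitting
    of
  \<open>\<Omega>\<^sup>\<tau> \<rightarrow> \<Omega>\<close> over \<open>V\<close>, with \<open>da \<mapsto> d\<^sup>\<tau> a - D a \<cdot> 1\<close>, and as a retraction \<open>\<Omega>\<^sup>\<tau> \<rightarrow> O\<close>, with
  \<open>1 \<mapsto> 1\<close> and \<open>d\<^sup>\<tau> a \<mapsto> D a\<close>. Over a smooth variety such derivations \<open>D\<^sub>i\<close> exist on the members of an
  affine cover: on a standard smooth algebra the coefficientwise derivation is corrected
      by means of the
  inverse Jacobian, and it extends to the spectrum by the quotient rule. The retractions belonging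
      to
  \<open>D\<^sub>i\<close> and \<open>D\<^sub>j\<close> differ by the contraction with \<open>D\<^sub>i - D\<^sub>j\<close>. Hence the retractions of a lift of
  \<open>\<omega>\<close> exhibit the cocycle \<open>\<langle>D\<^sub>i - D\<^sub>j, \<omega>\<rangle>\<close>, which represents the cup product, as a coboundary.
      Conversely,
  if it is the coboundary of \<open>(b\<^sub>i)\<close>, then the local lifts of \<open>\<omega>\<close> given by the splittings, corrected
      by
  \<open>b\<^sub>i \<cdot> 1\<close>, glue.\<close>

section \<open>Free modules and semilinear maps\<close>

text \<open>Sections of both sheaves of forms are functions into germs of cosets, and contraction is
  given by a unique description, so nothing can be computed on a section as a whole: values are
  prescribed on representatives of germs, shown not to depend on them, and glued. The two sheaves
  differ in generators and relations alone, so this is done once, for any presheaf of free modules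
  modulo relations and any natural family of functionals that kills the relations. Contraction with
  a vector field and the retraction attached to an extension of \<open>\<delta>\<close> are its two
  instances. Cohomology is a colimit over all open covers. A vanishing cup product therefore gives a
  coboundary on some refinement, with a refinement map \<open>r\<close> back to the affine cover.
  The lift is assembled there, with the derivation taken from \<open>r W\<close> and the correction
  from \<open>W\<close>. The sheaf derivations must act on every open set inside a chart and not on
  the coordinate ring alone. This is why the quotient rule is carried out prime by prime on local
  fractions.\<close>

locale plain_cring = cring R for R :: "'a ring" (structure)

locale plain_hom = ring_hom_cring R S h for R :: "'a ring" and S :: "'b ring" and h
begin

sublocale R: plain_cring R by unfold_locales

sublocale S: plain_cring S by unfold_locales

end

lemma plain_homI: "cring R \<Longrightarrow> cring S \<Longrightarrow> h \<in> ring_hom R S \<Longrightarrow> plain_hom R S h"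
  by (simp add: plain_hom_def ring_hom_cring_def ring_hom_cring_axioms_def)

lemma free_mod_carrier:
  "v \<in> carrier (free_mod R B) \<longleftrightarrow>
     (\<forall>b. v b \<in> carrier R) \<and> finite {b. v b \<noteq> \<zero>\<^bsub>R\<^esub>} \<and> {b. v b \<noteq> \<zero>\<^bsub>R\<^esub>} \<subseteq> B"
  by (simp add: free_mod_def)

lemma free_mod_simps [simp]:
  "\<zero>\<^bsub>free_mod R B\<^esub> = (\<lambda>_. \<zero>\<^bsub>R\<^esub>)"
  "v \<oplus>\<^bsub>free_mod R B\<^esub> w = (\<lambda>b. v b \<oplus>\<^bsub>R\<^esub> w b)"
  "r \<odot>\<^bsub>free_mod R B\<^esub> v = (\<lambda>b. r \<otimes>\<^bsub>R\<^esub> v b)"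
  by (simp_all add: free_mod_def)

lemma free_mod_D:
  assumes "v \<in> carrier (free_mod R B)"
  shows "v b \<in> carrier R" "finite {b. v b \<noteq> \<zero>\<^bsub>R\<^esub>}" "{b. v b \<noteq> \<zero>\<^bsub>R\<^esub>} \<subseteq> B" "b \<notin> B \<Longrightarrow> v b = \<zero>\<^bsub>R\<^esub>"
  using assms by (auto simp: free_mod_carrier)

lemma (in plain_cring) free_mod_closed:
  assumes "v \<in> carrier (free_mod R B)"
  shows "w \<in> carrier (free_mod R B) \<Longrightarrow> (\<lambda>b. v b \<oplus> w b) \<in> carrier (free_mod R B)"
    and "r \<in> carrier R \<Longrightarrow> (\<lambda>b. r \<otimes> v b) \<in> carrier (free_mod R B)"
    and "(\<lambda>b. \<ominus> v b) \<in> carrier (free_mod R B)"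
proof -
  note v = free_mod_D[OF assms]
  show "(\<lambda>b. v b \<oplus> w b) \<in> carrier (free_mod R B)" if "w \<in> carrier (free_mod R B)"
  proof -
    note w = free_mod_D[OF that]
    have "{b. v b \<oplus> w b \<noteq> \<zero>} \<subseteq> {b. v b \<noteq> \<zero>} \<union> {b. w b \<noteq> \<zero>}" using v(1) w(1) by auto
    moreover have "finite ({b. v b \<noteq> \<zero>} \<union> {b. w b \<noteq> \<zero>})" using v(2) w(2) by simp
    ultimately show ?thesis unfolding free_mod_carrier using v w
        by (meson a_closed finite_subset le_sup_iff subset_trans)
  qed
  show "(\<lambda>b. r \<otimes> v b) \<in> carrier (free_mod R B)" if r: "r \<in> carrier R"
  proof -
    have "{b. r \<otimes> v b \<noteq> \<zero>} \<subseteq> {b. v b \<noteq> \<zero>}" using v(1) r by auto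
    then show ?thesis unfolding free_mod_carrier using v r
        by (meson m_closed finite_subset subset_trans)
  qed
  have "{b. \<ominus> v b \<noteq> \<zero>} \<subseteq> {b. v b \<noteq> \<zero>}" by auto
  then show "(\<lambda>b. \<ominus> v b) \<in> carrier (free_mod R B)"
    unfolding free_mod_carrier using v by (meson a_inv_closed finite_subset subset_trans)
qed

lemma (in plain_cring) free_mod_zero: "(\<lambda>_. \<zero>) \<in> carrier (free_mod R B)"
  by (simp add: free_mod_carrier)

lemma (in plain_cring) free_mod_module: "module R (free_mod R B)"
proof (rule moduleI)
  show "cring R" ..
  show "abelian_group (free_mod R B)"
  proof (rule abelian_groupI)
    fix x assume x: "x \<in> carrier (free_mod R B)"
    show "\<exists>y\<in>carrier (free_mod R B). y \<oplus>\<^bsub>free_mod R B\<^esub> x = \<zero>\<^bsub>free_mod R B\<^esub>"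
      using free_mod_closed(3)[OF x] free_mod_D(1)[OF x] by (intro bexI[of _ "\<lambda>b. \<ominus> x b"]) (simp_all
          add: l_neg)
  qed (auto simp: free_mod_zero free_mod_closed free_mod_D(1) a_assoc intro!: ext a_comm dest:
      free_mod_D(1))
qed (auto simp: free_mod_closed free_mod_D(1) l_distr r_distr m_assoc intro!: ext dest:
    free_mod_D(1))

lemma (in plain_cring) free_mod_a_inv:
  assumes "v \<in> carrier (free_mod R B)"
  shows "\<ominus>\<^bsub>free_mod R B\<^esub> v = (\<lambda>b. \<ominus> v b)"
proof -
  interpret M: module R "free_mod R B" by (rule free_mod_module)
  show ?thesis
    using free_mod_closed(3)[OF assms] assms free_mod_D(1)[OF assms]
    by (intro M.minus_equality) (simp_all add: l_neg)
qed

lemma (in plain_cring) free_mod_minus: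
  assumes "v \<in> carrier (free_mod R B)" "w \<in> carrier (free_mod R B)"
  shows "v \<ominus>\<^bsub>free_mod R B\<^esub> w = (\<lambda>b. v b \<ominus> w b)"
  using free_mod_a_inv[OF assms(2)] by (simp add: a_minus_def)

lemma (in plain_cring) gen_closed: "b \<in> B \<Longrightarrow> gen R b \<in> carrier (free_mod R B)"
  by (auto simp: free_mod_carrier gen_def intro: rev_finite_subset[of "{b}"])

text \<open>Deleting one coordinate removes one point from the finite support, so every vector
  arises from zero by adding multiples of basis elements. The deleted coordinate is added back as
  \<open>v x\<close> times \<open>gen R x\<close>.\<close>

lemma (in plain_cring) free_mod_induct [consumes 1, case_names zero add]:
  assumes "v \<in> carrier (free_mod R B)" and "P (\<lambda>_. \<zero>)"
    and "\<And>v r b. \<lbrakk>v \<in> carrier (free_mod R B); r \<in> carrier R; b \<in> B; P v\<rbrakk> \<Longrightarrow>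
      P (v \<oplus>\<^bsub>free_mod R B\<^esub> r \<odot>\<^bsub>free_mod R B\<^esub> gen R b)"
  shows "P v"
proof -
  have "finite A \<Longrightarrow> v \<in> carrier (free_mod R B) \<Longrightarrow> {b. v b \<noteq> \<zero>} = A \<Longrightarrow> P v" for A v
  proof (induction A arbitrary: v rule: finite_induct)
    case empty
    then have "v = (\<lambda>_. \<zero>)" by auto
    then show ?case using assms(2) by simp
  next
    case (insert x A)
    note v = free_mod_D[OF insert.prems(1)]
    let ?w = "v(x := \<zero>)"
    have supp: "{b. ?w b \<noteq> \<zero>} = A" using insert by auto
    have w: "?w \<in> carrier (free_mod R B)"
      unfolding free_mod_carrier supp using v insert.hyps(1) insert.prems(2) by auto
    have "P (?w \<oplus>\<^bsub>free_mod R B\<^esub> v x \<odot>\<^bsub>free_mod R B\<^esub> gen R x)"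
      by (rule assms(3)[OF w v(1) _ insert.IH[OF w supp]]) (use v(3) insert.prems(2) in blast)
    also have "?w \<oplus>\<^bsub>free_mod R B\<^esub> v x \<odot>\<^bsub>free_mod R B\<^esub> gen R x = v"
      using v(1) by (auto simp: gen_def)
    finally show ?case .
  qed
  then show ?thesis using assms(1) free_mod_D(2) by blast
qed

text \<open>The map from a free module to \<open>S\<close> with value \<open>h b\<close> on the
  basis element \<open>b\<close>, semilinear along \<open>\<rho>\<close>. With \<open>\<rho>\<close>
  the identity it is literally the sum in \<open>contract\<close>; along other homomorphisms it
  gives the coordinates of \<open>push\<close> and the evaluation of polynomials.\<close>

definition semilin :: "'a ring \<Rightarrow> 'b ring \<Rightarrow> ('a \<Rightarrow> 'b) \<Rightarrow> ('g \<Rightarrow> 'b) \<Rightarrow> ('g \<Rightarrow> 'a) \<Rightarrow> 'b" where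
  "semilin R S \<rho> h v = (\<Oplus>\<^bsub>S\<^esub>b\<in>{b. v b \<noteq> \<zero>\<^bsub>R\<^esub>}. \<rho> (v b) \<otimes>\<^bsub>S\<^esub> h b)"

locale semilinear = plain_hom R S \<rho> for R :: "'a ring" and S :: "'b ring" and \<rho> +
  fixes B :: "'g set" and h :: "'g \<Rightarrow> 'b"
  assumes h_closed: "b \<in> B \<Longrightarrow> h b \<in> carrier S"
begin

abbreviation "F \<equiv> free_mod R B"

text \<open>The index set of the sum is the support and changes with the vector. Padding it by
  indices whose terms vanish allows two vectors to be compared term by term.\<close>

lemma semilin_superset:
  assumes "v \<in> carrier F" "finite A" "{b. v b \<noteq> \<zero>\<^bsub>R\<^esub>} \<subseteq> A" "A \<subseteq> B"
  shows "semilin R S \<rho> h v = (\<Oplus>\<^bsub>S\<^esub>b\<in>A. \<rho> (v b) \<otimes>\<^bsub>S\<^esub> h b)"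
  unfolding semilin_def
  by (rule S.add.finprod_mono_neutral_cong_left)
     (use assms free_mod_D[OF assms(1)] h_closed in auto)

lemma semilin_closed: "v \<in> carrier F \<Longrightarrow> semilin R S \<rho> h v \<in> carrier S"
  unfolding semilin_def
  by (rule S.finsum_closed) (use free_mod_D[of v R B] h_closed in auto)

lemma semilin_add:
  assumes v: "v \<in> carrier F" and w: "w \<in> carrier F"
  shows "semilin R S \<rho> h (v \<oplus>\<^bsub>F\<^esub> w) = semilin R S \<rho> h v \<oplus>\<^bsub>S\<^esub> semilin R S \<rho> h w"
proof -
  note v' = free_mod_D[OF v] and w' = free_mod_D[OF w]
  define A where "A = {b. v b \<noteq> \<zero>\<^bsub>R\<^esub>} \<union> {b. w b \<noteq> \<zero>\<^bsub>R\<^esub>}"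
  have A: "finite A" "A \<subseteq> B" "{b. v b \<noteq> \<zero>\<^bsub>R\<^esub>} \<subseteq> A" "{b. w b \<noteq> \<zero>\<^bsub>R\<^esub>} \<subseteq> A"
    "{b. v b \<oplus>\<^bsub>R\<^esub> w b \<noteq> \<zero>\<^bsub>R\<^esub>} \<subseteq> A"
    using v' w' by (auto simp: A_def)
  have vw: "v \<oplus>\<^bsub>F\<^esub> w \<in> carrier F" using R.free_mod_closed(1)[OF v w] by simp
  have "semilin R S \<rho> h (v \<oplus>\<^bsub>F\<^esub> w) = (\<Oplus>\<^bsub>S\<^esub>b\<in>A. \<rho> (v b \<oplus>\<^bsub>R\<^esub> w b) \<otimes>\<^bsub>S\<^esub> h b)"
    using semilin_superset[OF vw, of A] A by simp
  also have "\<dots> = (\<Oplus>\<^bsub>S\<^esub>b\<in>A. \<rho> (v b) \<otimes>\<^bsub>S\<^esub> h b \<oplus>\<^bsub>S\<^esub> \<rho> (w b) \<otimes>\<^bsub>S\<^esub> h b)"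
    using A(2) v'(1) w'(1) h_closed
    by (intro S.finsum_cong') (auto simp: S.l_distr subset_iff)
  also have "\<dots> = (\<Oplus>\<^bsub>S\<^esub>b\<in>A. \<rho> (v b) \<otimes>\<^bsub>S\<^esub> h b) \<oplus>\<^bsub>S\<^esub> (\<Oplus>\<^bsub>S\<^esub>b\<in>A. \<rho> (w b) \<otimes>\<^bsub>S\<^esub> h b)"
    using A(2) v'(1) w'(1) h_closed by (intro S.finsum_addf) auto
  finally show ?thesis using semilin_superset[OF v, of A] semilin_superset[OF w, of A] A by simp
qed

lemma semilin_smult:
  assumes v: "v \<in> carrier F" and r: "r \<in> carrier R"
  shows "semilin R S \<rho> h (r \<odot>\<^bsub>F\<^esub> v) = \<rho> r \<otimes>\<^bsub>S\<^esub> semilin R S \<rho> h v"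
proof -
  note v' = free_mod_D[OF v]
  define A where "A = {b. v b \<noteq> \<zero>\<^bsub>R\<^esub>}"
  have A: "finite A" "A \<subseteq> B" "{b. r \<otimes>\<^bsub>R\<^esub> v b \<noteq> \<zero>\<^bsub>R\<^esub>} \<subseteq> A"
    using v' r by (auto simp: A_def)
  have rv: "r \<odot>\<^bsub>F\<^esub> v \<in> carrier F" using R.free_mod_closed(2)[OF v r] by simp
  have "semilin R S \<rho> h (r \<odot>\<^bsub>F\<^esub> v) = (\<Oplus>\<^bsub>S\<^esub>b\<in>A. \<rho> (r \<otimes>\<^bsub>R\<^esub> v b) \<otimes>\<^bsub>S\<^esub> h b)"
    using semilin_superset[OF rv, of A] A by simp
  also have "\<dots> = (\<Oplus>\<^bsub>S\<^esub>b\<in>A. \<rho> r \<otimes>\<^bsub>S\<^esub> (\<rho> (v b) \<otimes>\<^bsub>S\<^esub> h b))"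
    using A(2) v'(1) r h_closed by (intro S.finsum_cong') (auto simp: S.m_assoc subset_iff)
  also have "\<dots> = \<rho> r \<otimes>\<^bsub>S\<^esub> semilin R S \<rho> h v"
    unfolding semilin_def A_def using v' r h_closed
    by (intro S.finsum_rdistr[symmetric]) auto
  finally show ?thesis .
qed

lemma semilin_gen:
  assumes "b \<in> B" shows "semilin R S \<rho> h (gen R b) = h b"
proof -
  have "semilin R S \<rho> h (gen R b) = (\<Oplus>\<^bsub>S\<^esub>c\<in>{b}. \<rho> (gen R b c) \<otimes>\<^bsub>S\<^esub> h c)"
    using assms by (intro semilin_superset R.gen_closed) (auto simp: gen_def)
  also have "\<dots> = h b" using h_closed[OF assms] by (simp add: gen_def)
  finally show ?thesis .
qed

lemma semilin_zero: "semilin R S \<rho> h (\<lambda>_. \<zero>\<^bsub>R\<^esub>) = \<zero>\<^bsub>S\<^esub>"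
  by (simp add: semilin_def)

lemma semilin_minus:
  assumes v: "v \<in> carrier F" and w: "w \<in> carrier F"
  shows "semilin R S \<rho> h (v \<ominus>\<^bsub>F\<^esub> w) = semilin R S \<rho> h v \<ominus>\<^bsub>S\<^esub> semilin R S \<rho> h w"
proof -
  interpret M: module R F by (rule R.free_mod_module)
  have "\<ominus>\<^bsub>F\<^esub> w = (\<ominus>\<^bsub>R\<^esub> \<one>\<^bsub>R\<^esub>) \<odot>\<^bsub>F\<^esub> w"
    using R.free_mod_a_inv[OF w] free_mod_D(1)[OF w] by (simp add: R.l_minus)
  then have "semilin R S \<rho> h (\<ominus>\<^bsub>F\<^esub> w) = (\<ominus>\<^bsub>S\<^esub> \<one>\<^bsub>S\<^esub>) \<otimes>\<^bsub>S\<^esub> semilin R S \<rho> h w"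
    using semilin_smult[OF w, of "\<ominus>\<^bsub>R\<^esub> \<one>\<^bsub>R\<^esub>"] by simp
  also have "\<dots> = \<ominus>\<^bsub>S\<^esub> semilin R S \<rho> h w"
    using semilin_closed[OF w] by (simp add: S.l_minus)
  finally show ?thesis
    using semilin_add[OF v, of "\<ominus>\<^bsub>F\<^esub> w"] w by (simp only: a_minus_def M.a_inv_closed)
qed

end

lemma semilin_cong:
  assumes "cring S" "v \<in> carrier (free_mod R B)" "\<And>b. b \<in> B \<Longrightarrow> h b = h' b" "\<And>b. b \<in> B \<Longrightarrow>
      h b \<in> carrier S"
    "\<And>r. r \<in> carrier R \<Longrightarrow> \<rho> r = \<rho>' r" "\<And>r. r \<in> carrier R \<Longrightarrow> \<rho> r \<in> carrier S"
  shows "semilin R S \<rho> h v = semilin R S \<rho>' h' v"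
proof -
  interpret cring S by fact
  show ?thesis unfolding semilin_def
    by (rule finsum_cong') (use assms(3-) free_mod_D[OF assms(2)] in \<open>auto simp: subset_iff\<close>)
qed

locale pushing = plain_hom R S \<rho> for R :: "'a ring" and S :: "'a ring" and \<rho> +
  fixes B B' :: "'g set" and g :: "'g \<Rightarrow> 'g"
  assumes g_closed: "b \<in> B \<Longrightarrow> g b \<in> B'"
begin

text \<open>Every coordinate \<open>c\<close> of a pushed vector is the semilinear functional whose
  value at a basis element \<open>b\<close> is the indicator of \<open>g b = c\<close>. The algebra
  of \<open>push\<close> thereby reduces, coordinate by coordinate, to that of
  \<open>semilin\<close>.\<close>

sublocale semilinear R S \<rho> B "\<lambda>b. if g b = c then \<one>\<^bsub>S\<^esub> else \<zero>\<^bsub>S\<^esub>" for c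
  by unfold_locales auto

lemma push_eq_semilin:
  assumes "v \<in> carrier F"
  shows "push R S \<rho> g v c = semilin R S \<rho> (\<lambda>b. if g b = c then \<one>\<^bsub>S\<^esub> else \<zero>\<^bsub>S\<^esub>) v"
  unfolding push_def semilin_def
  by (rule S.add.finprod_mono_neutral_cong_left) (use free_mod_D[OF assms] in auto)

lemma push_closed:
  assumes v: "v \<in> carrier F" shows "push R S \<rho> g v \<in> carrier (free_mod S B')"
proof -
  note v' = free_mod_D[OF v]
  have "{c. push R S \<rho> g v c \<noteq> \<zero>\<^bsub>S\<^esub>} \<subseteq> g ` {b. v b \<noteq> \<zero>\<^bsub>R\<^esub>}"
  proof
    fix c assume "c \<in> {c. push R S \<rho> g v c \<noteq> \<zero>\<^bsub>S\<^esub>}"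
    then have "{b. v b \<noteq> \<zero>\<^bsub>R\<^esub> \<and> g b = c} \<noteq> {}" unfolding push_def
        by (metis (mono_tags, lifting) S.finsum_empty mem_Collect_eq)
    then show "c \<in> g ` {b. v b \<noteq> \<zero>\<^bsub>R\<^esub>}" by auto
  qed
  moreover have "g ` {b. v b \<noteq> \<zero>\<^bsub>R\<^esub>} \<subseteq> B'" "finite (g ` {b. v b \<noteq> \<zero>\<^bsub>R\<^esub>})" using v' g_closed by auto
  moreover have "push R S \<rho> g v c \<in> carrier S" for c
    using semilin_closed[OF v] push_eq_semilin[OF v] by simp
  ultimately show ?thesis unfolding free_mod_carrier by (meson finite_subset subset_trans)
qed

lemma push_add:
  assumes v: "v \<in> carrier F" and w: "w \<in> carrier F"
  shows "push R S \<rho> g (v \<oplus>\<^bsub>F\<^esub> w) = push R S \<rho> g v \<oplus>\<^bsub>free_mod S B'\<^esub> push R S \<rho> g w"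
proof -
  have "v \<oplus>\<^bsub>F\<^esub> w \<in> carrier F" using R.free_mod_closed(1)[OF v w] by simp
  then show ?thesis
    by (intro ext) (simp only: push_eq_semilin v w semilin_add[OF v w] free_mod_simps(2)[where R=S
        and B=B'])
qed

lemma push_smult:
  assumes v: "v \<in> carrier F" and r: "r \<in> carrier R"
  shows "push R S \<rho> g (r \<odot>\<^bsub>F\<^esub> v) = \<rho> r \<odot>\<^bsub>free_mod S B'\<^esub> push R S \<rho> g v"
proof -
  have "r \<odot>\<^bsub>F\<^esub> v \<in> carrier F" using R.free_mod_closed(2)[OF v r] by simp
  then show ?thesis
    by (intro ext) (simp only: push_eq_semilin v semilin_smult[OF v r] free_mod_simps(3)[where R=S
        and B=B'])
qed

lemma push_minus:
  assumes v: "v \<in> carrier F" and w: "w \<in> carrier F"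
  shows "push R S \<rho> g (v \<ominus>\<^bsub>F\<^esub> w) = push R S \<rho> g v \<ominus>\<^bsub>free_mod S B'\<^esub> push R S \<rho> g w"
proof -
  interpret M: module R F by (rule R.free_mod_module)
  have "v \<ominus>\<^bsub>F\<^esub> w \<in> carrier F" using v w by simp
  then show ?thesis
    by (intro ext) (simp only: push_eq_semilin v w semilin_minus[OF v w] S.free_mod_minus[of _ B']
        push_closed)
qed

lemma push_zero: "push R S \<rho> g (\<lambda>_. \<zero>\<^bsub>R\<^esub>) = (\<lambda>_. \<zero>\<^bsub>S\<^esub>)"
  by (simp add: push_def)

lemma push_gen: "b \<in> B \<Longrightarrow> push R S \<rho> g (gen R b) = gen S (g b)"
  by (intro ext) (simp add: push_eq_semilin[OF R.gen_closed] semilin_gen, simp add: gen_def)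

text \<open>Both sides are additive and semilinear, so it is enough to compare them on generators.\<close>

lemma semilin_push:
  assumes S': "semilinear S S' \<sigma> B' h'" and v: "v \<in> carrier F"
  shows "semilin S S' \<sigma> h' (push R S \<rho> g v) = semilin R S' (\<sigma> \<circ> \<rho>) (h' \<circ> g) v"
proof -
  interpret T: semilinear S S' \<sigma> B' h' by fact
  interpret U: semilinear R S' "\<sigma> \<circ> \<rho>" B "h' \<circ> g"
    using g_closed T.h_closed homh T.homh
    by unfold_locales (auto intro!: ring_hom_memI)
  interpret M: module R F by (rule R.free_mod_module)
  show ?thesis using v
  proof (induction rule: R.free_mod_induct)
    case zero
    then show ?case by (simp only: push_zero T.semilin_zero U.semilin_zero)
  next
    case (add v r b)
    have g: "gen R b \<in> carrier F" "r \<odot>\<^bsub>F\<^esub> gen R b \<in> carrier F"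
      "gen S (g b) \<in> carrier (free_mod S B')"
      using add.hyps R.gen_closed[of b B] S.gen_closed[of "g b" B'] g_closed[of b]
      by (simp_all del: free_mod_simps)
    show ?case
      using add g g_closed S.free_mod_module[of B'] push_closed[OF g(2)] push_closed[OF g(1)]
      by (simp add: push_add push_smult push_gen push_closed T.semilin_add T.semilin_smult
          T.semilin_gen
          U.semilin_add[unfolded comp_def] U.semilin_smult[unfolded comp_def] U.semilin_gen[unfolded
              comp_def]
          module.smult_closed del: free_mod_simps)
  qed
qed

end

lemma (in plain_hom) hom_semilin:
  assumes "semilinear S' R \<rho> B k" "v \<in> carrier (free_mod S' B)"
  shows "h (semilin S' R \<rho> k v) = semilin S' S (h \<circ> \<rho>) (h \<circ> k) v"
proof -
  interpret T: semilinear S' R \<rho> B k by fact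
  have "h (semilin S' R \<rho> k v) = (\<Oplus>\<^bsub>S\<^esub>b\<in>{b. v b \<noteq> \<zero>\<^bsub>S'\<^esub>}. h (\<rho> (v b) \<otimes>\<^bsub>R\<^esub> k b))"
    unfolding semilin_def using free_mod_D[OF assms(2)] T.h_closed
    by (subst hom_finsum) (auto simp: comp_def)
  also have "\<dots> = semilin S' S (h \<circ> \<rho>) (h \<circ> k) v"
    unfolding semilin_def using free_mod_D[OF assms(2)] T.h_closed
    by (intro S.finsum_cong') (auto simp: subset_iff)
  finally show ?thesis .
qed

section \<open>Submodules spanned by a set\<close>

context
  fixes R :: "'a ring" (structure) and M :: "('a, 'v) module" (structure)
  assumes module: "module R M"
begin

interpretation module R M by (rule module)

lemma submodule_zero: "submodule N R M \<Longrightarrow> \<zero>\<^bsub>M\<^esub> \<in> N"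
  using subgroup.one_closed[of N "add_monoid M"] by (simp add: submodule_def)

lemma span_submodule:
  assumes "S \<subseteq> carrier M" shows "submodule (submodule_span R M S) R M"
proof (rule submoduleI)
  show "submodule_span R M S \<subseteq> carrier M"
    unfolding submodule_span_def using assms carrier_is_submodule by blast
qed (auto simp: submodule_span_def dest: submoduleE submodule_zero)

lemma span_superset: "S \<subseteq> submodule_span R M S"
  by (auto simp: submodule_span_def)

lemma span_sub: "S \<subseteq> carrier M \<Longrightarrow> submodule_span R M S \<subseteq> carrier M"
  using span_submodule submoduleE(1) by blast

text \<open>The elements of the span with property \<open>P\<close> form a submodule that contains
  the generators, so they exhaust the intersection that defines the span. Negation has no case of
  its own, being multiplication by \<open>\<ominus> \<one>\<close>.\<close>

lemma span_induct [consumes 3, case_names zero gens add smult]: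
  assumes "S \<subseteq> carrier M" "x \<in> submodule_span R M S" "P \<zero>\<^bsub>M\<^esub>" "\<And>s. s \<in> S \<Longrightarrow> P s"
    "\<And>x y. \<lbrakk>x \<in> submodule_span R M S; y \<in> submodule_span R M S; P x; P y\<rbrakk> \<Longrightarrow> P (x \<oplus>\<^bsub>M\<^esub> y)"
    "\<And>r x. \<lbrakk>r \<in> carrier R; x \<in> submodule_span R M S; P x\<rbrakk> \<Longrightarrow> P (r \<odot>\<^bsub>M\<^esub> x)"
  shows "P x"
proof -
  let ?N = "{x \<in> submodule_span R M S. P x}"
  note sp = submoduleE[OF span_submodule[OF assms(1)]]
  have "submodule ?N R M"
  proof (rule submoduleI)
    show "?N \<subseteq> carrier M" using span_sub[OF assms(1)] by auto
    show "\<zero>\<^bsub>M\<^esub> \<in> ?N" using assms(3) submodule_zero[OF span_submodule[OF assms(1)]] by simp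
    show "\<ominus>\<^bsub>M\<^esub> a \<in> ?N" if "a \<in> ?N" for a
    proof -
      have "a \<in> carrier M" using that sp by blast
      then have "\<ominus>\<^bsub>M\<^esub> a = (\<ominus> \<one>) \<odot>\<^bsub>M\<^esub> a" by (simp add: smult_l_minus)
      then show ?thesis using that assms(6)[of "\<ominus> \<one>" a] sp(4)[of "\<ominus> \<one>" a] sp by auto
    qed
  qed (use assms sp in auto)
  moreover have "S \<subseteq> ?N" using assms(4) span_superset by auto
  ultimately have "submodule_span R M S \<subseteq> ?N" unfolding submodule_span_def by blast
  then show ?thesis using assms(2) by blast
qed

lemma span_abelian_subgroup: "S \<subseteq> carrier M \<Longrightarrow> abelian_subgroup (submodule_span R M S) M"
  using span_submodule[of S] a_comm_group
  by (intro abelian_subgroupI3 additive_subgroup.intro) (auto simp: submodule_def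
      module.axioms(2)[OF module])

end

section \<open>Ringed spaces\<close>

lemma (in abelian_group) minus_eq_zeroD:
  assumes "x \<ominus> y = \<zero>" "x \<in> carrier G" "y \<in> carrier G" shows "x = y"
  using minus_equality[of x "\<ominus> y"] assms by (simp add: a_minus_def)

locale K_ringed =
  fixes X :: "('p, 'a, 'k::field_char_0) kspace"
  assumes ringed: "ringed_space_over_K X"
begin

abbreviation "opn \<equiv> openin (topo X)"

lemma sheaf: "ring_sheaf (topo X) (Str X)"
  using ringed by (simp add: ringed_space_over_K_def)

lemma cring_Sect: "opn U \<Longrightarrow> cring (Sect X U)"
  using sheaf by (simp add: ring_sheaf_def)

lemma plain_Sect: "opn U \<Longrightarrow> plain_cring (Sect X U)"
  using cring_Sect by (simp add: plain_cring_def)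

lemma res_hom: "opn U \<Longrightarrow> opn V \<Longrightarrow> V \<subseteq> U \<Longrightarrow> Rest X U V \<in> ring_hom (Sect X U) (Sect X V)"
  using sheaf by (simp add: ring_sheaf_def)

lemma res_plain_hom: "opn U \<Longrightarrow> opn V \<Longrightarrow> V \<subseteq> U \<Longrightarrow> plain_hom (Sect X U) (Sect X V) (Rest X U V)"
  by (intro plain_homI cring_Sect res_hom)

lemma res_closed:
  "opn U \<Longrightarrow> opn V \<Longrightarrow> V \<subseteq> U \<Longrightarrow> a \<in> carrier (Sect X U) \<Longrightarrow> Rest X U V a \<in> carrier (Sect X V)"
  using res_hom ring_hom_closed by metis

lemma res_id: "opn U \<Longrightarrow> a \<in> carrier (Sect X U) \<Longrightarrow> Rest X U U a = a"
  using sheaf by (simp add: ring_sheaf_def)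

lemma res_res:
  "opn U \<Longrightarrow> opn V \<Longrightarrow> opn W \<Longrightarrow> V \<subseteq> U \<Longrightarrow> W \<subseteq> V \<Longrightarrow> a \<in> carrier (Sect X U) \<Longrightarrow>
    Rest X V W (Rest X U V a) = Rest X U W a"
  using sheaf unfolding ring_sheaf_def by blast

lemma res_minus:
  assumes "opn U" "opn V" "V \<subseteq> U" "a \<in> carrier (Sect X U)" "b \<in> carrier (Sect X U)"
  shows "Rest X U V (a \<ominus>\<^bsub>Sect X U\<^esub> b) = Rest X U V a \<ominus>\<^bsub>Sect X V\<^esub> Rest X U V b"
proof -
  interpret h: plain_hom "Sect X U" "Sect X V" "Rest X U V" by (rule res_plain_hom) fact+
  show ?thesis using assms(4,5) by (simp add: a_minus_def)
qed

lemma res_add: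
  "opn U \<Longrightarrow> opn V \<Longrightarrow> V \<subseteq> U \<Longrightarrow> a \<in> carrier (Sect X U) \<Longrightarrow> b \<in> carrier (Sect X U) \<Longrightarrow>
   Rest X U V (a \<oplus>\<^bsub>Sect X U\<^esub> b) = Rest X U V a \<oplus>\<^bsub>Sect X V\<^esub> Rest X U V b"
  using res_hom ring_hom_add by metis

lemma opn_sub: "opn U \<Longrightarrow> U \<subseteq> pts X" by (rule openin_subset)

lemma cst_on_closed: "opn U \<Longrightarrow> cst_on X U c \<in> carrier (Sect X U)"
  using ringed opn_sub[of U] ring_hom_closed[of "cst X" K_ring "Sect X (pts X)" c]
  by (auto simp: cst_on_def ringed_space_over_K_def K_ring_def intro!: res_closed)

lemma res_cst_on: "opn U \<Longrightarrow> opn V \<Longrightarrow> V \<subseteq> U \<Longrightarrow> Rest X U V (cst_on X U c) = cst_on X V c"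
  using ringed opn_sub[of U] ring_hom_closed[of "cst X" K_ring "Sect X (pts X)" c]
  by (auto simp: cst_on_def ringed_space_over_K_def K_ring_def intro!: res_res)

lemma glue_ex1:
  "(\<forall>U\<in>\<U>. opn U \<and> s U \<in> carrier (Sect X U)) \<Longrightarrow>
   (\<forall>U\<in>\<U>. \<forall>V\<in>\<U>. Rest X U (U \<inter> V) (s U) = Rest X V (U \<inter> V) (s V)) \<Longrightarrow>
   \<exists>!t. t \<in> carrier (Sect X (\<Union>\<U>)) \<and> (\<forall>U\<in>\<U>. Rest X (\<Union>\<U>) U t = s U)"
  using sheaf unfolding ring_sheaf_def by simp

text \<open>The open subsets of \<open>U\<close> on which \<open>a\<close> and \<open>b\<close>
  agree cover \<open>U\<close>, and both sections glue the restrictions of \<open>a\<close> to them;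
  the uniqueness in the gluing axiom identifies them.\<close>

lemma local_eq:
  assumes U: "opn U" and a: "a \<in> carrier (Sect X U)" and b: "b \<in> carrier (Sect X U)"
    and loc: "\<And>p. p \<in> U \<Longrightarrow> \<exists>W. opn W \<and> p \<in> W \<and> W \<subseteq> U \<and> Rest X U W a = Rest X U W b"
  shows "a = b"
proof -
  define \<U> where "\<U> = {W. opn W \<and> W \<subseteq> U \<and> Rest X U W a = Rest X U W b}"
  have un: "\<Union>\<U> = U" using loc by (auto simp: \<U>_def)
  have "\<exists>!t. t \<in> carrier (Sect X (\<Union>\<U>)) \<and> (\<forall>V\<in>\<U>. Rest X (\<Union>\<U>) V t = Rest X U V a)"
  proof (rule glue_ex1)
    show "\<forall>V\<in>\<U>. \<forall>W\<in>\<U>. Rest X V (V \<inter> W) (Rest X U V a) = Rest X W (V \<inter> W) (Rest X U W a)"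
    proof (intro ballI)
      fix V W assume VW: "V \<in> \<U>" "W \<in> \<U>"
      have "Rest X V (V \<inter> W) (Rest X U V a) = Rest X U (V \<inter> W) a"
        using VW U a by (intro res_res) (auto simp: \<U>_def)
      moreover have "Rest X W (V \<inter> W) (Rest X U W a) = Rest X U (V \<inter> W) a"
        using VW U a by (intro res_res) (auto simp: \<U>_def)
      ultimately show "Rest X V (V \<inter> W) (Rest X U V a) = Rest X W (V \<inter> W) (Rest X U W a)" by simp
    qed
    show "\<forall>V\<in>\<U>. opn V \<and> Rest X U V a \<in> carrier (Sect X V)"
      unfolding \<U>_def using U a res_closed by blast
  qed
  moreover have "\<forall>V\<in>\<U>. Rest X U V b = Rest X U V a" by (auto simp: \<U>_def)
  ultimately show ?thesis using a b unfolding un by blast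
qed

lemma glue_points:
  assumes U: "opn U"
    and W: "\<And>p. p \<in> U \<Longrightarrow> opn (W p) \<and> p \<in> W p \<and> W p \<subseteq> U \<and> f p \<in> carrier (Sect X (W p))"
    and agree: "\<And>p q. p \<in> U \<Longrightarrow> q \<in> U \<Longrightarrow>
      Rest X (W p) (W p \<inter> W q) (f p) = Rest X (W q) (W p \<inter> W q) (f q)"
  obtains t where "t \<in> carrier (Sect X U)" "\<And>p. p \<in> U \<Longrightarrow> Rest X U (W p) t = f p"
proof -
  \<comment> \<open>The gluing axiom is indexed by open sets, the data here by points, and several
    points may share one open set. The choice is harmless: if \<open>W p = W q\<close>,
    compatibility on the intersection already says \<open>f p = f q\<close>.\<close>
  define s where "s V = f (SOME p. p \<in> U \<and> W p = V)" for V
  have s: "s (W p) = f p" if p: "p \<in> U" for p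
  proof -
    let ?q = "SOME q. q \<in> U \<and> W q = W p"
    have q: "?q \<in> U \<and> W ?q = W p" by (rule someI) (use p in simp)
    then have "Rest X (W p) (W p) (f ?q) = Rest X (W p) (W p) (f p)" using agree[of ?q p] p by simp
    then show ?thesis using q W[of ?q] W[OF p] by (simp add: s_def res_id)
  qed
  have un: "\<Union>(W ` U) = U" using W by blast
  have "\<exists>!t. t \<in> carrier (Sect X (\<Union>(W ` U))) \<and> (\<forall>V\<in>W ` U. Rest X (\<Union>(W ` U)) V t = s V)"
    by (rule glue_ex1) (use W s agree in auto)
  then obtain t where t: "t \<in> carrier (Sect X U)" "\<forall>V\<in>W ` U. Rest X U V t = s V"
    unfolding un by blast
  show ?thesis
  proof (rule that[OF t(1)])
    fix p assume "p \<in> U"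
    then show "Rest X U (W p) t = f p" using t(2) s[of p] by (metis image_eqI)
  qed
qed

end

section \<open>Sheaves presented by generators and relations\<close>

text \<open>The common shape of the presheaves behind \<open>Omega\<close> and
  \<open>Omega_tau\<close>: over \<open>U\<close> the free module on \<open>B U\<close> modulo the
  span of \<open>G U\<close>, where \<open>g U V\<close> restricts the labels of the generators. The
  last assumption makes restriction descend to the quotients.\<close>

locale presented = K_ringed X for X :: "('p, 'a, 'k::field_char_0) kspace" +
  fixes B :: "'p set \<Rightarrow> 'g set" and G :: "'p set \<Rightarrow> ('g \<Rightarrow> 'a) set"
    and g :: "'p set \<Rightarrow> 'p set \<Rightarrow> 'g \<Rightarrow> 'g"
  assumes g_closed: "\<lbrakk>opn U; opn V; V \<subseteq> U; b \<in> B U\<rbrakk> \<Longrightarrow> g U V b \<in> B V"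
    and g_id: "\<lbrakk>opn U; b \<in> B U\<rbrakk> \<Longrightarrow> g U U b = b"
    and g_g: "\<lbrakk>opn U; opn V; opn W; V \<subseteq> U; W \<subseteq> V; b \<in> B U\<rbrakk> \<Longrightarrow> g V W (g U V b) = g U W b"
    and G_sub: "opn U \<Longrightarrow> G U \<subseteq> carrier (free_mod (Sect X U) (B U))"
    and G_push: "\<lbrakk>opn U; opn V; V \<subseteq> U; r \<in> G U\<rbrakk> \<Longrightarrow>
      push (Sect X U) (Sect X V) (Rest X U V) (g U V) r \<in> G V"
begin

abbreviation "M U \<equiv> free_mod (Sect X U) (B U)"
abbreviation "N U \<equiv> submodule_span (Sect X U) (M U) (G U)"
abbreviation "pu U V \<equiv> push (Sect X U) (Sect X V) (Rest X U V) (g U V)"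
abbreviation "cl U v \<equiv> N U +>\<^bsub>M U\<^esub> v"
abbreviation "Q U \<equiv> a_rcosets\<^bsub>M U\<^esub> (N U)"
abbreviation "rs U V C \<equiv> (\<Union>v\<in>C. cl V (pu U V v))"
abbreviation "gm \<equiv> germ (topo X) Q rs"
abbreviation "Shf \<equiv> sheafify (topo X) Q rs"

section \<open>Restriction of cosets in a presented presheaf\<close>

lemma M_module: "opn U \<Longrightarrow> module (Sect X U) (M U)"
  by (rule plain_cring.free_mod_module[OF plain_Sect])

lemma N_submodule: "opn U \<Longrightarrow> submodule (N U) (Sect X U) (M U)"
  by (rule span_submodule[OF M_module G_sub])

lemma N_abelian_subgroup: "opn U \<Longrightarrow> abelian_subgroup (N U) (M U)"
  by (rule span_abelian_subgroup[OF M_module G_sub])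

lemma pushing: "\<lbrakk>opn U; opn V; V \<subseteq> U\<rbrakk> \<Longrightarrow>
    pushing (Sect X U) (Sect X V) (Rest X U V) (B U) (B V) (g U V)"
  using res_plain_hom g_closed by (simp add: pushing_def pushing_axioms_def)

lemma pu_closed: "\<lbrakk>opn U; opn V; V \<subseteq> U; v \<in> carrier (M U)\<rbrakk> \<Longrightarrow> pu U V v \<in> carrier (M V)"
  by (rule pushing.push_closed[OF pushing])

text \<open>Each coordinate of a pushed vector is a functional, and \<open>semilin_push\<close>
  composes functionals with \<open>push\<close>. The claim thus becomes transitivity of restriction
  on coefficients (\<open>res_res\<close>) and on generators (\<open>g_g\<close>).\<close>

lemma pu_pu:
  assumes U: "opn U" "opn V" "opn W" "V \<subseteq> U" "W \<subseteq> V" and v: "v \<in> carrier (M U)"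
  shows "pu V W (pu U V v) = pu U W v"
proof
  fix c
  have UW: "W \<subseteq> U" using U by blast
  interpret UV: pushing "Sect X U" "Sect X V" "Rest X U V" "B U" "B V" "g U V"
      by (rule pushing) fact+
  interpret VW: pushing "Sect X V" "Sect X W" "Rest X V W" "B V" "B W" "g V W"
      by (rule pushing) fact+
  interpret UW: pushing "Sect X U" "Sect X W" "Rest X U W" "B U" "B W" "g U W"
      by (rule pushing) fact+
  have "pu V W (pu U V v) c = semilin (Sect X V) (Sect X W) (Rest X V W) (\<lambda>b. if g V W b =
      c then \<one>\<^bsub>Sect X W\<^esub> else \<zero>\<^bsub>Sect X W\<^esub>) (pu U V v)"
    by (rule VW.push_eq_semilin) (rule UV.push_closed[OF v])
  also have "\<dots> = semilin (Sect X U) (Sect X W) (Rest X V W \<circ> Rest X U V)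
      ((\<lambda>b. if g V W b = c then \<one>\<^bsub>Sect X W\<^esub> else \<zero>\<^bsub>Sect X W\<^esub>) \<circ> g U V) v"
    by (rule UV.semilin_push[OF _ v]) (rule VW.semilinear_axioms)
  also have "\<dots> = semilin (Sect X U) (Sect X W) (Rest X U W) (\<lambda>b. if g U W b =
      c then \<one>\<^bsub>Sect X W\<^esub> else \<zero>\<^bsub>Sect X W\<^esub>) v"
    using U by (intro semilin_cong[OF cring_Sect v]) (auto simp: g_g res_res intro: res_closed)
  also have "\<dots> = pu U W v c"
    by (rule UW.push_eq_semilin[symmetric]) (rule v)
  finally show "pu V W (pu U V v) c = pu U W v c" .
qed

lemma pu_minus: "\<lbrakk>opn U; opn V; V \<subseteq> U; v \<in> carrier (M U); w \<in> carrier (M U)\<rbrakk> \<Longrightarrow>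
   pu U V (v \<ominus>\<^bsub>M U\<^esub> w) = pu U V v \<ominus>\<^bsub>M V\<^esub> pu U V w"
  by (rule pushing.push_minus[OF pushing])

lemma pu_N:
  assumes "opn U" "opn V" "V \<subseteq> U" and n: "n \<in> N U"
  shows "pu U V n \<in> N V"
proof -
  interpret UV: pushing "Sect X U" "Sect X V" "Rest X U V" "B U" "B V" "g U V"
      by (rule pushing) fact+
  note NV = module.submoduleE[OF M_module N_submodule, OF \<open>opn V\<close> \<open>opn V\<close>]
  have sub: "N U \<subseteq> carrier (M U)" by (rule span_sub[OF M_module G_sub]) fact+
  show ?thesis using M_module[OF \<open>opn U\<close>] G_sub[OF \<open>opn U\<close>] n
  proof (induction rule: span_induct)
    case zero
    then show ?case using UV.push_zero submodule_zero[OF M_module N_submodule, OF \<open>opn V\<close> \<open>opn V\<close>]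
        by simp
  next
    case (gens s)
    then show ?case
      by (intro subsetD[OF span_superset[OF M_module[OF \<open>opn V\<close>]]] G_push[OF assms(1-3)])
  next
    case (add x y)
    then show ?case using NV(5) UV.push_add[of x y] sub
        by (simp del: free_mod_simps add: subset_iff)
  next
    case (smult r x)
    then show ?case using NV(4) UV.push_smult[of x r] sub UV.hom_closed
        by (simp del: free_mod_simps add: subset_iff)
  qed
qed

lemma cl_self: "opn U \<Longrightarrow> v \<in> carrier (M U) \<Longrightarrow> v \<in> cl U v"
  by (rule abelian_subgroup.a_rcos_self[OF N_abelian_subgroup])

lemma cl_in_Q: "opn U \<Longrightarrow> v \<in> carrier (M U) \<Longrightarrow> cl U v \<in> Q U"
  by (auto simp: A_RCOSETS_def')

lemma mem_cl_iff:
  assumes "opn U" "v \<in> carrier (M U)" "w \<in> carrier (M U)"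
  shows "w \<in> cl U v \<longleftrightarrow> w \<ominus>\<^bsub>M U\<^esub> v \<in> N U"
  unfolding a_minus_def by (rule abelian_subgroup.a_rcos_module[OF N_abelian_subgroup]) fact+

lemma cl_sub: "opn U \<Longrightarrow> v \<in> carrier (M U) \<Longrightarrow> cl U v \<subseteq> carrier (M U)"
  using abelian_subgroup.a_elemrcos_carrier[OF N_abelian_subgroup] module.axioms(2)[OF M_module]
  by blast

lemma cl_eq_iff:
  assumes "opn U" "v \<in> carrier (M U)" "w \<in> carrier (M U)"
  shows "cl U w = cl U v \<longleftrightarrow> w \<ominus>\<^bsub>M U\<^esub> v \<in> N U"
proof -
  interpret abelian_subgroup "N U" "M U" by (rule N_abelian_subgroup) fact
  show ?thesis using mem_cl_iff[OF assms] a_repr_independence'[of w v] cl_self[OF assms(1,3)] assms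
      by blast
qed

lemma Q_cases: "C \<in> Q U \<Longrightarrow> (\<And>v. v \<in> carrier (M U) \<Longrightarrow> C = cl U v \<Longrightarrow> P) \<Longrightarrow> P"
  by (auto simp: A_RCOSETS_def')

lemma Q_mem:
  assumes "opn U" "C \<in> Q U" "v \<in> C" shows "v \<in> carrier (M U)" "C = cl U v"
proof -
  obtain w where w: "w \<in> carrier (M U)" "C = cl U w" using Q_cases[OF assms(2)] .
  then show v: "v \<in> carrier (M U)" using cl_sub assms by blast
  show "C = cl U v" using w v assms mem_cl_iff cl_eq_iff by blast
qed

text \<open>The restriction of a coset is a union over its representatives. All of them yield the
  same coset, because \<open>pu U V\<close> maps relations to relations, so the union
  collapses.\<close>

lemma rs_cl:
  assumes U: "opn U" "opn V" "V \<subseteq> U" and v: "v \<in> carrier (M U)"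
  shows "rs U V (cl U v) = cl V (pu U V v)"
proof -
  have "cl V (pu U V w) = cl V (pu U V v)" if "w \<in> cl U v" for w
  proof -
    have w: "w \<in> carrier (M U)" using that cl_sub U v by blast
    then have "pu U V (w \<ominus>\<^bsub>M U\<^esub> v) \<in> N V" using that mem_cl_iff U v pu_N by blast
    then show ?thesis using cl_eq_iff U v w pu_closed pu_minus by simp
  qed
  then show ?thesis using cl_self[OF U(1) v] by blast
qed

lemma rs_closed: "opn U \<Longrightarrow> opn V \<Longrightarrow> V \<subseteq> U \<Longrightarrow> C \<in> Q U \<Longrightarrow> rs U V C \<in> Q V"
  by (metis Q_cases rs_cl cl_in_Q pu_closed)

lemma rs_rs: "opn U \<Longrightarrow> opn V \<Longrightarrow> opn W \<Longrightarrow> V \<subseteq> U \<Longrightarrow> W \<subseteq> V \<Longrightarrow> C \<in> Q U \<Longrightarrow>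
    rs V W (rs U V C) = rs U W C"
  by (erule Q_cases) (simp add: rs_cl pu_closed pu_pu subset_trans[of W V U])

subsection \<open>Germs\<close>

lemma germ_iff:
  "(V, t) \<in> gm p (U, s) \<longleftrightarrow> opn V \<and> p \<in> V \<and> t \<in> Q V \<and>
     (\<exists>W. opn W \<and> p \<in> W \<and> W \<subseteq> U \<inter> V \<and> rs U W s = rs V W t)"
  by (simp add: germ_def)

text \<open>The witness for the new pair is the intersection \<open>W \<inter> W'\<close> of the
  neighbourhoods on which the two given agreements hold.\<close>

lemma germ_trans:
  assumes "opn U" "s \<in> Q U" "opn V" "t \<in> Q V"
    and W: "opn W" "p \<in> W" "W \<subseteq> U \<inter> V" "rs U W s = rs V W t"
    and mem: "(Z, u) \<in> gm p (U, s)"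
  shows "(Z, u) \<in> gm p (V, t)"
proof -
  obtain W' where W': "opn Z" "p \<in> Z" "u \<in> Q Z" "opn W'" "p \<in> W'" "W' \<subseteq> U \<inter> Z" "rs U W' s =
      rs Z W' u"
    using mem unfolding germ_iff by blast
  let ?W = "W \<inter> W'"
  have "rs V ?W t = rs W ?W (rs V W t)" using assms W' by (intro rs_rs[symmetric]) auto
  also have "\<dots> = rs W ?W (rs U W s)" using W by simp
  also have "\<dots> = rs U ?W s" using assms W' by (intro rs_rs) auto
  also have "\<dots> = rs W' ?W (rs U W' s)" using assms W' by (intro rs_rs[symmetric]) auto
  also have "\<dots> = rs W' ?W (rs Z W' u)" using W' by simp
  also have "\<dots> = rs Z ?W u" using assms W' by (intro rs_rs) auto
  finally show ?thesis unfolding germ_iff using W W' by (intro conjI exI[of _ ?W]) auto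
qed

lemma germ_eqI:
  assumes "opn U" "s \<in> Q U" "opn V" "t \<in> Q V" "opn W" "p \<in> W" "W \<subseteq> U \<inter> V" "rs U W s = rs V W t"
  shows "gm p (U, s) = gm p (V, t)"
proof -
  have "(Z, u) \<in> gm p (U, s) \<longleftrightarrow> (Z, u) \<in> gm p (V, t)" for Z u
    using germ_trans[OF assms(1-8)] germ_trans[OF assms(3,4,1,2,5,6) _ assms(8)[symmetric]] assms(7)
        by blast
  then show ?thesis by auto
qed

lemma germ_self: "opn U \<Longrightarrow> p \<in> U \<Longrightarrow> s \<in> Q U \<Longrightarrow> (U, s) \<in> gm p (U, s)"
  unfolding germ_iff by blast

lemma germ_mem_eq: "opn U \<Longrightarrow> s \<in> Q U \<Longrightarrow> (V, t) \<in> gm p (U, s) \<Longrightarrow> gm p (V, t) = gm p (U, s)"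
  unfolding germ_iff by (elim conjE exE) (rule germ_eqI[symmetric])

lemma Shf_E:
  assumes "\<sigma> \<in> Shf U" "p \<in> U"
  obtains V v where "opn V" "p \<in> V" "V \<subseteq> U" "v \<in> carrier (M V)" "\<And>q. q \<in> V \<Longrightarrow> \<sigma> q = gm q (V, cl V v)"
    "\<And>q. q \<in> V \<Longrightarrow> (V, cl V v) \<in> \<sigma> q"
proof -
  obtain V s where V: "opn V" "p \<in> V" "V \<subseteq> U" "s \<in> Q V" "\<forall>q\<in>V. \<sigma> q = gm q (V, s)"
    using assms unfolding sheafify_def by blast
  moreover obtain v where "v \<in> carrier (M V)" "s = cl V v" using Q_cases V(4) by metis
  ultimately show ?thesis using that[of V v] germ_self cl_in_Q by simp
qed

text \<open>A germ is an equivalence class, so any pair found in \<open>\<sigma> p\<close> may serve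
  as its representative at \<open>p\<close>.\<close>

lemma Shf_mem:
  assumes "\<sigma> \<in> Shf U" "p \<in> U" "(W, C) \<in> \<sigma> p"
  shows "opn W" "p \<in> W" "C \<in> Q W" "\<sigma> p = gm p (W, C)"
proof -
  obtain V v where V: "opn V" "p \<in> V" "V \<subseteq> U" "v \<in> carrier (M V)" "\<sigma> p = gm p (V, cl V v)"
    by (rule Shf_E[OF assms(1,2)]) blast
  have mem: "(W, C) \<in> gm p (V, cl V v)" using V assms by simp
  then show "opn W" "p \<in> W" "C \<in> Q W" unfolding germ_iff by blast+
  show "\<sigma> p = gm p (W, C)" using germ_mem_eq[OF V(1) cl_in_Q mem] V by simp
qed

lemma germ_mem_shrink:
  assumes "opn U" "s \<in> Q U" "opn V" "V \<subseteq> U" "p \<in> V"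
  shows "(V, rs U V s) \<in> gm p (U, s)"
  unfolding germ_iff using assms rs_closed[of U V s] rs_rs[of U V V s]
  by (intro conjI exI[of _ V]) auto

lemma Shf_mem_shrink:
  assumes "\<sigma> \<in> Shf U" "p \<in> U" "(W, C) \<in> \<sigma> p" "opn V" "V \<subseteq> W" "p \<in> V"
  shows "(V, rs W V C) \<in> \<sigma> p"
  using Shf_mem[OF assms(1-3)] germ_mem_shrink[of W C V p] assms by simp

lemma Shf_mem2:
  assumes "\<sigma> \<in> Shf U" "p \<in> U" "(W, C) \<in> \<sigma> p" "v \<in> C" "(W', C') \<in> \<sigma> p" "v' \<in> C'"
  obtains V where "opn V" "p \<in> V" "V \<subseteq> W \<inter> W'" "pu W V v \<ominus>\<^bsub>M V\<^esub> pu W' V v' \<in> N V"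
proof -
  note 1 = Shf_mem[OF assms(1-3)] and 2 = Shf_mem[OF assms(1,2,5)]
  have "(W', C') \<in> gm p (W, C)" using 1 2 assms by simp
  then obtain V where V: "opn V" "p \<in> V" "V \<subseteq> W \<inter> W'" "rs W V C = rs W' V C'"
    unfolding germ_iff by blast
  note 3 = Q_mem[OF 1(1,3) assms(4)] Q_mem[OF 2(1,3) assms(6)]
  have "rs W V C = cl V (pu W V v)" "rs W' V C' = cl V (pu W' V v')"
    using 1 2 3 V rs_cl by auto
  then have "cl V (pu W V v) = cl V (pu W' V v')" using V(4) by simp
  then have "pu W V v \<ominus>\<^bsub>M V\<^esub> pu W' V v' \<in> N V" using cl_eq_iff[of V "pu W' V v'" "pu W V v"] 1 2 3 V
      pu_closed by auto
  then show ?thesis using that V by blast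
qed

lemma Shf_restrict:
  assumes "\<sigma> \<in> Shf U" "opn V" "V \<subseteq> U" shows "restrict \<sigma> V \<in> Shf V"
  unfolding sheafify_def
proof (safe)
  fix p assume p: "p \<in> V"
  then have "p \<in> U" using assms(3) by blast
  then obtain W v where W: "opn W" "p \<in> W" "W \<subseteq> U" "v \<in> carrier (M W)" "\<And>q. q \<in> W \<Longrightarrow>
      \<sigma> q = gm q (W, cl W v)"
    by (rule Shf_E[OF assms(1)]) blast
  let ?W = "W \<inter> V"
  have oW: "opn ?W" using W assms by auto
  have "gm q (W, cl W v) = gm q (?W, cl ?W (pu W ?W v))" if "q \<in> ?W" for q
    using that W assms oW by (intro germ_mem_eq[symmetric] cl_in_Q) (auto simp: rs_cl[symmetric]
        intro!: germ_mem_shrink cl_in_Q)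
  then show "\<exists>Va. opn Va \<and> p \<in> Va \<and> Va \<subseteq> V \<and> (\<exists>s\<in>Q Va. \<forall>q\<in>Va. restrict \<sigma> V q = gm q (Va, s))"
    using W p assms oW pu_closed[of W ?W v] cl_in_Q[of ?W]
        by (intro exI[of _ ?W] conjI bexI[of _ "cl ?W (pu W ?W v)"]) auto
qed auto

subsection \<open>Pairing sections with a compatible family of linear functionals\<close>

text \<open>For differentials this is the property that singles out \<open>contract\<close>. Stated
  for presented sheaves, it lets one proof of existence and uniqueness serve the retractions of
  Kodaira--Spencer forms as well. The proviso \<open>W \<subseteq> U\<close> is there because a germ
  also has representatives on open sets that leave \<open>U\<close>, where \<open>h\<close> has no
  meaning.\<close>

definition is_pairing :: "'p set \<Rightarrow> ('p set \<Rightarrow> 'g \<Rightarrow> 'a) \<Rightarrow> ('p \<Rightarrow> ('p set \<times> ('g \<Rightarrow> 'a) set) set) \<Rightarrow> 'a \<Rightarrow>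
    bool" where
  "is_pairing U h \<sigma> f \<longleftrightarrow> f \<in> carrier (Sect X U) \<and>
     (\<forall>p\<in>U. \<forall>(W, C)\<in>\<sigma> p. \<forall>v\<in>C. W \<subseteq> U \<longrightarrow>
        (\<exists>W'. opn W' \<and> p \<in> W' \<and> W' \<subseteq> W \<and>
           Rest X U W' f = Rest X W W'
             (\<Oplus>\<^bsub>Sect X W\<^esub>b\<in>{b. v b \<noteq> \<zero>\<^bsub>Sect X W\<^esub>}. v b \<otimes>\<^bsub>Sect X W\<^esub> h W b)))"

end

text \<open>A morphism over \<open>U\<close> from the presented sheaf to the structure sheaf,
  encoded by its values on the generators.\<close>

locale functional = presented X B G g for X :: "('p, 'a, 'k::field_char_0) kspace" and B G
    and g :: "'p set \<Rightarrow> 'p set \<Rightarrow> 'g \<Rightarrow> 'g" +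
  fixes U :: "'p set" and h :: "'p set \<Rightarrow> 'g \<Rightarrow> 'a"
  assumes opn_U: "opn U"
    and h_closed: "\<lbrakk>opn W; W \<subseteq> U; b \<in> B W\<rbrakk> \<Longrightarrow> h W b \<in> carrier (Sect X W)"
    and h_nat: "\<lbrakk>opn V; opn W; V \<subseteq> U; W \<subseteq> V; b \<in> B V\<rbrakk> \<Longrightarrow> h W (g V W b) = Rest X V W (h V b)"
    and h_rel: "\<lbrakk>opn W; W \<subseteq> U; r \<in> G W\<rbrakk> \<Longrightarrow> semilin (Sect X W) (Sect X W) (\<lambda>x. x) (h W) r = \<zero>\<^bsub>Sect X W\<^esub>"
begin

abbreviation "L W \<equiv> semilin (Sect X W) (Sect X W) (\<lambda>x. x) (h W)"

lemma L_semilinear: "opn W \<Longrightarrow> W \<subseteq> U \<Longrightarrow> semilinear (Sect X W) (Sect X W) (\<lambda>x. x) (B W) (h W)"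
  using cring_Sect[of W] h_closed
  by (intro semilinear.intro semilinear_axioms.intro plain_homI) (auto intro!: ring_hom_memI)

lemma L_closed: "opn W \<Longrightarrow> W \<subseteq> U \<Longrightarrow> v \<in> carrier (M W) \<Longrightarrow> L W v \<in> carrier (Sect X W)"
  by (rule semilinear.semilin_closed[OF L_semilinear])

lemma L_N:
  assumes W: "opn W" "W \<subseteq> U" and n: "n \<in> N W" shows "L W n = \<zero>\<^bsub>Sect X W\<^esub>"
proof -
  interpret semilinear "Sect X W" "Sect X W" "\<lambda>x. x" "B W" "h W" by (rule L_semilinear[OF W])
  have sub: "N W \<subseteq> carrier (M W)" by (rule span_sub[OF M_module G_sub]) fact+
  show ?thesis using M_module[OF W(1)] G_sub[OF W(1)] n
  proof (induction rule: span_induct)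
    case zero
    then show ?case by (simp only: free_mod_simps(1) semilin_zero)
  next
    case (gens s)
    then show ?case using h_rel W by blast
  next
    case (add x y)
    then show ?case using semilin_add[of x y] sub
        by (simp only: subsetD[OF sub] R.l_zero R.zero_closed)
  next
    case (smult r x)
    then show ?case using semilin_smult[of x r] sub by (simp only: subsetD[OF sub] R.r_null)
  qed
qed

lemma L_pu:
  assumes V: "opn V" "opn W" "V \<subseteq> U" "W \<subseteq> V" and v: "v \<in> carrier (M V)"
  shows "L W (pu V W v) = Rest X V W (L V v)"
proof -
  have WU: "W \<subseteq> U" using V by blast
  interpret VW: pushing "Sect X V" "Sect X W" "Rest X V W" "B V" "B W" "g V W"
      by (rule pushing) fact+
  have "L W (pu V W v) = semilin (Sect X V) (Sect X W) ((\<lambda>x. x) \<circ> Rest X V W) (h W \<circ> g V W) v"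
    by (rule VW.semilin_push[OF _ v]) (rule L_semilinear[OF V(2) WU])
  also have "\<dots> = semilin (Sect X V) (Sect X W) (Rest X V W \<circ> (\<lambda>x. x)) (Rest X V W \<circ> h V) v"
    using V by (intro semilin_cong[OF cring_Sect v]) (auto simp: h_nat intro: res_closed h_closed)
  also have "\<dots> = Rest X V W (L V v)"
    by (rule VW.hom_semilin[symmetric, OF _ v]) (rule L_semilinear[OF V(1,3)])
  finally show ?thesis .
qed

lemma is_pairing_L:
  "is_pairing U h \<sigma> f \<longleftrightarrow> f \<in> carrier (Sect X U) \<and>
     (\<forall>p\<in>U. \<forall>W C v. (W, C)\<in>\<sigma> p \<and> v\<in>C \<and> W \<subseteq> U \<longrightarrow>
        (\<exists>W'. opn W' \<and> p \<in> W' \<and> W' \<subseteq> W \<and> Rest X U W' f = Rest X W W' (L W v)))"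
  unfolding is_pairing_def semilin_def by blast

lemma L_cong:
  assumes "opn V" "V \<subseteq> U" "v \<in> carrier (M V)" "w \<in> carrier (M V)" "v \<ominus>\<^bsub>M V\<^esub> w \<in> N V"
  shows "L V v = L V w"
proof -
  interpret semilinear "Sect X V" "Sect X V" "\<lambda>x. x" "B V" "h V"
      by (rule L_semilinear[OF assms(1,2)])
  have "L V v \<ominus>\<^bsub>Sect X V\<^esub> L V w = \<zero>\<^bsub>Sect X V\<^esub>"
    by (rule trans[OF semilin_minus[OF assms(3,4), symmetric] L_N[OF assms(1,2,5)]])
  then show ?thesis
    by (rule R.minus_eq_zeroD[OF _ semilin_closed[OF assms(3)] semilin_closed[OF assms(4)]])
qed

text \<open>On a small enough \<open>V\<close> the two representatives of the germ differ by an
  element of \<open>N V\<close>, which \<open>L V\<close> kills.\<close>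

lemma L_agree:
  assumes "\<sigma> \<in> Shf U'" "p \<in> U'" "(W, C) \<in> \<sigma> p" "v \<in> C" "W \<subseteq> U" "(W', C') \<in> \<sigma> p" "v' \<in> C'" "W' \<subseteq> U"
  obtains V where "opn V" "p \<in> V" "V \<subseteq> W \<inter> W'" "Rest X W V (L W v) = Rest X W' V (L W' v')"
proof -
  obtain V where V: "opn V" "p \<in> V" "V \<subseteq> W \<inter> W'" "pu W V v \<ominus>\<^bsub>M V\<^esub> pu W' V v' \<in> N V"
    using Shf_mem2[OF assms(1-4,6,7)] .
  note 1 = Shf_mem[OF assms(1-3)] Shf_mem[OF assms(1,2,6)]
  note 2 = Q_mem[OF 1(1,3) assms(4)] Q_mem[OF 1(5,7) assms(7)]
  have "L V (pu W V v) = L V (pu W' V v')"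
    using V assms 1 2 by (intro L_cong pu_closed) auto
  then have "Rest X W V (L W v) = Rest X W' V (L W' v')"
    using V assms 1 2 L_pu[of W V v] L_pu[of W' V v'] by simp
  then show ?thesis using that V by blast
qed

text \<open>One representative at each point is enough: \<open>L_agree\<close> carries the equation
  to every other representative of the same germ, after intersecting the neighbourhoods.\<close>

lemma is_pairingI:
  assumes \<sigma>: "\<sigma> \<in> Shf U" and f: "f \<in> carrier (Sect X U)"
    and ex: "\<And>p. p \<in> U \<Longrightarrow> \<exists>W C v W'. (W, C) \<in> \<sigma> p \<and> v \<in> C \<and> W \<subseteq> U \<and>
      opn W' \<and> p \<in> W' \<and> W' \<subseteq> W \<and> Rest X U W' f = Rest X W W' (L W v)"
  shows "is_pairing U h \<sigma> f"
  unfolding is_pairing_L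
proof (intro conjI f ballI allI impI)
  fix p W C v assume p: "p \<in> U" and W: "(W, C) \<in> \<sigma> p \<and> v \<in> C \<and> W \<subseteq> U"
  obtain W0 C0 v0 W' where W0: "(W0, C0) \<in> \<sigma> p" "v0 \<in> C0" "W0 \<subseteq> U"
    "opn W'" "p \<in> W'" "W' \<subseteq> W0" "Rest X U W' f = Rest X W0 W' (L W0 v0)"
    using ex[OF p] by blast
  obtain V where V: "opn V" "p \<in> V" "V \<subseteq> W \<inter> W0" "Rest X W V (L W v) = Rest X W0 V (L W0 v0)"
    using L_agree[OF \<sigma> p, of W C v W0 C0 v0] W W0 by blast
  note 1 = Shf_mem[OF \<sigma> p, of W C] Shf_mem[OF \<sigma> p W0(1)]
  have c: "L W v \<in> carrier (Sect X W)" "L W0 v0 \<in> carrier (Sect X W0)"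
    using 1 W W0 Q_mem by (auto intro!: L_closed)
  let ?V = "V \<inter> W'"
  have oV: "opn ?V" using V W0 by auto
  have "Rest X U ?V f = Rest X W' ?V (Rest X U W' f)"
    using f W0 oV opn_U by (intro res_res[symmetric]) auto
  also have "\<dots> = Rest X W' ?V (Rest X W0 W' (L W0 v0))" using W0 by simp
  also have "\<dots> = Rest X W0 ?V (L W0 v0)" using 1 W0 c oV by (intro res_res) auto
  also have "\<dots> = Rest X V ?V (Rest X W0 V (L W0 v0))" using 1 W0 c oV V
      by (intro res_res[symmetric]) auto
  also have "\<dots> = Rest X V ?V (Rest X W V (L W v))" using V by simp
  also have "\<dots> = Rest X W ?V (L W v)" using 1 W c oV V by (intro res_res) auto
  finally show "\<exists>W'. opn W' \<and> p \<in> W' \<and> W' \<subseteq> W \<and> Rest X U W' f = Rest X W W' (L W v)"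
    using oV V W0 by (intro exI[of _ ?V]) auto
qed

text \<open>The local values \<open>L (V p) (v p)\<close> glue. On an overlap they agree near each
  point, since there they come from two representatives of one germ, and hence agree on the whole
  overlap by \<open>local_eq\<close>.\<close>

lemma pairing_ex:
  assumes \<sigma>: "\<sigma> \<in> Shf U" obtains f where "is_pairing U h \<sigma> f"
proof -
  have "\<exists>V v. opn V \<and> p \<in> V \<and> V \<subseteq> U \<and> v \<in> carrier (M V) \<and> (\<forall>q\<in>V. (V, cl V v) \<in> \<sigma> q)"
    if "p \<in> U" for p by (rule Shf_E[OF \<sigma> that]) blast
  then obtain V v where V: "\<And>p. p \<in> U \<Longrightarrow> opn (V p) \<and> p \<in> V p \<and> V p \<subseteq> U \<and> v p \<in> carrier (M (V p))"
    and mem: "\<And>p q. p \<in> U \<Longrightarrow> q \<in> V p \<Longrightarrow> (V p, cl (V p) (v p)) \<in> \<sigma> q" by metis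
  have c: "L (V p) (v p) \<in> carrier (Sect X (V p))" if "p \<in> U" for p using V[OF that] L_closed
      by blast
  obtain t where t: "t \<in> carrier (Sect X U)" "\<And>p. p \<in> U \<Longrightarrow> Rest X U (V p) t = L (V p) (v p)"
  proof (rule glue_points[OF opn_U, of V "\<lambda>p. L (V p) (v p)"])
    fix p q assume p: "p \<in> U" and q: "q \<in> U"
    let ?W = "V p \<inter> V q"
    have oW: "opn ?W" using V p q by auto
    show "Rest X (V p) ?W (L (V p) (v p)) = Rest X (V q) ?W (L (V q) (v q))"
    proof (rule local_eq[OF oW])
      fix x assume x: "x \<in> ?W"
      have xU: "x \<in> U" using x V p by auto
      obtain W where W: "opn W" "x \<in> W" "W \<subseteq> V p \<inter> V q" "Rest X (V p) W (L (V p) (v p)) =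
          Rest X (V q) W (L (V q) (v q))"
        using L_agree[OF \<sigma> xU, of "V p" "cl (V p) (v p)" "v p" "V q" "cl (V q) (v q)" "v q"] mem p q
            x V cl_self
        by (metis IntD1 IntD2)
      then show "\<exists>W. opn W \<and> x \<in> W \<and> W \<subseteq> ?W \<and>
            Rest X ?W W (Rest X (V p) ?W (L (V p) (v p))) = Rest X ?W W (Rest X (V q) ?W (L (V q) (v
                q)))"
        using V[OF p] V[OF q] oW c[OF p] c[OF q] by (intro exI[of _ W]) (simp add: res_res)
    qed (use V p q c oW res_closed in auto)
  qed (use V c in auto)
  have "is_pairing U h \<sigma> t"
  proof (rule is_pairingI[OF \<sigma> t(1)])
    fix p assume p: "p \<in> U"
    show "\<exists>W C v W'. (W, C) \<in> \<sigma> p \<and> v \<in> C \<and> W \<subseteq> U \<and> opn W' \<and> p \<in> W' \<and> W' \<subseteq> W \<and> Rest X U W' t =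
        Rest X W W' (L W v)"
      using V[OF p] mem[OF p, of p] cl_self[of "V p" "v p"] t(2)[OF p] c[OF p] res_id
      by (intro exI[of _ "V p"] exI[of _ "cl (V p) (v p)"] exI[of _ "v p"]) simp
  qed
  then show ?thesis using that by blast
qed

text \<open>Near each point both candidates restrict to the same \<open>L V v\<close>.\<close>

lemma pairing_unique:
  assumes \<sigma>: "\<sigma> \<in> Shf U" and f: "is_pairing U h \<sigma> f" "is_pairing U h \<sigma> f'" shows "f = f'"
proof (rule local_eq[OF opn_U])
  show c: "f \<in> carrier (Sect X U)" "f' \<in> carrier (Sect X U)" using f by (auto simp: is_pairing_def)
  fix p assume p: "p \<in> U"
  obtain V v where V: "opn V" "p \<in> V" "V \<subseteq> U" "v \<in> carrier (M V)" "(V, cl V v) \<in> \<sigma> p"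
    by (rule Shf_E[OF \<sigma> p]) blast
  have c': "L V v \<in> carrier (Sect X V)" using V L_closed by blast
  obtain W where W: "opn W" "p \<in> W" "W \<subseteq> V" "Rest X U W f = Rest X V W (L V v)"
    using f(1) p V cl_self[OF V(1,4)] unfolding is_pairing_L by blast
  obtain W' where W': "opn W'" "p \<in> W'" "W' \<subseteq> V" "Rest X U W' f' = Rest X V W' (L V v)"
    using f(2) p V cl_self[OF V(1,4)] unfolding is_pairing_L by blast
  let ?W = "W \<inter> W'"
  have oW: "opn ?W" using W W' by auto
  have "Rest X U ?W f = Rest X W ?W (Rest X U W f)" using opn_U W V oW c
      by (intro res_res[symmetric]) auto
  also have "\<dots> = Rest X V ?W (L V v)" unfolding W(4) using W V oW c' by (intro res_res) auto
  also have "\<dots> = Rest X W' ?W (Rest X V W' (L V v))" using W' V oW c'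
      by (intro res_res[symmetric]) auto
  also have "\<dots> = Rest X U ?W f'" unfolding W'(4)[symmetric] using opn_U W' V oW c
      by (intro res_res) auto
  finally show "\<exists>W. opn W \<and> p \<in> W \<and> W \<subseteq> U \<and> Rest X U W f = Rest X U W f'"
    using oW W W' V by (intro exI[of _ ?W]) auto
qed

end

section \<open>First Cech cohomology\<close>

context abelian_group
begin

text \<open>With subtraction moved across the equation, cocycle conditions and ring identities can
  be checked with sums alone.\<close>

lemma minus_eq_iff_add:
  assumes "x \<in> carrier G" "y \<in> carrier G" "z \<in> carrier G" "w \<in> carrier G"
  shows "x \<ominus> y = z \<ominus> w \<longleftrightarrow> x \<oplus> w = z \<oplus> y"
proof -
  have "(x \<ominus> y) \<oplus> (y \<oplus> w) = x \<oplus> w"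
    using assms by (simp add: a_minus_def a_assoc r_neg1 r_neg2)
  moreover have "(z \<ominus> w) \<oplus> (y \<oplus> w) = z \<oplus> y"
    using assms by (simp add: a_minus_def a_assoc a_comm[of y w] r_neg1 r_neg2)
  ultimately show ?thesis
    using assms add.right_cancel[of "y \<oplus> w" "x \<ominus> y" "z \<ominus> w"] by simp
qed

lemma minus_add_minus:
  assumes "x \<in> carrier G" "y \<in> carrier G" "z \<in> carrier G"
  shows "(x \<ominus> y) \<oplus> (y \<ominus> z) = x \<ominus> z"
  using assms by (simp add: a_minus_def a_assoc r_neg1 r_neg2)

end

text \<open>The structure shared by the structure sheaf and the tangent sheaf. The latter has no
  multiplication, so the cohomology is developed for additive groups.\<close>

locale ab_presheaf =
  fixes T :: "'p topology" and F :: "('p, 's) presheaf"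
  assumes ab: "openin T U \<Longrightarrow> abelian_group (Sec F U)"
    and Res_closed: "\<lbrakk>openin T U; openin T V; V \<subseteq> U; a \<in> carrier (Sec F U)\<rbrakk> \<Longrightarrow>
        Res F U V a \<in> carrier (Sec F V)"
    and Res_add: "\<lbrakk>openin T U; openin T V; V \<subseteq> U; a \<in> carrier (Sec F U); b \<in> carrier (Sec F U)\<rbrakk> \<Longrightarrow>
      Res F U V (a \<oplus>\<^bsub>Sec F U\<^esub> b) = Res F U V a \<oplus>\<^bsub>Sec F V\<^esub> Res F U V b"
    and Res_Res: "\<lbrakk>openin T U; openin T V; openin T W; V \<subseteq> U; W \<subseteq> V; a \<in> carrier (Sec F U)\<rbrakk> \<Longrightarrow>
      Res F V W (Res F U V a) = Res F U W a"
begin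

lemma zero_closed: "openin T U \<Longrightarrow> \<zero>\<^bsub>Sec F U\<^esub> \<in> carrier (Sec F U)"
  by (intro abelian_monoid.zero_closed abelian_group.axioms(1) ab)

lemma add_closed: "openin T U \<Longrightarrow> a \<in> carrier (Sec F U) \<Longrightarrow> b \<in> carrier (Sec F U) \<Longrightarrow>
    a \<oplus>\<^bsub>Sec F U\<^esub> b \<in> carrier (Sec F U)"
  by (intro abelian_monoid.a_closed abelian_group.axioms(1) ab)

lemma Res_zero:
  assumes "openin T U" "openin T V" "V \<subseteq> U"
  shows "Res F U V \<zero>\<^bsub>Sec F U\<^esub> = \<zero>\<^bsub>Sec F V\<^esub>"
proof -
  interpret U: abelian_group "Sec F U" by (rule ab) fact
  interpret V: abelian_group "Sec F V" by (rule ab) fact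
  have c: "Res F U V \<zero>\<^bsub>Sec F U\<^esub> \<in> carrier (Sec F V)" by (rule Res_closed) (use assms in auto)
  have "Res F U V \<zero>\<^bsub>Sec F U\<^esub> \<oplus>\<^bsub>Sec F V\<^esub> Res F U V \<zero>\<^bsub>Sec F U\<^esub> = Res F U V \<zero>\<^bsub>Sec F U\<^esub>"
    using Res_add[OF assms, of "\<zero>\<^bsub>Sec F U\<^esub>" "\<zero>\<^bsub>Sec F U\<^esub>"] by simp
  then show ?thesis using V.add.r_cancel_one'[OF c c] by simp
qed

text \<open>The condition \<open>c - d = b - b'\<close> of the definition is put into the form
  \<open>c + b' = b + d\<close>, since sums are what \<open>Res_add\<close> lets pass through
  restriction.\<close>

lemma cohomologous_iff:
  "((\<U>, c), (\<V>, d)) \<in> cohomologous T F \<longleftrightarrow> (\<U>, c) \<in> cocycles T F \<and> (\<V>, d) \<in> cocycles T F \<and>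
     (\<exists>\<W> r s b. open_cover T \<W> \<and>
        (\<forall>W\<in>\<W>. r W \<in> \<U> \<and> W \<subseteq> r W \<and> s W \<in> \<V> \<and> W \<subseteq> s W \<and> b W \<in> carrier (Sec F W)) \<and>
        (\<forall>W\<in>\<W>. \<forall>W'\<in>\<W>.
           Res F (r W \<inter> r W') (W \<inter> W') (c (r W) (r W')) \<oplus>\<^bsub>Sec F (W \<inter> W')\<^esub> Res F W' (W \<inter> W') (b W') =
           Res F W (W \<inter> W') (b W) \<oplus>\<^bsub>Sec F (W \<inter> W')\<^esub> Res F (s W \<inter> s W') (W \<inter> W') (d (s W) (s W'))))"
  (is "_ \<longleftrightarrow> ?z \<and> ?z' \<and> (\<exists>\<W> r s b. ?A \<W> r s b \<and> ?B \<W> r s b \<and> ?C \<W> r s b)")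
proof -
  let ?D = "\<lambda>\<W> r s b. \<forall>W\<in>\<W>. \<forall>W'\<in>\<W>.
           Res F (r W \<inter> r W') (W \<inter> W') (c (r W) (r W')) \<ominus>\<^bsub>Sec F (W \<inter> W')\<^esub>
           Res F (s W \<inter> s W') (W \<inter> W') (d (s W) (s W')) =
           Res F W (W \<inter> W') (b W) \<ominus>\<^bsub>Sec F (W \<inter> W')\<^esub> Res F W' (W \<inter> W') (b W')"
  have key: "?D \<W> r s b \<longleftrightarrow> ?C \<W> r s b"
    if z: "?z" and z': "?z'" and A: "?A \<W> r s b" and B: "?B \<W> r s b" for \<W> r s b
  proof (intro ball_cong refl)
    fix W W' assume W: "W \<in> \<W>" "W' \<in> \<W>"
    have o: "openin T W" "openin T W'" using W A by (auto simp: open_cover_def)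
    then have o': "openin T (W \<inter> W')" by auto
    have c: "c (r W) (r W') \<in> carrier (Sec F (r W \<inter> r W'))" "openin T (r W \<inter> r W')"
      using z W B by (auto simp: cocycles_def open_cover_def)
    have d: "d (s W) (s W') \<in> carrier (Sec F (s W \<inter> s W'))" "openin T (s W \<inter> s W')"
      using z' W B by (auto simp: cocycles_def open_cover_def)
    have sub: "W \<inter> W' \<subseteq> r W \<inter> r W'" "W \<inter> W' \<subseteq> s W \<inter> s W'" using B W by blast+
    interpret abelian_group "Sec F (W \<inter> W')" by (rule ab[OF o'])
    show "(Res F (r W \<inter> r W') (W \<inter> W') (c (r W) (r W')) \<ominus>\<^bsub>Sec F (W \<inter> W')\<^esub>
           Res F (s W \<inter> s W') (W \<inter> W') (d (s W) (s W')) =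
           Res F W (W \<inter> W') (b W) \<ominus>\<^bsub>Sec F (W \<inter> W')\<^esub> Res F W' (W \<inter> W') (b W')) =
          (Res F (r W \<inter> r W') (W \<inter> W') (c (r W) (r W')) \<oplus>\<^bsub>Sec F (W \<inter> W')\<^esub> Res F W' (W \<inter> W') (b W') =
           Res F W (W \<inter> W') (b W) \<oplus>\<^bsub>Sec F (W \<inter> W')\<^esub> Res F (s W \<inter> s W') (W \<inter> W') (d (s W) (s W')))"
      using B W o o' by (intro minus_eq_iff_add Res_closed c d sub) auto
  qed
  have "((\<U>, c), (\<V>, d)) \<in> cohomologous T F \<longleftrightarrow> ?z \<and> ?z' \<and> (\<exists>\<W> r s b. ?A \<W> r s b \<and> ?B \<W> r s b \<and>
      ?D \<W> r s b)"
    by (simp only: cohomologous_def mem_Collect_eq prod.case)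
  also have "\<dots> \<longleftrightarrow> ?z \<and> ?z' \<and> (\<exists>\<W> r s b. ?A \<W> r s b \<and> ?B \<W> r s b \<and> ?C \<W> r s b)"
    by (intro conj_cong refl ex_cong1 key)
  finally show ?thesis .
qed

lemma cohomologousI:
  assumes "(\<U>, c) \<in> cocycles T F" "(\<V>, d) \<in> cocycles T F" "open_cover T \<W>"
    "\<And>W. W \<in> \<W> \<Longrightarrow> r W \<in> \<U> \<and> W \<subseteq> r W" "\<And>W. W \<in> \<W> \<Longrightarrow> s W \<in> \<V> \<and> W \<subseteq> s W"
    "\<And>W. W \<in> \<W> \<Longrightarrow> b W \<in> carrier (Sec F W)"
    "\<And>W W'. W \<in> \<W> \<Longrightarrow> W' \<in> \<W> \<Longrightarrow>
      Res F (r W \<inter> r W') (W \<inter> W') (c (r W) (r W')) \<oplus>\<^bsub>Sec F (W \<inter> W')\<^esub> Res F W' (W \<inter> W') (b W') =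
      Res F W (W \<inter> W') (b W) \<oplus>\<^bsub>Sec F (W \<inter> W')\<^esub> Res F (s W \<inter> s W') (W \<inter> W') (d (s W) (s W'))"
  shows "((\<U>, c), (\<V>, d)) \<in> cohomologous T F"
  unfolding cohomologous_iff
  by (rule conjI[OF assms(1)], rule conjI[OF assms(2)], rule exI[of _ \<W>], rule exI[of _ r], rule
      exI[of _ s], rule exI[of _ b])
     (use assms(3-) in simp)

lemma cocycle_open:
  assumes "(\<U>, c) \<in> cocycles T F" "U \<in> \<U>" "V \<in> \<U>"
  shows "openin T U" "openin T (U \<inter> V)" "c U V \<in> carrier (Sec F (U \<inter> V))"
  using assms by (auto simp: cocycles_def open_cover_def)

lemma cocycle_res:
  assumes z: "(\<U>, c) \<in> cocycles T F" and U: "U \<in> \<U>" "V \<in> \<U>" "W \<in> \<U>"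
    and O': "openin T Z" "Z \<subseteq> U" "Z \<subseteq> V" "Z \<subseteq> W"
  shows "Res F (U \<inter> W) Z (c U W) = Res F (U \<inter> V) Z (c U V) \<oplus>\<^bsub>Sec F Z\<^esub> Res F (V \<inter> W) Z (c V W)"
proof -
  let ?Y = "U \<inter> V \<inter> W"
  note o = cocycle_open[OF z U(1,2)] cocycle_open[OF z U(2,3)] cocycle_open[OF z U(1,3)]
      cocycle_open[OF z U(3,3)]
  have oY: "openin T ?Y" using o by (intro openin_Int) auto
  have "Res F (U \<inter> W) Z (c U W) = Res F ?Y Z (Res F (U \<inter> W) ?Y (c U W))"
    using o oY O' by (intro Res_Res[symmetric]) auto
  also have "Res F (U \<inter> W) ?Y (c U W) = Res F (U \<inter> V) ?Y (c U V) \<oplus>\<^bsub>Sec F ?Y\<^esub> Res F (V \<inter> W) ?Y (c V W)"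
    using z U unfolding cocycles_def by blast
  also have "Res F ?Y Z \<dots> = Res F ?Y Z (Res F (U \<inter> V) ?Y (c U V)) \<oplus>\<^bsub>Sec F Z\<^esub> Res F ?Y Z (Res F (V \<inter> W)
      ?Y (c V W))"
    using o oY O' by (intro Res_add Res_closed) auto
  also have "Res F ?Y Z (Res F (U \<inter> V) ?Y (c U V)) = Res F (U \<inter> V) Z (c U V)"
    using o oY O' by (intro Res_Res) auto
  also have "Res F ?Y Z (Res F (V \<inter> W) ?Y (c V W)) = Res F (V \<inter> W) Z (c V W)"
    using o oY O' by (intro Res_Res) auto
  finally show ?thesis .
qed

lemma cohomologous_refl: "z \<in> cocycles T F \<Longrightarrow> (z, z) \<in> cohomologous T F"
proof (cases z)
  case (Pair \<U> c)
  assume z: "z \<in> cocycles T F"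
  show ?thesis unfolding Pair
  proof (rule cohomologousI[where \<W>=\<U> and r="\<lambda>U. U" and s="\<lambda>U. U" and b="\<lambda>U. \<zero>\<^bsub>Sec F U\<^esub>"])
    fix U V assume U: "U \<in> \<U>" "V \<in> \<U>"
    note o = cocycle_open[OF z[unfolded Pair] U] cocycle_open[OF z[unfolded Pair] U(2,1)]
    interpret abelian_group "Sec F (U \<inter> V)" by (rule ab) (rule o)
    have "Res F (U \<inter> V) (U \<inter> V) (c U V) \<in> carrier (Sec F (U \<inter> V))" using o
        by (intro Res_closed) auto
    then show "Res F (U \<inter> V) (U \<inter> V) (c U V) \<oplus>\<^bsub>Sec F (U \<inter> V)\<^esub> Res F V (U \<inter> V) \<zero>\<^bsub>Sec F V\<^esub> =
         Res F U (U \<inter> V) \<zero>\<^bsub>Sec F U\<^esub> \<oplus>\<^bsub>Sec F (U \<inter> V)\<^esub> Res F (U \<inter> V) (U \<inter> V) (c U V)"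
      using o by (simp add: Res_zero)
  qed (use z Pair zero_closed in \<open>auto simp: cocycles_def open_cover_def\<close>)
qed

lemma cohomologous_sym:
  assumes "(z, z') \<in> cohomologous T F" shows "(z', z) \<in> cohomologous T F"
proof -
  obtain \<U> c \<V> d where zz: "z = (\<U>, c)" "z' = (\<V>, d)" by (metis surj_pair)
  obtain \<W> r s b where z: "(\<U>, c) \<in> cocycles T F" "(\<V>, d) \<in> cocycles T F" "open_cover T \<W>"
    and W: "\<forall>W\<in>\<W>. r W \<in> \<U> \<and> W \<subseteq> r W \<and> s W \<in> \<V> \<and> W \<subseteq> s W \<and> b W \<in> carrier (Sec F W)"
    and eq: "\<forall>W\<in>\<W>. \<forall>W'\<in>\<W>.
           Res F (r W \<inter> r W') (W \<inter> W') (c (r W) (r W')) \<oplus>\<^bsub>Sec F (W \<inter> W')\<^esub> Res F W' (W \<inter> W') (b W') =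
           Res F W (W \<inter> W') (b W) \<oplus>\<^bsub>Sec F (W \<inter> W')\<^esub> Res F (s W \<inter> s W') (W \<inter> W') (d (s W) (s W'))"
    using assms unfolding zz cohomologous_iff by (elim conjE exE) (rule that)
  note W = W[rule_format] and eq = eq[rule_format]
  have oW: "openin T W" if "W \<in> \<W>" for W using that z(3) by (auto simp: open_cover_def)
  show ?thesis unfolding zz
  proof (rule cohomologousI[OF z(2,1,3), where r=s and s=r and b="\<lambda>W. \<ominus>\<^bsub>Sec F W\<^esub> b W"])
    fix W assume W1: "W \<in> \<W>"
    interpret abelian_group "Sec F W" by (rule ab[OF oW[OF W1]])
    show "\<ominus>\<^bsub>Sec F W\<^esub> b W \<in> carrier (Sec F W)" using W[OF W1] by simp
  next
    fix W W' assume W12: "W \<in> \<W>" "W' \<in> \<W>"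
    have o: "openin T (W \<inter> W')" using W12 oW by blast
    interpret abelian_group "Sec F (W \<inter> W')" by (rule ab[OF o])
    have neg: "Res F V (W \<inter> W') (\<ominus>\<^bsub>Sec F V\<^esub> b V) = \<ominus>\<^bsub>Sec F (W \<inter> W')\<^esub> Res F V (W \<inter> W') (b V)"
      if V: "V \<in> \<W>" "W \<inter> W' \<subseteq> V" for V
    proof -
      interpret V: abelian_group "Sec F V" by (rule ab[OF oW[OF V(1)]])
      have "Res F V (W \<inter> W') (\<ominus>\<^bsub>Sec F V\<^esub> b V) \<oplus>\<^bsub>Sec F (W \<inter> W')\<^esub> Res F V (W \<inter> W') (b V) =
          \<zero>\<^bsub>Sec F (W \<inter> W')\<^esub>"
        using W[OF V(1)] oW[OF V(1)] o V(2) by (simp add: Res_add[symmetric] V.l_neg Res_zero)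
      then show ?thesis using W[OF V(1)] oW[OF V(1)] o V(2)
        by (intro minus_equality[symmetric] Res_closed) auto
    qed
    let ?c = "Res F (r W \<inter> r W') (W \<inter> W') (c (r W) (r W'))"
        and ?d = "Res F (s W \<inter> s W') (W \<inter> W') (d (s W) (s W'))"
    let ?b = "Res F W (W \<inter> W') (b W)" and ?b' = "Res F W' (W \<inter> W') (b W')"
    have cl: "?c \<in> carrier (Sec F (W \<inter> W'))" "?d \<in> carrier (Sec F (W \<inter> W'))"
       "?b \<in> carrier (Sec F (W \<inter> W'))" "?b' \<in> carrier (Sec F (W \<inter> W'))"
      using W[OF W12(1)] W[OF W12(2)] W12 oW o cocycle_open[OF z(1)] cocycle_open[OF z(2)]
      by (auto intro!: Res_closed)
    have "?c \<ominus>\<^bsub>Sec F (W \<inter> W')\<^esub> ?d = ?b \<ominus>\<^bsub>Sec F (W \<inter> W')\<^esub> ?b'"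
      using eq[OF W12] cl minus_eq_iff_add by blast
    then have "\<ominus>\<^bsub>Sec F (W \<inter> W')\<^esub> (?c \<ominus>\<^bsub>Sec F (W \<inter> W')\<^esub> ?d) = \<ominus>\<^bsub>Sec F (W \<inter> W')\<^esub> (?b \<ominus>\<^bsub>Sec F (W \<inter> W')\<^esub> ?b')"
        by simp
    then have "?d \<ominus>\<^bsub>Sec F (W \<inter> W')\<^esub> ?c = (\<ominus>\<^bsub>Sec F (W \<inter> W')\<^esub> ?b) \<ominus>\<^bsub>Sec F (W \<inter> W')\<^esub> (\<ominus>\<^bsub>Sec F (W \<inter> W')\<^esub> ?b')"
      using cl by (simp add: a_minus_def minus_add a_comm)
    then have "?d \<oplus>\<^bsub>Sec F (W \<inter> W')\<^esub> (\<ominus>\<^bsub>Sec F (W \<inter> W')\<^esub> ?b') = (\<ominus>\<^bsub>Sec F (W \<inter> W')\<^esub> ?b) \<oplus>\<^bsub>Sec F (W \<inter> W')\<^esub> ?c"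
      using cl minus_eq_iff_add by simp
    then show "?d \<oplus>\<^bsub>Sec F (W \<inter> W')\<^esub> Res F W' (W \<inter> W') (\<ominus>\<^bsub>Sec F W'\<^esub> b W') =
         Res F W (W \<inter> W') (\<ominus>\<^bsub>Sec F W\<^esub> b W) \<oplus>\<^bsub>Sec F (W \<inter> W')\<^esub> ?c"
      using neg W12 by simp
  qed (use W in auto)
qed

lemma common_refinement:
  assumes "open_cover T \<V>" "open_cover T \<W>"
  obtains \<Y> a b where "open_cover T \<Y>" "\<And>Y. Y \<in> \<Y> \<Longrightarrow> a Y \<in> \<V> \<and> b Y \<in> \<W> \<and> Y = a Y \<inter> b Y \<and> openin T Y"
proof -
  define \<Y> where "\<Y> = {A \<inter> B | A B. A \<in> \<V> \<and> B \<in> \<W>}"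
  \<comment> \<open>Distinct pairs may have the same intersection, so each member of
    \<open>\<Y>\<close> is assigned one pair.\<close>
  have "\<forall>Y\<in>\<Y>. \<exists>A B. A \<in> \<V> \<and> B \<in> \<W> \<and> Y = A \<inter> B" by (auto simp: \<Y>_def)
  then obtain a b where ab: "\<And>Y. Y \<in> \<Y> \<Longrightarrow> a Y \<in> \<V> \<and> b Y \<in> \<W> \<and> Y = a Y \<inter> b Y" by metis
  have o: "openin T Y" if "Y \<in> \<Y>" for Y using that assms by (auto simp: \<Y>_def open_cover_def)
  have "\<Union>\<Y> = \<Union>\<V> \<inter> \<Union>\<W>" by (auto simp: \<Y>_def)
  then have "open_cover T \<Y>" using assms o by (auto simp: open_cover_def)
  then show ?thesis using that ab o by blast
qed

text \<open>On a common refinement, the two restrictions of the middle cocycle \<open>d\<close> along different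
    refinement
  maps \<open>s\<close> and \<open>r'\<close> differ by the coboundary of \<open>d (s W) (r' W)\<close>.\<close>

lemma cohomologous_trans:
  assumes "(x, y) \<in> cohomologous T F" "(y, z) \<in> cohomologous T F" shows "(x, z) \<in> cohomologous T F"
proof -
  obtain \<U> c \<V> d \<E> e where xyz: "x = (\<U>, c)" "y = (\<V>, d)" "z = (\<E>, e)" by (metis surj_pair)
  obtain \<W> r s b where z1: "(\<U>, c) \<in> cocycles T F" "(\<V>, d) \<in> cocycles T F" "open_cover T \<W>"
    and W: "\<forall>W\<in>\<W>. r W \<in> \<U> \<and> W \<subseteq> r W \<and> s W \<in> \<V> \<and> W \<subseteq> s W \<and> b W \<in> carrier (Sec F W)"
    and eq: "\<forall>W\<in>\<W>. \<forall>W'\<in>\<W>.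
           Res F (r W \<inter> r W') (W \<inter> W') (c (r W) (r W')) \<oplus>\<^bsub>Sec F (W \<inter> W')\<^esub> Res F W' (W \<inter> W') (b W') =
           Res F W (W \<inter> W') (b W) \<oplus>\<^bsub>Sec F (W \<inter> W')\<^esub> Res F (s W \<inter> s W') (W \<inter> W') (d (s W) (s W'))"
    using assms(1) unfolding xyz cohomologous_iff by (elim conjE exE) (rule that)
  note W = W[rule_format] and eq = eq[rule_format]
  obtain \<W>' r' s' b' where z2: "(\<E>, e) \<in> cocycles T F" "open_cover T \<W>'"
    and W': "\<forall>W\<in>\<W>'. r' W \<in> \<V> \<and> W \<subseteq> r' W \<and> s' W \<in> \<E> \<and> W \<subseteq> s' W \<and> b' W \<in> carrier (Sec F W)"
    and eq': "\<forall>W\<in>\<W>'. \<forall>W'\<in>\<W>'.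
           Res F (r' W \<inter> r' W') (W \<inter> W') (d (r' W) (r' W')) \<oplus>\<^bsub>Sec F (W \<inter> W')\<^esub> Res F W' (W \<inter> W') (b'
               W') =
           Res F W (W \<inter> W') (b' W) \<oplus>\<^bsub>Sec F (W \<inter> W')\<^esub> Res F (s' W \<inter> s' W') (W \<inter> W') (e (s' W) (s' W'))"
    using assms(2) unfolding xyz cohomologous_iff by (elim conjE exE) (rule that)
  note W' = W'[rule_format] and eq' = eq'[rule_format]
  obtain \<Y> a a' where Y: "open_cover T \<Y>"
    and a: "\<And>Y. Y \<in> \<Y> \<Longrightarrow> a Y \<in> \<W> \<and> a' Y \<in> \<W>' \<and> Y = a Y \<inter> a' Y \<and> openin T Y"
    by (rule common_refinement[OF z1(3) z2(2)]) (rule that)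
  have oW: "openin T W" if "W \<in> \<W> \<or> W \<in> \<W>'" for W using that z1(3) z2(2)
      by (auto simp: open_cover_def)
  have sub: "Y \<subseteq> a Y" "Y \<subseteq> a' Y" "Y \<subseteq> r (a Y)" "Y \<subseteq> s (a Y)" "Y \<subseteq> r' (a' Y)" "Y \<subseteq> s' (a' Y)"
      if "Y \<in> \<Y>" for Y
  proof -
    show s: "Y \<subseteq> a Y" "Y \<subseteq> a' Y" using a[OF that] by blast+
    have "a Y \<in> \<W>" "a' Y \<in> \<W>'" using a[OF that] by auto
    then show "Y \<subseteq> r (a Y)" "Y \<subseteq> s (a Y)" "Y \<subseteq> r' (a' Y)" "Y \<subseteq> s' (a' Y)"
      using W[of "a Y"] W'[of "a' Y"] s by auto
  qed
  have mem: "r (a Y) \<in> \<U>" "s (a Y) \<in> \<V>" "r' (a' Y) \<in> \<V>" "s' (a' Y) \<in> \<E>"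
    "b (a Y) \<in> carrier (Sec F (a Y))" "b' (a' Y) \<in> carrier (Sec F (a' Y))" "openin T (a Y)"
        "openin T (a' Y)" if "Y \<in> \<Y>" for Y
  proof -
    have "a Y \<in> \<W>" "a' Y \<in> \<W>'" using a[OF that] by auto
    then show "r (a Y) \<in> \<U>" "s (a Y) \<in> \<V>" "r' (a' Y) \<in> \<V>" "s' (a' Y) \<in> \<E>"
      "b (a Y) \<in> carrier (Sec F (a Y))" "b' (a' Y) \<in> carrier (Sec F (a' Y))" "openin T (a Y)"
          "openin T (a' Y)"
      using W[of "a Y"] W'[of "a' Y"] oW by auto
  qed
  note co = cocycle_open[OF z1(1)] cocycle_open[OF z1(2)] cocycle_open[OF z2(1)]
  define h where "h Y = Res F (s (a Y) \<inter> r' (a' Y)) Y (d (s (a Y)) (r' (a' Y)))" for Y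
  define k where "k Y = Res F (a Y) Y (b (a Y)) \<oplus>\<^bsub>Sec F Y\<^esub> h Y \<oplus>\<^bsub>Sec F Y\<^esub> Res F (a' Y) Y (b' (a' Y))"
      for Y
  have hc: "h Y \<in> carrier (Sec F Y)" if Y: "Y \<in> \<Y>" for Y
    unfolding h_def using a[OF Y] mem[OF Y] sub[OF Y] co by (intro Res_closed) auto
  have bc: "Res F (a Y) Y (b (a Y)) \<in> carrier (Sec F Y)"
      "Res F (a' Y) Y (b' (a' Y)) \<in> carrier (Sec F Y)" if Y: "Y \<in> \<Y>" for Y
    using a[OF Y] mem[OF Y] sub[OF Y] by (auto intro!: Res_closed)
  show ?thesis unfolding xyz
  proof (rule cohomologousI[OF z1(1) z2(1) Y, where r="\<lambda>Y. r (a Y)" and s="\<lambda>Y. s' (a' Y)" and b=k])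
    fix Y assume "Y \<in> \<Y>"
    then show "k Y \<in> carrier (Sec F Y)" unfolding k_def using a hc bc by (intro add_closed) auto
  next
    fix Y Y' assume YY: "Y \<in> \<Y>" "Y' \<in> \<Y>"
    let ?Z = "Y \<inter> Y'"
    have oZ: "openin T ?Z" using a YY by blast
    have o: "openin T Y" "openin T Y'" using a YY by blast+
    interpret abelian_group "Sec F ?Z" by (rule ab[OF oZ])
    let ?c = "Res F (r (a Y) \<inter> r (a Y')) ?Z (c (r (a Y)) (r (a Y')))"
    let ?d = "Res F (s (a Y) \<inter> s (a Y')) ?Z (d (s (a Y)) (s (a Y')))"
    let ?d' = "Res F (r' (a' Y) \<inter> r' (a' Y')) ?Z (d (r' (a' Y)) (r' (a' Y')))"
    let ?e = "Res F (s' (a' Y) \<inter> s' (a' Y')) ?Z (e (s' (a' Y)) (s' (a' Y')))"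
    let ?h = "Res F (s (a Y) \<inter> r' (a' Y)) ?Z (d (s (a Y)) (r' (a' Y)))"
    let ?h' = "Res F (s (a Y') \<inter> r' (a' Y')) ?Z (d (s (a Y')) (r' (a' Y')))"
    let ?b = "Res F (a Y) ?Z (b (a Y))" and ?b' = "Res F (a Y') ?Z (b (a Y'))"
    let ?g = "Res F (a' Y) ?Z (b' (a' Y))" and ?g' = "Res F (a' Y') ?Z (b' (a' Y'))"
    note m = mem[OF YY(1)] mem[OF YY(2)] and su = sub[OF YY(1)] sub[OF YY(2)]
    have cl: "?c \<in> carrier (Sec F ?Z)" "?d \<in> carrier (Sec F ?Z)" "?d' \<in> carrier (Sec F ?Z)"
        "?e \<in> carrier (Sec F ?Z)"
      "?h \<in> carrier (Sec F ?Z)" "?h' \<in> carrier (Sec F ?Z)" "?b \<in> carrier (Sec F ?Z)"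
          "?b' \<in> carrier (Sec F ?Z)"
      "?g \<in> carrier (Sec F ?Z)" "?g' \<in> carrier (Sec F ?Z)"
      using m su co oZ by (auto intro!: Res_closed)
    have rr: "Res F V ?Z x = Res F (V \<inter> V') ?Z (Res F V (V \<inter> V') x)"
      if "openin T V" "openin T V'" "x \<in> carrier (Sec F V)" "?Z \<subseteq> V" "?Z \<subseteq> V'" for V V' x
      using that oZ by (intro Res_Res[symmetric]) auto
    have e1: "?c \<oplus>\<^bsub>Sec F ?Z\<^esub> ?b' = ?b \<oplus>\<^bsub>Sec F ?Z\<^esub> ?d"
    proof -
      let ?A = "a Y \<inter> a Y'"
      have oA: "openin T ?A" "?Z \<subseteq> ?A" using m su by auto
      have sA: "?A \<subseteq> r (a Y) \<inter> r (a Y')" "?A \<subseteq> s (a Y) \<inter> s (a Y')" using W a YY by blast+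
      have "?c \<oplus>\<^bsub>Sec F ?Z\<^esub> ?b' = Res F ?A ?Z (Res F (r (a Y) \<inter> r (a Y')) ?A (c (r (a Y)) (r (a Y')))
          \<oplus>\<^bsub>Sec F ?A\<^esub> Res F (a Y') ?A (b (a Y')))"
        using m co oA oZ sA by (subst Res_add) (auto intro!: Res_closed simp: Res_Res)
      also have "\<dots> = Res F ?A ?Z (Res F (a Y) ?A (b (a Y)) \<oplus>\<^bsub>Sec F ?A\<^esub> Res F (s (a Y) \<inter> s (a Y')) ?A
          (d (s (a Y)) (s (a Y'))))"
        using eq a YY by simp
      also have "\<dots> = ?b \<oplus>\<^bsub>Sec F ?Z\<^esub> ?d"
        using m co oA oZ sA by (subst Res_add) (auto intro!: Res_closed simp: Res_Res)
      finally show ?thesis .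
    qed
    have e2: "?d' \<oplus>\<^bsub>Sec F ?Z\<^esub> ?g' = ?g \<oplus>\<^bsub>Sec F ?Z\<^esub> ?e"
    proof -
      let ?A = "a' Y \<inter> a' Y'"
      have oA: "openin T ?A" "?Z \<subseteq> ?A" using m su by auto
      have sA: "?A \<subseteq> r' (a' Y) \<inter> r' (a' Y')" "?A \<subseteq> s' (a' Y) \<inter> s' (a' Y')" using W' a YY by blast+
      have "?d' \<oplus>\<^bsub>Sec F ?Z\<^esub> ?g' = Res F ?A ?Z (Res F (r' (a' Y) \<inter> r' (a' Y')) ?A (d (r' (a' Y)) (r'
          (a' Y'))) \<oplus>\<^bsub>Sec F ?A\<^esub> Res F (a' Y') ?A (b' (a' Y')))"
        using m co oA oZ sA by (subst Res_add) (auto intro!: Res_closed simp: Res_Res)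
      also have "\<dots> = Res F ?A ?Z (Res F (a' Y) ?A (b' (a' Y)) \<oplus>\<^bsub>Sec F ?A\<^esub> Res F (s' (a' Y) \<inter> s' (a'
          Y')) ?A (e (s' (a' Y)) (s' (a' Y'))))"
        using eq' a YY by simp
      also have "\<dots> = ?g \<oplus>\<^bsub>Sec F ?Z\<^esub> ?e"
        using m co oA oZ sA by (subst Res_add) (auto intro!: Res_closed simp: Res_Res)
      finally show ?thesis .
    qed
    \<comment> \<open>Both sides are the restriction of \<open>d (s (a Y)) (r' (a' Y'))\<close>, by
      the cocycle identity for \<open>d\<close> taken once through \<open>s (a Y')\<close> and once
      through \<open>r' (a' Y)\<close>.\<close>
    have e3: "?d \<oplus>\<^bsub>Sec F ?Z\<^esub> ?h' = ?h \<oplus>\<^bsub>Sec F ?Z\<^esub> ?d'"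
    proof -
      have "?d \<oplus>\<^bsub>Sec F ?Z\<^esub> ?h' = Res F (s (a Y) \<inter> r' (a' Y')) ?Z (d (s (a Y)) (r' (a' Y')))"
        by (rule cocycle_res[OF z1(2), symmetric]) (use m su oZ in auto)
      also have "\<dots> = ?h \<oplus>\<^bsub>Sec F ?Z\<^esub> ?d'"
        by (rule cocycle_res[OF z1(2)]) (use m su oZ in auto)
      finally show ?thesis .
    qed
    have k: "Res F Y ?Z (k Y) = ?b \<oplus>\<^bsub>Sec F ?Z\<^esub> ?h \<oplus>\<^bsub>Sec F ?Z\<^esub> ?g"
      unfolding k_def using m su o oZ co hc[OF YY(1)] bc[OF YY(1)]
      by (simp add: Res_add add_closed Res_Res) (simp add: h_def Res_Res)
    have k': "Res F Y' ?Z (k Y') = ?b' \<oplus>\<^bsub>Sec F ?Z\<^esub> ?h' \<oplus>\<^bsub>Sec F ?Z\<^esub> ?g'"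
      unfolding k_def using m su o oZ co hc[OF YY(2)] bc[OF YY(2)]
      by (simp add: Res_add add_closed Res_Res) (simp add: h_def Res_Res)
    have "?c \<oplus>\<^bsub>Sec F ?Z\<^esub> (?b' \<oplus>\<^bsub>Sec F ?Z\<^esub> ?h' \<oplus>\<^bsub>Sec F ?Z\<^esub> ?g') =
        (?c \<oplus>\<^bsub>Sec F ?Z\<^esub> ?b') \<oplus>\<^bsub>Sec F ?Z\<^esub> (?h' \<oplus>\<^bsub>Sec F ?Z\<^esub> ?g')"
      using cl by (simp add: a_assoc)
    also have "\<dots> = ?b \<oplus>\<^bsub>Sec F ?Z\<^esub> (?d \<oplus>\<^bsub>Sec F ?Z\<^esub> ?h') \<oplus>\<^bsub>Sec F ?Z\<^esub> ?g'"
      unfolding e1 using cl by (simp add: a_assoc)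
    also have "\<dots> = ?b \<oplus>\<^bsub>Sec F ?Z\<^esub> ?h \<oplus>\<^bsub>Sec F ?Z\<^esub> (?d' \<oplus>\<^bsub>Sec F ?Z\<^esub> ?g')"
      unfolding e3 using cl by (simp add: a_assoc)
    also have "\<dots> = (?b \<oplus>\<^bsub>Sec F ?Z\<^esub> ?h \<oplus>\<^bsub>Sec F ?Z\<^esub> ?g) \<oplus>\<^bsub>Sec F ?Z\<^esub> ?e"
      unfolding e2 using cl by (simp add: a_assoc)
    finally show "?c \<oplus>\<^bsub>Sec F ?Z\<^esub> Res F Y' ?Z (k Y') = Res F Y ?Z (k Y) \<oplus>\<^bsub>Sec F ?Z\<^esub> ?e"
      unfolding k k' .
  qed (simp_all add: mem sub)
qed

lemma cech_class_eq_iff: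
  assumes "z \<in> cocycles T F"
  shows "cech_class T F z = cech_class T F z' \<longleftrightarrow> (z, z') \<in> cohomologous T F"
  unfolding cech_class_def
  using cohomologous_refl[OF assms] cohomologous_sym cohomologous_trans by blast

lemma zero_cocycle: "({topspace T}, \<lambda>U V. \<zero>\<^bsub>Sec F (U \<inter> V)\<^esub>) \<in> cocycles T F"
proof -
  interpret abelian_group "Sec F (topspace T)" by (rule ab) simp
  show ?thesis by (auto simp: cocycles_def open_cover_def Res_zero)
qed

text \<open>The zero class is represented on the cover with the single member
  \<open>topspace T\<close>. Its refinement map is therefore constant and its cocycle restricts to
  zero, which leaves a condition on \<open>c\<close>, \<open>r\<close> and \<open>b\<close>.\<close>

lemma cech_class_eq_zero_iff:
  assumes z: "(\<U>, c) \<in> cocycles T F"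
  shows "cech_class T F (\<U>, c) = \<zero>\<^bsub>H1 T F\<^esub> \<longleftrightarrow>
    (\<exists>\<W> r b. open_cover T \<W> \<and> (\<forall>W\<in>\<W>. r W \<in> \<U> \<and> W \<subseteq> r W \<and> b W \<in> carrier (Sec F W)) \<and>
        (\<forall>W\<in>\<W>. \<forall>W'\<in>\<W>.
           Res F (r W \<inter> r W') (W \<inter> W') (c (r W) (r W')) \<oplus>\<^bsub>Sec F (W \<inter> W')\<^esub> Res F W' (W \<inter> W') (b W') =
           Res F W (W \<inter> W') (b W)))" (is "_ \<longleftrightarrow> (\<exists>\<W> r b. ?A \<W> r b \<and> ?B \<W> r b \<and> ?C \<W> r b)")
proof -
  let ?z0 = "({topspace T}, \<lambda>U V. \<zero>\<^bsub>Sec F (U \<inter> V)\<^esub>)"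
  have zr: "Res F W (W \<inter> W') (b W) \<oplus>\<^bsub>Sec F (W \<inter> W')\<^esub> Res F (topspace T \<inter> topspace T) (W \<inter> W') \<zero>\<^bsub>Sec F
      (topspace T \<inter> topspace T)\<^esub>
      = Res F W (W \<inter> W') (b W)" if A: "?A \<W> r b" "?B \<W> r b" "W \<in> \<W>" "W' \<in> \<W>" for \<W> r b W W'
  proof -
    have o: "openin T W" "openin T (W \<inter> W')" using A by (auto simp: open_cover_def)
    interpret abelian_group "Sec F (W \<inter> W')" by (rule ab[OF o(2)])
    have "Res F W (W \<inter> W') (b W) \<in> carrier (Sec F (W \<inter> W'))" using A o by (intro Res_closed) auto
    then show ?thesis using o openin_subset[OF o(2)] by (simp add: Res_zero)
  qed
  have "cech_class T F (\<U>, c) = \<zero>\<^bsub>H1 T F\<^esub> \<longleftrightarrow> ((\<U>, c), ?z0) \<in> cohomologous T F"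
    using cech_class_eq_iff[OF z, of ?z0] by (simp add: H1_def)
  also have "\<dots> \<longleftrightarrow> (\<exists>\<W> r b. ?A \<W> r b \<and> ?B \<W> r b \<and> ?C \<W> r b)"
  proof
    assume "((\<U>, c), ?z0) \<in> cohomologous T F"
    then obtain \<W> r s b where W: "open_cover T \<W>"
      "\<forall>W\<in>\<W>. r W \<in> \<U> \<and> W \<subseteq> r W \<and> s W \<in> {topspace T} \<and> W \<subseteq> s W \<and> b W \<in> carrier (Sec F W)"
      "\<forall>W\<in>\<W>. \<forall>W'\<in>\<W>.
           Res F (r W \<inter> r W') (W \<inter> W') (c (r W) (r W')) \<oplus>\<^bsub>Sec F (W \<inter> W')\<^esub> Res F W' (W \<inter> W') (b W') =
           Res F W (W \<inter> W') (b W) \<oplus>\<^bsub>Sec F (W \<inter> W')\<^esub> Res F (s W \<inter> s W') (W \<inter> W') \<zero>\<^bsub>Sec F (s W \<inter> s W')\<^esub>"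
      unfolding cohomologous_iff by (elim conjE exE) (rule that)
    have AB: "?A \<W> r b" "?B \<W> r b" using W by blast+
    moreover have "?C \<W> r b"
    proof (intro ballI)
      fix W W' assume WW: "W \<in> \<W>" "W' \<in> \<W>"
      have s: "s W = topspace T" "s W' = topspace T" using W(2) WW by blast+
      show "Res F (r W \<inter> r W') (W \<inter> W') (c (r W) (r W')) \<oplus>\<^bsub>Sec F (W \<inter> W')\<^esub> Res F W' (W \<inter> W') (b W') =
           Res F W (W \<inter> W') (b W)"
        using W(3)[rule_format, OF WW] zr[OF AB WW] unfolding s by simp
    qed
    ultimately show "\<exists>\<W> r b. ?A \<W> r b \<and> ?B \<W> r b \<and> ?C \<W> r b" by blast
  next
    assume "\<exists>\<W> r b. ?A \<W> r b \<and> ?B \<W> r b \<and> ?C \<W> r b"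
    then obtain \<W> r b where W: "?A \<W> r b" "?B \<W> r b" "?C \<W> r b" by blast
    show "((\<U>, c), ?z0) \<in> cohomologous T F"
    proof (rule cohomologousI[OF z zero_cocycle, where \<W>=\<W> and r=r and s="\<lambda>_. topspace T" and b=b])
      fix U V assume "U \<in> \<W>" "V \<in> \<W>"
      then show "Res F (r U \<inter> r V) (U \<inter> V) (c (r U) (r V)) \<oplus>\<^bsub>Sec F (U \<inter> V)\<^esub> Res F V (U \<inter> V) (b V) =
       Res F U (U \<inter> V) (b U) \<oplus>\<^bsub>Sec F (U \<inter> V)\<^esub>
       Res F (topspace T \<inter> topspace T) (U \<inter> V) \<zero>\<^bsub>Sec F (topspace T \<inter> topspace T)\<^esub>"
        using W(3) zr[OF W(1,2)] by simp
    next
      fix W assume "W \<in> \<W>"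
      then show "topspace T \<in> {topspace T} \<and> W \<subseteq> topspace T"
        using W(1) openin_subset by (auto simp: open_cover_def)
    qed (use W in auto)
  qed
  finally show ?thesis .
qed

end

section \<open>Derivations of the structure sheaf\<close>

context K_ringed
begin

lemma on_opens_apply: "opn W \<Longrightarrow> W \<subseteq> U \<Longrightarrow> a \<in> carrier (Sect X W) \<Longrightarrow> on_opens X U D W a = D W a"
  by (simp add: on_opens_def)

text \<open>\<open>on_opens\<close> normalizes a family of maps outside its domain, so equality of
  derivations can be tested on sections over open subsets of \<open>U\<close>.\<close>

lemma on_opens_eqI:
  "(\<And>W a. opn W \<Longrightarrow> W \<subseteq> U \<Longrightarrow> a \<in> carrier (Sect X W) \<Longrightarrow> D W a = E W a) \<Longrightarrow> on_opens X U D = on_opens X U E"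
  by (auto simp: on_opens_def fun_eq_iff)

lemma on_opens_on_opens: "V \<subseteq> U \<Longrightarrow> on_opens X V (on_opens X U D) = on_opens X V D"
  by (rule on_opens_eqI) (simp add: on_opens_apply)

lemma derivs_on_opens: "D \<in> derivs X \<delta> U \<Longrightarrow> on_opens X U D = D"
  by (simp add: derivs_def)

lemma derivs_props:
  assumes "D \<in> derivs X \<delta> U" "opn W" "W \<subseteq> U"
  shows "a \<in> carrier (Sect X W) \<Longrightarrow> D W a \<in> carrier (Sect X W)"
    and "a \<in> carrier (Sect X W) \<Longrightarrow> b \<in> carrier (Sect X W) \<Longrightarrow>
      D W (a \<oplus>\<^bsub>Sect X W\<^esub> b) = D W a \<oplus>\<^bsub>Sect X W\<^esub> D W b"
    and "a \<in> carrier (Sect X W) \<Longrightarrow> b \<in> carrier (Sect X W) \<Longrightarrow>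
      D W (a \<otimes>\<^bsub>Sect X W\<^esub> b) = D W a \<otimes>\<^bsub>Sect X W\<^esub> b \<oplus>\<^bsub>Sect X W\<^esub> a \<otimes>\<^bsub>Sect X W\<^esub> D W b"
    and "D W (cst_on X W c) = cst_on X W (\<delta> c)"
  using assms unfolding derivs_def Let_def by (simp_all add: Pi_iff)

lemma derivs_res:
  "D \<in> derivs X \<delta> U \<Longrightarrow> opn V \<Longrightarrow> opn W \<Longrightarrow> V \<subseteq> U \<Longrightarrow> W \<subseteq> V \<Longrightarrow> a \<in> carrier (Sect X V) \<Longrightarrow>
    D W (Rest X V W a) = Rest X V W (D V a)"
  unfolding derivs_def by blast

lemma derivsI:
  assumes closed: "\<And>W a. opn W \<Longrightarrow> W \<subseteq> U \<Longrightarrow> a \<in> carrier (Sect X W) \<Longrightarrow> D W a \<in> carrier (Sect X W)"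
    and add: "\<And>W a b. opn W \<Longrightarrow> W \<subseteq> U \<Longrightarrow> a \<in> carrier (Sect X W) \<Longrightarrow> b \<in> carrier (Sect X W) \<Longrightarrow>
      D W (a \<oplus>\<^bsub>Sect X W\<^esub> b) = D W a \<oplus>\<^bsub>Sect X W\<^esub> D W b"
    and mult: "\<And>W a b. opn W \<Longrightarrow> W \<subseteq> U \<Longrightarrow> a \<in> carrier (Sect X W) \<Longrightarrow> b \<in> carrier (Sect X W) \<Longrightarrow>
      D W (a \<otimes>\<^bsub>Sect X W\<^esub> b) = D W a \<otimes>\<^bsub>Sect X W\<^esub> b \<oplus>\<^bsub>Sect X W\<^esub> a \<otimes>\<^bsub>Sect X W\<^esub> D W b"
    and cst: "\<And>W c. opn W \<Longrightarrow> W \<subseteq> U \<Longrightarrow> D W (cst_on X W c) = cst_on X W (\<delta> c)"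
    and res: "\<And>V W a. opn V \<Longrightarrow> opn W \<Longrightarrow> V \<subseteq> U \<Longrightarrow> W \<subseteq> V \<Longrightarrow> a \<in> carrier (Sect X V) \<Longrightarrow>
      D W (Rest X V W a) = Rest X V W (D V a)"
  shows "on_opens X U D \<in> derivs X \<delta> U"
proof -
  have c: "a \<oplus>\<^bsub>Sect X W\<^esub> b \<in> carrier (Sect X W)" "a \<otimes>\<^bsub>Sect X W\<^esub> b \<in> carrier (Sect X W)"
    if "opn W" "a \<in> carrier (Sect X W)" "b \<in> carrier (Sect X W)" for a b W
  proof -
    interpret cring "Sect X W" by (rule cring_Sect) fact
    show "a \<oplus>\<^bsub>Sect X W\<^esub> b \<in> carrier (Sect X W)" "a \<otimes>\<^bsub>Sect X W\<^esub> b \<in> carrier (Sect X W)" using that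
        by auto
  qed
  show ?thesis
    unfolding derivs_def Let_def mem_Collect_eq
  proof (intro conjI allI impI ballI Pi_I, goal_cases)
    case (6 V W a)
    then have "W \<subseteq> U" "Rest X V W a \<in> carrier (Sect X W)" using res_closed by auto
    then show ?case using 6 res by (simp add: on_opens_apply)
  qed (use closed add mult cst c cst_on_closed in \<open>simp_all add: on_opens_on_opens on_opens_apply\<close>)
qed

lemma cst_on_zero: "opn U \<Longrightarrow> cst_on X U 0 = \<zero>\<^bsub>Sect X U\<^esub>"
proof -
  assume U: "opn U"
  interpret P: cring "Sect X (pts X)" by (rule cring_Sect) simp
  interpret h: plain_hom "Sect X (pts X)" "Sect X U" "Rest X (pts X) U"
    by (rule res_plain_hom) (use U opn_sub in auto)
  have "cst X \<in> ring_hom K_ring (Sect X (pts X))" using ringed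
      by (simp add: ringed_space_over_K_def)
  then have c: "cst X 0 \<in> carrier (Sect X (pts X))" "cst X (0 + 0) =
      cst X 0 \<oplus>\<^bsub>Sect X (pts X)\<^esub> cst X 0"
    using ring_hom_add[of "cst X" K_ring "Sect X (pts X)" 0 0]
    by (auto simp: ring_hom_def K_ring_def)
  then have "cst X 0 = \<zero>\<^bsub>Sect X (pts X)\<^esub>" by (metis P.add.r_cancel_one' add_0)
  then show ?thesis by (simp add: cst_on_def)
qed

lemma derivs_res_on:
  assumes D: "D \<in> derivs X \<delta> U" and "V \<subseteq> U" shows "on_opens X V D \<in> derivs X \<delta> V"
  using derivs_props[OF D] derivs_res[OF D] \<open>V \<subseteq> U\<close> by (intro derivsI) (auto dest: subset_trans)

text \<open>On constants the values cancel, because both derivations extend the same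
  \<open>\<delta>\<close>. The difference is thus a vector field, which is why the Kodaira--Spencer
  cocycle takes values in the tangent sheaf.\<close>

lemma derivs_minus:
  assumes D: "D \<in> derivs X \<delta> U" and E: "E \<in> derivs X \<delta> U"
  shows "on_opens X U (\<lambda>W a. D W a \<ominus>\<^bsub>Sect X W\<^esub> E W a) \<in> derivs X (\<lambda>_. 0) U"
proof (rule derivsI)
  fix W a b assume W: "opn W" "W \<subseteq> U" and a: "a \<in> carrier (Sect X W)"
  interpret cring "Sect X W" by (rule cring_Sect) fact
  note d = derivs_props[OF D W] derivs_props[OF E W]
  show "D W a \<ominus>\<^bsub>Sect X W\<^esub> E W a \<in> carrier (Sect X W)" using a d by simp
  assume b: "b \<in> carrier (Sect X W)"
  have [simp]: "D W a \<in> carrier (Sect X W)" "D W b \<in> carrier (Sect X W)"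
      "E W a \<in> carrier (Sect X W)" "E W b \<in> carrier (Sect X W)"
    using a b d by auto
  show "D W (a \<oplus>\<^bsub>Sect X W\<^esub> b) \<ominus>\<^bsub>Sect X W\<^esub> E W (a \<oplus>\<^bsub>Sect X W\<^esub> b) =
       D W a \<ominus>\<^bsub>Sect X W\<^esub> E W a \<oplus>\<^bsub>Sect X W\<^esub> (D W b \<ominus>\<^bsub>Sect X W\<^esub> E W b)"
    using a b d(2,6) by (simp add: a_minus_def minus_add a_ac)
  show "D W (a \<otimes>\<^bsub>Sect X W\<^esub> b) \<ominus>\<^bsub>Sect X W\<^esub> E W (a \<otimes>\<^bsub>Sect X W\<^esub> b) =
       (D W a \<ominus>\<^bsub>Sect X W\<^esub> E W a) \<otimes>\<^bsub>Sect X W\<^esub> b \<oplus>\<^bsub>Sect X W\<^esub> a \<otimes>\<^bsub>Sect X W\<^esub> (D W b \<ominus>\<^bsub>Sect X W\<^esub> E W b)"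
    using a b d(3,7) by (simp add: a_minus_def minus_add a_ac l_distr r_distr l_minus r_minus)
next
  fix W c assume W: "opn W" "W \<subseteq> U"
  interpret cring "Sect X W" by (rule cring_Sect) fact
  note d = derivs_props[OF D W] derivs_props[OF E W]
  show "D W (cst_on X W c) \<ominus>\<^bsub>Sect X W\<^esub> E W (cst_on X W c) = cst_on X W 0"
    using W cst_on_closed[OF W(1)] by (simp add: d cst_on_zero a_minus_def r_neg)
next
  fix V W a assume V: "opn V" "opn W" "V \<subseteq> U" "W \<subseteq> V" and a: "a \<in> carrier (Sect X V)"
  show "D W (Rest X V W a) \<ominus>\<^bsub>Sect X W\<^esub> E W (Rest X V W a) = Rest X V W (D V a \<ominus>\<^bsub>Sect X V\<^esub> E V a)"
    using V a derivs_props(1)[OF D V(1,3) a] derivs_props(1)[OF E V(1,3) a]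
    by (simp add: res_minus derivs_res[OF D V a] derivs_res[OF E V a])
qed

lemma derivs_add:
  assumes D: "D \<in> derivs X (\<lambda>_. 0) U" and E: "E \<in> derivs X (\<lambda>_. 0) U"
  shows "on_opens X U (\<lambda>W a. D W a \<oplus>\<^bsub>Sect X W\<^esub> E W a) \<in> derivs X (\<lambda>_. 0) U"
proof (rule derivsI)
  fix W a b assume W: "opn W" "W \<subseteq> U" and a: "a \<in> carrier (Sect X W)"
  interpret cring "Sect X W" by (rule cring_Sect) fact
  note d = derivs_props[OF D W] derivs_props[OF E W]
  show "D W a \<oplus>\<^bsub>Sect X W\<^esub> E W a \<in> carrier (Sect X W)" using a d by simp
  assume b: "b \<in> carrier (Sect X W)"
  have [simp]: "D W a \<in> carrier (Sect X W)" "D W b \<in> carrier (Sect X W)"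
      "E W a \<in> carrier (Sect X W)" "E W b \<in> carrier (Sect X W)"
    using a b d by auto
  show "D W (a \<oplus>\<^bsub>Sect X W\<^esub> b) \<oplus>\<^bsub>Sect X W\<^esub> E W (a \<oplus>\<^bsub>Sect X W\<^esub> b) =
       D W a \<oplus>\<^bsub>Sect X W\<^esub> E W a \<oplus>\<^bsub>Sect X W\<^esub> (D W b \<oplus>\<^bsub>Sect X W\<^esub> E W b)"
    using a b d(2,6) by (simp add: a_ac)
  show "D W (a \<otimes>\<^bsub>Sect X W\<^esub> b) \<oplus>\<^bsub>Sect X W\<^esub> E W (a \<otimes>\<^bsub>Sect X W\<^esub> b) =
       (D W a \<oplus>\<^bsub>Sect X W\<^esub> E W a) \<otimes>\<^bsub>Sect X W\<^esub> b \<oplus>\<^bsub>Sect X W\<^esub> a \<otimes>\<^bsub>Sect X W\<^esub> (D W b \<oplus>\<^bsub>Sect X W\<^esub> E W b)"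
    using a b d(3,7) by (simp add: a_ac l_distr r_distr)
next
  fix W c assume W: "opn W" "W \<subseteq> U"
  interpret cring "Sect X W" by (rule cring_Sect) fact
  note d = derivs_props[OF D W] derivs_props[OF E W]
  show "D W (cst_on X W c) \<oplus>\<^bsub>Sect X W\<^esub> E W (cst_on X W c) = cst_on X W 0"
    using W by (simp add: d cst_on_zero)
next
  fix V W a assume V: "opn V" "opn W" "V \<subseteq> U" "W \<subseteq> V" and a: "a \<in> carrier (Sect X V)"
  show "D W (Rest X V W a) \<oplus>\<^bsub>Sect X W\<^esub> E W (Rest X V W a) = Rest X V W (D V a \<oplus>\<^bsub>Sect X V\<^esub> E V a)"
    using V a derivs_props(1)[OF D V(1,3) a] derivs_props(1)[OF E V(1,3) a]
    by (simp add: res_add derivs_res[OF D V a] derivs_res[OF E V a])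
qed

lemma derivs_zero: "on_opens X U (\<lambda>W _. \<zero>\<^bsub>Sect X W\<^esub>) \<in> derivs X (\<lambda>_. 0) U"
proof (rule derivsI)
  fix V W a assume V: "opn V" "opn W" "V \<subseteq> U" "W \<subseteq> V" and a: "a \<in> carrier (Sect X V)"
  interpret h: plain_hom "Sect X V" "Sect X W" "Rest X V W" by (rule res_plain_hom) fact+
  show "\<zero>\<^bsub>Sect X W\<^esub> = Rest X V W \<zero>\<^bsub>Sect X V\<^esub>" by simp
next
  fix W a b assume W: "opn W" "W \<subseteq> U" and a: "a \<in> carrier (Sect X W)" "b \<in> carrier (Sect X W)"
  interpret cring "Sect X W" by (rule cring_Sect) fact
  show "\<zero>\<^bsub>Sect X W\<^esub> = \<zero>\<^bsub>Sect X W\<^esub> \<oplus>\<^bsub>Sect X W\<^esub> \<zero>\<^bsub>Sect X W\<^esub>" by simp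
  show "\<zero>\<^bsub>Sect X W\<^esub> = \<zero>\<^bsub>Sect X W\<^esub> \<otimes>\<^bsub>Sect X W\<^esub> b \<oplus>\<^bsub>Sect X W\<^esub> a \<otimes>\<^bsub>Sect X W\<^esub> \<zero>\<^bsub>Sect X W\<^esub>" using a by simp
next
  fix W a assume W: "opn W" "W \<subseteq> U"
  interpret cring "Sect X W" by (rule cring_Sect) fact
  show "\<zero>\<^bsub>Sect X W\<^esub> \<in> carrier (Sect X W)" by simp
qed (simp add: cst_on_zero)

lemma tangent_simps:
  "carrier (Sec (tangent_sheaf X) U) = derivs X (\<lambda>_. 0) U"
  "\<zero>\<^bsub>Sec (tangent_sheaf X) U\<^esub> = on_opens X U (\<lambda>W _. \<zero>\<^bsub>Sect X W\<^esub>)"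
  "D \<oplus>\<^bsub>Sec (tangent_sheaf X) U\<^esub> E = on_opens X U (\<lambda>W a. D W a \<oplus>\<^bsub>Sect X W\<^esub> E W a)"
  "Res (tangent_sheaf X) U V D = on_opens X V D"
  by (simp_all add: tangent_sheaf_def)

lemma tangent_abelian_group: "abelian_group (Sec (tangent_sheaf X) U)"
proof (rule abelian_groupI, unfold tangent_simps)
  fix D E F assume D: "D \<in> derivs X (\<lambda>_. 0) U"
  note d = derivs_props[OF D]
  have z: "on_opens X U (\<lambda>W a. on_opens X U (\<lambda>W _. \<zero>\<^bsub>Sect X W\<^esub>) W a \<oplus>\<^bsub>Sect X W\<^esub> D W a) = on_opens X U D"
  proof (rule on_opens_eqI)
    fix W a assume W: "opn W" "W \<subseteq> U" "a \<in> carrier (Sect X W)"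
    interpret cring "Sect X W" by (rule cring_Sect) fact
    show "on_opens X U (\<lambda>W _. \<zero>\<^bsub>Sect X W\<^esub>) W a \<oplus>\<^bsub>Sect X W\<^esub> D W a = D W a"
      using W d by (simp add: on_opens_apply)
  qed
  then show "on_opens X U (\<lambda>W a. on_opens X U (\<lambda>W _. \<zero>\<^bsub>Sect X W\<^esub>) W a \<oplus>\<^bsub>Sect X W\<^esub> D W a) = D"
    by (simp add: derivs_on_opens[OF D])
  let ?E = "on_opens X U (\<lambda>W a. \<zero>\<^bsub>Sect X W\<^esub> \<ominus>\<^bsub>Sect X W\<^esub> D W a)"
  have "?E = on_opens X U (\<lambda>W a. on_opens X U (\<lambda>W _. \<zero>\<^bsub>Sect X W\<^esub>) W a \<ominus>\<^bsub>Sect X W\<^esub> D W a)"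
    by (rule on_opens_eqI) (simp add: on_opens_apply)
  then have E: "?E \<in> derivs X (\<lambda>_. 0) U" using derivs_minus[OF derivs_zero D] by simp
  have "on_opens X U (\<lambda>W a. ?E W a \<oplus>\<^bsub>Sect X W\<^esub> D W a) = on_opens X U (\<lambda>W _. \<zero>\<^bsub>Sect X W\<^esub>)"
  proof (rule on_opens_eqI)
    fix W a assume W: "opn W" "W \<subseteq> U" "a \<in> carrier (Sect X W)"
    interpret cring "Sect X W" by (rule cring_Sect) fact
    show "?E W a \<oplus>\<^bsub>Sect X W\<^esub> D W a = \<zero>\<^bsub>Sect X W\<^esub>"
      using W d by (simp add: on_opens_apply a_minus_def l_neg)
  qed
  then show "\<exists>E\<in>derivs X (\<lambda>_. 0) U. on_opens X U (\<lambda>W a. E W a \<oplus>\<^bsub>Sect X W\<^esub> D W a) =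
      on_opens X U (\<lambda>W _. \<zero>\<^bsub>Sect X W\<^esub>)"
    using E by blast
  assume E: "E \<in> derivs X (\<lambda>_. 0) U"
  show "on_opens X U (\<lambda>W a. D W a \<oplus>\<^bsub>Sect X W\<^esub> E W a) \<in> derivs X (\<lambda>_. 0) U"
      by (rule derivs_add[OF D E])
  show "on_opens X U (\<lambda>W a. D W a \<oplus>\<^bsub>Sect X W\<^esub> E W a) = on_opens X U (\<lambda>W a. E W a \<oplus>\<^bsub>Sect X W\<^esub> D W a)"
  proof (rule on_opens_eqI)
    fix W a assume W: "opn W" "W \<subseteq> U" "a \<in> carrier (Sect X W)"
    interpret cring "Sect X W" by (rule cring_Sect) fact
    show "D W a \<oplus>\<^bsub>Sect X W\<^esub> E W a = E W a \<oplus>\<^bsub>Sect X W\<^esub> D W a"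
      using W d derivs_props[OF E] by (intro a_comm) auto
  qed
  assume F: "F \<in> derivs X (\<lambda>_. 0) U"
  show "on_opens X U (\<lambda>W a. on_opens X U (\<lambda>W a. D W a \<oplus>\<^bsub>Sect X W\<^esub> E W a) W a \<oplus>\<^bsub>Sect X W\<^esub> F W a) =
    on_opens X U (\<lambda>W a. D W a \<oplus>\<^bsub>Sect X W\<^esub> on_opens X U (\<lambda>W a. E W a \<oplus>\<^bsub>Sect X W\<^esub> F W a) W a)"
  proof (rule on_opens_eqI)
    fix W a assume W: "opn W" "W \<subseteq> U" "a \<in> carrier (Sect X W)"
    interpret cring "Sect X W" by (rule cring_Sect) fact
    show "on_opens X U (\<lambda>W a. D W a \<oplus>\<^bsub>Sect X W\<^esub> E W a) W a \<oplus>\<^bsub>Sect X W\<^esub> F W a =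
         D W a \<oplus>\<^bsub>Sect X W\<^esub> on_opens X U (\<lambda>W a. E W a \<oplus>\<^bsub>Sect X W\<^esub> F W a) W a"
      using W d derivs_props[OF E] derivs_props[OF F] by (simp add: on_opens_apply a_assoc)
  qed
qed (rule derivs_zero)

sublocale tangent: ab_presheaf "topo X" "tangent_sheaf X"
proof (rule ab_presheaf.intro)
  fix U V :: "'p set" and D E :: "'p set \<Rightarrow> 'a \<Rightarrow> 'a" assume "V \<subseteq> U"
  then show "Res (tangent_sheaf X) U V (D \<oplus>\<^bsub>Sec (tangent_sheaf X) U\<^esub> E) =
      Res (tangent_sheaf X) U V D \<oplus>\<^bsub>Sec (tangent_sheaf X) V\<^esub> Res (tangent_sheaf X) U V E"
    unfolding tangent_simps by (auto simp: on_opens_on_opens on_opens_apply intro!: on_opens_eqI)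
qed (auto simp: tangent_abelian_group tangent_simps(1,4) derivs_res_on on_opens_on_opens)

sublocale str: ab_presheaf "topo X" "Str X"
  by (rule ab_presheaf.intro)
     (simp_all add: res_closed res_add res_res ring.is_abelian_group[OF cring.axioms(1)[OF
         cring_Sect]])

subsection \<open>The Kodaira--Spencer class\<close>

definition KS_cocycle :: "('p set \<Rightarrow> 'p set \<Rightarrow> 'a \<Rightarrow> 'a) \<Rightarrow> 'p set \<Rightarrow> 'p set \<Rightarrow> 'p set \<Rightarrow> 'a \<Rightarrow> 'a" where
  "KS_cocycle D U V = on_opens X (U \<inter> V) (\<lambda>W a. D U W a \<ominus>\<^bsub>Sect X W\<^esub> D V W a)"

lemma KS_cocycle_closed:
  assumes "D U \<in> derivs X \<delta> U" "D V \<in> derivs X \<delta> V"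
  shows "KS_cocycle D U V \<in> derivs X (\<lambda>_. 0) (U \<inter> V)"
proof -
  have "on_opens X (U \<inter> V) (D U) \<in> derivs X \<delta> (U \<inter> V)"
      "on_opens X (U \<inter> V) (D V) \<in> derivs X \<delta> (U \<inter> V)"
    using assms by (auto intro: derivs_res_on)
  note m = derivs_minus[OF this]
  have "on_opens X (U \<inter> V) (\<lambda>W a. on_opens X (U \<inter> V) (D U) W a \<ominus>\<^bsub>Sect X W\<^esub> on_opens X (U \<inter> V) (D V) W
      a) = KS_cocycle D U V"
    unfolding KS_cocycle_def by (rule on_opens_eqI) (simp add: on_opens_apply)
  then show ?thesis using m by simp
qed

lemma KS_cocycle_in_cocycles:
  assumes \<V>: "open_cover (topo X) \<V>" and D: "\<And>V. V \<in> \<V> \<Longrightarrow> D V \<in> derivs X \<delta> V"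
  shows "(\<V>, KS_cocycle D) \<in> cocycles (topo X) (tangent_sheaf X)"
  unfolding cocycles_def mem_Collect_eq prod.case tangent_simps
proof (intro conjI \<V> ballI)
  fix U V W assume U: "U \<in> \<V>" "V \<in> \<V>" "W \<in> \<V>"
  show "on_opens X (U \<inter> V \<inter> W) (KS_cocycle D U W) =
       on_opens X (U \<inter> V \<inter> W) (\<lambda>Z a. on_opens X (U \<inter> V \<inter> W) (KS_cocycle D U V) Z a \<oplus>\<^bsub>Sect X Z\<^esub>
                 on_opens X (U \<inter> V \<inter> W) (KS_cocycle D V W) Z a)"
  proof (rule on_opens_eqI)
    fix Z a assume Z: "opn Z" "Z \<subseteq> U \<inter> V \<inter> W" "a \<in> carrier (Sect X Z)"
    interpret cring "Sect X Z" by (rule cring_Sect) fact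
    have "D U Z a \<in> carrier (Sect X Z)" "D V Z a \<in> carrier (Sect X Z)"
        "D W Z a \<in> carrier (Sect X Z)"
      using Z U derivs_props(1)[OF D] by auto
    then show "KS_cocycle D U W Z a = on_opens X (U \<inter> V \<inter> W) (KS_cocycle D U V) Z a \<oplus>\<^bsub>Sect X Z\<^esub>
                 on_opens X (U \<inter> V \<inter> W) (KS_cocycle D V W) Z a"
      using Z by (simp add: KS_cocycle_def on_opens_apply minus_add_minus)
  qed
qed (auto intro!: KS_cocycle_closed D)

text \<open>On a common refinement the two cocycles differ by the coboundary of
  \<open>D (a Y) - D' (a' Y)\<close>, itself a difference of two extensions of
  \<open>\<delta>\<close> and hence a vector field. So neither the cover nor the derivations affect
  the class.\<close>

lemma KS_cocycle_cohomologous: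
  assumes \<V>: "open_cover (topo X) \<V>" and D: "\<And>V. V \<in> \<V> \<Longrightarrow> D V \<in> derivs X \<delta> V"
    and \<V>': "open_cover (topo X) \<V>'" and D': "\<And>V. V \<in> \<V>' \<Longrightarrow> D' V \<in> derivs X \<delta> V"
  shows "((\<V>, KS_cocycle D), (\<V>', KS_cocycle D')) \<in> cohomologous (topo X) (tangent_sheaf X)"
proof -
  obtain \<Y> a a' where Y: "open_cover (topo X) \<Y>"
    and a: "\<And>Y. Y \<in> \<Y> \<Longrightarrow> a Y \<in> \<V> \<and> a' Y \<in> \<V>' \<and> Y = a Y \<inter> a' Y \<and> opn Y"
    by (rule tangent.common_refinement[OF \<V> \<V>']) (rule that)
  define b where "b Y = on_opens X Y (\<lambda>W x. D (a Y) W x \<ominus>\<^bsub>Sect X W\<^esub> D' (a' Y) W x)" for Y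
  show ?thesis
  proof (rule tangent.cohomologousI[OF KS_cocycle_in_cocycles[OF \<V> D] KS_cocycle_in_cocycles[OF \<V>'
      D'] Y,
      where r=a and s=a' and b=b], unfold tangent_simps)
    fix Y assume Y: "Y \<in> \<Y>"
    have s: "Y \<subseteq> a Y" "Y \<subseteq> a' Y" using a[OF Y] by blast+
    have "on_opens X Y (D (a Y)) \<in> derivs X \<delta> Y" "on_opens X Y (D' (a' Y)) \<in> derivs X \<delta> Y"
      using a[OF Y] by (auto intro!: derivs_res_on[OF D s(1)] derivs_res_on[OF D' s(2)])
    note m = derivs_minus[OF this]
    have "on_opens X Y (\<lambda>W x. on_opens X Y (D (a Y)) W x \<ominus>\<^bsub>Sect X W\<^esub> on_opens X Y (D' (a' Y)) W x) =
        b Y"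
      unfolding b_def by (rule on_opens_eqI) (simp add: on_opens_apply)
    then show "b Y \<in> derivs X (\<lambda>_. 0) Y" using m by simp
  next
    fix Y Y' assume Y: "Y \<in> \<Y>" "Y' \<in> \<Y>"
    have s: "Y \<subseteq> a Y" "Y \<subseteq> a' Y" "Y' \<subseteq> a Y'" "Y' \<subseteq> a' Y'" using a[OF Y(1)] a[OF Y(2)] by blast+
    show "on_opens X (Y \<inter> Y') (\<lambda>W x. on_opens X (Y \<inter> Y') (KS_cocycle D (a Y) (a Y')) W x \<oplus>\<^bsub>Sect X W\<^esub>
                   on_opens X (Y \<inter> Y') (b Y') W x) =
       on_opens X (Y \<inter> Y') (\<lambda>W x. on_opens X (Y \<inter> Y') (b Y) W x \<oplus>\<^bsub>Sect X W\<^esub>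
                   on_opens X (Y \<inter> Y') (KS_cocycle D' (a' Y) (a' Y')) W x)"
    proof (rule on_opens_eqI)
      fix W x assume W: "opn W" "W \<subseteq> Y \<inter> Y'" "x \<in> carrier (Sect X W)"
      have s': "W \<subseteq> a Y" "W \<subseteq> a' Y" "W \<subseteq> a Y'" "W \<subseteq> a' Y'" using s W by blast+
      interpret cring "Sect X W" by (rule cring_Sect) fact
      have "D (a Y) W x \<in> carrier (Sect X W)" "D (a Y') W x \<in> carrier (Sect X W)"
         "D' (a' Y) W x \<in> carrier (Sect X W)" "D' (a' Y') W x \<in> carrier (Sect X W)"
        using W a[OF Y(1)] a[OF Y(2)] s' derivs_props(1)[OF D] derivs_props(1)[OF D'] by auto
      then show "on_opens X (Y \<inter> Y') (KS_cocycle D (a Y) (a Y')) W x \<oplus>\<^bsub>Sect X W\<^esub> on_opens X (Y \<inter> Y')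
          (b Y') W x =
         on_opens X (Y \<inter> Y') (b Y) W x \<oplus>\<^bsub>Sect X W\<^esub> on_opens X (Y \<inter> Y') (KS_cocycle D' (a' Y) (a' Y'))
             W x"
        using W s' by (simp add: KS_cocycle_def b_def on_opens_apply minus_add_minus)
    qed
  qed (use a in blast)+
qed

text \<open>\<open>KS_class\<close> is a unique description: the given cover with its derivations
  provides a candidate, and \<open>KS_cocycle_cohomologous\<close> shows that any other cover and
  derivations give the same class.\<close>

lemma KS_class_eq:
  assumes \<V>: "open_cover (topo X) \<V>" and D: "\<And>V. V \<in> \<V> \<Longrightarrow> affine_open X V \<and> D V \<in> derivs X \<delta> V"
  shows "KS_class X \<delta> = cech_class (topo X) (tangent_sheaf X) (\<V>, KS_cocycle D)"
  unfolding KS_class_def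
proof (rule the_equality)
  show "\<exists>\<V>' D'. open_cover (topo X) \<V>' \<and> (\<forall>V\<in>\<V>'. affine_open X V \<and> D' V \<in> derivs X \<delta> V) \<and>
     cech_class (topo X) (tangent_sheaf X) (\<V>, KS_cocycle D) = cech_class (topo X) (tangent_sheaf X)
       (\<V>', \<lambda>U V. on_opens X (U \<inter> V) (\<lambda>W a. D' U W a \<ominus>\<^bsub>Sect X W\<^esub> D' V W a))"
    using \<V> D by (intro exI[of _ \<V>] exI[of _ D]) (auto simp: KS_cocycle_def[abs_def])
next
  fix \<xi> assume "\<exists>\<V>' D'. open_cover (topo X) \<V>' \<and> (\<forall>V\<in>\<V>'. affine_open X V \<and> D' V \<in> derivs X \<delta> V) \<and>
     \<xi> = cech_class (topo X) (tangent_sheaf X)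
       (\<V>', \<lambda>U V. on_opens X (U \<inter> V) (\<lambda>W a. D' U W a \<ominus>\<^bsub>Sect X W\<^esub> D' V W a))"
  then obtain \<V>' D' where *: "open_cover (topo X) \<V>'" "\<And>V. V \<in> \<V>' \<Longrightarrow> affine_open X V \<and>
      D' V \<in> derivs X \<delta> V"
    "\<xi> = cech_class (topo X) (tangent_sheaf X) (\<V>', KS_cocycle D')"
    by (auto simp: KS_cocycle_def[abs_def])
  have "((\<V>', KS_cocycle D'), (\<V>, KS_cocycle D)) \<in> cohomologous (topo X) (tangent_sheaf X)"
    by (rule KS_cocycle_cohomologous[where \<delta>=\<delta>]) (use * \<V> D in auto)
  then show "\<xi> = cech_class (topo X) (tangent_sheaf X) (\<V>, KS_cocycle D)"
    unfolding *(3) using tangent.cech_class_eq_iff[OF KS_cocycle_in_cocycles[of \<V>' D' \<delta>]] * by blast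
qed

end

section \<open>Kaehler differentials and Kodaira--Spencer forms\<close>

text \<open>Additivity in the functional, not in the vector: this is what makes contraction additive
  in the vector field.\<close>

lemma semilin_add_right:
  assumes h: "semilinear R S \<rho> B h" and h': "semilinear R S \<rho> B h'"
      and v: "v \<in> carrier (free_mod R B)"
  shows "semilin R S \<rho> (\<lambda>b. h b \<oplus>\<^bsub>S\<^esub> h' b) v = semilin R S \<rho> h v \<oplus>\<^bsub>S\<^esub> semilin R S \<rho> h' v"
proof -
  interpret h: semilinear R S \<rho> B h by fact
  interpret h': semilinear R S \<rho> B h' by fact
  note v' = free_mod_D[OF v]
  have "semilin R S \<rho> (\<lambda>b. h b \<oplus>\<^bsub>S\<^esub> h' b) v =
      (\<Oplus>\<^bsub>S\<^esub>b\<in>{b. v b \<noteq> \<zero>\<^bsub>R\<^esub>}. \<rho> (v b) \<otimes>\<^bsub>S\<^esub> h b \<oplus>\<^bsub>S\<^esub> \<rho> (v b) \<otimes>\<^bsub>S\<^esub> h' b)"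
    unfolding semilin_def using v' h.h_closed h'.h_closed h.hom_closed
    by (intro h.S.finsum_cong') (auto simp: h.S.r_distr subset_iff)
  also have "\<dots> = semilin R S \<rho> h v \<oplus>\<^bsub>S\<^esub> semilin R S \<rho> h' v"
    unfolding semilin_def using v' h.h_closed h'.h_closed h.hom_closed
    by (intro h.S.finsum_addf) (auto simp: subset_iff)
  finally show ?thesis .
qed

text \<open>The relations before the span is taken, since the locale \<open>presented\<close> takes
  the generators of the relations as its parameter \<open>G\<close>.\<close>

definition kaehler_gens :: "'a ring \<Rightarrow> ('k \<Rightarrow> 'a) \<Rightarrow> ('a \<Rightarrow> 'a) set" where
  "kaehler_gens R \<iota> = (let M = free_mod R (carrier R); d = gen R in
     {d (a \<otimes>\<^bsub>R\<^esub> b) \<ominus>\<^bsub>M\<^esub> (b \<odot>\<^bsub>M\<^esub> d a \<oplus>\<^bsub>M\<^esub> a \<odot>\<^bsub>M\<^esub> d b) | a b. a \<in> carrier R \<and> b \<in> carrier R} \<union>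
      {d (a \<oplus>\<^bsub>R\<^esub> b) \<ominus>\<^bsub>M\<^esub> (d a \<oplus>\<^bsub>M\<^esub> d b) | a b. a \<in> carrier R \<and> b \<in> carrier R} \<union>
      {d (\<iota> c) | c. True})"

abbreviation ks_basis :: "'a ring \<Rightarrow> 'a option set" where
  "ks_basis R \<equiv> insert None (Some ` carrier R)"

definition ks_gens :: "'a ring \<Rightarrow> ('k \<Rightarrow> 'a) \<Rightarrow> ('k \<Rightarrow> 'k) \<Rightarrow> ('a option \<Rightarrow> 'a) set" where
  "ks_gens R \<iota> \<delta> = (let M = free_mod R (ks_basis R); e = gen R None; d = (\<lambda>a. gen R (Some a)) in
     {d (a \<otimes>\<^bsub>R\<^esub> b) \<ominus>\<^bsub>M\<^esub> (b \<odot>\<^bsub>M\<^esub> d a \<oplus>\<^bsub>M\<^esub> a \<odot>\<^bsub>M\<^esub> d b) | a b. a \<in> carrier R \<and> b \<in> carrier R} \<union>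
      {d (a \<oplus>\<^bsub>R\<^esub> b) \<ominus>\<^bsub>M\<^esub> (d a \<oplus>\<^bsub>M\<^esub> d b) | a b. a \<in> carrier R \<and> b \<in> carrier R} \<union>
      {d (\<iota> c) \<ominus>\<^bsub>M\<^esub> \<iota> (\<delta> c) \<odot>\<^bsub>M\<^esub> e | c. True})"

lemma kaehler_gensE:
  assumes "r \<in> kaehler_gens R \<iota>"
  obtains (mult) a b where "a \<in> carrier R" "b \<in> carrier R"
      "r = gen R (a \<otimes>\<^bsub>R\<^esub> b) \<ominus>\<^bsub>free_mod R (carrier R)\<^esub> (b \<odot>\<^bsub>free_mod R (carrier R)\<^esub> gen R a \<oplus>\<^bsub>free_mod R
          (carrier R)\<^esub> a \<odot>\<^bsub>free_mod R (carrier R)\<^esub> gen R b)"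
  | (add) a b where "a \<in> carrier R" "b \<in> carrier R"
      "r = gen R (a \<oplus>\<^bsub>R\<^esub> b) \<ominus>\<^bsub>free_mod R (carrier R)\<^esub> (gen R a \<oplus>\<^bsub>free_mod R (carrier R)\<^esub> gen R b)"
  | (cst) c where "r = gen R (\<iota> c)"
  using assms unfolding kaehler_gens_def Let_def by (elim UnE CollectE exE conjE) (rule mult;
      assumption | rule add; assumption | rule cst; assumption)+

lemma ks_gensE:
  assumes "r \<in> ks_gens R \<iota> \<delta>"
  obtains (mult) a b where "a \<in> carrier R" "b \<in> carrier R"
      "r = gen R (Some (a \<otimes>\<^bsub>R\<^esub> b)) \<ominus>\<^bsub>free_mod R (ks_basis R)\<^esub> (b \<odot>\<^bsub>free_mod R (ks_basis R)\<^esub> gen R (Some a)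
          \<oplus>\<^bsub>free_mod R (ks_basis R)\<^esub> a \<odot>\<^bsub>free_mod R (ks_basis R)\<^esub> gen R (Some b))"
  | (add) a b where "a \<in> carrier R" "b \<in> carrier R"
      "r = gen R (Some (a \<oplus>\<^bsub>R\<^esub> b)) \<ominus>\<^bsub>free_mod R (ks_basis R)\<^esub> (gen R (Some a) \<oplus>\<^bsub>free_mod R (ks_basis R)\<^esub>
          gen R (Some b))"
  | (cst) c where "r = gen R (Some (\<iota> c)) \<ominus>\<^bsub>free_mod R (ks_basis R)\<^esub> \<iota> (\<delta> c) \<odot>\<^bsub>free_mod R (ks_basis R)\<^esub>
      gen R None"
  using assms unfolding ks_gens_def Let_def by (elim UnE CollectE exE conjE) (rule mult; assumption
      | rule add; assumption | rule cst; assumption)+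

lemma gensI:
  "a \<in> carrier R \<Longrightarrow> b \<in> carrier R \<Longrightarrow> gen R (a \<otimes>\<^bsub>R\<^esub> b) \<ominus>\<^bsub>free_mod R (carrier R)\<^esub> (b \<odot>\<^bsub>free_mod R (carrier R)\<^esub>
      gen R a \<oplus>\<^bsub>free_mod R (carrier R)\<^esub> a \<odot>\<^bsub>free_mod R (carrier R)\<^esub> gen R b) \<in> kaehler_gens R \<iota>"
  "a \<in> carrier R \<Longrightarrow> b \<in> carrier R \<Longrightarrow>
      gen R (a \<oplus>\<^bsub>R\<^esub> b) \<ominus>\<^bsub>free_mod R (carrier R)\<^esub> (gen R a \<oplus>\<^bsub>free_mod R (carrier R)\<^esub> gen R b) \<in>
      kaehler_gens R \<iota>"
  "gen R (\<iota> c) \<in> kaehler_gens R \<iota>"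
  "a \<in> carrier R \<Longrightarrow> b \<in> carrier R \<Longrightarrow> gen R (Some (a \<otimes>\<^bsub>R\<^esub> b)) \<ominus>\<^bsub>free_mod R (ks_basis R)\<^esub> (b \<odot>\<^bsub>free_mod R
      (ks_basis R)\<^esub> gen R (Some a) \<oplus>\<^bsub>free_mod R (ks_basis R)\<^esub> a \<odot>\<^bsub>free_mod R (ks_basis R)\<^esub> gen R (Some
      b)) \<in> ks_gens R \<iota> \<delta>"
  "a \<in> carrier R \<Longrightarrow> b \<in> carrier R \<Longrightarrow> gen R (Some (a \<oplus>\<^bsub>R\<^esub> b)) \<ominus>\<^bsub>free_mod R (ks_basis R)\<^esub> (gen R (Some a)
      \<oplus>\<^bsub>free_mod R (ks_basis R)\<^esub> gen R (Some b)) \<in> ks_gens R \<iota> \<delta>"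
  "gen R (Some (\<iota> c)) \<ominus>\<^bsub>free_mod R (ks_basis R)\<^esub> \<iota> (\<delta> c) \<odot>\<^bsub>free_mod R (ks_basis R)\<^esub> gen R None \<in> ks_gens
      R \<iota> \<delta>"
  unfolding kaehler_gens_def ks_gens_def Let_def by blast+

lemma kaehler_rels_eq: "kaehler_rels R \<iota> = submodule_span R (free_mod R (carrier R)) (kaehler_gens R
    \<iota>)"
  by (simp only: kaehler_rels_def kaehler_free_def kaehler_gens_def Let_def)

lemma ks_rels_eq: "ks_rels R \<iota> \<delta> = submodule_span R (free_mod R (ks_basis R)) (ks_gens R \<iota> \<delta>)"
  by (simp only: ks_rels_def ks_free_def ks_gens_def Let_def)

context K_ringed
begin

lemma kaehler_gens_sub:
  assumes "opn U" shows "kaehler_gens (Sect X U) (cst_on X U) \<subseteq> carrier (free_mod (Sect X U)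
      (carrier (Sect X U)))"
proof
  interpret plain_cring "Sect X U" by (rule plain_Sect) fact
  interpret M: module "Sect X U" "free_mod (Sect X U) (carrier (Sect X U))"
      by (rule free_mod_module)
  note [simp del] = free_mod_simps
  fix r assume "r \<in> kaehler_gens (Sect X U) (cst_on X U)"
  then show "r \<in> carrier (free_mod (Sect X U) (carrier (Sect X U)))"
    by (cases rule: kaehler_gensE) (simp_all add: gen_closed cst_on_closed assms)
qed

lemma ks_gens_sub:
  assumes "opn U" shows "ks_gens (Sect X U) (cst_on X U) \<delta> \<subseteq> carrier (free_mod (Sect X U) (ks_basis
      (Sect X U)))"
proof
  interpret plain_cring "Sect X U" by (rule plain_Sect) fact
  interpret M: module "Sect X U" "free_mod (Sect X U) (ks_basis (Sect X U))"
      by (rule free_mod_module)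
  note [simp del] = free_mod_simps
  fix r assume "r \<in> ks_gens (Sect X U) (cst_on X U) \<delta>"
  then show "r \<in> carrier (free_mod (Sect X U) (ks_basis (Sect X U)))"
    by (cases rule: ks_gensE) (simp_all add: gen_closed cst_on_closed assms)
qed

text \<open>A restriction map is a ring homomorphism that preserves constants, so each of the three
  kinds of relation restricts to one of the same kind.\<close>

sublocale kae: presented X "\<lambda>U. carrier (Sect X U)" "\<lambda>U. kaehler_gens (Sect X U) (cst_on X U)"
    "Rest X"
proof
  fix U V r assume U: "opn U" "opn V" "V \<subseteq> U" and r: "r \<in> kaehler_gens (Sect X U) (cst_on X U)"
  interpret pushing "Sect X U" "Sect X V" "Rest X U V" "carrier (Sect X U)" "carrier (Sect X V)"
      "Rest X U V"
    by (intro pushing.intro pushing_axioms.intro res_plain_hom U res_closed)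
  interpret M: module "Sect X U" "free_mod (Sect X U) (carrier (Sect X U))"
      by (rule R.free_mod_module)
  note [simp del] = free_mod_simps
  show "push (Sect X U) (Sect X V) (Rest X U V) (Rest X U V) r \<in> kaehler_gens (Sect X V) (cst_on X
      V)"
    using r
  proof (cases rule: kaehler_gensE)
    case (mult a b)
    then show ?thesis
      by (simp add: push_minus push_add push_smult push_gen R.gen_closed gensI)
  next
    case (add a b)
    then show ?thesis
      by (simp add: push_minus push_add push_gen R.gen_closed gensI)
  next
    case (cst c)
    then show ?thesis using U by (simp add: push_gen cst_on_closed res_cst_on gensI)
  qed
qed (auto simp: res_closed res_id res_res kaehler_gens_sub)

text \<open>\<open>map_option\<close> fixes \<open>None\<close>, so the generator \<open>1\<close>
  restricts to itself and the third kind of relation, which involves it, is preserved as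
  well.\<close>

sublocale ks: presented X "\<lambda>U. ks_basis (Sect X U)" "\<lambda>U. ks_gens (Sect X U) (cst_on X U) \<delta>"
  "\<lambda>U V. map_option (Rest X U V)" for \<delta>
proof
  fix U V r assume U: "opn U" "opn V" "V \<subseteq> U" and r: "r \<in> ks_gens (Sect X U) (cst_on X U) \<delta>"
  interpret pushing "Sect X U" "Sect X V" "Rest X U V" "ks_basis (Sect X U)" "ks_basis (Sect X V)"
      "map_option (Rest X U V)"
    by (intro pushing.intro pushing_axioms.intro res_plain_hom U) (elim insertE imageE, simp_all
        add: res_closed U)
  interpret M: module "Sect X U" "free_mod (Sect X U) (ks_basis (Sect X U))"
      by (rule R.free_mod_module)
  note [simp del] = free_mod_simps
  show "push (Sect X U) (Sect X V) (Rest X U V) (map_option (Rest X U V)) r \<in> ks_gens (Sect X V)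
      (cst_on X V) \<delta>"
    using r
  proof (cases rule: ks_gensE)
    case (mult a b)
    then show ?thesis
      by (simp add: push_minus push_add push_smult push_gen R.gen_closed gensI)
  next
    case (add a b)
    then show ?thesis
      by (simp add: push_minus push_add push_gen R.gen_closed gensI)
  next
    case (cst c)
    then show ?thesis using U by (simp add: push_minus push_smult push_gen R.gen_closed
        cst_on_closed res_cst_on gensI)
  qed
qed (auto simp: res_closed res_id res_res ks_gens_sub)

lemma kaehler_eqs:
  "kaehler_sec X = kae.Q" "kaehler_res X = kae.rs" "Omega X = kae.Shf"
proof -
  show 1: "kaehler_sec X = kae.Q" by (simp add: fun_eq_iff kaehler_sec_def kaehler_rels_eq
      kaehler_free_def)
  show 2: "kaehler_res X = kae.rs" by (simp add: fun_eq_iff kaehler_res_def kaehler_rels_eq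
      kaehler_free_def)
  show "Omega X = kae.Shf" unfolding Omega_def 1 2 by simp
qed

lemma ks_eqs:
  "ks_sec X \<delta> = ks.Q \<delta>" "ks_res X \<delta> = ks.rs \<delta>" "Omega_tau X \<delta> = ks.Shf \<delta>"
proof -
  show 1: "ks_sec X \<delta> = ks.Q \<delta>" by (simp add: fun_eq_iff ks_sec_def ks_rels_eq ks_free_def)
  show 2: "ks_res X \<delta> = ks.rs \<delta>" by (simp add: fun_eq_iff ks_res_def ks_rels_eq ks_free_def)
  show "Omega_tau X \<delta> = ks.Shf \<delta>" unfolding Omega_tau_def 1 2 by simp
qed

subsection \<open>Derivations as functionals\<close>

abbreviation "Ld D W \<equiv> semilin (Sect X W) (Sect X W) (\<lambda>x. x) (D W)"

lemma semilinear_id: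
  "opn W \<Longrightarrow> (\<And>b. b \<in> B \<Longrightarrow> h b \<in> carrier (Sect X W)) \<Longrightarrow> semilinear (Sect X W) (Sect X W) (\<lambda>x. x) B h"
  using cring_Sect[of W]
  by (intro semilinear.intro semilinear_axioms.intro plain_homI) (auto intro!: ring_hom_memI)

lemma D_semilinear:
  "D \<in> derivs X \<delta> U \<Longrightarrow> opn W \<Longrightarrow> W \<subseteq> U \<Longrightarrow> semilinear (Sect X W) (Sect X W) (\<lambda>x. x) (carrier (Sect X W))
      (D W)"
  using derivs_props(1) by (intro semilinear_id) auto

text \<open>The three kinds of relation express the Leibniz rule, additivity and vanishing on
  constants; a derivation that extends zero has exactly these properties.\<close>

lemma kae_functional:
  assumes D: "D \<in> derivs X (\<lambda>_. 0) U" and U: "opn U"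
  shows "functional X (\<lambda>U. carrier (Sect X U)) (\<lambda>U. kaehler_gens (Sect X U) (cst_on X U)) (Rest X) U
      D"
proof unfold_locales
  fix W r assume W: "opn W" "W \<subseteq> U" and r: "r \<in> kaehler_gens (Sect X W) (cst_on X W)"
  interpret semilinear "Sect X W" "Sect X W" "\<lambda>x. x" "carrier (Sect X W)" "D W"
      by (rule D_semilinear[OF D W])
  interpret M: module "Sect X W" F by (rule R.free_mod_module)
  \<comment> \<open>for the identity homomorphism these simp rules rewrite a term to itself\<close>
  note [simp del] = free_mod_simps hom_finsum hom_closed hom_mult hom_add hom_one hom_zero hom_a_inv
  note d = derivs_props[OF D W]
  show "Ld D W r = \<zero>\<^bsub>Sect X W\<^esub>"
    using r
  proof (cases rule: kaehler_gensE)
    case (mult a b)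
    have "Ld D W r = D W (a \<otimes>\<^bsub>Sect X W\<^esub> b) \<ominus>\<^bsub>Sect X W\<^esub> (b \<otimes>\<^bsub>Sect X W\<^esub> D W a \<oplus>\<^bsub>Sect X W\<^esub> a \<otimes>\<^bsub>Sect X W\<^esub> D W b)"
      unfolding mult(3) using mult(1,2)
      by (simp only: semilin_minus semilin_add semilin_smult semilin_gen R.gen_closed M.smult_closed
          M.a_closed
          R.m_closed insertI1 insertI2 imageI option.case)
    also have "\<dots> = \<zero>\<^bsub>Sect X W\<^esub>"
      using mult(1,2) d(1)[of a] d(1)[of b] d(3)[of a b]
          by (simp add: R.m_comm[of b "D W a"] a_minus_def R.r_neg)
    finally show ?thesis .
  next
    case (add a b)
    have "Ld D W r = D W (a \<oplus>\<^bsub>Sect X W\<^esub> b) \<ominus>\<^bsub>Sect X W\<^esub> (D W a \<oplus>\<^bsub>Sect X W\<^esub> D W b)"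
      unfolding add(3) using add(1,2)
      by (simp only: semilin_minus semilin_add semilin_gen R.gen_closed M.a_closed R.a_closed
          insertI1 insertI2 imageI option.case)
    also have "\<dots> = \<zero>\<^bsub>Sect X W\<^esub>"
      using add(1,2) d by (simp add: a_minus_def R.r_neg)
    finally show ?thesis .
  next
    case (cst c)
    then show ?thesis using d(4)[of c] W by (simp add: semilin_gen cst_on_closed cst_on_zero)
  qed
qed (use U derivs_props(1)[OF D] derivs_res[OF D] in auto)

abbreviation "hks D W \<equiv> case_option \<one>\<^bsub>Sect X W\<^esub> (D W)"

text \<open>The third kind of relation equates the form of a constant \<open>c\<close> with
  \<open>\<delta> c\<close> times the form \<open>1\<close>. As the form \<open>1\<close> goes to
  the function \<open>1\<close>, it is killed because \<open>D\<close> extends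
  \<open>\<delta>\<close>.\<close>

lemma ks_functional:
  assumes D: "D \<in> derivs X \<delta> U" and U: "opn U"
  shows "functional X (\<lambda>U. ks_basis (Sect X U)) (\<lambda>U. ks_gens (Sect X U) (cst_on X U) \<delta>)
    (\<lambda>U V. map_option (Rest X U V)) U (hks D)"
proof unfold_locales
  fix W r assume W: "opn W" "W \<subseteq> U" and r: "r \<in> ks_gens (Sect X W) (cst_on X W) \<delta>"
  have one: "\<one>\<^bsub>Sect X W\<^esub> \<in> carrier (Sect X W)"
    using cring_Sect[OF W(1)] by (simp add: cring.axioms(1) monoid.one_closed ring.is_monoid)
  interpret semilinear "Sect X W" "Sect X W" "\<lambda>x. x" "ks_basis (Sect X W)" "hks D W"
    using one derivs_props(1)[OF D W] by (intro semilinear_id[OF W(1)]) (elim insertE imageE,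
        simp_all)
  interpret M: module "Sect X W" F by (rule R.free_mod_module)
  note [simp del] = free_mod_simps hom_finsum hom_closed hom_mult hom_add hom_one hom_zero hom_a_inv
  note d = derivs_props[OF D W]
  let ?L = "semilin (Sect X W) (Sect X W) (\<lambda>x. x) (hks D W)"
  show "?L r = \<zero>\<^bsub>Sect X W\<^esub>"
    using r
  proof (cases rule: ks_gensE)
    case (mult a b)
    have "?L r = D W (a \<otimes>\<^bsub>Sect X W\<^esub> b) \<ominus>\<^bsub>Sect X W\<^esub> (b \<otimes>\<^bsub>Sect X W\<^esub> D W a \<oplus>\<^bsub>Sect X W\<^esub> a \<otimes>\<^bsub>Sect X W\<^esub> D W b)"
      unfolding mult(3) using mult(1,2)
      by (simp only: semilin_minus semilin_add semilin_smult semilin_gen R.gen_closed M.smult_closed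
          M.a_closed
          R.m_closed insertI1 insertI2 imageI option.case)
    also have "\<dots> = \<zero>\<^bsub>Sect X W\<^esub>"
      using mult(1,2) d(1)[of a] d(1)[of b] d(3)[of a b]
          by (simp add: R.m_comm[of b "D W a"] a_minus_def R.r_neg)
    finally show ?thesis .
  next
    case (add a b)
    have "?L r = D W (a \<oplus>\<^bsub>Sect X W\<^esub> b) \<ominus>\<^bsub>Sect X W\<^esub> (D W a \<oplus>\<^bsub>Sect X W\<^esub> D W b)"
      unfolding add(3) using add(1,2)
      by (simp only: semilin_minus semilin_add semilin_gen R.gen_closed M.a_closed R.a_closed
          insertI1 insertI2 imageI option.case)
    also have "\<dots> = \<zero>\<^bsub>Sect X W\<^esub>"
      using add(1,2) d by (simp add: a_minus_def R.r_neg)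
    finally show ?thesis .
  next
    case (cst c)
    have "?L r = D W (cst_on X W c) \<ominus>\<^bsub>Sect X W\<^esub> cst_on X W (\<delta> c)"
      unfolding cst using W by (simp add: semilin_minus semilin_smult semilin_gen R.gen_closed
          cst_on_closed)
    then show ?thesis using d(4)[of c] W cst_on_closed by (simp add: a_minus_def R.r_neg)
  qed
next
  fix V W b assume V: "opn V" "opn W" "V \<subseteq> U" "W \<subseteq> V" "b \<in> ks_basis (Sect X V)"
  interpret h: plain_hom "Sect X V" "Sect X W" "Rest X V W" by (rule res_plain_hom) fact+
  show "hks D W (map_option (Rest X V W) b) = Rest X V W (hks D V b)"
    using V derivs_res[OF D] by auto
next
  fix W b assume W: "opn W" "W \<subseteq> U" "b \<in> ks_basis (Sect X W)"
  interpret cring "Sect X W" by (rule cring_Sect) fact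
  show "hks D W b \<in> carrier (Sect X W)" using W derivs_props(1)[OF D] by auto
qed (rule U)

text \<open>Forgetting the coordinate at \<open>None\<close> is the projection \<lambda> on the
  level of representatives.\<close>

lemma Some_comp_closed:
  assumes "w \<in> carrier (free_mod R (ks_basis R))"
  shows "(\<lambda>a. w (Some a)) \<in> carrier (free_mod R (carrier R))"
proof -
  note w = free_mod_D[OF assms]
  have "finite (Some -` {b. w b \<noteq> \<zero>\<^bsub>R\<^esub>})" by (rule finite_vimageI[OF w(2)]) simp
  then show ?thesis unfolding free_mod_carrier using w by (auto simp: vimage_def)
qed

text \<open>Splitting off the index \<open>None\<close> shows the retraction of a representative as
  its coefficient at the form \<open>1\<close> plus a term that depends on its image under
  \<lambda>. The coefficient does not involve the derivation and will cancel between two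
  retractions.\<close>

lemma ks_semilin_split:
  assumes W: "opn W" and h: "\<And>b. b \<in> carrier (Sect X W) \<Longrightarrow> h b \<in> carrier (Sect X W)"
    and w: "w \<in> carrier (free_mod (Sect X W) (ks_basis (Sect X W)))"
  shows "semilin (Sect X W) (Sect X W) (\<lambda>x. x) (case_option \<one>\<^bsub>Sect X W\<^esub> h) w =
    w None \<oplus>\<^bsub>Sect X W\<^esub> semilin (Sect X W) (Sect X W) (\<lambda>x. x) h (\<lambda>a. w (Some a))"
proof -
  interpret plain_cring "Sect X W" by (rule plain_Sect[OF W])
  interpret s: semilinear "Sect X W" "Sect X W" "\<lambda>x. x" "ks_basis (Sect X W)"
      "case_option \<one>\<^bsub>Sect X W\<^esub> h"
    using h by (intro semilinear_id[OF W]) (elim insertE imageE, simp_all)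
  note [simp del] = s.hom_finsum s.hom_closed s.hom_mult s.hom_add s.hom_one s.hom_zero s.hom_a_inv
  note w' = free_mod_D[OF w]
  let ?S = "{a. w (Some a) \<noteq> \<zero>\<^bsub>Sect X W\<^esub>}"
  let ?t = "\<lambda>b. w b \<otimes>\<^bsub>Sect X W\<^esub> case_option \<one>\<^bsub>Sect X W\<^esub> h b"
  have S: "finite ?S" "?S \<subseteq> carrier (Sect X W)"
    using free_mod_D(2,3)[OF Some_comp_closed[OF w]] by auto
  have sub: "{b. w b \<noteq> \<zero>\<^bsub>Sect X W\<^esub>} \<subseteq> insert None (Some ` ?S)"
  proof
    fix b assume "b \<in> {b. w b \<noteq> \<zero>\<^bsub>Sect X W\<^esub>}" then show "b \<in> insert None (Some ` ?S)"
        by (cases b) auto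
  qed
  have "semilin (Sect X W) (Sect X W) (\<lambda>x. x) (case_option \<one>\<^bsub>Sect X W\<^esub> h) w =
      (\<Oplus>\<^bsub>Sect X W\<^esub>b\<in>insert None (Some ` ?S). ?t b)"
    by (rule s.semilin_superset[OF w _ sub]) (use S in auto)
  also have "\<dots> = ?t None \<oplus>\<^bsub>Sect X W\<^esub> (\<Oplus>\<^bsub>Sect X W\<^esub>b\<in>Some ` ?S. ?t b)"
    using S w'(1) h by (intro finsum_insert) auto
  also have "(\<Oplus>\<^bsub>Sect X W\<^esub>b\<in>Some ` ?S. ?t b) = (\<Oplus>\<^bsub>Sect X W\<^esub>a\<in>?S. ?t (Some a))"
    using S w'(1) h by (intro finsum_reindex) auto
  finally show ?thesis using w'(1) by (simp add: semilin_def)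
qed

lemma push_ks_Some:
  assumes "cring S" "\<And>r. r \<in> carrier R \<Longrightarrow> \<rho> r \<in> carrier S" "w \<in> carrier (free_mod R (ks_basis R))"
  shows "push R S \<rho> (map_option \<rho>) w (Some c) = push R S \<rho> \<rho> (\<lambda>a. w (Some a)) c"
proof -
  interpret cring S by fact
  have eq: "{b. w b \<noteq> \<zero>\<^bsub>R\<^esub> \<and> map_option \<rho> b = Some c} = Some ` {a. w (Some a) \<noteq> \<zero>\<^bsub>R\<^esub> \<and> \<rho> a = c}"
    by force
  show ?thesis unfolding push_def eq
    by (rule finsum_reindex) (use assms(2) free_mod_D(1)[OF assms(3)] in auto)
qed

end

section \<open>Contraction and cup product\<close>

context K_ringed
begin

lemma contract_eq: "contract X U D \<omega> = (THE f. kae.is_pairing U D \<omega> f)"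
  by (simp only: contract_def kae.is_pairing_def)

lemma contract_pairing:
  assumes "D \<in> derivs X (\<lambda>_. 0) U" "opn U" "\<omega> \<in> Omega X U"
  shows "kae.is_pairing U D \<omega> (contract X U D \<omega>)"
proof -
  interpret f: functional X "\<lambda>U. carrier (Sect X U)" "\<lambda>U. kaehler_gens (Sect X U) (cst_on X U)"
      "Rest X" U D
    by (rule kae_functional[OF assms(1,2)])
  have \<omega>: "\<omega> \<in> kae.Shf U" using assms(3) kaehler_eqs(3) by simp
  obtain f where f: "kae.is_pairing U D \<omega> f" by (rule f.pairing_ex[OF \<omega>])
  show ?thesis unfolding contract_eq using f by (rule theI) (rule f.pairing_unique[OF \<omega> _ f])
qed

lemma contract_closed:
  "D \<in> derivs X (\<lambda>_. 0) U \<Longrightarrow> opn U \<Longrightarrow> \<omega> \<in> Omega X U \<Longrightarrow> contract X U D \<omega> \<in> carrier (Sect X U)"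
  using contract_pairing by (simp add: kae.is_pairing_def)

lemma contract_local:
  assumes "D \<in> derivs X (\<lambda>_. 0) U" "opn U" "\<omega> \<in> Omega X U" "p \<in> U" "(W, C) \<in> \<omega> p" "v \<in> C" "W \<subseteq> U"
  obtains W' where "opn W'" "p \<in> W'" "W' \<subseteq> W" "Rest X U W' (contract X U D \<omega>) =
      Rest X W W' (Ld D W v)"
proof -
  interpret f: functional X "\<lambda>U. carrier (Sect X U)" "\<lambda>U. kaehler_gens (Sect X U) (cst_on X U)"
      "Rest X" U D
    by (rule kae_functional[OF assms(1,2)])
  show ?thesis using contract_pairing[OF assms(1-3)] assms(4-7) that unfolding f.is_pairing_L
      by blast
qed

lemma contract_eqI:
  assumes D: "D \<in> derivs X (\<lambda>_. 0) U" and U: "opn U" and \<omega>: "\<omega> \<in> Omega X U"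
      and f: "f \<in> carrier (Sect X U)"
    and ex: "\<And>p. p \<in> U \<Longrightarrow> \<exists>W C v W'. (W, C) \<in> \<omega> p \<and> v \<in> C \<and> W \<subseteq> U \<and>
      opn W' \<and> p \<in> W' \<and> W' \<subseteq> W \<and> Rest X U W' f = Rest X W W' (Ld D W v)"
  shows "contract X U D \<omega> = f"
proof -
  interpret f: functional X "\<lambda>U. carrier (Sect X U)" "\<lambda>U. kaehler_gens (Sect X U) (cst_on X U)"
      "Rest X" U D
    by (rule kae_functional[OF D U])
  have \<omega>': "\<omega> \<in> kae.Shf U" using \<omega> kaehler_eqs(3) by simp
  show ?thesis
    by (rule f.pairing_unique[OF \<omega>' contract_pairing[OF D U \<omega>] f.is_pairingI[OF \<omega>' f ex]])
qed

lemma Omega_E: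
  assumes "\<omega> \<in> Omega X U" "p \<in> U"
  obtains V v where "opn V" "p \<in> V" "V \<subseteq> U" "v \<in> carrier (kae.M V)" "v \<in> kae.cl V v"
    "\<And>q. q \<in> V \<Longrightarrow> (V, kae.cl V v) \<in> \<omega> q"
proof -
  have \<omega>: "\<omega> \<in> kae.Shf U" using assms(1) kaehler_eqs(3) by simp
  show ?thesis using kae.cl_self that by (rule_tac kae.Shf_E[OF \<omega> assms(2)]) blast
qed

lemma Omega_restrict: "\<omega> \<in> Omega X U \<Longrightarrow> opn V \<Longrightarrow> V \<subseteq> U \<Longrightarrow> restrict \<omega> V \<in> Omega X V"
  unfolding kaehler_eqs by (rule kae.Shf_restrict)

lemma res_shrink:
  assumes "opn U" "opn V" "opn W" "opn Z" "W \<subseteq> U" "W \<subseteq> V" "Z \<subseteq> W"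
    and "f \<in> carrier (Sect X U)" "x \<in> carrier (Sect X V)" "Rest X U W f = Rest X V W x"
  shows "Rest X U Z f = Rest X V Z x"
  using assms res_res[of U W Z f] res_res[of V W Z x] by simp

lemma Ld_closed:
  "D \<in> derivs X \<delta> U \<Longrightarrow> opn W \<Longrightarrow> W \<subseteq> U \<Longrightarrow> v \<in> carrier (kae.M W) \<Longrightarrow> Ld D W v \<in> carrier (Sect X W)"
  by (rule semilinear.semilin_closed[OF D_semilinear])

text \<open>Both sides are determined by their values near points, and a representative on an open
  set inside \<open>V\<close> serves for the germ of \<open>\<omega>\<close> over \<open>U\<close>
  and over \<open>V\<close> alike.\<close>

lemma contract_res:
  assumes D: "D \<in> derivs X (\<lambda>_. 0) U" and U: "opn U" "opn V" "V \<subseteq> U" and \<omega>: "\<omega> \<in> Omega X U"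
  shows "contract X V (on_opens X V D) (restrict \<omega> V) = Rest X U V (contract X U D \<omega>)"
proof (rule contract_eqI)
  show "on_opens X V D \<in> derivs X (\<lambda>_. 0) V" by (rule derivs_res_on[OF D U(3)])
  show \<omega>': "restrict \<omega> V \<in> Omega X V" by (rule Omega_restrict[OF \<omega> U(2,3)])
  note c = contract_closed[OF D U(1) \<omega>]
  show "Rest X U V (contract X U D \<omega>) \<in> carrier (Sect X V)" by (rule res_closed[OF U c])
  fix p assume p: "p \<in> V"
  obtain W v where W: "opn W" "p \<in> W" "W \<subseteq> V" "v \<in> carrier (kae.M W)" "v \<in> kae.cl W v"
    "\<And>q. q \<in> W \<Longrightarrow> (W, kae.cl W v) \<in> restrict \<omega> V q" by (rule Omega_E[OF \<omega>' p]) (rule that)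
  have "p \<in> U" "(W, kae.cl W v) \<in> \<omega> p" "W \<subseteq> U" using W(2,3) W(6)[of p] p U(3) by auto
  then obtain W' where W': "opn W'" "p \<in> W'" "W' \<subseteq> W" "Rest X U W' (contract X U D \<omega>) =
      Rest X W W' (Ld D W v)"
    using contract_local[OF D U(1) \<omega> _ _ W(5)] by metis
  have "Ld (on_opens X V D) W v = Ld D W v"
    by (rule semilin_cong[OF cring_Sect W(4)]) (use W D U derivs_props(1)[OF D] in \<open>auto simp:
        on_opens_apply\<close>)
  moreover have "Rest X V W' (Rest X U V (contract X U D \<omega>)) = Rest X U W' (contract X U D \<omega>)"
    using U W W' c by (intro res_res) auto
  ultimately show "\<exists>W C v W'. (W, C) \<in> restrict \<omega> V p \<and> v \<in> C \<and> W \<subseteq> V \<and>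
      opn W' \<and> p \<in> W' \<and> W' \<subseteq> W \<and> Rest X V W' (Rest X U V (contract X U D \<omega>)) = Rest X W W' (Ld
          (on_opens X V D) W v)"
    using W W' W(6)[OF W(2)] by (intro exI[of _ W] exI[of _ "kae.cl W v"] exI[of _ v] exI[of _ W'])
        simp
qed (rule U)

lemma contract_add:
  assumes D: "D \<in> derivs X (\<lambda>_. 0) U" and E: "E \<in> derivs X (\<lambda>_. 0) U" and U: "opn U"
      and \<omega>: "\<omega> \<in> Omega X U"
  shows "contract X U (on_opens X U (\<lambda>W a. D W a \<oplus>\<^bsub>Sect X W\<^esub> E W a)) \<omega> =
      contract X U D \<omega> \<oplus>\<^bsub>Sect X U\<^esub> contract X U E \<omega>"
    (is "contract X U ?S \<omega> = ?d \<oplus>\<^bsub>_\<^esub> ?e")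
proof (rule contract_eqI[OF derivs_add[OF D E] U \<omega>])
  interpret U: cring "Sect X U" by (rule cring_Sect[OF U])
  have cl: "?d \<in> carrier (Sect X U)" "?e \<in> carrier (Sect X U)"
    using contract_closed D E U \<omega> by auto
  then show "?d \<oplus>\<^bsub>Sect X U\<^esub> ?e \<in> carrier (Sect X U)" by simp
  fix p assume p: "p \<in> U"
  obtain W v where W: "opn W" "p \<in> W" "W \<subseteq> U" "v \<in> carrier (kae.M W)" "v \<in> kae.cl W v"
    "\<And>q. q \<in> W \<Longrightarrow> (W, kae.cl W v) \<in> \<omega> q" by (rule Omega_E[OF \<omega> p]) (rule that)
  note cl' = Ld_closed[OF D W(1,3,4)] Ld_closed[OF E W(1,3,4)]
  obtain W1 where W1: "opn W1" "p \<in> W1" "W1 \<subseteq> W" "Rest X U W1 ?d = Rest X W W1 (Ld D W v)"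
    by (rule contract_local[OF D U \<omega> p W(6)[OF W(2)] W(5,3)]) (rule that)
  obtain W2 where W2: "opn W2" "p \<in> W2" "W2 \<subseteq> W" "Rest X U W2 ?e = Rest X W W2 (Ld E W v)"
    by (rule contract_local[OF E U \<omega> p W(6)[OF W(2)] W(5,3)]) (rule that)
  let ?Z = "W1 \<inter> W2"
  have Z: "opn ?Z" "?Z \<subseteq> W1" "?Z \<subseteq> W2" using W1 W2 by auto
  have 1: "Rest X U ?Z ?d = Rest X W ?Z (Ld D W v)"
    by (rule res_shrink[OF U W(1) W1(1) Z(1) _ W1(3) Z(2) cl(1) cl'(1) W1(4)]) (use W1 W in blast)
  have 2: "Rest X U ?Z ?e = Rest X W ?Z (Ld E W v)"
    by (rule res_shrink[OF U W(1) W2(1) Z(1) _ W2(3) Z(3) cl(2) cl'(2) W2(4)]) (use W2 W in blast)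
  have 3: "Ld ?S W v = Ld D W v \<oplus>\<^bsub>Sect X W\<^esub> Ld E W v"
  proof -
    have "Ld ?S W v = semilin (Sect X W) (Sect X W) (\<lambda>x. x) (\<lambda>b. D W b \<oplus>\<^bsub>Sect X W\<^esub> E W b) v"
      using W cring.cring_simprules(1)[OF cring_Sect[OF W(1)]]
      by (intro semilin_cong[OF cring_Sect W(4)])
         (auto simp: on_opens_apply derivs_props(1)[OF D W(1,3)] derivs_props(1)[OF E W(1,3)])
    also have "\<dots> = Ld D W v \<oplus>\<^bsub>Sect X W\<^esub> Ld E W v"
      by (rule semilin_add_right[OF D_semilinear[OF D W(1,3)] D_semilinear[OF E W(1,3)] W(4)])
    finally show ?thesis .
  qed
  have "Rest X U ?Z (?d \<oplus>\<^bsub>Sect X U\<^esub> ?e) = Rest X W ?Z (Ld ?S W v)"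
    unfolding 3 using U W W1 Z cl cl' by (subst (1 2) res_add) (auto simp: 1 2)
  then show "\<exists>W C v W'. (W, C) \<in> \<omega> p \<and> v \<in> C \<and> W \<subseteq> U \<and> opn W' \<and> p \<in> W' \<and> W' \<subseteq> W \<and>
      Rest X U W' (?d \<oplus>\<^bsub>Sect X U\<^esub> ?e) = Rest X W W' (Ld ?S W v)"
    using W W(6)[OF W(2)] Z W1 W2 by (intro exI[of _ W] exI[of _ "kae.cl W v"] exI[of _ v] exI[of _
        ?Z]) auto
qed

end

section \<open>The cup product with a fixed global differential\<close>

locale global_form = K_ringed X for X :: "('p, 'a, 'k::field_char_0) kspace" +
  fixes \<omega> :: "'p \<Rightarrow> ('p set \<times> ('a \<Rightarrow> 'a) set) set"
  assumes \<omega>: "\<omega> \<in> Omega X (pts X)"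
begin

definition ct :: "'p set \<Rightarrow> ('p set \<Rightarrow> 'a \<Rightarrow> 'a) \<Rightarrow> 'a" where
  "ct U D = contract X U D (restrict \<omega> U)"

lemma \<omega>_res: "opn U \<Longrightarrow> restrict \<omega> U \<in> Omega X U"
  by (rule Omega_restrict[OF \<omega> _ opn_sub])

lemma ct_closed: "opn U \<Longrightarrow> D \<in> derivs X (\<lambda>_. 0) U \<Longrightarrow> ct U D \<in> carrier (Sect X U)"
  unfolding ct_def by (rule contract_closed[OF _ _ \<omega>_res])

lemma ct_res:
  assumes "opn U" "opn V" "V \<subseteq> U" "D \<in> derivs X (\<lambda>_. 0) U"
  shows "Rest X U V (ct U D) = ct V (on_opens X V D)"
proof -
  have "restrict (restrict \<omega> U) V = restrict \<omega> V" using assms(3)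
      by (auto simp: restrict_def fun_eq_iff)
  then show ?thesis unfolding ct_def using contract_res[OF assms(4,1-3) \<omega>_res[OF assms(1)]] by simp
qed

lemma ct_add:
  "opn U \<Longrightarrow> D \<in> derivs X (\<lambda>_. 0) U \<Longrightarrow> E \<in> derivs X (\<lambda>_. 0) U \<Longrightarrow>
    ct U (D \<oplus>\<^bsub>Sec (tangent_sheaf X) U\<^esub> E) = ct U D \<oplus>\<^bsub>Sect X U\<^esub> ct U E"
  unfolding ct_def tangent_simps by (rule contract_add[OF _ _ _ \<omega>_res])

text \<open>By \<open>ct_res\<close> and \<open>ct_add\<close>, contraction with a fixed form is a
  morphism from the tangent sheaf to the structure sheaf. It therefore acts on cocycles.\<close>

lemma ct_cocycle:
  assumes z: "(\<U>, c) \<in> cocycles (topo X) (tangent_sheaf X)"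
  shows "(\<U>, \<lambda>U V. ct (U \<inter> V) (c U V)) \<in> cocycles (topo X) (Str X)"
  unfolding cocycles_def mem_Collect_eq prod.case
proof (intro conjI ballI)
  show "open_cover (topo X) \<U>" using z by (simp add: cocycles_def)
  note o = tangent.cocycle_open[OF z, unfolded tangent_simps]
  fix U V assume U: "U \<in> \<U>" "V \<in> \<U>"
  show "ct (U \<inter> V) (c U V) \<in> carrier (Sect X (U \<inter> V))" by (rule ct_closed) (use o U in auto)
  fix W assume W: "W \<in> \<U>"
  let ?Y = "U \<inter> V \<inter> W"
  have Y: "opn ?Y" using o(1)[OF U] o(1)[OF U(2) U(1)] o(1)[OF W W] by (intro openin_Int)
  have eq: "on_opens X ?Y (c U W) = on_opens X ?Y (c U V) \<oplus>\<^bsub>Sec (tangent_sheaf X) ?Y\<^esub> on_opens X ?Y (c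
      V W)"
    using tangent.cocycle_res[OF z U W Y] by (simp only: tangent_simps) blast
  have d: "on_opens X ?Y (c U V) \<in> derivs X (\<lambda>_. 0) ?Y"
      "on_opens X ?Y (c V W) \<in> derivs X (\<lambda>_. 0) ?Y"
    using o(3)[OF U] o(3)[OF U(2) W] by (auto intro!: derivs_res_on)
  have "Rest X (U \<inter> W) ?Y (ct (U \<inter> W) (c U W)) = ct ?Y (on_opens X ?Y (c U W))"
    by (rule ct_res) (use o U W Y in auto)
  also have "\<dots> = ct ?Y (on_opens X ?Y (c U V)) \<oplus>\<^bsub>Sect X ?Y\<^esub> ct ?Y (on_opens X ?Y (c V W))"
    unfolding eq by (rule ct_add[OF Y d])
  also have "ct ?Y (on_opens X ?Y (c U V)) = Rest X (U \<inter> V) ?Y (ct (U \<inter> V) (c U V))"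
    by (rule ct_res[symmetric]) (use o U W Y in auto)
  also have "ct ?Y (on_opens X ?Y (c V W)) = Rest X (V \<inter> W) ?Y (ct (V \<inter> W) (c V W))"
    by (rule ct_res[symmetric]) (use o U W Y in auto)
  finally show "Rest X (U \<inter> W) ?Y (ct (U \<inter> W) (c U W)) =
     Rest X (U \<inter> V) ?Y (ct (U \<inter> V) (c U V)) \<oplus>\<^bsub>Sect X ?Y\<^esub> Rest X (V \<inter> W) ?Y (ct (V \<inter> W) (c V W))" .
qed

text \<open>The same morphism sends a coboundary given by the vector fields \<open>b W\<close> to
  the one given by the functions \<open>ct W (b W)\<close>, with unchanged refinement maps.\<close>

lemma ct_cohomologous:
  assumes "((\<U>, c), (\<V>, d)) \<in> cohomologous (topo X) (tangent_sheaf X)"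
  shows "((\<U>, \<lambda>U V. ct (U \<inter> V) (c U V)), (\<V>, \<lambda>U V. ct (U \<inter> V) (d U V))) \<in> cohomologous (topo X) (Str
      X)"
proof -
  obtain \<W> r s b where z: "(\<U>, c) \<in> cocycles (topo X) (tangent_sheaf X)"
      "(\<V>, d) \<in> cocycles (topo X) (tangent_sheaf X)"
      "open_cover (topo X) \<W>"
    and W: "\<forall>W\<in>\<W>. r W \<in> \<U> \<and> W \<subseteq> r W \<and> s W \<in> \<V> \<and> W \<subseteq> s W \<and> b W \<in> carrier (Sec (tangent_sheaf X) W)"
    and eq: "\<forall>W\<in>\<W>. \<forall>W'\<in>\<W>. Res (tangent_sheaf X) (r W \<inter> r W') (W \<inter> W') (c (r W) (r W')) \<oplus>\<^bsub>Sec
        (tangent_sheaf X) (W \<inter> W')\<^esub> Res (tangent_sheaf X) W' (W \<inter> W') (b W') =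
           Res (tangent_sheaf X) W (W \<inter> W') (b W) \<oplus>\<^bsub>Sec (tangent_sheaf X) (W \<inter> W')\<^esub> Res (tangent_sheaf
               X) (s W \<inter> s W') (W \<inter> W') (d (s W) (s W'))"
    using assms unfolding tangent.cohomologous_iff by (elim conjE exE) (rule that)
  note W = W[rule_format, unfolded tangent_simps]
  have oW: "opn W" if "W \<in> \<W>" for W using that z(3) by (auto simp: open_cover_def)
  note oc = tangent.cocycle_open[OF z(1), unfolded tangent_simps]
      and od = tangent.cocycle_open[OF z(2), unfolded tangent_simps]
  show ?thesis
  proof (rule str.cohomologousI[OF ct_cocycle[OF z(1)] ct_cocycle[OF z(2)] z(3), where r=r and s=s
      and b="\<lambda>W. ct W (b W)"])
    fix W W' assume WW: "W \<in> \<W>" "W' \<in> \<W>"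
    let ?Z = "W \<inter> W'"
    have Z: "opn ?Z" "?Z \<subseteq> r W \<inter> r W'" "?Z \<subseteq> s W \<inter> s W'" using WW oW W by blast+
    note w = W[OF WW(1)] W[OF WW(2)]
    have m: "r W \<in> \<U>" "r W' \<in> \<U>" "s W \<in> \<V>" "s W' \<in> \<V>" "b W \<in> derivs X (\<lambda>_. 0) W"
        "b W' \<in> derivs X (\<lambda>_. 0) W'"
      using w by auto
    have dd: "on_opens X ?Z (c (r W) (r W')) \<in> derivs X (\<lambda>_. 0) ?Z"
        "on_opens X ?Z (d (s W) (s W')) \<in> derivs X (\<lambda>_. 0) ?Z"
       "on_opens X ?Z (b W) \<in> derivs X (\<lambda>_. 0) ?Z" "on_opens X ?Z (b W') \<in> derivs X (\<lambda>_. 0) ?Z"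
      using oc(3)[OF m(1,2)] od(3)[OF m(3,4)] m(5,6) Z by (auto intro!: derivs_res_on)
    have "ct ?Z (on_opens X ?Z (c (r W) (r W'))) \<oplus>\<^bsub>Sect X ?Z\<^esub> ct ?Z (on_opens X ?Z (b W')) =
        ct ?Z (on_opens X ?Z (b W)) \<oplus>\<^bsub>Sect X ?Z\<^esub> ct ?Z (on_opens X ?Z (d (s W) (s W')))"
      using eq[rule_format, OF WW] by (simp only: tangent_simps(4) ct_add[symmetric] Z dd)
    moreover have "Rest X (r W \<inter> r W') ?Z (ct (r W \<inter> r W') (c (r W) (r W'))) =
        ct ?Z (on_opens X ?Z (c (r W) (r W')))"
      by (rule ct_res[OF oc(2)[OF m(1,2)] Z(1,2) oc(3)[OF m(1,2)]])
    moreover have "Rest X (s W \<inter> s W') ?Z (ct (s W \<inter> s W') (d (s W) (s W'))) =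
        ct ?Z (on_opens X ?Z (d (s W) (s W')))"
      by (rule ct_res[OF od(2)[OF m(3,4)] Z(1,3) od(3)[OF m(3,4)]])
    moreover have "Rest X W ?Z (ct W (b W)) = ct ?Z (on_opens X ?Z (b W))"
      by (rule ct_res[OF oW[OF WW(1)] Z(1) _ m(5)]) simp
    moreover have "Rest X W' ?Z (ct W' (b W')) = ct ?Z (on_opens X ?Z (b W'))"
      by (rule ct_res[OF oW[OF WW(2)] Z(1) _ m(6)]) simp
    ultimately show "Rest X (r W \<inter> r W') ?Z (ct (r W \<inter> r W') (c (r W) (r W'))) \<oplus>\<^bsub>Sect X ?Z\<^esub> Rest X W'
        ?Z (ct W' (b W')) =
           Rest X W ?Z (ct W (b W)) \<oplus>\<^bsub>Sect X ?Z\<^esub> Rest X (s W \<inter> s W') ?Z (ct (s W \<inter> s W') (d (s W) (s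
               W')))" by simp
  qed (use W oW ct_closed in auto)
qed

text \<open>The cup product is a union over all cocycles in the class. By
  \<open>ct_cohomologous\<close> they all contribute the same class, so any one of them computes
  it.\<close>

lemma cup_cech_class:
  assumes z: "(\<U>, c) \<in> cocycles (topo X) (tangent_sheaf X)"
  shows "cup X (cech_class (topo X) (tangent_sheaf X) (\<U>, c)) \<omega> =
    cech_class (topo X) (Str X) (\<U>, \<lambda>U V. ct (U \<inter> V) (c U V))"
proof -
  let ?\<xi> = "cech_class (topo X) (tangent_sheaf X) (\<U>, c)"
  have mem: "(\<U>, c) \<in> ?\<xi>" using tangent.cohomologous_refl[OF z] by (simp add: cech_class_def)
  have "cech_class (topo X) (Str X) (\<V>, \<lambda>U V. ct (U \<inter> V) (d U V)) =
      cech_class (topo X) (Str X) (\<U>, \<lambda>U V. ct (U \<inter> V) (c U V))" if "(\<V>, d) \<in> ?\<xi>" for \<V> d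
  proof -
    have "((\<U>, c), (\<V>, d)) \<in> cohomologous (topo X) (tangent_sheaf X)" using that
        by (simp add: cech_class_def)
    show ?thesis
      by (rule sym, rule iffD2[OF str.cech_class_eq_iff[OF ct_cocycle[OF z]] ct_cohomologous]) fact
  qed
  then have "(\<Union>(\<V>, d)\<in>?\<xi>. cech_class (topo X) (Str X) (\<V>, \<lambda>U V. ct (U \<inter> V) (d U V))) =
      (\<Union>x\<in>?\<xi>. cech_class (topo X) (Str X) (\<U>, \<lambda>U V. ct (U \<inter> V) (c U V)))"
    by (intro SUP_cong refl) (auto split: prod.splits)
  also have "\<dots> = cech_class (topo X) (Str X) (\<U>, \<lambda>U V. ct (U \<inter> V) (c U V))" using mem by blast
  finally show ?thesis unfolding cup_def ct_def .
qed

end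

section \<open>The projection from Kodaira--Spencer forms to differentials\<close>

context K_ringed
begin

text \<open>Forgetting \<open>None\<close> turns every defining relation between Kodaira--Spencer
  forms into one between differentials. The third kind loses its multiple of \<open>1\<close> and
  becomes the relation \<open>d c = 0\<close> for a constant.\<close>

lemma N_ks_Some:
  assumes U: "opn U" and n: "n \<in> ks.N \<delta> U" shows "(\<lambda>a. n (Some a)) \<in> kae.N U"
proof -
  interpret plain_cring "Sect X U" by (rule plain_Sect[OF U])
  interpret M: module "Sect X U" "kae.M U" by (rule kae.M_module[OF U])
  interpret M': module "Sect X U" "ks.M U" by (rule ks.M_module[OF U])
  note N = M.submoduleE[OF kae.N_submodule[OF U]]
  have g: "(\<lambda>a. gen (Sect X U) (Some x) (Some a)) = gen (Sect X U) x"
      "(\<lambda>a. gen (Sect X U) None (Some a)) = (\<lambda>_. \<zero>\<^bsub>Sect X U\<^esub>)" for x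
    by (auto simp: gen_def)
  have sub: "(\<lambda>a. r (Some a)) \<in> kaehler_gens (Sect X U) (cst_on X U)"
    if r: "r \<in> ks_gens (Sect X U) (cst_on X U) \<delta>" for r
    using r
  proof (cases rule: ks_gensE)
    case (mult a b)
    have "(\<lambda>x. r (Some x)) = gen (Sect X U) (a \<otimes>\<^bsub>Sect X U\<^esub> b) \<ominus>\<^bsub>kae.M U\<^esub> (b \<odot>\<^bsub>kae.M U\<^esub> gen (Sect X U) a
        \<oplus>\<^bsub>kae.M U\<^esub> a \<odot>\<^bsub>kae.M U\<^esub> gen (Sect X U) b)"
      unfolding mult(3) using mult(1,2)
      by (subst (1 2) free_mod_minus) (auto simp: gen_closed free_mod_closed, auto simp: gen_def
          fun_eq_iff)
    then show ?thesis using gensI(1)[OF mult(1,2)] by simp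
  next
    case (add a b)
    have "(\<lambda>x. r (Some x)) = gen (Sect X U) (a \<oplus>\<^bsub>Sect X U\<^esub> b) \<ominus>\<^bsub>kae.M U\<^esub> (gen (Sect X U) a \<oplus>\<^bsub>kae.M U\<^esub> gen
        (Sect X U) b)"
      unfolding add(3) using add(1,2)
      by (subst (1 2) free_mod_minus) (auto simp: gen_closed free_mod_closed, auto simp: gen_def
          fun_eq_iff)
    then show ?thesis using gensI(2)[OF add(1,2)] by simp
  next
    case (cst c)
    have "(\<lambda>x. r (Some x)) = gen (Sect X U) (cst_on X U c)"
      unfolding cst using cst_on_closed[OF U]
      by (subst free_mod_minus) (auto simp: gen_closed free_mod_closed, auto simp: gen_def
          fun_eq_iff a_minus_def)
    then show ?thesis using gensI(3) by metis
  qed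
  show ?thesis using ks.M_module[OF U] ks.G_sub[OF U] n
  proof (induction rule: span_induct)
    case zero
    show ?case using submodule_zero[OF kae.M_module[OF U] kae.N_submodule[OF U]] by simp
  next
    case (gens s)
    then show ?case using sub span_superset[OF kae.M_module[OF U]] by blast
  next
    case (add x y)
    then show ?case using N(5)[of "\<lambda>a. x (Some a)" "\<lambda>a. y (Some a)"] by simp
  next
    case (smult r x)
    then show ?case using N(4)[of r "\<lambda>a. x (Some a)"] by simp
  qed
qed

lemma lambda_pre_cl:
  assumes U: "opn U" and w: "w \<in> carrier (ks.M U)"
  shows "lambda_pre X U (ks.cl \<delta> U w) = kae.cl U (\<lambda>a. w (Some a))"
proof -
  interpret plain_cring "Sect X U" by (rule plain_Sect[OF U])
  have "kae.cl U (\<lambda>a. v (Some a)) = kae.cl U (\<lambda>a. w (Some a))" if v: "v \<in> ks.cl \<delta> U w" for v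
  proof -
    have vc: "v \<in> carrier (ks.M U)" "v \<ominus>\<^bsub>ks.M U\<^esub> w \<in> ks.N \<delta> U"
      using ks.cl_sub[OF U w] ks.mem_cl_iff[OF U w] v by auto
    have "(\<lambda>a. v (Some a)) \<ominus>\<^bsub>kae.M U\<^esub> (\<lambda>a. w (Some a)) = (\<lambda>a. (v \<ominus>\<^bsub>ks.M U\<^esub> w) (Some a))"
      using vc(1) w Some_comp_closed by (subst (1 2) free_mod_minus) auto
    then show ?thesis using kae.cl_eq_iff[OF U Some_comp_closed[OF w] Some_comp_closed[OF vc(1)]]
        N_ks_Some[OF U vc(2)] by simp
  qed
  then show ?thesis unfolding lambda_pre_def kaehler_rels_eq kaehler_free_def
      using ks.cl_self[OF U w] by blast
qed

lemma pu_ks_Some: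
  assumes U: "opn U" "opn V" "V \<subseteq> U" and w: "w \<in> carrier (ks.M U)"
  shows "(\<lambda>a. ks.pu U V w (Some a)) = kae.pu U V (\<lambda>a. w (Some a))"
  using push_ks_Some[OF cring_Sect[OF U(2)] res_closed[OF U] w] by auto

text \<open>The union in \<open>lambda\<close> runs over all representatives of the germ, but has a
  single value: on a common neighbourhood two of them have the same class, and
  \<open>lambda_pre\<close> respects classes and restriction.\<close>

lemma lambda_germ:
  assumes \<eta>: "\<eta> \<in> Omega_tau X \<delta> U" and p: "p \<in> U" and W: "(W, C) \<in> \<eta> p"
  shows "lambda X U \<eta> p = kae.gm p (W, lambda_pre X W C)"
proof -
  have \<eta>': "\<eta> \<in> ks.Shf \<delta> U" using \<eta> ks_eqs(3) by simp
  note 1 = ks.Shf_mem[OF \<eta>' p W]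
  obtain w where w: "w \<in> carrier (ks.M W)" "C = ks.cl \<delta> W w" using ks.Q_cases[OF 1(3)] .
  have "kae.gm p (V, lambda_pre X V D) = kae.gm p (W, lambda_pre X W C)" if V: "(V, D) \<in> \<eta> p"
      for V D
  proof -
    note 2 = ks.Shf_mem[OF \<eta>' p V]
    obtain v where v: "v \<in> carrier (ks.M V)" "D = ks.cl \<delta> V v" using ks.Q_cases[OF 2(3)] .
    obtain Z where Z: "opn Z" "p \<in> Z" "Z \<subseteq> V \<inter> W" "ks.pu V Z v \<ominus>\<^bsub>ks.M Z\<^esub> ks.pu W Z w \<in> ks.N \<delta> Z"
      by (rule ks.Shf_mem2[OF \<eta>' p V _ W, of v w]) (use v w 1 2 ks.cl_self in auto)
    have ZV: "Z \<subseteq> V" "Z \<subseteq> W" using Z by auto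
    have c: "ks.pu V Z v \<in> carrier (ks.M Z)" "ks.pu W Z w \<in> carrier (ks.M Z)"
      using ks.pu_closed 1 2 v w Z ZV by auto
    have "ks.cl \<delta> Z (ks.pu V Z v) = ks.cl \<delta> Z (ks.pu W Z w)"
      using ks.cl_eq_iff[OF Z(1) c(2,1)] Z(4) by simp
    then have "kae.cl Z (\<lambda>a. ks.pu V Z v (Some a)) = kae.cl Z (\<lambda>a. ks.pu W Z w (Some a))"
      using lambda_pre_cl[OF Z(1) c(1)] lambda_pre_cl[OF Z(1) c(2)] by metis
    then have "kae.rs V Z (kae.cl V (\<lambda>a. v (Some a))) = kae.rs W Z (kae.cl W (\<lambda>a. w (Some a)))"
      using kae.rs_cl[OF 2(1) Z(1) ZV(1) Some_comp_closed[OF v(1)]] kae.rs_cl[OF 1(1) Z(1) ZV(2)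
          Some_comp_closed[OF w(1)]]
        pu_ks_Some[OF 2(1) Z(1) ZV(1) v(1)] pu_ks_Some[OF 1(1) Z(1) ZV(2) w(1)] by simp
    then show ?thesis unfolding v(2) w(2) lambda_pre_cl[OF 2(1) v(1)] lambda_pre_cl[OF 1(1) w(1)]
      by (intro kae.germ_eqI[OF 2(1) _ 1(1) _ Z(1,2,3)] kae.cl_in_Q 1 2 Some_comp_closed v w)
  qed
  then have "(\<Union>(V, D)\<in>\<eta> p. kae.gm p (V, lambda_pre X V D)) =
      (\<Union>x\<in>\<eta> p. kae.gm p (W, lambda_pre X W C))"
    by (intro SUP_cong refl) (auto split: prod.splits)
  also have "\<dots> = kae.gm p (W, lambda_pre X W C)" using W by blast
  finally show ?thesis unfolding lambda_def kaehler_eqs using p by simp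
qed

end

section \<open>The obstruction to lifting\<close>

context K_ringed
begin

lemma Ld_KS:
  assumes D: "D U \<in> derivs X \<delta> U" "D V \<in> derivs X \<delta> V" and W: "opn W" "W \<subseteq> U" "W \<subseteq> V"
    and u: "u \<in> carrier (kae.M W)"
  shows "Ld (D U) W u = Ld (KS_cocycle D U V) W u \<oplus>\<^bsub>Sect X W\<^esub> Ld (D V) W u"
proof -
  interpret cring "Sect X W" by (rule cring_Sect[OF W(1)])
  have W': "W \<subseteq> U \<inter> V" using W by blast
  note KS = KS_cocycle_closed[of D, OF D]
  have "Ld (D U) W u = semilin (Sect X W) (Sect X W) (\<lambda>x. x) (\<lambda>b. KS_cocycle D U V W b \<oplus>\<^bsub>Sect X W\<^esub> D V
      W b) u"
  proof (rule semilin_cong[OF cring_Sect[OF W(1)] u])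
    fix b assume b: "b \<in> carrier (Sect X W)"
    have c: "D U W b \<in> carrier (Sect X W)" "D V W b \<in> carrier (Sect X W)"
      using derivs_props(1)[OF D(1) W(1,2) b] derivs_props(1)[OF D(2) W(1,3) b] .
    then show "D U W b = KS_cocycle D U V W b \<oplus>\<^bsub>Sect X W\<^esub> D V W b" "D U W b \<in> carrier (Sect X W)"
      using W W' b by (simp_all add: KS_cocycle_def on_opens_apply a_minus_def a_assoc l_neg)
  qed auto
  also have "\<dots> = Ld (KS_cocycle D U V) W u \<oplus>\<^bsub>Sect X W\<^esub> Ld (D V) W u"
    by (rule semilin_add_right[OF D_semilinear[OF KS W(1) W'] D_semilinear[OF D(2) W(1,3)] u])
  finally show ?thesis .
qed

abbreviation "Lk D W \<equiv> semilin (Sect X W) (Sect X W) (\<lambda>x. x) (hks D W)"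

lemma Lk_eq:
  "D \<in> derivs X \<delta> U \<Longrightarrow> opn W \<Longrightarrow> W \<subseteq> U \<Longrightarrow> w \<in> carrier (ks.M W) \<Longrightarrow>
    Lk D W w = w None \<oplus>\<^bsub>Sect X W\<^esub> Ld D W (\<lambda>a. w (Some a))"
  by (rule ks_semilin_split) (auto intro: derivs_props(1))

lemma Lk_closed:
  assumes "D \<in> derivs X \<delta> U" "opn W" "W \<subseteq> U" "w \<in> carrier (ks.M W)"
  shows "Lk D W w \<in> carrier (Sect X W)"
  unfolding Lk_eq[OF assms]
  by (intro str.add_closed[simplified] assms(2) Ld_closed[OF assms(1-3)] Some_comp_closed[OF
      assms(4)] free_mod_D(1)[OF assms(4)])

end

section \<open>From a lift to a coboundary\<close>

context global_form
begin

lemma lift_imp_coboundary: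
  assumes \<V>: "open_cover (topo X) \<V>" and D: "\<And>V. V \<in> \<V> \<Longrightarrow> D V \<in> derivs X \<delta> V"
    and \<eta>: "\<eta> \<in> Omega_tau X \<delta> (pts X)" and lam: "lambda X (pts X) \<eta> = \<omega>"
  obtains \<beta> where "\<And>V. V \<in> \<V> \<Longrightarrow> \<beta> V \<in> carrier (Sect X V)"
    "\<And>U V. U \<in> \<V> \<Longrightarrow> V \<in> \<V> \<Longrightarrow> ct (U \<inter> V) (KS_cocycle D U V) \<oplus>\<^bsub>Sect X (U \<inter> V)\<^esub> Rest X V (U \<inter> V) (\<beta> V) =
        Rest X U (U \<inter> V) (\<beta> U)"
proof -
  have \<eta>': "\<eta> \<in> ks.Shf \<delta> (pts X)" using \<eta> ks_eqs(3) by simp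
  have oV: "opn V" if "V \<in> \<V>" for V using that \<V> by (auto simp: open_cover_def)
  have \<eta>V: "restrict \<eta> V \<in> ks.Shf \<delta> V" if "opn V" for V
    by (rule ks.Shf_restrict[OF \<eta>' that opn_sub[OF that]])
  have "\<exists>f. ks.is_pairing V (hks (D V)) (restrict \<eta> V) f" if V: "V \<in> \<V>" for V
  proof -
    interpret f: functional X "\<lambda>U. ks_basis (Sect X U)" "\<lambda>U. ks_gens (Sect X U) (cst_on X U) \<delta>"
      "\<lambda>U V. map_option (Rest X U V)" V "hks (D V)" by (rule ks_functional[OF D[OF V] oV[OF V]])
    show ?thesis by (rule f.pairing_ex[OF \<eta>V[OF oV[OF V]]]) blast
  qed
  \<comment> \<open>\<open>\<beta> V\<close> is the image of the lift under the retraction that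
    belongs to \<open>D V\<close>.\<close>
  then obtain \<beta> where \<beta>: "\<And>V. V \<in> \<V> \<Longrightarrow> ks.is_pairing V (hks (D V)) (restrict \<eta> V) (\<beta> V)" by metis
  have \<beta>c: "\<beta> V \<in> carrier (Sect X V)" if "V \<in> \<V>" for V using \<beta>[OF that]
      by (simp add: ks.is_pairing_def)
  have loc: "\<exists>W'. opn W' \<and> p \<in> W' \<and> W' \<subseteq> W \<and> Rest X V W' (\<beta> V) = Rest X W W' (Lk (D V) W w)"
    if V: "V \<in> \<V>" and p: "p \<in> V" and W: "W \<subseteq> V" "(W, C) \<in> \<eta> p" "w \<in> C" for V p W C w
  proof -
    interpret f: functional X "\<lambda>U. ks_basis (Sect X U)" "\<lambda>U. ks_gens (Sect X U) (cst_on X U) \<delta>"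
      "\<lambda>U V. map_option (Rest X U V)" V "hks (D V)" by (rule ks_functional[OF D[OF V] oV[OF V]])
    have "(W, C) \<in> restrict \<eta> V p" using p W by simp
    then show ?thesis using \<beta>[OF V] p W unfolding f.is_pairing_L by blast
  qed
  show ?thesis
  proof (rule that[OF \<beta>c])
    fix U V assume UV: "U \<in> \<V>" "V \<in> \<V>"
    let ?Y = "U \<inter> V"
    have Y: "opn ?Y" "?Y \<subseteq> U" "?Y \<subseteq> V" using oV UV by auto
    interpret Y: cring "Sect X ?Y" by (rule cring_Sect[OF Y(1)])
    let ?bU = "Rest X U ?Y (\<beta> U)" and ?bV = "Rest X V ?Y (\<beta> V)"
    have bc: "?bU \<in> carrier (Sect X ?Y)" "?bV \<in> carrier (Sect X ?Y)"
      using res_closed[OF oV[OF UV(1)] Y(1,2) \<beta>c[OF UV(1)]] res_closed[OF oV[OF UV(2)] Y(1,3) \<beta>c[OF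
          UV(2)]] .
    note KS = KS_cocycle_closed[of D, OF D[OF UV(1)] D[OF UV(2)]]
    \<comment> \<open>This is checked on germs. A representative \<open>w\<close> of the lift
      yields, by forgetting \<open>None\<close>, a representative of \<open>\<omega>\<close> on the
      same open set, so that the contraction and both retractions are computed from
      \<open>w\<close>.\<close>
    have "ct ?Y (KS_cocycle D U V) = ?bU \<ominus>\<^bsub>Sect X ?Y\<^esub> ?bV"
      unfolding ct_def
    proof (rule contract_eqI[OF KS Y(1) \<omega>_res[OF Y(1)]])
      show "?bU \<ominus>\<^bsub>Sect X ?Y\<^esub> ?bV \<in> carrier (Sect X ?Y)" using bc by simp
      fix p assume p: "p \<in> ?Y"
      obtain W w where W: "opn W" "p \<in> W" "W \<subseteq> ?Y" "w \<in> carrier (ks.M W)" "\<And>q. q \<in> W \<Longrightarrow>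
          (W, ks.cl \<delta> W w) \<in> restrict \<eta> ?Y q"
        by (rule ks.Shf_E[OF \<eta>V[OF Y(1)] p]) (rule that)
      have WUV: "W \<subseteq> U" "W \<subseteq> V" using W by auto
      let ?u = "\<lambda>a. w (Some a)"
      have mem: "(W, ks.cl \<delta> W w) \<in> \<eta> p" using W(5)[OF W(2)] p by simp
      have ppts: "p \<in> pts X" using opn_sub[OF W(1)] W(2) by blast
      have "\<omega> p = kae.gm p (W, kae.cl W ?u)"
        using lambda_germ[OF \<eta> ppts mem] lam lambda_pre_cl[OF W(1,4)] by simp
      then have mem': "(W, kae.cl W ?u) \<in> \<omega> p"
        using kae.germ_self[OF W(1,2) kae.cl_in_Q[OF W(1) Some_comp_closed[OF W(4)]]] by simp
      have u: "?u \<in> carrier (kae.M W)" by (rule Some_comp_closed[OF W(4)])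
      obtain W1 where W1: "opn W1" "p \<in> W1" "W1 \<subseteq> W" "Rest X U W1 (\<beta> U) =
          Rest X W W1 (Lk (D U) W w)"
        using loc[OF UV(1) _ WUV(1) mem ks.cl_self[OF W(1,4)]] p by blast
      obtain W2 where W2: "opn W2" "p \<in> W2" "W2 \<subseteq> W" "Rest X V W2 (\<beta> V) =
          Rest X W W2 (Lk (D V) W w)"
        using loc[OF UV(2) _ WUV(2) mem ks.cl_self[OF W(1,4)]] p by blast
      let ?Z = "W1 \<inter> W2"
      have Z: "opn ?Z" "?Z \<subseteq> W1" "?Z \<subseteq> W2" "p \<in> ?Z" "?Z \<subseteq> W" "?Z \<subseteq> ?Y" using W1 W2 W by auto
      interpret W: cring "Sect X W" by (rule cring_Sect[OF W(1)])
      note cl = Lk_closed[OF D[OF UV(1)] W(1) WUV(1) W(4)] Lk_closed[OF D[OF UV(2)] W(1) WUV(2)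
          W(4)]
      have s: "Rest X U ?Z (\<beta> U) = Rest X W ?Z (Lk (D U) W w)" "Rest X V ?Z (\<beta> V) =
          Rest X W ?Z (Lk (D V) W w)"
        using res_shrink[OF oV[OF UV(1)] W(1) W1(1) Z(1) _ W1(3) Z(2) \<beta>c[OF UV(1)] cl(1) W1(4)]
          res_shrink[OF oV[OF UV(2)] W(1) W2(1) Z(1) _ W2(3) Z(3) \<beta>c[OF UV(2)] cl(2) W2(4)] W1 W2
              WUV by auto
      have b: "Rest X ?Y ?Z ?bU = Rest X U ?Z (\<beta> U)" "Rest X ?Y ?Z ?bV = Rest X V ?Z (\<beta> V)"
        using res_res[OF oV[OF UV(1)] Y(1) Z(1) Y(2) Z(6) \<beta>c[OF UV(1)]] res_res[OF oV[OF UV(2)] Y(1)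
            Z(1) Y(3) Z(6) \<beta>c[OF UV(2)]] .
      have "Rest X ?Y ?Z (?bU \<ominus>\<^bsub>Sect X ?Y\<^esub> ?bV) = Rest X W ?Z (Lk (D U) W w \<ominus>\<^bsub>Sect X W\<^esub> Lk (D V) W w)"
        by (simp only: res_minus[OF Y(1) Z(1,6) bc] res_minus[OF W(1) Z(1,5) cl] b s)
      \<comment> \<open>The coefficient \<open>w None\<close> occurs in both retractions and
        cancels; the contraction with \<open>D U - D V\<close> remains.\<close>
      also have "Lk (D U) W w \<ominus>\<^bsub>Sect X W\<^esub> Lk (D V) W w = Ld (KS_cocycle D U V) W ?u"
      proof -
        note k = Ld_closed[OF KS W(1,3) u] Ld_closed[OF D[OF UV(2)] W(1) WUV(2) u] free_mod_D(1)[OF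
            W(4), of None]
        have "Lk (D U) W w = Ld (KS_cocycle D U V) W ?u \<oplus>\<^bsub>Sect X W\<^esub> Lk (D V) W w"
          unfolding Lk_eq[OF D[OF UV(1)] W(1) WUV(1) W(4)] Lk_eq[OF D[OF UV(2)] W(1) WUV(2) W(4)]
            Ld_KS[of D, OF D[OF UV(1)] D[OF UV(2)] W(1) WUV u] using k by (simp add: W.a_lcomm)
        then show ?thesis using k(1) cl(2) by (simp add: a_minus_def W.a_assoc W.r_neg)
      qed
      finally show "\<exists>W C v W'. (W, C) \<in> restrict \<omega> ?Y p \<and> v \<in> C \<and> W \<subseteq> ?Y \<and> opn W' \<and> p \<in> W' \<and>
          W' \<subseteq> W \<and>
          Rest X ?Y W' (?bU \<ominus>\<^bsub>Sect X ?Y\<^esub> ?bV) = Rest X W W' (Ld (KS_cocycle D U V) W v)"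
        using mem' kae.cl_self[OF W(1) u] W(3) Z p
        by (intro exI[of _ W] exI[of _ "kae.cl W ?u"] exI[of _ ?u] exI[of _ ?Z]) simp
    qed
    then show "ct ?Y (KS_cocycle D U V) \<oplus>\<^bsub>Sect X ?Y\<^esub> ?bV = ?bU"
      using bc by (simp add: a_minus_def Y.a_assoc Y.l_neg)
  qed
qed

end

section \<open>Splittings of the projection to differentials\<close>

context K_ringed
begin

text \<open>For \<open>t = \<zero>\<close> this is the splitting \<open>da \<mapsto> d\<^sup>\<tau> a - D a \<cdot> 1\<close> of the projection to Kaehler
  differentials; in general the multiple \<open>t\<close> of the form \<open>1\<close> is added.\<close>

definition split_ks :: "('p set \<Rightarrow> 'a \<Rightarrow> 'a) \<Rightarrow> 'p set \<Rightarrow> 'a \<Rightarrow> ('a \<Rightarrow> 'a) \<Rightarrow> 'a option \<Rightarrow> 'a" where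
  "split_ks D W t v = case_option (t \<ominus>\<^bsub>Sect X W\<^esub> Ld D W v) v"

lemma split_ks_simps [simp]:
  "split_ks D W t v None = t \<ominus>\<^bsub>Sect X W\<^esub> Ld D W v" "split_ks D W t v (Some a) = v a"
  by (simp_all add: split_ks_def)

lemma option_fun_eqI: "f None = g None \<Longrightarrow> (\<And>a. f (Some a) = g (Some a)) \<Longrightarrow> f = g"
  by (rule ext) (case_tac x; simp)

lemma split_ks_closed:
  assumes D: "D \<in> derivs X \<delta> U" "opn W" "W \<subseteq> U" and v: "v \<in> carrier (kae.M W)"
      and t: "t \<in> carrier (Sect X W)"
  shows "split_ks D W t v \<in> carrier (ks.M W)"
proof -
  interpret cring "Sect X W" by (rule cring_Sect[OF D(2)])
  note v' = free_mod_D(1,2,3)[OF v]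
  have "{b. split_ks D W t v b \<noteq> \<zero>\<^bsub>Sect X W\<^esub>} \<subseteq> insert None (Some ` {b. v b \<noteq> \<zero>\<^bsub>Sect X W\<^esub>})"
  proof
    fix b assume "b \<in> {b. split_ks D W t v b \<noteq> \<zero>\<^bsub>Sect X W\<^esub>}"
    then show "b \<in> insert None (Some ` {b. v b \<noteq> \<zero>\<^bsub>Sect X W\<^esub>})" by (cases b) auto
  qed
  moreover have "finite (insert None (Some ` {b. v b \<noteq> \<zero>\<^bsub>Sect X W\<^esub>}))" using v'(2) by simp
  moreover have "insert None (Some ` {b. v b \<noteq> \<zero>\<^bsub>Sect X W\<^esub>}) \<subseteq> ks_basis (Sect X W)" using v'(3)
      by blast
  moreover have "split_ks D W t v b \<in> carrier (Sect X W)" for b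
    using v'(1) Ld_closed[OF D v] t by (cases b) auto
  ultimately show ?thesis unfolding free_mod_carrier by (meson finite_subset subset_trans)
qed

text \<open>With \<open>t\<close> equal to zero the splitting is linear and sends relation
  generators to relation generators. On the Leibniz and sum relations the coefficient at
  \<open>1\<close> vanishes because \<open>D\<close> is a derivation. On the differential of a
  constant \<open>c\<close> it is \<open>- \<delta> c\<close>, just the term by which the third kind
  of relation differs from its counterpart for differentials.\<close>

lemma split_ks_N:
  assumes D: "D \<in> derivs X \<delta> U" "opn W" "W \<subseteq> U" and n: "n \<in> kae.N W"
  shows "split_ks D W \<zero>\<^bsub>Sect X W\<^esub> n \<in> ks.N \<delta> W"
proof -
  interpret plain_cring "Sect X W" by (rule plain_Sect[OF D(2)])
  note sl = D_semilinear[OF D]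
  note d = derivs_props[OF D]
  interpret M: module "Sect X W" "kae.M W" by (rule kae.M_module[OF D(2)])
  interpret M': module "Sect X W" "ks.M W" by (rule ks.M_module[OF D(2)])
  note N' = M'.submoduleE[OF ks.N_submodule[OF D(2)]]
  have sub: "kae.N W \<subseteq> carrier (kae.M W)" by (rule span_sub[OF kae.M_module[OF D(2)] kae.G_sub[OF
      D(2)]])
  note Ld_simps = semilinear.semilin_minus[OF sl] semilinear.semilin_add[OF sl]
      semilinear.semilin_smult[OF sl]
    semilinear.semilin_gen[OF sl] gen_closed M.a_closed M.smult_closed m_closed a_closed insertI1
        insertI2 imageI
  have minus_zero_minus: "\<zero>\<^bsub>Sect X W\<^esub> \<ominus>\<^bsub>Sect X W\<^esub> x = \<ominus>\<^bsub>Sect X W\<^esub> x" if "x \<in> carrier (Sect X W)" for x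
    using that by (simp add: a_minus_def)
  have gens: "split_ks D W \<zero>\<^bsub>Sect X W\<^esub> r \<in> ks_gens (Sect X W) (cst_on X W) \<delta>"
    if r: "r \<in> kaehler_gens (Sect X W) (cst_on X W)" for r
    using r
  proof (cases rule: kaehler_gensE)
    case (mult a b)
    have "Ld D W r = D W (a \<otimes>\<^bsub>Sect X W\<^esub> b) \<ominus>\<^bsub>Sect X W\<^esub> (b \<otimes>\<^bsub>Sect X W\<^esub> D W a \<oplus>\<^bsub>Sect X W\<^esub> a \<otimes>\<^bsub>Sect X W\<^esub> D W b)"
      unfolding mult(3) using mult(1,2) by (simp only: Ld_simps)
    also have "\<dots> = \<zero>\<^bsub>Sect X W\<^esub>"
      using mult(1,2) d(1)[of a] d(1)[of b] d(3)[of a b]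
          by (simp add: m_comm[of b "D W a"] a_minus_def r_neg)
    finally have L: "Ld D W r = \<zero>\<^bsub>Sect X W\<^esub>" .
    have "split_ks D W \<zero>\<^bsub>Sect X W\<^esub> r = gen (Sect X W) (Some (a \<otimes>\<^bsub>Sect X W\<^esub> b)) \<ominus>\<^bsub>ks.M W\<^esub> (b \<odot>\<^bsub>ks.M W\<^esub> gen
        (Sect X W) (Some a) \<oplus>\<^bsub>ks.M W\<^esub> a \<odot>\<^bsub>ks.M W\<^esub> gen (Sect X W) (Some b))"
    proof (rule option_fun_eqI)
      show "split_ks D W \<zero>\<^bsub>Sect X W\<^esub> r None = (gen (Sect X W) (Some (a \<otimes>\<^bsub>Sect X W\<^esub> b)) \<ominus>\<^bsub>ks.M W\<^esub> (b \<odot>\<^bsub>ks.M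
          W\<^esub> gen (Sect X W) (Some a) \<oplus>\<^bsub>ks.M W\<^esub> a \<odot>\<^bsub>ks.M W\<^esub> gen (Sect X W) (Some b))) None"
        using mult(1,2) L by (subst free_mod_minus) (auto simp: gen_closed free_mod_closed, auto
            simp: gen_def a_minus_def)
      show "split_ks D W \<zero>\<^bsub>Sect X W\<^esub> r (Some x) = (gen (Sect X W) (Some (a \<otimes>\<^bsub>Sect X W\<^esub> b)) \<ominus>\<^bsub>ks.M W\<^esub> (b
          \<odot>\<^bsub>ks.M W\<^esub> gen (Sect X W) (Some a) \<oplus>\<^bsub>ks.M W\<^esub> a \<odot>\<^bsub>ks.M W\<^esub> gen (Sect X W) (Some b))) (Some
          x)" for x
        unfolding mult(3) using mult(1,2) by (subst (1 2) free_mod_minus) (auto simp: gen_closed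
            free_mod_closed, auto simp: gen_def)
    qed
    then show ?thesis using gensI(4)[OF mult(1,2)] by simp
  next
    case (add a b)
    have "Ld D W r = D W (a \<oplus>\<^bsub>Sect X W\<^esub> b) \<ominus>\<^bsub>Sect X W\<^esub> (D W a \<oplus>\<^bsub>Sect X W\<^esub> D W b)"
      unfolding add(3) using add(1,2) by (simp only: Ld_simps)
    also have "\<dots> = \<zero>\<^bsub>Sect X W\<^esub>"
      using add(1,2) d(1)[of a] d(1)[of b] d(2)[of a b] by (simp add: a_minus_def r_neg)
    finally have L: "Ld D W r = \<zero>\<^bsub>Sect X W\<^esub>" .
    have "split_ks D W \<zero>\<^bsub>Sect X W\<^esub> r = gen (Sect X W) (Some (a \<oplus>\<^bsub>Sect X W\<^esub> b)) \<ominus>\<^bsub>ks.M W\<^esub> (gen (Sect X W)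
        (Some a) \<oplus>\<^bsub>ks.M W\<^esub> gen (Sect X W) (Some b))"
    proof (rule option_fun_eqI)
      show "split_ks D W \<zero>\<^bsub>Sect X W\<^esub> r None = (gen (Sect X W) (Some (a \<oplus>\<^bsub>Sect X W\<^esub> b)) \<ominus>\<^bsub>ks.M W\<^esub> (gen
          (Sect X W) (Some a) \<oplus>\<^bsub>ks.M W\<^esub> gen (Sect X W) (Some b))) None"
        using add(1,2) L by (subst free_mod_minus) (auto simp: gen_closed free_mod_closed, auto
            simp: gen_def a_minus_def)
      show "split_ks D W \<zero>\<^bsub>Sect X W\<^esub> r (Some x) = (gen (Sect X W) (Some (a \<oplus>\<^bsub>Sect X W\<^esub> b)) \<ominus>\<^bsub>ks.M W\<^esub> (gen
          (Sect X W) (Some a) \<oplus>\<^bsub>ks.M W\<^esub> gen (Sect X W) (Some b))) (Some x)" for x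
        unfolding add(3) using add(1,2) by (subst (1 2) free_mod_minus) (auto simp: gen_closed
            free_mod_closed, auto simp: gen_def)
    qed
    then show ?thesis using gensI(5)[OF add(1,2)] by simp
  next
    case (cst c)
    have L: "Ld D W r = cst_on X W (\<delta> c)"
      unfolding cst using d(4)[of c] cst_on_closed[OF D(2), of c] by (simp only: Ld_simps)
    have "split_ks D W \<zero>\<^bsub>Sect X W\<^esub> r = gen (Sect X W) (Some (cst_on X W c)) \<ominus>\<^bsub>ks.M W\<^esub> cst_on X W (\<delta> c)
        \<odot>\<^bsub>ks.M W\<^esub> gen (Sect X W) None"
      using cst_on_closed[OF D(2)] L
      by (subst free_mod_minus) (auto simp: gen_closed free_mod_closed, auto simp: cst gen_def
          a_minus_def intro!: option_fun_eqI)
    then show ?thesis using gensI(6) by metis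
  qed
  show ?thesis using kae.M_module[OF D(2)] kae.G_sub[OF D(2)] n
  proof (induction rule: span_induct)
    case zero
    have "split_ks D W \<zero>\<^bsub>Sect X W\<^esub> (\<lambda>_. \<zero>\<^bsub>Sect X W\<^esub>) = (\<lambda>_. \<zero>\<^bsub>Sect X W\<^esub>)"
      by (rule option_fun_eqI) (simp_all add: semilinear.semilin_zero[OF sl] a_minus_def)
    then show ?case using submodule_zero[OF ks.M_module[OF D(2)] ks.N_submodule[OF D(2)]] by simp
  next
    case (gens s)
    then show ?case using gens span_superset[OF ks.M_module[OF D(2)]] \<open>\<And>r. r \<in> kaehler_gens (Sect X
        W) (cst_on X W) \<Longrightarrow> split_ks D W \<zero>\<^bsub>Sect X W\<^esub> r \<in> ks_gens (Sect X W) (cst_on X W) \<delta>\<close>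
      by blast
  next
    case (add x y)
    have c: "x \<in> carrier (kae.M W)" "y \<in> carrier (kae.M W)" using add sub by auto
    note cl = Ld_closed[OF D c(1)] Ld_closed[OF D c(2)]
    have "split_ks D W \<zero>\<^bsub>Sect X W\<^esub> (x \<oplus>\<^bsub>kae.M W\<^esub> y) =
        split_ks D W \<zero>\<^bsub>Sect X W\<^esub> x \<oplus>\<^bsub>ks.M W\<^esub> split_ks D W \<zero>\<^bsub>Sect X W\<^esub> y"
      using cl semilinear.semilin_add[OF sl c] by (intro option_fun_eqI) (auto simp: a_minus_def
          minus_add a_comm)
    then show ?case using N'(5)[OF add(3,4)] by simp
  next
    case (smult r x)
    have c: "x \<in> carrier (kae.M W)" using smult sub by auto
    note cl = Ld_closed[OF D c]
    have "split_ks D W \<zero>\<^bsub>Sect X W\<^esub> (r \<odot>\<^bsub>kae.M W\<^esub> x) = r \<odot>\<^bsub>ks.M W\<^esub> split_ks D W \<zero>\<^bsub>Sect X W\<^esub> x"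
      using cl smult(1) semilinear.semilin_smult[OF sl c smult(1)]
          by (intro option_fun_eqI) (auto simp: a_minus_def r_minus)
    then show ?case using N'(4)[OF smult(1,3)] by simp
  qed
qed

lemma pu_split_ks:
  assumes D: "D \<in> derivs X \<delta> U" and V: "opn V" "V \<subseteq> U" "opn Z" "Z \<subseteq> V"
    and v: "v \<in> carrier (kae.M V)" and t: "t \<in> carrier (Sect X V)"
  shows "ks.pu V Z (split_ks D V t v) = split_ks D Z (Rest X V Z t) (kae.pu V Z v)"
proof (rule option_fun_eqI)
  interpret h: plain_hom "Sect X V" "Sect X Z" "Rest X V Z" by (rule res_plain_hom) fact+
  note c = split_ks_closed[OF D V(1,2) v t]
  have ZU: "Z \<subseteq> U" using V by blast
  let ?w = "split_ks D V t v"
  \<comment> \<open>\<open>None\<close> is the only index mapped to \<open>None\<close>, so the sum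
    for this coordinate has at most one term. It is empty when the coefficient vanishes, since
    \<open>push\<close> sums over the support.\<close>
  have "ks.pu V Z ?w None = Rest X V Z (?w None)"
  proof (cases "?w None = \<zero>\<^bsub>Sect X V\<^esub>")
    case True
    then have "b \<noteq> None" if "?w b \<noteq> \<zero>\<^bsub>Sect X V\<^esub>" for b using that by (cases b) auto
    then have S: "{b. ?w b \<noteq> \<zero>\<^bsub>Sect X V\<^esub> \<and> map_option (Rest X V Z) b = None} = {}" by auto
    show ?thesis unfolding push_def S True by simp
  next
    case False
    then have "{b. ?w b \<noteq> \<zero>\<^bsub>Sect X V\<^esub> \<and> map_option (Rest X V Z) b = None} = {None}" by auto
    then have "ks.pu V Z ?w None = (\<Oplus>\<^bsub>Sect X Z\<^esub>b\<in>{None}. Rest X V Z (?w b))" unfolding push_def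
        by (simp only:)
    also have "\<dots> = Rest X V Z (?w None)"
      using free_mod_D(1)[OF c, of None] h.hom_closed by (subst h.S.finsum_insert) (auto simp del:
          split_ks_simps)
    finally show ?thesis .
  qed
  also have "\<dots> = Rest X V Z t \<ominus>\<^bsub>Sect X Z\<^esub> Rest X V Z (Ld D V v)"
    using res_minus[OF V(1,3,4) t Ld_closed[OF D V(1,2) v]] by simp
  also have "Rest X V Z (Ld D V v) = Ld D Z (kae.pu V Z v)"
  proof -
    interpret VZ: pushing "Sect X V" "Sect X Z" "Rest X V Z" "carrier (Sect X V)"
        "carrier (Sect X Z)" "Rest X V Z"
      by (rule kae.pushing[OF V(1,3,4)])
    have "Ld D Z (kae.pu V Z v) = semilin (Sect X V) (Sect X Z) ((\<lambda>x. x) \<circ> Rest X V Z) (D Z \<circ> Rest X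
        V Z) v"
      by (rule VZ.semilin_push[OF D_semilinear[OF D V(3) ZU] v])
    also have "\<dots> = semilin (Sect X V) (Sect X Z) (Rest X V Z \<circ> (\<lambda>x. x)) (Rest X V Z \<circ> D V) v"
      using derivs_props(1)[OF D V(1,2)] derivs_res[OF D V(1,3,2,4)]
      by (intro semilin_cong[OF cring_Sect[OF V(3)] v]) (auto simp: h.hom_closed)
    also have "\<dots> = Rest X V Z (Ld D V v)"
      by (rule h.hom_semilin[symmetric, OF D_semilinear[OF D V(1,2)] v])
    finally show ?thesis by simp
  qed
  finally show "ks.pu V Z ?w None = split_ks D Z (Rest X V Z t) (kae.pu V Z v) None" by simp
  fix a
  have "ks.pu V Z ?w (Some a) = kae.pu V Z (\<lambda>a. ?w (Some a)) a"
    using pu_ks_Some[OF V(1,3,4) c] by metis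
  then show "ks.pu V Z ?w (Some a) = split_ks D Z (Rest X V Z t) (kae.pu V Z v) (Some a)" by simp
qed

end

section \<open>From a coboundary to a lift\<close>

context global_form
begin

text \<open>The local lifts given by two members of the cover agree: their difference is the splitting of
    a
  relation between Kaehler differentials.\<close>

lemma local_lifts_agree:
  assumes D: "D U \<in> derivs X \<delta> U" "D U' \<in> derivs X \<delta> U'"
    and W: "opn W" "opn W'" "W \<subseteq> U" "W' \<subseteq> U'"
        and b: "b \<in> carrier (Sect X W)" "b' \<in> carrier (Sect X W')"
    and eq: "ct (W \<inter> W') (on_opens X (W \<inter> W') (KS_cocycle D U U')) \<oplus>\<^bsub>Sect X (W \<inter> W')\<^esub> Rest X W' (W \<inter>
        W') b' = Rest X W (W \<inter> W') b"
    and V: "opn V" "V \<subseteq> W" "v \<in> carrier (kae.M V)" "(V, kae.cl V v) \<in> \<omega> q" "q \<in> V"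
    and V': "opn V'" "V' \<subseteq> W'" "v' \<in> carrier (kae.M V')" "(V', kae.cl V' v') \<in> \<omega> q" "q \<in> V'"
  shows "ks.gm \<delta> q (V, ks.cl \<delta> V (split_ks (D U) V (Rest X W V b) v)) =
    ks.gm \<delta> q (V', ks.cl \<delta> V' (split_ks (D U') V' (Rest X W' V' b') v'))"
proof -
  have \<omega>': "\<omega> \<in> kae.Shf (pts X)" using \<omega> kaehler_eqs(3) by simp
  have q: "q \<in> pts X" using opn_sub[OF V(1)] V(5) by blast
  let ?Y = "W \<inter> W'"
  have Y: "opn ?Y" "?Y \<subseteq> U \<inter> U'" "?Y \<subseteq> W" "?Y \<subseteq> W'" using W by auto
  let ?K = "on_opens X ?Y (KS_cocycle D U U')"
  have K: "?K \<in> derivs X (\<lambda>_. 0) ?Y"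
    by (rule derivs_res_on[OF KS_cocycle_closed[of D, OF D] Y(2)])
  obtain Z where Z: "opn Z" "q \<in> Z" "Z \<subseteq> V \<inter> V'" "kae.pu V Z v \<ominus>\<^bsub>kae.M Z\<^esub> kae.pu V' Z v' \<in> kae.N Z"
    by (rule kae.Shf_mem2[OF \<omega>' q V(4) kae.cl_self[OF V(1,3)] V'(4) kae.cl_self[OF V'(1,3)]]) (rule
        that)
  have ZV: "Z \<subseteq> V" "Z \<subseteq> V'" "Z \<subseteq> ?Y" "q \<in> ?Y" using Z V V' by auto
  have vZ: "kae.pu V Z v \<in> carrier (kae.M Z)" "kae.pu V' Z v' \<in> carrier (kae.M Z)"
    using kae.pu_closed V V' Z(1) ZV by auto
  have "(Z, kae.rs V Z (kae.cl V v)) \<in> \<omega> q"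
    by (rule kae.Shf_mem_shrink[OF \<omega>' q V(4) Z(1) ZV(1) Z(2)])
  then have "(Z, kae.cl Z (kae.pu V Z v)) \<in> restrict \<omega> ?Y q"
    using kae.rs_cl[OF V(1) Z(1) ZV(1) V(3)] ZV(4) by simp
  then obtain Z' where "opn Z'" "q \<in> Z'" "Z' \<subseteq> Z" "Rest X ?Y Z' (contract X ?Y ?K (restrict \<omega> ?Y)) =
      Rest X Z Z' (Ld ?K Z (kae.pu V Z v))"
    by (rule contract_local[OF K Y(1) \<omega>_res[OF Y(1)] ZV(4) _ kae.cl_self[OF Z(1) vZ(1)] ZV(3)])
        (rule that)
  note Z' = this[folded ct_def]
  have sub: "Z' \<subseteq> V" "Z' \<subseteq> V'" "Z' \<subseteq> ?Y" "Z' \<subseteq> W" "Z' \<subseteq> W'" "Z' \<subseteq> U" "Z' \<subseteq> U'" "Z \<subseteq> U" "Z \<subseteq> U'"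
      "V \<subseteq> U" "V' \<subseteq> U'"
    using Z' ZV W V V' by auto
  interpret R: plain_cring "Sect X Z'" by (rule plain_Sect[OF Z'(1)])
  let ?u = "kae.pu V Z' v" and ?u' = "kae.pu V' Z' v'"
  have u: "?u \<in> carrier (kae.M Z')" "?u' \<in> carrier (kae.M Z')"
    using kae.pu_closed[OF V(1) Z'(1) sub(1) V(3)] kae.pu_closed[OF V'(1) Z'(1) sub(2) V'(3)] .
  have pp: "kae.pu Z Z' (kae.pu V Z v) = ?u" "kae.pu Z Z' (kae.pu V' Z v') = ?u'"
    using kae.pu_pu[OF V(1) Z(1) Z'(1) ZV(1) Z'(3) V(3)] kae.pu_pu[OF V'(1) Z(1) Z'(1) ZV(2) Z'(3)
        V'(3)] .
  have n: "?u \<ominus>\<^bsub>kae.M Z'\<^esub> ?u' \<in> kae.N Z'"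
    using kae.pu_N[OF Z(1) Z'(1,3) Z(4)] kae.pu_minus[OF Z(1) Z'(1,3) vZ] pp by simp
  let ?b = "Rest X W Z' b" and ?b' = "Rest X W' Z' b'"
  have bc: "?b \<in> carrier (Sect X Z')" "?b' \<in> carrier (Sect X Z')"
    using res_closed[OF W(1) Z'(1) sub(4) b(1)] res_closed[OF W(2) Z'(1) sub(5) b(2)] .
  note Lc = Ld_closed[OF D(1) Z'(1) sub(6) u(1)] Ld_closed[OF D(2) Z'(1) sub(7) u(2)] Ld_closed[OF
      D(2) Z'(1) sub(7) u(1)]
    Ld_closed[OF K Z'(1) sub(3) u(1)]
  have "Rest X Z Z' (Ld ?K Z (kae.pu V Z v)) = Ld ?K Z' ?u"
  proof -
    interpret f: functional X "\<lambda>U. carrier (Sect X U)" "\<lambda>U. kaehler_gens (Sect X U) (cst_on X U)"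
        "Rest X" ?Y ?K
      by (rule kae_functional[OF K Y(1)])
    show ?thesis using f.L_pu[OF Z(1) Z'(1) ZV(3) Z'(3) vZ(1)] pp by simp
  qed
  then have ctZ: "Rest X ?Y Z' (ct ?Y ?K) = Ld ?K Z' ?u" using Z'(4) by simp
  have "Rest X ?Y Z' (ct ?Y ?K \<oplus>\<^bsub>Sect X ?Y\<^esub> Rest X W' ?Y b') = Rest X ?Y Z' (Rest X W ?Y b)"
    using eq by simp
  \<comment> \<open>The coboundary condition on the small set: \<open>b\<close> exceeds
    \<open>b'\<close> by the contraction of \<open>D U - D U'\<close> with the form, evaluated on
    the representative that comes from \<open>v\<close>.\<close>
  then have beq: "Ld ?K Z' ?u \<oplus>\<^bsub>Sect X Z'\<^esub> ?b' = ?b"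
    using res_add[OF Y(1) Z'(1) sub(3) ct_closed[OF Y(1) K] res_closed[OF W(2) Y(1,4) b(2)]] ctZ
      res_res[OF W(2) Y(1) Z'(1) Y(4) sub(3) b(2)] res_res[OF W(1) Y(1) Z'(1) Y(3) sub(3) b(1)]
          by simp
  have "Ld ?K Z' ?u = Ld (KS_cocycle D U U') Z' ?u"
    by (rule semilin_cong[OF cring_Sect[OF Z'(1)] u(1)])
       (use Z' sub derivs_props(1)[OF K Z'(1) sub(3)] in \<open>auto simp: on_opens_apply\<close>)
  then have Leq: "Ld (D U) Z' ?u = Ld ?K Z' ?u \<oplus>\<^bsub>Sect X Z'\<^esub> Ld (D U') Z' ?u"
    using Ld_KS[of D, OF D Z'(1) sub(6,7) u(1)] by simp
  let ?s = "split_ks (D U) V (Rest X W V b) v" and ?s' = "split_ks (D U') V' (Rest X W' V' b') v'"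
  have bV: "Rest X W V b \<in> carrier (Sect X V)" "Rest X W' V' b' \<in> carrier (Sect X V')"
    using res_closed[OF W(1) V(1,2) b(1)] res_closed[OF W(2) V'(1,2) b(2)] .
  have sc: "?s \<in> carrier (ks.M V)" "?s' \<in> carrier (ks.M V')"
    using split_ks_closed[OF D(1) V(1) sub(10) V(3) bV(1)] split_ks_closed[OF D(2) V'(1) sub(11)
        V'(3) bV(2)] .
  have ps: "ks.pu V Z' ?s = split_ks (D U) Z' ?b ?u" "ks.pu V' Z' ?s' = split_ks (D U') Z' ?b' ?u'"
    using pu_split_ks[OF D(1) V(1) sub(10) Z'(1) sub(1) V(3) bV(1)] pu_split_ks[OF D(2) V'(1)
        sub(11) Z'(1) sub(2) V'(3) bV(2)]
      res_res[OF W(1) V(1) Z'(1) V(2) sub(1) b(1)] res_res[OF W(2) V'(1) Z'(1) V'(2) sub(2) b(2)]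
          by simp_all
  have psc: "split_ks (D U) Z' ?b ?u \<in> carrier (ks.M Z')"
      "split_ks (D U') Z' ?b' ?u' \<in> carrier (ks.M Z')"
    using split_ks_closed[OF D(1) Z'(1) sub(6) u(1) bc(1)] split_ks_closed[OF D(2) Z'(1) sub(7) u(2)
        bc(2)] .
  \<comment> \<open>At the indices \<open>Some a\<close> both sides are \<open>?u - ?u'\<close>. At
    \<open>None\<close>, replacing \<open>D U\<close> by \<open>D U'\<close> on \<open>?u\<close>
    changes the coefficient by the contraction that \<open>b - b'\<close> supplies, so what remains
    is minus the functional of \<open>D U'\<close> on \<open>?u - ?u'\<close>.\<close>
  have "split_ks (D U) Z' ?b ?u \<ominus>\<^bsub>ks.M Z'\<^esub> split_ks (D U') Z' ?b' ?u' =
      split_ks (D U') Z' \<zero>\<^bsub>Sect X Z'\<^esub> (?u \<ominus>\<^bsub>kae.M Z'\<^esub> ?u')"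
  proof (rule option_fun_eqI)
    have "Ld (D U') Z' (?u \<ominus>\<^bsub>kae.M Z'\<^esub> ?u') = Ld (D U') Z' ?u \<ominus>\<^bsub>Sect X Z'\<^esub> Ld (D U') Z' ?u'"
      by (rule semilinear.semilin_minus[OF D_semilinear[OF D(2) Z'(1) sub(7)] u])
    moreover have "(?b \<ominus>\<^bsub>Sect X Z'\<^esub> Ld (D U) Z' ?u) \<ominus>\<^bsub>Sect X Z'\<^esub> (?b' \<ominus>\<^bsub>Sect X Z'\<^esub> Ld (D U') Z' ?u') =
       \<zero>\<^bsub>Sect X Z'\<^esub> \<ominus>\<^bsub>Sect X Z'\<^esub> (Ld (D U') Z' ?u \<ominus>\<^bsub>Sect X Z'\<^esub> Ld (D U') Z' ?u')"
    proof -
      have alg: "((k \<oplus>\<^bsub>Sect X Z'\<^esub> b') \<ominus>\<^bsub>Sect X Z'\<^esub> (k \<oplus>\<^bsub>Sect X Z'\<^esub> l)) \<ominus>\<^bsub>Sect X Z'\<^esub> (b' \<ominus>\<^bsub>Sect X Z'\<^esub> l') =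
         \<zero>\<^bsub>Sect X Z'\<^esub> \<ominus>\<^bsub>Sect X Z'\<^esub> (l \<ominus>\<^bsub>Sect X Z'\<^esub> l')"
        if c: "k \<in> carrier (Sect X Z')" "b' \<in> carrier (Sect X Z')" "l \<in> carrier (Sect X Z')"
            "l' \<in> carrier (Sect X Z')" for k b' l l'
      proof -
        have "(k \<oplus>\<^bsub>Sect X Z'\<^esub> b') \<ominus>\<^bsub>Sect X Z'\<^esub> (k \<oplus>\<^bsub>Sect X Z'\<^esub> l) = b' \<ominus>\<^bsub>Sect X Z'\<^esub> l"
          using c by (simp add: R.minus_eq_iff_add R.a_ac)
        then show ?thesis using c by (simp add: R.minus_eq_iff_add[of "b' \<ominus>\<^bsub>Sect X Z'\<^esub> l"] a_minus_def
            R.minus_add R.a_ac R.r_neg1 R.r_neg2)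
      qed
      show ?thesis unfolding beq[symmetric] Leq by (rule alg[OF Lc(4) bc(2) Lc(3,2)])
    qed
    ultimately show "(split_ks (D U) Z' ?b ?u \<ominus>\<^bsub>ks.M Z'\<^esub> split_ks (D U') Z' ?b' ?u') None =
      split_ks (D U') Z' \<zero>\<^bsub>Sect X Z'\<^esub> (?u \<ominus>\<^bsub>kae.M Z'\<^esub> ?u') None"
      by (subst R.free_mod_minus[OF psc]) simp
  qed (simp add: R.free_mod_minus[OF psc] R.free_mod_minus[OF u])
  then have "split_ks (D U) Z' ?b ?u \<ominus>\<^bsub>ks.M Z'\<^esub> split_ks (D U') Z' ?b' ?u' \<in> ks.N \<delta> Z'"
    using split_ks_N[OF D(2) Z'(1) sub(7) n] by simp
  then have "ks.cl \<delta> Z' (ks.pu V Z' ?s) = ks.cl \<delta> Z' (ks.pu V' Z' ?s')"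
    unfolding ps using ks.cl_eq_iff[OF Z'(1) psc(2,1)] by simp
  then have "ks.rs \<delta> V Z' (ks.cl \<delta> V ?s) = ks.rs \<delta> V' Z' (ks.cl \<delta> V' ?s')"
    using ks.rs_cl[OF V(1) Z'(1) sub(1) sc(1)] ks.rs_cl[OF V'(1) Z'(1) sub(2) sc(2)] by simp
  then show ?thesis
    by (intro ks.germ_eqI[OF V(1) ks.cl_in_Q[OF V(1) sc(1)] V'(1) ks.cl_in_Q[OF V'(1) sc(2)]
        Z'(1,2)]) (use sub in auto)
qed

lemma coboundary_imp_lift:
  assumes D: "\<And>V. V \<in> \<V> \<Longrightarrow> opn V \<and> D V \<in> derivs X \<delta> V"
    and \<W>: "open_cover (topo X) \<W>" and r: "\<And>W. W \<in> \<W> \<Longrightarrow> r W \<in> \<V> \<and> W \<subseteq> r W \<and> b W \<in> carrier (Sect X W)"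
    and eq: "\<And>W W'. W \<in> \<W> \<Longrightarrow> W' \<in> \<W> \<Longrightarrow>
       Rest X (r W \<inter> r W') (W \<inter> W') (ct (r W \<inter> r W') (KS_cocycle D (r W) (r W'))) \<oplus>\<^bsub>Sect X (W \<inter> W')\<^esub>
           Rest X W' (W \<inter> W') (b W') =
           Rest X W (W \<inter> W') (b W)"
  shows "\<exists>\<eta>\<in>Omega_tau X \<delta> (pts X). lambda X (pts X) \<eta> = \<omega>"
proof -
  have \<omega>': "\<omega> \<in> kae.Shf (pts X)" using \<omega> kaehler_eqs(3) by simp
  have oW: "opn W" if "W \<in> \<W>" for W using that \<W> by (auto simp: open_cover_def)
  have "\<exists>W V v. W \<in> \<W> \<and> opn V \<and> p \<in> V \<and> V \<subseteq> W \<and> v \<in> carrier (kae.M V) \<and>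
      (\<forall>q\<in>V. (V, kae.cl V v) \<in> \<omega> q)"
    if p: "p \<in> pts X" for p
  proof -
    obtain W where W: "W \<in> \<W>" "p \<in> W" using p \<W> unfolding open_cover_def by blast
    obtain V v where V: "opn V" "p \<in> V" "V \<subseteq> W" "v \<in> carrier (kae.M V)" "v \<in> kae.cl V v"
      "\<And>q. q \<in> V \<Longrightarrow> (V, kae.cl V v) \<in> restrict \<omega> W q"
      by (rule Omega_E[OF \<omega>_res[OF oW[OF W(1)]] W(2)]) (rule that)
    have "(V, kae.cl V v) \<in> \<omega> q" if "q \<in> V" for q
    proof -
      have "q \<in> W" using V(3) that by blast
      then show ?thesis using V(6)[OF that] by simp
    qed
    then show ?thesis using W(1) V(1-4) by blast
  qed
  then obtain W V v where W: "\<And>p. p \<in> pts X \<Longrightarrow> W p \<in> \<W> \<and> opn (V p) \<and> p \<in> V p \<and> V p \<subseteq> W p \<and>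
      v p \<in> carrier (kae.M (V p))"
    and mem: "\<And>p q. p \<in> pts X \<Longrightarrow> q \<in> V p \<Longrightarrow> (V p, kae.cl (V p) (v p)) \<in> \<omega> q" by metis
  \<comment> \<open>The derivation belongs to the member \<open>r (W p)\<close> of the original
    cover, the correction to the refining set \<open>W p\<close>: the coboundary is known on the
    refinement, the derivations on the cover.\<close>
  define s where "s p = split_ks (D (r (W p))) (V p) (Rest X (W p) (V p) (b (W p))) (v p)" for p
  have props: "D (r (W p)) \<in> derivs X \<delta> (r (W p))" "opn (W p)" "W p \<subseteq> r (W p)"
      "b (W p) \<in> carrier (Sect X (W p))"
     "opn (V p)" "V p \<subseteq> W p" "v p \<in> carrier (kae.M (V p))" "p \<in> V p" "W p \<in> \<W>" "opn (r (W p))"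
         if p: "p \<in> pts X" for p
    using W[OF p] r[of "W p"] D oW by auto
  have sc: "s p \<in> carrier (ks.M (V p))" if p: "p \<in> pts X" for p
    unfolding s_def
    by (rule split_ks_closed[OF props(1)[OF p] props(5)[OF p] subset_trans[OF props(6)[OF p]
        props(3)[OF p]] props(7)[OF p]
        res_closed[OF props(2)[OF p] props(5)[OF p] props(6)[OF p] props(4)[OF p]]])
  have agree: "ks.gm \<delta> q (V p, ks.cl \<delta> (V p) (s p)) = ks.gm \<delta> q (V p', ks.cl \<delta> (V p') (s p'))"
    if p: "p \<in> pts X" "p' \<in> pts X" and q: "q \<in> V p" "q \<in> V p'" for p p' q
  proof -
    let ?Y = "W p \<inter> W p'"
    have Y: "opn ?Y" "?Y \<subseteq> r (W p) \<inter> r (W p')" using props[OF p(1)] props[OF p(2)] by auto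
    have "Rest X (r (W p) \<inter> r (W p')) ?Y (ct (r (W p) \<inter> r (W p')) (KS_cocycle D (r (W p)) (r (W
        p')))) =
      ct ?Y (on_opens X ?Y (KS_cocycle D (r (W p)) (r (W p'))))"
      using props(10)[OF p(1)] props(10)[OF p(2)]
      by (intro ct_res Y KS_cocycle_closed[of D, OF props(1)[OF p(1)] props(1)[OF p(2)]]) auto
    then have e: "ct ?Y (on_opens X ?Y (KS_cocycle D (r (W p)) (r (W p')))) \<oplus>\<^bsub>Sect X ?Y\<^esub> Rest X (W p')
        ?Y (b (W p')) = Rest X (W p) ?Y (b (W p))"
      using eq[OF props(9)[OF p(1)] props(9)[OF p(2)]] by simp
    show ?thesis unfolding s_def
      by (rule local_lifts_agree[OF props(1)[OF p(1)] props(1)[OF p(2)] props(2)[OF p(1)]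
          props(2)[OF p(2)] props(3)[OF p(1)] props(3)[OF p(2)]
          props(4)[OF p(1)] props(4)[OF p(2)] e props(5)[OF p(1)] props(6)[OF p(1)] props(7)[OF
              p(1)] mem[OF p(1) q(1)] q(1)
          props(5)[OF p(2)] props(6)[OF p(2)] props(7)[OF p(2)] mem[OF p(2) q(2)] q(2)])
  qed
  define \<eta> where "\<eta> = (\<lambda>p\<in>pts X. ks.gm \<delta> p (V p, ks.cl \<delta> (V p) (s p)))"
  \<comment> \<open>The value at \<open>q\<close> was defined from the data chosen at
    \<open>q\<close>. By \<open>agree\<close> it can be read off from the data chosen at any
    \<open>p\<close> with \<open>q \<in> V p\<close>, so one representative serves on all of
    \<open>V p\<close>, as sheafification demands.\<close>
  have \<eta>q: "\<eta> q = ks.gm \<delta> q (V p, ks.cl \<delta> (V p) (s p))" if p: "p \<in> pts X" and q: "q \<in> V p" for p q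
  proof -
    have q': "q \<in> pts X" using opn_sub[OF props(5)[OF p]] q by blast
    show ?thesis unfolding \<eta>_def using q' agree[OF q' p props(8)[OF q'] q] by simp
  qed
  have \<eta>: "\<eta> \<in> Omega_tau X \<delta> (pts X)"
    unfolding ks_eqs sheafify_def mem_Collect_eq
  proof (intro conjI ballI)
    show "\<eta> \<in> extensional (pts X)" by (simp add: \<eta>_def)
    fix p assume p: "p \<in> pts X"
    show "\<exists>Va. opn Va \<and> p \<in> Va \<and> Va \<subseteq> pts X \<and> (\<exists>s\<in>ks.Q \<delta> Va. \<forall>q\<in>Va. \<eta> q = ks.gm \<delta> q (Va, s))"
      using props[OF p] \<eta>q[OF p] opn_sub[OF props(5)[OF p]] ks.cl_in_Q[OF props(5)[OF p] sc[OF p]]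
      by (intro exI[of _ "V p"] conjI bexI[of _ "ks.cl \<delta> (V p) (s p)"]) auto
  qed
  have "lambda X (pts X) \<eta> p = \<omega> p" for p
  proof (cases "p \<in> pts X")
    case True
    note pr = props[OF True]
    have "(V p, ks.cl \<delta> (V p) (s p)) \<in> \<eta> p"
      unfolding \<eta>q[OF True pr(8)] by (rule ks.germ_self[OF pr(5,8) ks.cl_in_Q[OF pr(5) sc[OF
          True]]])
    then have "lambda X (pts X) \<eta> p = kae.gm p (V p, lambda_pre X (V p) (ks.cl \<delta> (V p) (s p)))"
      by (rule lambda_germ[OF \<eta> True])
    also have "lambda_pre X (V p) (ks.cl \<delta> (V p) (s p)) = kae.cl (V p) (v p)"
      unfolding lambda_pre_cl[OF pr(5) sc[OF True]] by (simp add: s_def)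
    also have "kae.gm p (V p, kae.cl (V p) (v p)) = \<omega> p"
      by (rule kae.Shf_mem(4)[OF \<omega>' True mem[OF True pr(8)], symmetric])
    finally show ?thesis .
  next
    case False
    moreover have "\<omega> \<in> extensional (pts X)" using \<omega>' by (simp add: sheafify_def)
    ultimately show ?thesis by (simp add: lambda_def extensional_def)
  qed
  then show ?thesis using \<eta> by blast
qed

text \<open>A cover with extensions of \<open>\<delta>\<close> makes the cup product the explicit
  class of \<open>ct (U \<inter> V) (KS_cocycle D U V)\<close>. Its vanishing means triviality on
  some refinement, and the existence of a lift is compared with that.\<close>

theorem lifts_iff_cup_zero:
  assumes \<V>: "open_cover (topo X) \<V>" and D: "\<And>V. V \<in> \<V> \<Longrightarrow> affine_open X V \<and> D V \<in> derivs X \<delta> V"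
  shows "(\<exists>\<eta>\<in>Omega_tau X \<delta> (pts X). lambda X (pts X) \<eta> = \<omega>) \<longleftrightarrow>
    cup X (KS_class X \<delta>) \<omega> = \<zero>\<^bsub>H1 (topo X) (Str X)\<^esub>"
proof -
  have D': "V \<in> \<V> \<Longrightarrow> D V \<in> derivs X \<delta> V" for V using D by blast
  have oV: "opn V" if "V \<in> \<V>" for V using that \<V> by (auto simp: open_cover_def)
  note z = KS_cocycle_in_cocycles[OF \<V> D']
  have "cup X (KS_class X \<delta>) \<omega> = cech_class (topo X) (Str X) (\<V>, \<lambda>U V. ct (U \<inter> V) (KS_cocycle D U
      V))"
    using cup_cech_class[OF z] KS_class_eq[OF \<V> D] by simp
  then have cup: "cup X (KS_class X \<delta>) \<omega> = \<zero>\<^bsub>H1 (topo X) (Str X)\<^esub> \<longleftrightarrow>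
    (\<exists>\<W> r b. open_cover (topo X) \<W> \<and> (\<forall>W\<in>\<W>. r W \<in> \<V> \<and> W \<subseteq> r W \<and> b W \<in> carrier (Sect X W)) \<and>
        (\<forall>W\<in>\<W>. \<forall>W'\<in>\<W>.
           Rest X (r W \<inter> r W') (W \<inter> W') (ct (r W \<inter> r W') (KS_cocycle D (r W) (r W'))) \<oplus>\<^bsub>Sect X (W \<inter>
               W')\<^esub> Rest X W' (W \<inter> W') (b W') =
           Rest X W (W \<inter> W') (b W)))" (is "_ \<longleftrightarrow> ?E")
    using str.cech_class_eq_zero_iff[OF ct_cocycle[OF z]] by simp
  have fwd: "?E" if "\<exists>\<eta>\<in>Omega_tau X \<delta> (pts X). lambda X (pts X) \<eta> = \<omega>"
  proof -
    obtain \<eta> where \<eta>: "\<eta> \<in> Omega_tau X \<delta> (pts X)" "lambda X (pts X) \<eta> = \<omega>" using \<open>\<exists>\<eta>\<in>_. _\<close> by blast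
    obtain \<beta> where \<beta>: "\<And>V. V \<in> \<V> \<Longrightarrow> \<beta> V \<in> carrier (Sect X V)"
      "\<And>U V. U \<in> \<V> \<Longrightarrow> V \<in> \<V> \<Longrightarrow> ct (U \<inter> V) (KS_cocycle D U V) \<oplus>\<^bsub>Sect X (U \<inter> V)\<^esub> Rest X V (U \<inter> V) (\<beta> V) =
          Rest X U (U \<inter> V) (\<beta> U)"
      by (rule lift_imp_coboundary[OF \<V> D' \<eta>]) (assumption, rule that)
    show ?thesis
    \<comment> \<open>A lift trivializes the cocycle on the given cover already, so the refinement
      map is the identity.\<close>
    proof (intro exI[of _ \<V>] exI[of _ "\<lambda>V. V"] exI[of _ \<beta>] conjI ballI \<V>)
      fix U V assume UV: "U \<in> \<V>" "V \<in> \<V>"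
      have o: "opn (U \<inter> V)" using oV UV by blast
      have "Rest X (U \<inter> V) (U \<inter> V) (ct (U \<inter> V) (KS_cocycle D U V)) = ct (U \<inter> V) (KS_cocycle D U V)"
        by (rule res_id[OF o ct_closed[OF o KS_cocycle_closed[of D, OF D'[OF UV(1)] D'[OF UV(2)]]]])
      then show "Rest X (U \<inter> V) (U \<inter> V) (ct (U \<inter> V) (KS_cocycle D U V)) \<oplus>\<^bsub>Sect X (U \<inter> V)\<^esub> Rest X V (U
          \<inter> V) (\<beta> V) =
           Rest X U (U \<inter> V) (\<beta> U)" using \<beta>(2)[OF UV] by simp
    qed (use \<beta> in auto)
  qed
  have bwd: "\<exists>\<eta>\<in>Omega_tau X \<delta> (pts X). lambda X (pts X) \<eta> = \<omega>" if ?E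
  proof -
    obtain \<W> r b where W: "open_cover (topo X) \<W>" "\<forall>W\<in>\<W>. r W \<in> \<V> \<and> W \<subseteq> r W \<and>
        b W \<in> carrier (Sect X W)"
      "\<forall>W\<in>\<W>. \<forall>W'\<in>\<W>.
           Rest X (r W \<inter> r W') (W \<inter> W') (ct (r W \<inter> r W') (KS_cocycle D (r W) (r W'))) \<oplus>\<^bsub>Sect X (W \<inter>
               W')\<^esub> Rest X W' (W \<inter> W') (b W') =
           Rest X W (W \<inter> W') (b W)"
      using \<open>?E\<close> by (elim exE conjE) (rule that)
    show ?thesis
      by (rule coboundary_imp_lift[where \<V>=\<V> and D=D and \<W>=\<W> and r=r and b=b]) (use W D' oV in auto)
  qed
  show ?thesis unfolding cup by (rule iffI[OF fwd bwd])
qed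

end

section \<open>Extending derivations from a ring to its spectrum\<close>

context cring
begin

text \<open>These rules bring a polynomial expression into the form \<open>p \<ominus> q\<close> with \<open>p\<close>
    and \<open>q\<close> free of subtraction.
  An identity between such expressions then follows by distributivity, associativity
      and commutativity.\<close>

lemma difference_simps:
  "\<lbrakk>p \<in> carrier R; q \<in> carrier R; r \<in> carrier R\<rbrakk> \<Longrightarrow> r \<otimes> (p \<ominus> q) = r \<otimes> p \<ominus> r \<otimes> q"
  "\<lbrakk>p \<in> carrier R; q \<in> carrier R; r \<in> carrier R\<rbrakk> \<Longrightarrow> (p \<ominus> q) \<otimes> r = p \<otimes> r \<ominus> q \<otimes> r"
  "\<lbrakk>p \<in> carrier R; q \<in> carrier R; r \<in> carrier R; s \<in> carrier R\<rbrakk> \<Longrightarrow> (p \<ominus> q) \<oplus> (r \<ominus> s) =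
      (p \<oplus> r) \<ominus> (q \<oplus> s)"
  "\<lbrakk>p \<in> carrier R; q \<in> carrier R; r \<in> carrier R; s \<in> carrier R\<rbrakk> \<Longrightarrow> (p \<ominus> q) \<ominus> (r \<ominus> s) =
      (p \<oplus> s) \<ominus> (q \<oplus> r)"
  "\<lbrakk>p \<in> carrier R; q \<in> carrier R\<rbrakk> \<Longrightarrow> \<ominus> (p \<ominus> q) = q \<ominus> p"
  by (simp_all add: a_minus_def l_distr r_distr l_minus r_minus minus_add a_ac)

text \<open>Fractions are equal when a multiplier outside the prime kills the cross difference. If
  \<open>u\<close> kills \<open>x\<close> and \<open>w\<close> kills \<open>y\<close>, the product
  kills every combination of \<open>x\<close> and \<open>y\<close>; the proofs below write a cross
  difference as such a combination.\<close>

lemma kill_two: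
  assumes [simp]: "u \<in> carrier R" "w \<in> carrier R" "p \<in> carrier R" "q \<in> carrier R" "x \<in> carrier R"
      "y \<in> carrier R"
    and "u \<otimes> x = \<zero>" "w \<otimes> y = \<zero>"
  shows "(u \<otimes> w) \<otimes> (p \<otimes> x \<oplus> q \<otimes> y) = \<zero>"
proof -
  have "(u \<otimes> w) \<otimes> (p \<otimes> x \<oplus> q \<otimes> y) = (w \<otimes> p) \<otimes> (u \<otimes> x) \<oplus> (u \<otimes> q) \<otimes> (w \<otimes> y)"
    by (simp add: r_distr m_ac)
  then show ?thesis using assms(7,8) by simp
qed

context
  fixes a b s t a' b' s' t'
  assumes [simp]: "a \<in> carrier R" "b \<in> carrier R" "s \<in> carrier R" "t \<in> carrier R"
    "a' \<in> carrier R" "b' \<in> carrier R" "s' \<in> carrier R" "t' \<in> carrier R"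
begin

text \<open>Primes stand for derivatives, though the identity is purely formal. With
  \<open>x = a \<otimes> t \<ominus> b \<otimes> s\<close>, the cross difference of the two quotient
  rule expressions is a combination of \<open>x\<close> and the formal derivative of
  \<open>x\<close>.\<close>

lemma quotient_rule_cross:
  "(a' \<otimes> s \<ominus> a \<otimes> s') \<otimes> (t \<otimes> t) \<ominus> (b' \<otimes> t \<ominus> b \<otimes> t') \<otimes> (s \<otimes> s) =
    (\<ominus> (s' \<otimes> t \<oplus> t' \<otimes> s)) \<otimes> (a \<otimes> t \<ominus> b \<otimes> s) \<oplus> (s \<otimes> t) \<otimes> (a' \<otimes> t \<oplus> a \<otimes> t' \<ominus> (b' \<otimes> s \<oplus> b \<otimes> s'))"
  by (simp add: l_minus, simp add: difference_simps, simp add: minus_eq_iff_add l_distr r_distr,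
      simp add: m_ac a_ac)

text \<open>The numerator on the left differentiates the sum of two fractions, the one on the right
  adds their derivatives. Each is multiplied by the denominator of the other, nested as
  \<open>Spec_add_at\<close> and \<open>Spec_deriv_at\<close> produce it, which is the form that
  \<open>frac_eqI'\<close> consumes. The next identity does the same for products.\<close>

lemma quotient_rule_add:
  "((a' \<otimes> t \<oplus> a \<otimes> t' \<oplus> (b' \<otimes> s \<oplus> b \<otimes> s')) \<otimes> (s \<otimes> t) \<ominus> (a \<otimes> t \<oplus> b \<otimes> s) \<otimes> (s' \<otimes> t \<oplus> s \<otimes> t')) \<otimes> ((s \<otimes>
      s) \<otimes> (t \<otimes> t)) =
    ((a' \<otimes> s \<ominus> a \<otimes> s') \<otimes> (t \<otimes> t) \<oplus> (b' \<otimes> t \<ominus> b \<otimes> t') \<otimes> (s \<otimes> s)) \<otimes> ((s \<otimes> t) \<otimes> (s \<otimes> t))"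
  by (simp add: difference_simps, simp add: minus_eq_iff_add l_distr r_distr, simp add: m_ac a_ac)

lemma quotient_rule_mult:
  "((a' \<otimes> b \<oplus> a \<otimes> b') \<otimes> (s \<otimes> t) \<ominus> (a \<otimes> b) \<otimes> (s' \<otimes> t \<oplus> s \<otimes> t')) \<otimes> (((s \<otimes> s) \<otimes> t) \<otimes> (s \<otimes> (t \<otimes> t))) =
    (((a' \<otimes> s \<ominus> a \<otimes> s') \<otimes> b) \<otimes> (s \<otimes> (t \<otimes> t)) \<oplus> (a \<otimes> (b' \<otimes> t \<ominus> b \<otimes> t')) \<otimes> ((s \<otimes> s) \<otimes> t)) \<otimes> ((s \<otimes> t) \<otimes>
        (s \<otimes> t))"
  by (simp add: difference_simps, simp add: minus_eq_iff_add l_distr r_distr, simp add: m_ac a_ac)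

end

end

section \<open>Fractions at a prime ideal\<close>

locale prime_of = plain_cring R + primeideal P R for R :: "'a ring" (structure) and P
begin

lemma compl_D: "s \<in> carrier R - P \<Longrightarrow> s \<in> carrier R" by blast

lemma one_compl: "\<one> \<in> carrier R - P"
  using one_imp_carrier I_notcarr by blast

lemma mult_compl: "s \<in> carrier R - P \<Longrightarrow> t \<in> carrier R - P \<Longrightarrow> s \<otimes> t \<in> carrier R - P"
  using I_prime[of s t] by auto

lemma frac_subI:
  assumes a: "a \<in> carrier R" "b \<in> carrier R" "s \<in> carrier R - P" "t \<in> carrier R - P"
      "u \<in> carrier R - P"
    and eq: "u \<otimes> (a \<otimes> t \<ominus> b \<otimes> s) = \<zero>"
  shows "frac R P a s \<subseteq> frac R P b t"
proof
  fix x assume "x \<in> frac R P a s"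
  then obtain c r w where x: "x = (c, r)" and [simp]: "c \<in> carrier R" and r: "r \<in> carrier R - P"
      and w: "w \<in> carrier R - P"
    and w0: "w \<otimes> (a \<otimes> r \<ominus> c \<otimes> s) = \<zero>" by (auto simp: frac_def)
  note [simp] = a(1,2) compl_D[OF a(3)] compl_D[OF a(4)] compl_D[OF a(5)] compl_D[OF r] compl_D[OF
      w]
  \<comment> \<open>Transitivity of the equality of fractions: after multiplication by
    \<open>s\<close>, the wanted cross difference is a combination of the two given ones. The factor
    \<open>s\<close> lies outside \<open>P\<close>, so it may join the multiplier
    \<open>u \<otimes> w\<close>.\<close>
  have *: "s \<otimes> (b \<otimes> r \<ominus> c \<otimes> t) = (\<ominus> r) \<otimes> (a \<otimes> t \<ominus> b \<otimes> s) \<oplus> t \<otimes> (a \<otimes> r \<ominus> c \<otimes> s)"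
    by (simp add: l_minus, simp add: difference_simps, simp add: minus_eq_iff_add l_distr r_distr,
        simp add: m_ac a_ac)
  have "(u \<otimes> w \<otimes> s) \<otimes> (b \<otimes> r \<ominus> c \<otimes> t) = (u \<otimes> w) \<otimes> (s \<otimes> (b \<otimes> r \<ominus> c \<otimes> t))"
    by (simp add: m_assoc)
  also have "\<dots> = \<zero>" unfolding * by (rule kill_two[OF _ _ _ _ _ _ eq w0]) simp_all
  finally have "(u \<otimes> w \<otimes> s) \<otimes> (b \<otimes> r \<ominus> c \<otimes> t) = \<zero>" .
  moreover have "u \<otimes> w \<otimes> s \<in> carrier R - P" by (intro mult_compl a w)
  ultimately show "x \<in> frac R P b t" unfolding x frac_def using r by auto
qed

lemma frac_eqI:
  assumes a: "a \<in> carrier R" "b \<in> carrier R" "s \<in> carrier R - P" "t \<in> carrier R - P"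
      "u \<in> carrier R - P"
    and eq: "u \<otimes> (a \<otimes> t \<ominus> b \<otimes> s) = \<zero>"
  shows "frac R P a s = frac R P b t"
proof
  show "frac R P a s \<subseteq> frac R P b t" by (rule frac_subI) fact+
  note [simp] = a(1,2) compl_D[OF a(3)] compl_D[OF a(4)] compl_D[OF a(5)]
  have "u \<otimes> (b \<otimes> s \<ominus> a \<otimes> t) = \<ominus> (u \<otimes> (a \<otimes> t \<ominus> b \<otimes> s))"
    by (simp add: difference_simps)
  then have "u \<otimes> (b \<otimes> s \<ominus> a \<otimes> t) = \<zero>" using eq by simp
  then show "frac R P b t \<subseteq> frac R P a s" using a by (intro frac_subI[of b a t s u])
qed

lemma frac_eqI':
  assumes "a \<in> carrier R" "b \<in> carrier R" "s \<in> carrier R - P" "t \<in> carrier R - P" "a \<otimes> t = b \<otimes> s"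
  shows "frac R P a s = frac R P b t"
  using assms by (intro frac_eqI[OF assms(1-4) one_compl]) (simp add: a_minus_def r_neg compl_D)

lemma frac_self: "a \<in> carrier R \<Longrightarrow> s \<in> carrier R - P \<Longrightarrow> (a, s) \<in> frac R P a s"
  unfolding frac_def using one_compl by (auto simp: a_minus_def r_neg intro!: bexI[of _ \<one>])

lemma frac_memD:
  assumes "(b, t) \<in> frac R P a s"
  obtains u where "b \<in> carrier R" "t \<in> carrier R - P" "u \<in> carrier R - P" "u \<otimes> (a \<otimes> t \<ominus> b \<otimes> s) = \<zero>"
  using assms by (auto simp: frac_def)

text \<open>Operations on fractions are unions over all representatives. Such a union collapses once
  its value is independent of them; it is not empty by \<open>frac_self\<close>.\<close>

lemma UN_frac:
  assumes "a \<in> carrier R" "s \<in> carrier R - P" "\<And>b t. (b, t) \<in> frac R P a s \<Longrightarrow> G b t = G a s"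
  shows "(\<Union>(b, t)\<in>frac R P a s. G b t) = G a s"
proof -
  have "(\<Union>(b, t)\<in>frac R P a s. G b t) = (\<Union>x\<in>frac R P a s. G a s)"
    by (intro SUP_cong refl) (auto simp: assms(3))
  also have "\<dots> = G a s" using frac_self[OF assms(1,2)] by blast
  finally show ?thesis .
qed

lemma mult_frac:
  assumes a: "a \<in> carrier R" "s \<in> carrier R - P" and b: "b \<in> carrier R" "t \<in> carrier R - P"
  shows "(\<Union>(a, s)\<in>frac R P a s. \<Union>(b, t)\<in>frac R P b t. frac R P (a \<otimes> b) (s \<otimes> t)) =
      frac R P (a \<otimes> b) (s \<otimes> t)"
proof -
  have key: "frac R P (a' \<otimes> b') (s' \<otimes> t') = frac R P (a \<otimes> b) (s \<otimes> t)"
    if m: "(a', s') \<in> frac R P a s" "(b', t') \<in> frac R P b t" for a' s' b' t'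
  proof -
    obtain u where u: "a' \<in> carrier R" "s' \<in> carrier R - P" "u \<in> carrier R - P"
        "u \<otimes> (a \<otimes> s' \<ominus> a' \<otimes> s) = \<zero>"
      by (rule frac_memD[OF m(1)])
    obtain w where w: "b' \<in> carrier R" "t' \<in> carrier R - P" "w \<in> carrier R - P"
        "w \<otimes> (b \<otimes> t' \<ominus> b' \<otimes> t) = \<zero>"
      by (rule frac_memD[OF m(2)])
    note [simp] = a(1) b(1) u(1) w(1) compl_D[OF a(2)] compl_D[OF b(2)] compl_D[OF u(2)] compl_D[OF
        u(3)] compl_D[OF w(2)] compl_D[OF w(3)]
    have *: "(a \<otimes> b) \<otimes> (s' \<otimes> t') \<ominus> (a' \<otimes> b') \<otimes> (s \<otimes> t) =
        (b \<otimes> t') \<otimes> (a \<otimes> s' \<ominus> a' \<otimes> s) \<oplus> (a' \<otimes> s) \<otimes> (b \<otimes> t' \<ominus> b' \<otimes> t)"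
      by (simp add: difference_simps, simp add: minus_eq_iff_add l_distr r_distr, simp add: m_ac
          a_ac)
    have "(u \<otimes> w) \<otimes> ((a \<otimes> b) \<otimes> (s' \<otimes> t') \<ominus> (a' \<otimes> b') \<otimes> (s \<otimes> t)) = \<zero>"
      unfolding * by (rule kill_two[OF _ _ _ _ _ _ u(4) w(4)]) simp_all
    then show ?thesis
      by (intro frac_eqI[symmetric, of _ _ _ _ "u \<otimes> w"] mult_compl) (simp_all add: a b u w del:
          compl_D Diff_iff)
  qed
  have "(\<Union>(b, t)\<in>frac R P b t. frac R P (a' \<otimes> b) (s' \<otimes> t)) = frac R P (a \<otimes> b) (s \<otimes> t)"
    if m: "(a', s') \<in> frac R P a s" for a' s'
    using UN_frac[OF b, of "\<lambda>b t. frac R P (a' \<otimes> b) (s' \<otimes> t)"] key[OF m] frac_self[OF b] by simp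
  then show ?thesis
    using UN_frac[OF a, of "\<lambda>a s. \<Union>(b, t)\<in>frac R P b t. frac R P (a \<otimes> b) (s \<otimes> t)"] frac_self[OF a]
        by simp
qed

lemma add_frac:
  assumes a: "a \<in> carrier R" "s \<in> carrier R - P" and b: "b \<in> carrier R" "t \<in> carrier R - P"
  shows "(\<Union>(a, s)\<in>frac R P a s. \<Union>(b, t)\<in>frac R P b t. frac R P (a \<otimes> t \<oplus> b \<otimes> s) (s \<otimes> t)) =
      frac R P (a \<otimes> t \<oplus> b \<otimes> s) (s \<otimes> t)"
proof -
  have key: "frac R P (a' \<otimes> t' \<oplus> b' \<otimes> s') (s' \<otimes> t') = frac R P (a \<otimes> t \<oplus> b \<otimes> s) (s \<otimes> t)"
    if m: "(a', s') \<in> frac R P a s" "(b', t') \<in> frac R P b t" for a' s' b' t'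
  proof -
    obtain u where u: "a' \<in> carrier R" "s' \<in> carrier R - P" "u \<in> carrier R - P"
        "u \<otimes> (a \<otimes> s' \<ominus> a' \<otimes> s) = \<zero>"
      by (rule frac_memD[OF m(1)])
    obtain w where w: "b' \<in> carrier R" "t' \<in> carrier R - P" "w \<in> carrier R - P"
        "w \<otimes> (b \<otimes> t' \<ominus> b' \<otimes> t) = \<zero>"
      by (rule frac_memD[OF m(2)])
    note [simp] = a(1) b(1) u(1) w(1) compl_D[OF a(2)] compl_D[OF b(2)] compl_D[OF u(2)] compl_D[OF
        u(3)] compl_D[OF w(2)] compl_D[OF w(3)]
    have *: "(a \<otimes> t \<oplus> b \<otimes> s) \<otimes> (s' \<otimes> t') \<ominus> (a' \<otimes> t' \<oplus> b' \<otimes> s') \<otimes> (s \<otimes> t) =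
        (t \<otimes> t') \<otimes> (a \<otimes> s' \<ominus> a' \<otimes> s) \<oplus> (s \<otimes> s') \<otimes> (b \<otimes> t' \<ominus> b' \<otimes> t)"
      by (simp add: difference_simps, simp add: minus_eq_iff_add l_distr r_distr, simp add: m_ac
          a_ac)
    have "(u \<otimes> w) \<otimes> ((a \<otimes> t \<oplus> b \<otimes> s) \<otimes> (s' \<otimes> t') \<ominus> (a' \<otimes> t' \<oplus> b' \<otimes> s') \<otimes> (s \<otimes> t)) = \<zero>"
      unfolding * by (rule kill_two[OF _ _ _ _ _ _ u(4) w(4)]) simp_all
    then show ?thesis
      by (intro frac_eqI[symmetric, of _ _ _ _ "u \<otimes> w"] mult_compl) (simp_all add: a b u w del:
          compl_D Diff_iff)
  qed
  have "(\<Union>(b, t)\<in>frac R P b t. frac R P (a' \<otimes> t \<oplus> b \<otimes> s') (s' \<otimes> t)) =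
      frac R P (a \<otimes> t \<oplus> b \<otimes> s) (s \<otimes> t)"
    if m: "(a', s') \<in> frac R P a s" for a' s'
    using UN_frac[OF b, of "\<lambda>b t. frac R P (a' \<otimes> t \<oplus> b \<otimes> s') (s' \<otimes> t)"] key[OF m] frac_self[OF b]
        by simp
  then show ?thesis
    using UN_frac[OF a, of "\<lambda>a s. \<Union>(b, t)\<in>frac R P b t. frac R P (a \<otimes> t \<oplus> b \<otimes> s) (s \<otimes> t)"]
        frac_self[OF a] by simp
qed

end

section \<open>The derivation induced on the spectrum\<close>

locale ring_derivation = plain_cring R for R :: "'a ring" (structure) +
  fixes D :: "'a \<Rightarrow> 'a"
  assumes D_closed [simp]: "a \<in> carrier R \<Longrightarrow> D a \<in> carrier R"
    and D_add: "a \<in> carrier R \<Longrightarrow> b \<in> carrier R \<Longrightarrow> D (a \<oplus> b) = D a \<oplus> D b"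
    and D_mult: "a \<in> carrier R \<Longrightarrow> b \<in> carrier R \<Longrightarrow> D (a \<otimes> b) = D a \<otimes> b \<oplus> a \<otimes> D b"
begin

lemma D_zero: "D \<zero> = \<zero>"
  using D_add[of \<zero> \<zero>] add.r_cancel_one'[of "D \<zero>" "D \<zero>"] by simp

lemma D_one: "D \<one> = \<zero>"
  using D_mult[of \<one> \<one>] add.r_cancel_one'[of "D \<one>" "D \<one>"] by simp

lemma D_minus:
  assumes "a \<in> carrier R" "b \<in> carrier R" shows "D (a \<ominus> b) = D a \<ominus> D b"
proof -
  have "D (a \<ominus> b) \<oplus> D b = D a"
    using D_add[of "a \<ominus> b" b] assms by (simp add: a_minus_def a_assoc l_neg)
  then have "D a \<ominus> D b = D (a \<ominus> b) \<oplus> D b \<ominus> D b" by simp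
  also have "\<dots> = D (a \<ominus> b)" using assms by (simp add: a_minus_def a_assoc r_neg)
  finally show ?thesis by simp
qed

text \<open>With \<open>x = a \<otimes> t \<ominus> b \<otimes> s\<close>, the cross difference of the two quotient rule expressions is a
  combination of \<open>x\<close> and \<open>D x\<close>, and \<open>u \<otimes> x = \<zero>\<close> implies \<open>u\<^sup>2 \<otimes> D x = \<zero>\<close>.\<close>

lemma D_frac:
  assumes P: "primeideal P R" and a: "a \<in> carrier R" "s \<in> carrier R - P"
  shows "(\<Union>(a, s)\<in>frac R P a s. frac R P (D a \<otimes> s \<ominus> a \<otimes> D s) (s \<otimes> s)) =
      frac R P (D a \<otimes> s \<ominus> a \<otimes> D s) (s \<otimes> s)"
proof -
  interpret primeideal P R by fact
  interpret prime_of R P by unfold_locales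
  have key: "frac R P (D b \<otimes> t \<ominus> b \<otimes> D t) (t \<otimes> t) = frac R P (D a \<otimes> s \<ominus> a \<otimes> D s) (s \<otimes> s)"
    if m: "(b, t) \<in> frac R P a s" for b t
  proof -
    obtain u where u: "b \<in> carrier R" "t \<in> carrier R - P" "u \<in> carrier R - P" "u \<otimes> (a \<otimes> t \<ominus> b \<otimes> s) =
        \<zero>"
      by (rule frac_memD[OF m])
    note [simp] = a(1) u(1) compl_D[OF a(2)] compl_D[OF u(2)] compl_D[OF u(3)]
    define x where "x = a \<otimes> t \<ominus> b \<otimes> s"
    have x [simp]: "x \<in> carrier R" by (simp add: x_def)
    have Dx: "D x = D a \<otimes> t \<oplus> a \<otimes> D t \<ominus> (D b \<otimes> s \<oplus> b \<otimes> D s)"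
      unfolding x_def by (simp add: D_minus D_mult)
    have ux: "u \<otimes> x = \<zero>" using u by (simp add: x_def)
    have "D u \<otimes> x \<oplus> u \<otimes> D x = \<zero>" using D_mult[of u x] ux D_zero by simp
    then have "u \<otimes> D x = \<ominus> (D u \<otimes> x)"
      by (intro minus_equality[symmetric]) (simp_all add: a_comm)
    then have "(u \<otimes> u) \<otimes> D x = \<ominus> (D u \<otimes> (u \<otimes> x))"
      by (simp add: m_assoc r_minus m_lcomm)
    then have uDx: "(u \<otimes> u) \<otimes> D x = \<zero>" using ux by simp
    have *: "(D a \<otimes> s \<ominus> a \<otimes> D s) \<otimes> (t \<otimes> t) \<ominus> (D b \<otimes> t \<ominus> b \<otimes> D t) \<otimes> (s \<otimes> s) =
        (\<ominus> (D s \<otimes> t \<oplus> D t \<otimes> s)) \<otimes> x \<oplus> (s \<otimes> t) \<otimes> D x"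
      unfolding Dx unfolding x_def by (rule quotient_rule_cross) simp_all
    have "(u \<otimes> (u \<otimes> u)) \<otimes> ((D a \<otimes> s \<ominus> a \<otimes> D s) \<otimes> (t \<otimes> t) \<ominus> (D b \<otimes> t \<ominus> b \<otimes> D t) \<otimes> (s \<otimes> s)) = \<zero>"
      unfolding * by (rule kill_two[OF _ _ _ _ _ _ ux uDx]) simp_all
    then show ?thesis
      by (intro frac_eqI[symmetric, of _ _ _ _ "u \<otimes> (u \<otimes> u)"] mult_compl) (simp_all add: a u del:
          compl_D Diff_iff)
  qed
  show ?thesis using UN_frac[OF a, of "\<lambda>a s. frac R P (D a \<otimes> s \<ominus> a \<otimes> D s) (s \<otimes> s)"] key by simp
qed

text \<open>The quotient rule at every prime at once; the union over representatives avoids a choice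
  of numerators and denominators.\<close>

definition Spec_deriv :: "'a set set \<Rightarrow> ('a set \<Rightarrow> ('a \<times> 'a) set) \<Rightarrow> 'a set \<Rightarrow> ('a \<times> 'a) set" where
  "Spec_deriv W \<sigma> = (\<lambda>P\<in>W. \<Union>(a, s)\<in>\<sigma> P. frac R P (D a \<otimes> s \<ominus> a \<otimes> D s) (s \<otimes> s))"

lemma Zariski_topspace: "topspace (Zariski R) = Spec_pts R"
proof -
  have "\<exists>f\<in>carrier R. f \<notin> P" if "P \<in> Spec_pts R" for P
  proof -
    interpret primeideal P R using that by (simp add: Spec_pts_def)
    show ?thesis using one_imp_carrier I_notcarr by blast
  qed
  then show ?thesis unfolding Zariski_def topology_generated_by_topspace by blast
qed

lemma open_primes: "openin (Zariski R) W \<Longrightarrow> P \<in> W \<Longrightarrow> primeideal P R"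
  using openin_subset[of "Zariski R" W] unfolding Zariski_topspace by (auto simp: Spec_pts_def)

lemma prime_of: "openin (Zariski R) W \<Longrightarrow> P \<in> W \<Longrightarrow> prime_of R P"
  using open_primes plain_cring_axioms by (simp add: prime_of_def)

lemma Spec_sec_E:
  assumes "\<sigma> \<in> carrier (Spec_sec R W)" "P \<in> W"
  obtains V a s where "openin (Zariski R) V" "P \<in> V" "V \<subseteq> W" "a \<in> carrier R" "s \<in> carrier R"
    "\<And>Q. Q \<in> V \<Longrightarrow> s \<in> carrier R - Q" "\<And>Q. Q \<in> V \<Longrightarrow> \<sigma> Q = frac R Q a s"
proof -
  obtain V a s where "openin (Zariski R) V" "P \<in> V" "V \<subseteq> W" "a \<in> carrier R" "s \<in> carrier R"
      "\<forall>Q\<in>V. s \<notin> Q \<and> \<sigma> Q = frac R Q a s"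
    using assms unfolding Spec_sec_def by auto
  then show ?thesis using that[of V a s] by blast
qed

lemma Spec_secI:
  assumes "\<sigma> \<in> extensional W"
    and "\<And>P. P \<in> W \<Longrightarrow> \<exists>V a s. openin (Zariski R) V \<and> P \<in> V \<and> V \<subseteq> W \<and> a \<in> carrier R \<and> s \<in> carrier R \<and>
        (\<forall>Q\<in>V. s \<notin> Q \<and> \<sigma> Q = frac R Q a s)"
  shows "\<sigma> \<in> carrier (Spec_sec R W)"
proof -
  have "\<exists>V. openin (Zariski R) V \<and> P \<in> V \<and> V \<subseteq> W \<and> (\<exists>a\<in>carrier R. \<exists>s\<in>carrier R. \<forall>Q\<in>V. s \<notin> Q \<and>
      \<sigma> Q = frac R Q a s)"
    if "P \<in> W" for P using assms(2)[OF that] by blast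
  then show ?thesis using assms(1) unfolding Spec_sec_def by simp
qed

lemma Spec_mult_at:
  assumes "openin (Zariski R) W" "P \<in> W" "a \<in> carrier R" "s \<in> carrier R - P" "b \<in> carrier R"
      "t \<in> carrier R - P"
    "\<sigma> P = frac R P a s" "\<tau> P = frac R P b t"
  shows "(\<sigma> \<otimes>\<^bsub>Spec_sec R W\<^esub> \<tau>) P = frac R P (a \<otimes> b) (s \<otimes> t)"
  using prime_of.mult_frac[OF prime_of[OF assms(1,2)] assms(3-6)] assms(2,7,8)
      by (simp add: Spec_sec_def)

lemma Spec_add_at:
  assumes "openin (Zariski R) W" "P \<in> W" "a \<in> carrier R" "s \<in> carrier R - P" "b \<in> carrier R"
      "t \<in> carrier R - P"
    "\<sigma> P = frac R P a s" "\<tau> P = frac R P b t"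
  shows "(\<sigma> \<oplus>\<^bsub>Spec_sec R W\<^esub> \<tau>) P = frac R P (a \<otimes> t \<oplus> b \<otimes> s) (s \<otimes> t)"
  using prime_of.add_frac[OF prime_of[OF assms(1,2)] assms(3-6)] assms(2,7,8)
      by (simp add: Spec_sec_def)

lemma Spec_deriv_at:
  assumes "openin (Zariski R) W" "P \<in> W" "a \<in> carrier R" "s \<in> carrier R - P" "\<sigma> P = frac R P a s"
  shows "Spec_deriv W \<sigma> P = frac R P (D a \<otimes> s \<ominus> a \<otimes> D s) (s \<otimes> s)"
  using D_frac[OF open_primes[OF assms(1,2)] assms(3,4)] assms(2,5) by (simp add: Spec_deriv_def)

lemma Spec_op_ext:
  "\<sigma> \<otimes>\<^bsub>Spec_sec R W\<^esub> \<tau> \<in> extensional W" "\<sigma> \<oplus>\<^bsub>Spec_sec R W\<^esub> \<tau> \<in> extensional W"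
      "Spec_deriv W \<sigma> \<in> extensional W"
  by (simp_all add: Spec_sec_def Spec_deriv_def)

lemma Spec_sec_E2:
  assumes "\<sigma> \<in> carrier (Spec_sec R W)" "\<tau> \<in> carrier (Spec_sec R W)" "P \<in> W"
  obtains V a s b t where "openin (Zariski R) V" "P \<in> V" "V \<subseteq> W" "a \<in> carrier R" "s \<in> carrier R"
      "b \<in> carrier R" "t \<in> carrier R"
    "\<And>Q. Q \<in> V \<Longrightarrow> s \<in> carrier R - Q" "\<And>Q. Q \<in> V \<Longrightarrow> \<sigma> Q = frac R Q a s"
    "\<And>Q. Q \<in> V \<Longrightarrow> t \<in> carrier R - Q" "\<And>Q. Q \<in> V \<Longrightarrow> \<tau> Q = frac R Q b t"
proof -
  obtain V a s where V: "openin (Zariski R) V" "P \<in> V" "V \<subseteq> W" "a \<in> carrier R" "s \<in> carrier R"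
    "\<And>Q. Q \<in> V \<Longrightarrow> s \<in> carrier R - Q" "\<And>Q. Q \<in> V \<Longrightarrow> \<sigma> Q = frac R Q a s"
        by (rule Spec_sec_E[OF assms(1,3)]) (rule that)
  obtain V' b t where V': "openin (Zariski R) V'" "P \<in> V'" "V' \<subseteq> W" "b \<in> carrier R" "t \<in> carrier R"
    "\<And>Q. Q \<in> V' \<Longrightarrow> t \<in> carrier R - Q" "\<And>Q. Q \<in> V' \<Longrightarrow> \<tau> Q = frac R Q b t"
        by (rule Spec_sec_E[OF assms(2,3)]) (rule that)
  show ?thesis by (rule that[of "V \<inter> V'" a s b t]) (use V V' in auto)
qed

lemma Spec_op_closed:
  assumes W: "openin (Zariski R) W" and \<sigma>: "\<sigma> \<in> carrier (Spec_sec R W)"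
      and \<tau>: "\<tau> \<in> carrier (Spec_sec R W)"
  shows "\<sigma> \<otimes>\<^bsub>Spec_sec R W\<^esub> \<tau> \<in> carrier (Spec_sec R W)" "\<sigma> \<oplus>\<^bsub>Spec_sec R W\<^esub> \<tau> \<in> carrier (Spec_sec R W)"
proof -
  have *: "(\<exists>V a s. openin (Zariski R) V \<and> P \<in> V \<and> V \<subseteq> W \<and> a \<in> carrier R \<and> s \<in> carrier R \<and>
      (\<forall>Q\<in>V. s \<notin> Q \<and> (\<sigma> \<otimes>\<^bsub>Spec_sec R W\<^esub> \<tau>) Q = frac R Q a s)) \<and>
     (\<exists>V a s. openin (Zariski R) V \<and> P \<in> V \<and> V \<subseteq> W \<and> a \<in> carrier R \<and> s \<in> carrier R \<and> (\<forall>Q\<in>V. s \<notin> Q \<and>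
         (\<sigma> \<oplus>\<^bsub>Spec_sec R W\<^esub> \<tau>) Q = frac R Q a s))"
    if P: "P \<in> W" for P
  proof -
    obtain V a s b t where V: "openin (Zariski R) V" "P \<in> V" "V \<subseteq> W" "a \<in> carrier R" "s \<in> carrier R"
        "b \<in> carrier R" "t \<in> carrier R"
      "\<And>Q. Q \<in> V \<Longrightarrow> s \<in> carrier R - Q" "\<And>Q. Q \<in> V \<Longrightarrow> \<sigma> Q = frac R Q a s"
      "\<And>Q. Q \<in> V \<Longrightarrow> t \<in> carrier R - Q" "\<And>Q. Q \<in> V \<Longrightarrow> \<tau> Q = frac R Q b t"
      by (rule Spec_sec_E2[OF \<sigma> \<tau> P]) (rule that)
    have st: "s \<otimes> t \<notin> Q" if Q: "Q \<in> V" for Q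
      using prime_of.mult_compl[OF prime_of[OF V(1) Q] V(8)[OF Q] V(10)[OF Q]] by blast
    have "\<forall>Q\<in>V. s \<otimes> t \<notin> Q \<and> (\<sigma> \<otimes>\<^bsub>Spec_sec R W\<^esub> \<tau>) Q = frac R Q (a \<otimes> b) (s \<otimes> t)"
      by (intro ballI conjI st Spec_mult_at[where \<sigma>=\<sigma> and \<tau>=\<tau>, OF W] V) (use V(3) in blast)+
    moreover have "\<forall>Q\<in>V. s \<otimes> t \<notin> Q \<and> (\<sigma> \<oplus>\<^bsub>Spec_sec R W\<^esub> \<tau>) Q = frac R Q (a \<otimes> t \<oplus> b \<otimes> s) (s \<otimes> t)"
      by (intro ballI conjI st Spec_add_at[where \<sigma>=\<sigma> and \<tau>=\<tau>, OF W] V) (use V(3) in blast)+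
    moreover have "a \<otimes> b \<in> carrier R" "a \<otimes> t \<oplus> b \<otimes> s \<in> carrier R" "s \<otimes> t \<in> carrier R" using V
        by auto
    ultimately show ?thesis using V(1-3) by blast
  qed
  show "\<sigma> \<otimes>\<^bsub>Spec_sec R W\<^esub> \<tau> \<in> carrier (Spec_sec R W)" "\<sigma> \<oplus>\<^bsub>Spec_sec R W\<^esub> \<tau> \<in> carrier (Spec_sec R W)"
    using * by (auto intro!: Spec_secI Spec_op_ext)
qed

text \<open>Where the section is a single fraction with denominator \<open>s\<close>, its derivative
  is a single fraction with denominator \<open>s \<otimes> s\<close> on the same open set.\<close>

lemma Spec_deriv_closed:
  assumes W: "openin (Zariski R) W" and \<sigma>: "\<sigma> \<in> carrier (Spec_sec R W)"
  shows "Spec_deriv W \<sigma> \<in> carrier (Spec_sec R W)"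
proof (rule Spec_secI[OF Spec_op_ext(3)])
  fix P assume P: "P \<in> W"
  obtain V a s where V: "openin (Zariski R) V" "P \<in> V" "V \<subseteq> W" "a \<in> carrier R" "s \<in> carrier R"
    "\<And>Q. Q \<in> V \<Longrightarrow> s \<in> carrier R - Q" "\<And>Q. Q \<in> V \<Longrightarrow> \<sigma> Q = frac R Q a s"
        by (rule Spec_sec_E[OF \<sigma> P]) (rule that)
  have "s \<otimes> s \<notin> Q" if Q: "Q \<in> V" for Q
    using prime_of.mult_compl[OF prime_of[OF V(1) Q] V(6)[OF Q] V(6)[OF Q]] by blast
  then have "\<forall>Q\<in>V. s \<otimes> s \<notin> Q \<and> Spec_deriv W \<sigma> Q = frac R Q (D a \<otimes> s \<ominus> a \<otimes> D s) (s \<otimes> s)"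
    using V(3) by (intro ballI conjI Spec_deriv_at[where \<sigma>=\<sigma>, OF W] V) blast+
  moreover have "D a \<otimes> s \<ominus> a \<otimes> D s \<in> carrier R" "s \<otimes> s \<in> carrier R" using V by auto
  ultimately show "\<exists>V a s. openin (Zariski R) V \<and> P \<in> V \<and> V \<subseteq> W \<and> a \<in> carrier R \<and> s \<in> carrier R \<and>
      (\<forall>Q\<in>V. s \<notin> Q \<and> Spec_deriv W \<sigma> Q = frac R Q a s)"
    using V(1-3) by blast
qed

lemma Spec_deriv_add:
  assumes W: "openin (Zariski R) W" and \<sigma>: "\<sigma> \<in> carrier (Spec_sec R W)"
      and \<tau>: "\<tau> \<in> carrier (Spec_sec R W)"
  shows "Spec_deriv W (\<sigma> \<oplus>\<^bsub>Spec_sec R W\<^esub> \<tau>) = Spec_deriv W \<sigma> \<oplus>\<^bsub>Spec_sec R W\<^esub> Spec_deriv W \<tau>"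
proof (rule extensionalityI[OF Spec_op_ext(3) Spec_op_ext(2)])
  fix P assume P: "P \<in> W"
  obtain V a s b t where V: "openin (Zariski R) V" "P \<in> V" "V \<subseteq> W" "a \<in> carrier R" "s \<in> carrier R"
      "b \<in> carrier R" "t \<in> carrier R"
      "\<And>Q. Q \<in> V \<Longrightarrow> s \<in> carrier R - Q" "\<And>Q. Q \<in> V \<Longrightarrow> \<sigma> Q = frac R Q a s"
      "\<And>Q. Q \<in> V \<Longrightarrow> t \<in> carrier R - Q" "\<And>Q. Q \<in> V \<Longrightarrow> \<tau> Q = frac R Q b t"
    by (rule Spec_sec_E2[OF \<sigma> \<tau> P]) (rule that)
  interpret prime_of R P by (rule prime_of[OF W P])
  note st = V(8)[OF V(2)] V(10)[OF V(2)]
  note stt = mult_compl[OF st] mult_compl[OF st(1) st(1)] mult_compl[OF st(2) st(2)]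
  note [simp] = V(4-7)
  have "Spec_deriv W (\<sigma> \<oplus>\<^bsub>Spec_sec R W\<^esub> \<tau>) P =
      frac R P (D (a \<otimes> t \<oplus> b \<otimes> s) \<otimes> (s \<otimes> t) \<ominus> (a \<otimes> t \<oplus> b \<otimes> s) \<otimes> D (s \<otimes> t)) ((s \<otimes> t) \<otimes> (s \<otimes> t))"
    by (rule Spec_deriv_at[where \<sigma>="\<sigma> \<oplus>\<^bsub>Spec_sec R W\<^esub> \<tau>", OF W P _ stt(1) Spec_add_at[where \<sigma>=\<sigma>
        and \<tau>=\<tau>, OF W P V(4) st(1) V(6) st(2) V(9)[OF V(2)] V(11)[OF V(2)]]]) simp
  also have "\<dots> = frac R P ((D a \<otimes> s \<ominus> a \<otimes> D s) \<otimes> (t \<otimes> t) \<oplus> (D b \<otimes> t \<ominus> b \<otimes> D t) \<otimes> (s \<otimes> s)) ((s \<otimes> s) \<otimes>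
      (t \<otimes> t))"
  proof (rule frac_eqI')
    show "(D (a \<otimes> t \<oplus> b \<otimes> s) \<otimes> (s \<otimes> t) \<ominus> (a \<otimes> t \<oplus> b \<otimes> s) \<otimes> D (s \<otimes> t)) \<otimes> ((s \<otimes> s) \<otimes> (t \<otimes> t)) =
      ((D a \<otimes> s \<ominus> a \<otimes> D s) \<otimes> (t \<otimes> t) \<oplus> (D b \<otimes> t \<ominus> b \<otimes> D t) \<otimes> (s \<otimes> s)) \<otimes> ((s \<otimes> t) \<otimes> (s \<otimes> t))"
      unfolding D_add[OF m_closed[OF V(4,7)] m_closed[OF V(6,5)]] D_mult[OF V(4,7)] D_mult[OF
          V(6,5)] D_mult[OF V(5,7)]
      by (rule quotient_rule_add) simp_all
  qed (use stt mult_compl in simp_all)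
  also have "\<dots> = (Spec_deriv W \<sigma> \<oplus>\<^bsub>Spec_sec R W\<^esub> Spec_deriv W \<tau>) P"
    by (rule Spec_add_at[where \<sigma>="Spec_deriv W \<sigma>" and \<tau>="Spec_deriv W \<tau>", OF W P _ stt(2) _ stt(3)
        Spec_deriv_at[where \<sigma>=\<sigma>, OF W P V(4) st(1) V(9)[OF V(2)]] Spec_deriv_at[where \<sigma>=\<tau>, OF W P
        V(6) st(2) V(11)[OF V(2)]], symmetric])
       simp_all
  finally show "Spec_deriv W (\<sigma> \<oplus>\<^bsub>Spec_sec R W\<^esub> \<tau>) P = (Spec_deriv W \<sigma> \<oplus>\<^bsub>Spec_sec R W\<^esub> Spec_deriv W \<tau>)
      P" .
qed

lemma Spec_deriv_mult:
  assumes W: "openin (Zariski R) W" and \<sigma>: "\<sigma> \<in> carrier (Spec_sec R W)"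
      and \<tau>: "\<tau> \<in> carrier (Spec_sec R W)"
  shows "Spec_deriv W (\<sigma> \<otimes>\<^bsub>Spec_sec R W\<^esub> \<tau>) =
    Spec_deriv W \<sigma> \<otimes>\<^bsub>Spec_sec R W\<^esub> \<tau> \<oplus>\<^bsub>Spec_sec R W\<^esub> \<sigma> \<otimes>\<^bsub>Spec_sec R W\<^esub> Spec_deriv W \<tau>"
proof (rule extensionalityI[OF Spec_op_ext(3) Spec_op_ext(2)])
  fix P assume P: "P \<in> W"
  obtain V a s b t where V: "openin (Zariski R) V" "P \<in> V" "V \<subseteq> W" "a \<in> carrier R" "s \<in> carrier R"
      "b \<in> carrier R" "t \<in> carrier R"
      "\<And>Q. Q \<in> V \<Longrightarrow> s \<in> carrier R - Q" "\<And>Q. Q \<in> V \<Longrightarrow> \<sigma> Q = frac R Q a s"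
      "\<And>Q. Q \<in> V \<Longrightarrow> t \<in> carrier R - Q" "\<And>Q. Q \<in> V \<Longrightarrow> \<tau> Q = frac R Q b t"
    by (rule Spec_sec_E2[OF \<sigma> \<tau> P]) (rule that)
  interpret prime_of R P by (rule prime_of[OF W P])
  note st = V(8)[OF V(2)] V(10)[OF V(2)]
  note fr = V(9)[OF V(2)] V(11)[OF V(2)]
  note stt = mult_compl[OF st] mult_compl[OF st(1) st(1)] mult_compl[OF st(2) st(2)]
  note sst = mult_compl[OF stt(2) st(2)] mult_compl[OF st(1) stt(3)]
  note [simp] = V(4-7)
  have "Spec_deriv W (\<sigma> \<otimes>\<^bsub>Spec_sec R W\<^esub> \<tau>) P =
      frac R P (D (a \<otimes> b) \<otimes> (s \<otimes> t) \<ominus> (a \<otimes> b) \<otimes> D (s \<otimes> t)) ((s \<otimes> t) \<otimes> (s \<otimes> t))"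
    by (rule Spec_deriv_at[where \<sigma>="\<sigma> \<otimes>\<^bsub>Spec_sec R W\<^esub> \<tau>", OF W P _ stt(1) Spec_mult_at[where \<sigma>=\<sigma>
        and \<tau>=\<tau>, OF W P V(4) st(1) V(6) st(2) fr]]) simp
  also have "\<dots> = frac R P (((D a \<otimes> s \<ominus> a \<otimes> D s) \<otimes> b) \<otimes> (s \<otimes> (t \<otimes> t)) \<oplus> (a \<otimes> (D b \<otimes> t \<ominus> b \<otimes> D t)) \<otimes>
      ((s \<otimes> s) \<otimes> t)) (((s \<otimes> s) \<otimes> t) \<otimes> (s \<otimes> (t \<otimes> t)))"
  proof (rule frac_eqI')
    show "(D (a \<otimes> b) \<otimes> (s \<otimes> t) \<ominus> (a \<otimes> b) \<otimes> D (s \<otimes> t)) \<otimes> (((s \<otimes> s) \<otimes> t) \<otimes> (s \<otimes> (t \<otimes> t))) =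
      (((D a \<otimes> s \<ominus> a \<otimes> D s) \<otimes> b) \<otimes> (s \<otimes> (t \<otimes> t)) \<oplus> (a \<otimes> (D b \<otimes> t \<ominus> b \<otimes> D t)) \<otimes> ((s \<otimes> s) \<otimes> t)) \<otimes> ((s
          \<otimes> t) \<otimes> (s \<otimes> t))"
      unfolding D_mult[OF V(4,6)] D_mult[OF V(5,7)] by (rule quotient_rule_mult) simp_all
  qed (use mult_compl[OF stt(1) stt(1)] mult_compl[OF sst] in simp_all)
  also have "\<dots> = (Spec_deriv W \<sigma> \<otimes>\<^bsub>Spec_sec R W\<^esub> \<tau> \<oplus>\<^bsub>Spec_sec R W\<^esub> \<sigma> \<otimes>\<^bsub>Spec_sec R W\<^esub> Spec_deriv W \<tau>) P"
    by (rule Spec_add_at[where \<sigma>="Spec_deriv W \<sigma> \<otimes>\<^bsub>Spec_sec R W\<^esub> \<tau>"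
        and \<tau>="\<sigma> \<otimes>\<^bsub>Spec_sec R W\<^esub> Spec_deriv W \<tau>", OF W P _ sst(1) _ sst(2)
          Spec_mult_at[where \<sigma>="Spec_deriv W \<sigma>"
              and \<tau>=\<tau>, OF W P _ stt(2) V(6) st(2) Spec_deriv_at[where \<sigma>=\<sigma>, OF W P V(4) st(1) fr(1)]
              fr(2)]
          Spec_mult_at[where \<sigma>=\<sigma> and \<tau>="Spec_deriv W \<tau>", OF W P V(4) st(1) _ stt(3) fr(1)
              Spec_deriv_at[where \<sigma>=\<tau>, OF W P V(6) st(2) fr(2)]], symmetric])
       simp_all
  finally show "Spec_deriv W (\<sigma> \<otimes>\<^bsub>Spec_sec R W\<^esub> \<tau>) P =
    (Spec_deriv W \<sigma> \<otimes>\<^bsub>Spec_sec R W\<^esub> \<tau> \<oplus>\<^bsub>Spec_sec R W\<^esub> \<sigma> \<otimes>\<^bsub>Spec_sec R W\<^esub> Spec_deriv W \<tau>) P" .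
qed

lemma Spec_deriv_restrict:
  "V \<subseteq> W \<Longrightarrow> Spec_deriv V (restrict \<sigma> V) = restrict (Spec_deriv W \<sigma>) V"
  by (auto simp: Spec_deriv_def restrict_def fun_eq_iff)

lemma restrict_closed:
  assumes W: "openin (Zariski R) V" "V \<subseteq> W" and \<sigma>: "\<sigma> \<in> carrier (Spec_sec R W)"
  shows "restrict \<sigma> V \<in> carrier (Spec_sec R V)"
proof (rule Spec_secI)
  fix P assume P: "P \<in> V"
  then have "P \<in> W" using W by blast
  then obtain Z a s where Z: "openin (Zariski R) Z" "P \<in> Z" "Z \<subseteq> W" "a \<in> carrier R" "s \<in> carrier R"
    "\<And>Q. Q \<in> Z \<Longrightarrow> s \<in> carrier R - Q" "\<And>Q. Q \<in> Z \<Longrightarrow> \<sigma> Q = frac R Q a s"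
        by (rule Spec_sec_E[OF \<sigma>]) (rule that)
  show "\<exists>Z a s. openin (Zariski R) Z \<and> P \<in> Z \<and> Z \<subseteq> V \<and> a \<in> carrier R \<and> s \<in> carrier R \<and>
      (\<forall>Q\<in>Z. s \<notin> Q \<and> restrict \<sigma> V Q = frac R Q a s)"
    using Z W P by (intro exI[of _ "Z \<inter> V"] exI[of _ a] exI[of _ s]) auto
qed simp

lemma Spec_cst_closed:
  assumes "c \<in> carrier R" "openin (Zariski R) W"
  shows "(\<lambda>P\<in>W. frac R P c \<one>) \<in> carrier (Spec_sec R W)"
proof (rule Spec_secI)
  fix P assume P: "P \<in> W"
  have "\<one> \<notin> Q" if "Q \<in> W" for Q
    using prime_of.one_compl[OF prime_of[OF assms(2) that]] by blast
  then show "\<exists>V a s. openin (Zariski R) V \<and> P \<in> V \<and> V \<subseteq> W \<and> a \<in> carrier R \<and> s \<in> carrier R \<and>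
      (\<forall>Q\<in>V. s \<notin> Q \<and> (\<lambda>P\<in>W. frac R P c \<one>) Q = frac R Q a s)"
    using assms P by (intro exI[of _ W] exI[of _ c] exI[of _ \<one>]) auto
qed simp

lemma Spec_deriv_cst:
  assumes "c \<in> carrier R" "openin (Zariski R) W"
  shows "Spec_deriv W (\<lambda>P\<in>W. frac R P c \<one>) = (\<lambda>P\<in>W. frac R P (D c) \<one>)"
proof (rule extensionalityI[OF Spec_op_ext(3)])
  fix P assume P: "P \<in> W"
  interpret prime_of R P by (rule prime_of[OF assms(2) P])
  have "Spec_deriv W (\<lambda>P\<in>W. frac R P c \<one>) P = frac R P (D c \<otimes> \<one> \<ominus> c \<otimes> D \<one>) (\<one> \<otimes> \<one>)"
    by (rule Spec_deriv_at[OF assms(2) P assms(1) one_compl]) (use P in simp)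
  then show "Spec_deriv W (\<lambda>P\<in>W. frac R P c \<one>) P = (\<lambda>P\<in>W. frac R P (D c) \<one>) P"
    using P assms(1) by (simp add: D_one a_minus_def)
qed simp

end

text \<open>The sheaf isomorphism \<open>\<phi>\<close> carries the quotient rule from the spectrum
  to \<open>U\<close>. It is indexed by open sets of the spectrum, so an open \<open>W\<close>
  inside \<open>U\<close> is addressed by its image under \<open>f\<close>. Injectivity of
  \<open>f\<close> makes \<open>W\<close> the full preimage of that image, and compatibility of
  \<open>\<phi>\<close> with restriction makes the result natural.\<close>

lemma (in K_ringed) chart_derivation:
  assumes chart: "affine_chart X U R \<iota>" and D: "ring_derivation R D" and \<iota>: "\<And>c. D (\<iota> c) = \<iota> (\<delta> c)"
  shows "\<exists>E. E \<in> derivs X \<delta> U"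
proof -
  interpret ring_derivation R D by fact
  have U: "opn U" and \<iota>R: "\<iota> c \<in> carrier R" for c
    using chart ring_hom_closed[of \<iota> K_ring R c] by (auto simp: affine_chart_def K_ring_def)
  obtain f \<phi> where f: "homeomorphic_map (subtopology (topo X) U) (Zariski R) f"
    and pre: "let pre = (\<lambda>V. {x \<in> pts (open_subspace X U). f x \<in> V}) in
       (\<forall>V. openin (Zariski R) V \<longrightarrow> \<phi> V \<in> ring_iso (Spec_sec R V) (Sect X (pre V))) \<and>
       (\<forall>V W. openin (Zariski R) V \<and> openin (Zariski R) W \<and> W \<subseteq> V \<longrightarrow>
          (\<forall>s\<in>carrier (Spec_sec R V). \<phi> W (restrict s W) = Rest X (pre V) (pre W) (\<phi> V s))) \<and>
       (\<forall>c. \<phi> (Spec_pts R) (\<lambda>P\<in>Spec_pts R. frac R P (\<iota> c) \<one>\<^bsub>R\<^esub>) = cst_on X U c)"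
    using chart unfolding affine_chart_def iso_over_K_def open_subspace_def Spec_def
    by (auto simp: Zariski_topspace)
  have ptsU: "pts (open_subspace X U) = U" using opn_sub[OF U] by (auto simp: open_subspace_def)
  have top: "topspace (subtopology (topo X) U) = U" using opn_sub[OF U] by auto
  have inj: "inj_on f U" using homeomorphic_imp_injective_map[OF f] top by simp
  have sub: "openin (subtopology (topo X) U) W" if "opn W" "W \<subseteq> U" for W
    using that U by (simp add: openin_open_subtopology)
  have img: "openin (Zariski R) (f ` W)" if "opn W" "W \<subseteq> U" for W
    using homeomorphic_imp_open_map[OF f] sub[OF that] unfolding open_map_def by blast
  have preimg: "{x \<in> U. f x \<in> f ` W} = W" if "W \<subseteq> U" for W
    using inj that by (auto simp: inj_on_def)
  have fU: "f ` U = Spec_pts R" using homeomorphic_imp_surjective_map[OF f] top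
      by (simp add: Zariski_topspace)
  have iso: "\<phi> (f ` W) \<in> ring_iso (Spec_sec R (f ` W)) (Sect X W)" if "opn W" "W \<subseteq> U" for W
    using pre img[OF that] unfolding Let_def ptsU using preimg[OF that(2)] by metis
  have nat: "\<phi> (f ` W) (restrict s (f ` W)) = Rest X V W (\<phi> (f ` V) s)"
    if V: "opn V" "opn W" "V \<subseteq> U" "W \<subseteq> V" and s: "s \<in> carrier (Spec_sec R (f ` V))" for V W s
  proof -
    have WU: "W \<subseteq> U" using V by blast
    have "f ` W \<subseteq> f ` V" using V(4) by blast
    then have "\<phi> (f ` W) (restrict s (f ` W)) = Rest X {x \<in> U. f x \<in> f ` V} {x \<in> U. f x \<in> f ` W} (\<phi>
        (f ` V) s)"
      using pre img[OF V(1,3)] img[OF V(2) WU] s unfolding Let_def ptsU by blast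
    then show ?thesis unfolding preimg[OF V(3)] preimg[OF WU] .
  qed
  have cst: "\<phi> (f ` W) (\<lambda>P\<in>f ` W. frac R P (\<iota> c) \<one>\<^bsub>R\<^esub>) = cst_on X W c" if W: "opn W" "W \<subseteq> U" for W c
  proof -
    have "(\<lambda>P\<in>f ` U. frac R P (\<iota> c) \<one>\<^bsub>R\<^esub>) \<in> carrier (Spec_sec R (f ` U))"
      by (rule Spec_cst_closed[OF \<iota>R img[OF U subset_refl]])
    from nat[OF U W(1) subset_refl W(2) this]
    have "\<phi> (f ` W) (restrict (\<lambda>P\<in>f ` U. frac R P (\<iota> c) \<one>\<^bsub>R\<^esub>) (f ` W)) = Rest X U W (cst_on X U c)"
      using pre unfolding Let_def fU by simp
    moreover have "restrict (\<lambda>P\<in>f ` U. frac R P (\<iota> c) \<one>\<^bsub>R\<^esub>) (f ` W) = (\<lambda>P\<in>f ` W. frac R P (\<iota> c) \<one>\<^bsub>R\<^esub>)"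
      using W(2) by (auto simp: restrict_def fun_eq_iff)
    ultimately show ?thesis using res_cst_on[OF U W] by simp
  qed
  define \<psi> where "\<psi> W = inv_into (carrier (Spec_sec R (f ` W))) (\<phi> (f ` W))" for W
  define E where "E W a = \<phi> (f ` W) (Spec_deriv (f ` W) (\<psi> W a))" for W a
  have bij: "bij_betw (\<phi> (f ` W)) (carrier (Spec_sec R (f ` W))) (carrier (Sect X W))"
    and hom: "\<phi> (f ` W) \<in> ring_hom (Spec_sec R (f ` W)) (Sect X W)" if "opn W" "W \<subseteq> U" for W
    using iso[OF that] by (auto simp: ring_iso_def)
  \<comment> \<open>The inverse hidden in \<open>\<psi>\<close> is used just here. Every section
    over \<open>W\<close> is a value of \<open>\<phi>\<close>, so \<open>E\<close> is handled from
    now on as the map that \<open>\<phi>\<close> intertwines with \<open>Spec_deriv\<close>.\<close>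
  have E\<phi>: "E W (\<phi> (f ` W) s) = \<phi> (f ` W) (Spec_deriv (f ` W) s)" if W: "opn W" "W \<subseteq> U"
      and s: "s \<in> carrier (Spec_sec R (f ` W))" for W s
    unfolding E_def \<psi>_def using inv_into_f_f[OF bij_betw_imp_inj_on[OF bij[OF W]] s] by simp
  have ex: "\<exists>s\<in>carrier (Spec_sec R (f ` W)). a = \<phi> (f ` W) s"
      if "opn W" "W \<subseteq> U" "a \<in> carrier (Sect X W)" for W a
    using bij_betw_imp_surj_on[OF bij[OF that(1,2)]] that(3) by blast
  have "on_opens X U E \<in> derivs X \<delta> U"
  proof (rule derivsI)
    fix W a b assume W: "opn W" "W \<subseteq> U" and a: "a \<in> carrier (Sect X W)"
    note h = ring_hom_closed[OF hom[OF W]] ring_hom_add[OF hom[OF W]] ring_hom_mult[OF hom[OF W]]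
    note d = Spec_deriv_closed[OF img[OF W]] Spec_op_closed[OF img[OF W]]
    obtain s where s: "s \<in> carrier (Spec_sec R (f ` W))" "a = \<phi> (f ` W) s" using ex[OF W a] by blast
    show "E W a \<in> carrier (Sect X W)" unfolding s(2) E\<phi>[OF W s(1)] by (intro h d s)
    assume b: "b \<in> carrier (Sect X W)"
    obtain t where t: "t \<in> carrier (Spec_sec R (f ` W))" "b = \<phi> (f ` W) t" using ex[OF W b] by blast
    have "E W (a \<oplus>\<^bsub>Sect X W\<^esub> b) = \<phi> (f ` W) (Spec_deriv (f ` W) (s \<oplus>\<^bsub>Spec_sec R (f ` W)\<^esub> t))"
      unfolding s(2) t(2) h(2)[OF s(1) t(1), symmetric] by (rule E\<phi>[OF W d(3)[OF s(1) t(1)]])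
    also have "\<dots> = E W a \<oplus>\<^bsub>Sect X W\<^esub> E W b"
      unfolding Spec_deriv_add[OF img[OF W] s(1) t(1)] s(2) t(2) E\<phi>[OF W s(1)] E\<phi>[OF W t(1)]
          by (intro h d s t)
    finally show "E W (a \<oplus>\<^bsub>Sect X W\<^esub> b) = E W a \<oplus>\<^bsub>Sect X W\<^esub> E W b" .
    have "E W (a \<otimes>\<^bsub>Sect X W\<^esub> b) = \<phi> (f ` W) (Spec_deriv (f ` W) (s \<otimes>\<^bsub>Spec_sec R (f ` W)\<^esub> t))"
      unfolding s(2) t(2) h(3)[OF s(1) t(1), symmetric] by (rule E\<phi>[OF W d(2)[OF s(1) t(1)]])
    also have "\<dots> = E W a \<otimes>\<^bsub>Sect X W\<^esub> b \<oplus>\<^bsub>Sect X W\<^esub> a \<otimes>\<^bsub>Sect X W\<^esub> E W b"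
      unfolding Spec_deriv_mult[OF img[OF W] s(1) t(1)] s(2) t(2) E\<phi>[OF W s(1)] E\<phi>[OF W t(1)]
        h(2)[OF d(2)[OF d(1)[OF s(1)] t(1)] d(2)[OF s(1) d(1)[OF t(1)]]]
        h(3)[OF d(1)[OF s(1)] t(1)] h(3)[OF s(1) d(1)[OF t(1)]] ..
    finally show "E W (a \<otimes>\<^bsub>Sect X W\<^esub> b) = E W a \<otimes>\<^bsub>Sect X W\<^esub> b \<oplus>\<^bsub>Sect X W\<^esub> a \<otimes>\<^bsub>Sect X W\<^esub> E W b" .
  next
    fix W c assume W: "opn W" "W \<subseteq> U"
    have "E W (cst_on X W c) = \<phi> (f ` W) (Spec_deriv (f ` W) (\<lambda>P\<in>f ` W. frac R P (\<iota> c) \<one>\<^bsub>R\<^esub>))"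
      unfolding cst[OF W, symmetric] by (rule E\<phi>[OF W Spec_cst_closed[OF \<iota>R img[OF W]]])
    then show "E W (cst_on X W c) = cst_on X W (\<delta> c)"
      unfolding Spec_deriv_cst[OF \<iota>R img[OF W]] \<iota> cst[OF W] .
  next
    fix V W a assume V: "opn V" "opn W" "V \<subseteq> U" "W \<subseteq> V" and a: "a \<in> carrier (Sect X V)"
    have WU: "W \<subseteq> U" and fWV: "f ` W \<subseteq> f ` V" using V by blast+
    obtain s where s: "s \<in> carrier (Spec_sec R (f ` V))" "a = \<phi> (f ` V) s" using ex[OF V(1,3) a]
        by blast
    have "E W (Rest X V W a) = E W (\<phi> (f ` W) (restrict s (f ` W)))"
      unfolding s(2) nat[OF V s(1)] ..
    also have "\<dots> = \<phi> (f ` W) (restrict (Spec_deriv (f ` V) s) (f ` W))"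
      unfolding Spec_deriv_restrict[OF fWV, symmetric]
      by (rule E\<phi>[OF V(2) WU restrict_closed[OF img[OF V(2) WU] fWV s(1)]])
    also have "\<dots> = Rest X V W (E V a)"
      unfolding s(2) E\<phi>[OF V(1,3) s(1)] by (rule nat[OF V Spec_deriv_closed[OF img[OF V(1,3)]
          s(1)]])
    finally show "E W (Rest X V W a) = Rest X V W (E V a)" .
  qed
  then show ?thesis by blast
qed

section \<open>Extending a derivation to a standard smooth algebra\<close>

lemma K_ring_simps [simp]:
  "carrier K_ring = UNIV" "mult K_ring = (*)" "one K_ring = 1" "zero K_ring = 0" "add K_ring = (+)"
  by (simp_all add: K_ring_def)

lemma K_ring_cring: "cring K_ring"
proof (rule cringI)
  show "abelian_group K_ring"
    by (rule abelian_groupI) (auto simp: algebra_simps, metis add.right_inverse)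
  show "Group.comm_monoid K_ring"
    by (rule comm_monoidI) (auto simp: algebra_simps)
qed (simp add: algebra_simps)

text \<open>Subtracting the term at \<open>m\<close> removes exactly \<open>m\<close> from the
  support. The predicate \<open>Q\<close> on monomials keeps the induction inside the polynomials in
  the first \<open>n\<close> variables.\<close>

lemma poly_induct [consumes 1, case_names zero add]:
  fixes p :: "('m \<Rightarrow>\<^sub>0 'c::ab_group_add)"
  assumes "\<forall>m\<in>Poly_Mapping.keys p. Q m" and "P 0"
    and "\<And>p m c. \<lbrakk>\<forall>m\<in>Poly_Mapping.keys p. Q m; Q m; P p\<rbrakk> \<Longrightarrow> P (p + Poly_Mapping.single m c)"
  shows "P p"
proof -
  have "finite A \<Longrightarrow> Poly_Mapping.keys p = A \<Longrightarrow> \<forall>m\<in>A. Q m \<Longrightarrow> P p" for A p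
  proof (induction A arbitrary: p rule: finite_induct)
    case empty
    then show ?case using assms(2) by simp
  next
    case (insert m A)
    define q where "q = p - Poly_Mapping.single m (Poly_Mapping.lookup p m)"
    have lq: "Poly_Mapping.lookup q k = (if k = m then 0 else Poly_Mapping.lookup p k)" for k
      by (simp add: q_def lookup_minus lookup_single)
    have "Poly_Mapping.keys q = A"
    proof (rule Set.set_eqI)
      fix k
      have "k \<in> Poly_Mapping.keys p \<longleftrightarrow> k = m \<or> k \<in> A" using insert.prems(1) by simp
      then show "k \<in> Poly_Mapping.keys q \<longleftrightarrow> k \<in> A" using insert.hyps(2)
          by (auto simp: in_keys_iff lq)
    qed
    then have "P (q + Poly_Mapping.single m (Poly_Mapping.lookup p m))"
      using insert by (intro assms(3)) auto
    then show ?case by (simp add: q_def)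
  qed
  from this[OF finite_keys refl assms(1)] show ?thesis .
qed

subsection \<open>Derivations of the polynomial ring\<close>

text \<open>The clause on \<open>mpolys n\<close> is included because the point at which a
  polynomial is evaluated is controlled in its first \<open>n\<close> coordinates alone.\<close>

definition poly_derivation :: "('k::field_char_0 mpoly \<Rightarrow> 'k mpoly) \<Rightarrow> bool" where
  "poly_derivation T \<longleftrightarrow> (\<forall>p q. T (p + q) = T p + T q) \<and> (\<forall>p q. T (p * q) = T p * q + p * T q) \<and>
     (\<forall>n. T ` mpolys n \<subseteq> mpolys n)"

text \<open>Both sides of the Leibniz rule are additive in each factor, so it is enough to check
  products of two single terms.\<close>

lemma poly_derivationI:
  assumes add: "\<And>p q. T (p + q) = T p + T q"
    and single: "\<And>m a m' b. T (Poly_Mapping.single m a * Poly_Mapping.single m' b) =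
      T (Poly_Mapping.single m a) * Poly_Mapping.single m' b + Poly_Mapping.single m a * T
          (Poly_Mapping.single m' b)"
    and cl: "\<And>n p. p \<in> mpolys n \<Longrightarrow> T p \<in> mpolys n"
  shows "poly_derivation T"
proof -
  have T0: "T 0 = 0" using add[of 0 0] by simp
  have 1: "T (Poly_Mapping.single m a * q) = T (Poly_Mapping.single m a) * q + Poly_Mapping.single m
      a * T q" for m a q
  proof -
    have "\<forall>m\<in>Poly_Mapping.keys q. True" by simp
    then show ?thesis
      by (induction q rule: poly_induct) (simp_all add: T0 add single distrib_left distrib_right
          add_ac)
  qed
  have "T (p * q) = T p * q + p * T q" for p q
  proof -
    have "\<forall>m\<in>Poly_Mapping.keys p. True" by simp
    then show ?thesis
      by (induction p rule: poly_induct) (simp_all add: T0 add 1 distrib_left distrib_right add_ac)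
  qed
  then show ?thesis unfolding poly_derivation_def using add cl by blast
qed

lemma keys_sum_subset: "finite A \<Longrightarrow> Poly_Mapping.keys (sum f A) \<subseteq> (\<Union>a\<in>A. Poly_Mapping.keys (f a))"
  for f :: "'i \<Rightarrow> ('m \<Rightarrow>\<^sub>0 'c::comm_monoid_add)"
proof (induction A rule: finite_induct)
  case (insert a A)
  then show ?case using keys_add[of "f a" "sum f A"] by auto
qed simp

lemma mpolys_closed:
  "p \<in> mpolys n \<Longrightarrow> q \<in> mpolys n \<Longrightarrow> p + q \<in> mpolys n"
  "p \<in> mpolys n \<Longrightarrow> q \<in> mpolys n \<Longrightarrow> p - q \<in> mpolys n"
  "p \<in> mpolys n \<Longrightarrow> q \<in> mpolys n \<Longrightarrow> p * q \<in> mpolys n"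
  "0 \<in> mpolys n" "Poly_Mapping.keys m \<subseteq> {..<n} \<Longrightarrow> Poly_Mapping.single m a \<in> mpolys n"
proof -
  show "p + q \<in> mpolys n" if "p \<in> mpolys n" "q \<in> mpolys n"
    using that keys_add[of p q] by (auto simp: mpolys_def)
  show "p - q \<in> mpolys n" if "p \<in> mpolys n" "q \<in> mpolys n"
  proof -
    have "Poly_Mapping.keys (p - q) \<subseteq> Poly_Mapping.keys p \<union> Poly_Mapping.keys q"
      by (auto simp: in_keys_iff lookup_minus)
    then show ?thesis using that unfolding mpolys_def by blast
  qed
  show "p * q \<in> mpolys n" if pq: "p \<in> mpolys n" "q \<in> mpolys n"
    unfolding mpolys_def
  proof (safe)
    fix m k assume "m \<in> Poly_Mapping.keys (p * q)" "k \<in> Poly_Mapping.keys m"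
    then obtain a b where "m = a + b" "a \<in> Poly_Mapping.keys p" "b \<in> Poly_Mapping.keys q"
        using keys_mult[of p q] by blast
    then show "k < n" using pq \<open>k \<in> _\<close> keys_add[of a b] unfolding mpolys_def by blast
  qed
qed (auto simp: mpolys_def)

lemma mpoly_deriv_superset:
  assumes "finite A" "Poly_Mapping.keys p \<subseteq> A"
  shows "mpoly_deriv j p = (\<Sum>m\<in>A. Poly_Mapping.single (m - Poly_Mapping.single j 1)
       (of_nat (Poly_Mapping.lookup m j) * Poly_Mapping.lookup p m))"
  unfolding mpoly_deriv_def using assms by (intro sum.mono_neutral_left) (auto simp: in_keys_iff)

lemma mpoly_deriv_single:
  "mpoly_deriv j (Poly_Mapping.single m a) = Poly_Mapping.single (m - Poly_Mapping.single j 1)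
      (of_nat (Poly_Mapping.lookup m j) * a)"
  using mpoly_deriv_superset[of "{m}" "Poly_Mapping.single m a" j] by simp

lemma poly_derivation_partial: "poly_derivation (mpoly_deriv j :: 'k::field_char_0 mpoly \<Rightarrow> _)"
proof (rule poly_derivationI)
  fix p q :: "'k mpoly"
  let ?A = "Poly_Mapping.keys p \<union> Poly_Mapping.keys q"
  show "mpoly_deriv j (p + q) = mpoly_deriv j p + mpoly_deriv j q"
    using mpoly_deriv_superset[of ?A p j] mpoly_deriv_superset[of ?A q j] mpoly_deriv_superset[of ?A
        "p + q" j] keys_add[of p q]
    by (simp add: lookup_add distrib_left single_add sum.distrib)
next
  fix m m' :: "nat \<Rightarrow>\<^sub>0 nat" and a b :: 'k
  let ?e = "Poly_Mapping.single j (1::nat)"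
  \<comment> \<open>Subtraction of exponents is truncated, so \<open>u + v - ?e\<close> and
    \<open>u - ?e + v\<close> may differ when the variable \<open>j\<close> does not occur in
    \<open>u\<close>. In that case the coefficient is zero and the exponent is irrelevant.\<close>
  have shift: "Poly_Mapping.single (u + v - ?e) (of_nat (Poly_Mapping.lookup u j) * c) =
     Poly_Mapping.single (u - ?e + v) (of_nat (Poly_Mapping.lookup u j) * c)" for u v :: "nat \<Rightarrow>\<^sub>0
         nat" and c :: 'k
  proof (cases "Poly_Mapping.lookup u j = 0")
    case False
    have "u + v - ?e = u - ?e + v"
      by (rule poly_mapping_eqI) (use False in \<open>auto simp: lookup_add lookup_minus lookup_single
          when_def\<close>)
    then show ?thesis by simp
  qed simp
  have "mpoly_deriv j (Poly_Mapping.single m a * Poly_Mapping.single m' b) =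
      Poly_Mapping.single (m + m' - ?e) (of_nat (Poly_Mapping.lookup m j) * (a * b)) +
      Poly_Mapping.single (m' + m - ?e) (of_nat (Poly_Mapping.lookup m' j) * (a * b))"
    by (simp add: mult_single mpoly_deriv_single lookup_add distrib_right single_add add.commute[of
        m' m])
  also have "\<dots> = mpoly_deriv j (Poly_Mapping.single m a) * Poly_Mapping.single m' b +
       Poly_Mapping.single m a * mpoly_deriv j (Poly_Mapping.single m' b)"
    unfolding shift by (simp add: mult_single mpoly_deriv_single add.commute[of m
        "m' - Poly_Mapping.single j (Suc 0)"] mult.assoc mult.left_commute)
  finally show "mpoly_deriv j (Poly_Mapping.single m a * Poly_Mapping.single m' b) =
       mpoly_deriv j (Poly_Mapping.single m a) * Poly_Mapping.single m' b +
       Poly_Mapping.single m a * mpoly_deriv j (Poly_Mapping.single m' b)" .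
next
  fix n and p :: "'k mpoly" assume p: "p \<in> mpolys n"
  have "Poly_Mapping.keys (m - Poly_Mapping.single j 1) \<subseteq> Poly_Mapping.keys m" for m :: "nat \<Rightarrow>\<^sub>0 nat"
    by (auto simp: in_keys_iff lookup_minus)
  then show "mpoly_deriv j p \<in> mpolys n"
    using p keys_sum_subset[OF finite_keys, of "\<lambda>m. Poly_Mapping.single (m - Poly_Mapping.single j
        1) (of_nat (Poly_Mapping.lookup m j) * Poly_Mapping.lookup p m)" p]
    unfolding mpolys_def mpoly_deriv_def by (fastforce split: if_splits)
qed

lemma poly_derivation_coeffs:
  assumes \<delta>: "field_derivation \<delta>" shows "poly_derivation (Poly_Mapping.map \<delta>)"
proof -
  have add: "\<delta> (a + b) = \<delta> a + \<delta> b" and mult: "\<delta> (a * b) = \<delta> a * b + a * \<delta> b" for a b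
    using \<delta> by (auto simp: field_derivation_def)
  have \<delta>0: "\<delta> 0 = 0" using add[of 0 0] by simp
  \<comment> \<open>\<open>Poly_Mapping.map\<close> keeps zero coefficients at zero; as
    \<open>\<delta> 0 = 0\<close>, it acts as \<open>\<delta>\<close> on every coefficient.\<close>
  have l: "Poly_Mapping.lookup (Poly_Mapping.map \<delta> p) m = \<delta> (Poly_Mapping.lookup p m)"
      for p :: "'b \<Rightarrow>\<^sub>0 _" and m
    using \<delta>0 by (simp add: Poly_Mapping.map.rep_eq when_def)
  show ?thesis
  proof (rule poly_derivationI)
    show "Poly_Mapping.map \<delta> (p + q) = Poly_Mapping.map \<delta> p + Poly_Mapping.map \<delta> q" for p q
      by (rule poly_mapping_eqI) (simp add: l lookup_add add)
    show "Poly_Mapping.map \<delta> (Poly_Mapping.single m a * Poly_Mapping.single m' b) =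
       Poly_Mapping.map \<delta> (Poly_Mapping.single m a) * Poly_Mapping.single m' b +
       Poly_Mapping.single m a * Poly_Mapping.map \<delta> (Poly_Mapping.single m' b)" for m a m' b
      by (simp add: mult_single \<delta>0 mult single_add)
    show "Poly_Mapping.map \<delta> p \<in> mpolys n" if "p \<in> mpolys n" for n p
    proof -
      have "Poly_Mapping.keys (Poly_Mapping.map \<delta> p) \<subseteq> Poly_Mapping.keys p"
        using \<delta>0 by (auto simp: in_keys_iff l)
      then show ?thesis using that unfolding mpolys_def by blast
    qed
  qed
qed

subsection \<open>Evaluation of polynomials\<close>

locale poly_eval = plain_cring R for R :: "'a ring" (structure) +
  fixes \<iota> :: "'k::field_char_0 \<Rightarrow> 'a" and x :: "nat \<Rightarrow> 'a" and n :: nat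
  assumes \<iota>: "\<iota> \<in> ring_hom K_ring R" and x: "j < n \<Longrightarrow> x j \<in> carrier R"
begin

abbreviation "ev \<equiv> mpoly_eval R \<iota> x"
abbreviation "xpow (m :: nat \<Rightarrow>\<^sub>0 nat) \<equiv> \<Otimes>\<^bsub>R\<^esub>j\<in>Poly_Mapping.keys m. x j [^]\<^bsub>R\<^esub> Poly_Mapping.lookup m j"
abbreviation "mons \<equiv> {m :: nat \<Rightarrow>\<^sub>0 nat. Poly_Mapping.keys m \<subseteq> {..<n}}"

lemma xpow_closed: "m \<in> mons \<Longrightarrow> xpow m \<in> carrier R"
  using x by (intro finprod_closed) auto

lemma \<iota>_simps: "\<iota> c \<in> carrier R" "\<iota> (a * b) = \<iota> a \<otimes> \<iota> b" "\<iota> (a + b) = \<iota> a \<oplus> \<iota> b" "\<iota> 1 = \<one>"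
  using ring_hom_closed[OF \<iota>] ring_hom_mult[OF \<iota>] ring_hom_add[OF \<iota>] ring_hom_one[OF \<iota>] by auto

text \<open>A polynomial is an element of the free module on the monomials, and evaluation extends
  \<open>m \<mapsto> xpow m\<close> semilinearly along \<open>\<iota>\<close>. Additivity of
  \<open>ev\<close> is thus an instance of the general theory; multiplicativity is proved by
  induction over terms.\<close>

sublocale sl: semilinear K_ring R \<iota> mons "\<lambda>m. xpow m"
proof (intro semilinear.intro semilinear_axioms.intro plain_homI K_ring_cring \<iota>)
  show "cring R" ..
qed (rule xpow_closed)

lemma mpolys_iff: "p \<in> mpolys n \<longleftrightarrow> Poly_Mapping.lookup p \<in> carrier (free_mod K_ring mons)"
  by (auto simp: mpolys_def free_mod_carrier in_keys_iff)

lemma ev_eq: "ev p = semilin K_ring R \<iota> (\<lambda>m. xpow m) (Poly_Mapping.lookup p)"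
  by (simp add: mpoly_eval_def semilin_def keys.rep_eq)

lemma ev_closed: "p \<in> mpolys n \<Longrightarrow> ev p \<in> carrier R"
  unfolding ev_eq mpolys_iff by (rule sl.semilin_closed)

lemma ev_add: "p \<in> mpolys n \<Longrightarrow> q \<in> mpolys n \<Longrightarrow> ev (p + q) = ev p \<oplus> ev q"
  unfolding ev_eq mpolys_iff
  by (simp add: sl.semilin_add[symmetric]) (simp add: plus_poly_mapping.rep_eq)

lemma ev_single:
  assumes "m \<in> mons" shows "ev (Poly_Mapping.single m c) = \<iota> c \<otimes> xpow m"
proof -
  have "Poly_Mapping.lookup (Poly_Mapping.single m c) = c \<odot>\<^bsub>sl.F\<^esub> gen K_ring m"
    by (auto simp: lookup_single gen_def fun_eq_iff when_def)
  then show ?thesis unfolding ev_eq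
    using sl.semilin_smult[of "gen K_ring m" c] sl.semilin_gen[OF assms] sl.R.gen_closed[OF assms]
        by simp
qed

lemma xpow_superset: "m \<in> mons \<Longrightarrow> xpow m = (\<Otimes>j\<in>{..<n}. x j [^] Poly_Mapping.lookup m j)"
  using x by (intro finprod_mono_neutral_cong_left) (auto simp: in_keys_iff)

lemma xpow_add:
  assumes "m \<in> mons" "m' \<in> mons" shows "xpow (m + m') = xpow m \<otimes> xpow m'"
proof -
  have "m + m' \<in> mons" using assms keys_add[of m m'] by auto
  then have "xpow (m + m') = (\<Otimes>j\<in>{..<n}. x j [^] Poly_Mapping.lookup (m + m') j)"
    by (rule xpow_superset)
  also have "\<dots> = (\<Otimes>j\<in>{..<n}. x j [^] Poly_Mapping.lookup m j \<otimes> x j [^] Poly_Mapping.lookup m' j)"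
    using x unfolding lookup_add by (intro finprod_cong') (auto simp: nat_pow_mult)
  also have "\<dots> = xpow m \<otimes> xpow m'"
    unfolding xpow_superset[OF assms(1)] xpow_superset[OF assms(2)] using x
        by (intro finprod_multf) auto
  finally show ?thesis .
qed

lemma mpolys_induct [consumes 1, case_names zero add]:
  assumes "p \<in> mpolys n" "P 0"
    "\<And>p m c. \<lbrakk>p \<in> mpolys n; m \<in> mons; P p\<rbrakk> \<Longrightarrow> P (p + Poly_Mapping.single m c)"
  shows "P p"
proof -
  have "\<forall>m\<in>Poly_Mapping.keys p. m \<in> mons" using assms(1) by (auto simp: mpolys_def)
  then show ?thesis
    by (induction p rule: poly_induct) (use assms(2,3) in \<open>auto simp: mpolys_def\<close>)
qed

lemma ev_zero: "ev 0 = \<zero>" by (simp add: mpoly_eval_def)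

lemma ev_mult:
  assumes p: "p \<in> mpolys n" and q: "q \<in> mpolys n" shows "ev (p * q) = ev p \<otimes> ev q"
proof -
  have 1: "ev (Poly_Mapping.single m a * q) = ev (Poly_Mapping.single m a) \<otimes> ev q" if m: "m \<in> mons"
      and q: "q \<in> mpolys n" for m a q
    using q
  proof (induction q rule: mpolys_induct)
    case zero
    then show ?case using m by (simp add: ev_zero ev_closed mpolys_closed)
  next
    case (add q m' c)
    have mm: "m + m' \<in> mons" using m add keys_add[of m m'] by auto
    have s: "Poly_Mapping.single m a \<in> mpolys n" "Poly_Mapping.single m' c \<in> mpolys n" using m add
        by (auto intro: mpolys_closed)
    have "ev (Poly_Mapping.single m a * Poly_Mapping.single m' c) =
        ev (Poly_Mapping.single m a) \<otimes> ev (Poly_Mapping.single m' c)"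
      using m add mm xpow_closed by (simp add: mult_single ev_single xpow_add \<iota>_simps m_ac)
    then show ?case using add s
      by (simp add: distrib_left ev_add mpolys_closed r_distr ev_closed)
  qed
  show ?thesis using p
  proof (induction p rule: mpolys_induct)
    case zero
    then show ?case using q by (simp add: ev_zero ev_closed)
  next
    case (add p m c)
    have s: "Poly_Mapping.single m c \<in> mpolys n" using add by (auto intro: mpolys_closed)
    then show ?case using add q 1
      by (simp add: distrib_right ev_add mpolys_closed l_distr ev_closed)
  qed
qed

lemma ev_const: "ev (Poly_Mapping.single 0 c) = \<iota> c"
  using ev_single[of 0 c] \<iota>_simps by simp

lemma const_mpolys: "Poly_Mapping.single 0 c \<in> mpolys n"
  by (rule mpolys_closed) simp

subsection \<open>Derivations over the evaluation map\<close>

text \<open>A derivation of the polynomial ring into \<open>R\<close>, regarded as a module over it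
  through \<open>ev\<close>. Such maps can be multiplied by elements of \<open>R\<close>, so the
  coefficients of the correction need not be lifted to polynomials.\<close>

definition ev_derivation :: "('k mpoly \<Rightarrow> 'a) \<Rightarrow> bool" where
  "ev_derivation F \<longleftrightarrow> (\<forall>p\<in>mpolys n. F p \<in> carrier R) \<and>
     (\<forall>p\<in>mpolys n. \<forall>q\<in>mpolys n. F (p + q) = F p \<oplus> F q) \<and>
     (\<forall>p\<in>mpolys n. \<forall>q\<in>mpolys n. F (p * q) = F p \<otimes> ev q \<oplus> ev p \<otimes> F q)"

lemma ev_derivation_D:
  assumes "ev_derivation F" "p \<in> mpolys n"
  shows "F p \<in> carrier R" "q \<in> mpolys n \<Longrightarrow> F (p + q) = F p \<oplus> F q"
    "q \<in> mpolys n \<Longrightarrow> F (p * q) = F p \<otimes> ev q \<oplus> ev p \<otimes> F q"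
  using assms by (auto simp: ev_derivation_def)

lemma ev_derivation_poly:
  assumes "poly_derivation T" shows "ev_derivation (\<lambda>p. ev (T p))"
proof -
  have T: "T p \<in> mpolys n" if "p \<in> mpolys n" for p using assms that unfolding poly_derivation_def
      by blast
  show ?thesis using assms T unfolding ev_derivation_def
    by (auto simp: ev_closed ev_add ev_mult mpolys_closed poly_derivation_def)
qed

lemma ev_derivation_smult:
  assumes F: "ev_derivation F" and y: "y \<in> carrier R" shows "ev_derivation (\<lambda>p. F p \<otimes> y)"
  unfolding ev_derivation_def using y
  by (auto simp: ev_derivation_D[OF F] ev_closed l_distr m_assoc m_comm[of y])

lemma ev_derivation_add:
  assumes F: "ev_derivation F" and G: "ev_derivation G" shows "ev_derivation (\<lambda>p. F p \<oplus> G p)"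
  unfolding ev_derivation_def
  by (auto simp: ev_derivation_D[OF F] ev_derivation_D[OF G] ev_closed l_distr r_distr a_ac)

lemma ev_derivation_zero: "ev_derivation (\<lambda>p. \<zero>)"
  by (auto simp: ev_derivation_def ev_closed)

text \<open>The terms \<open>F j p\<close> are known to lie in \<open>R\<close> for \<open>p\<close>
  in \<open>mpolys n\<close>, hence the default value elsewhere.\<close>

lemma ev_derivation_finsum:
  fixes c :: nat
  assumes "\<And>j. j < c \<Longrightarrow> ev_derivation (F j)" shows
      "ev_derivation (\<lambda>p. if p \<in> mpolys n then \<Oplus>j\<in>{..<c}. F j p else \<zero>)"
  using assms
proof (induction c)
  case 0
  then show ?case using ev_derivation_zero by (simp add: ev_derivation_def)
next
  case (Suc c)
  have *: "(\<Oplus>j\<in>{..<Suc c}. F j p) = F c p \<oplus> (\<Oplus>j\<in>{..<c}. F j p)" if "p \<in> mpolys n" for p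
    using Suc.prems that by (simp add: lessThan_Suc ev_derivation_D(1))
  have "ev_derivation (\<lambda>p. F c p \<oplus> (if p \<in> mpolys n then \<Oplus>j\<in>{..<c}. F j p else \<zero>))"
    using Suc by (intro ev_derivation_add) auto
  then show ?case using * by (simp add: ev_derivation_def mpolys_closed)
qed

text \<open>In the Leibniz rule for \<open>g i * f i\<close> one summand contains
  \<open>ev (f i)\<close> and the other \<open>F (f i)\<close>, and both vanish. A derivation that
  kills the relations thus kills the ideal they generate, which allows it to descend to
  \<open>R\<close>.\<close>

lemma ev_derivation_ideal:
  fixes c :: nat
  assumes F: "ev_derivation F" and f: "\<And>i. i < c \<Longrightarrow> f i \<in> mpolys n" "\<And>i. i < c \<Longrightarrow> ev (f i) = \<zero>"
      "\<And>i. i < c \<Longrightarrow> F (f i) = \<zero>"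
    and g: "\<And>i. i < c \<Longrightarrow> g i \<in> mpolys n"
  shows "(\<Sum>i<c. g i * f i) \<in> mpolys n \<and> F (\<Sum>i<c. g i * f i) = \<zero>"
  using f g
proof (induction c)
  case 0
  have "F 0 \<in> carrier R" "F 0 = F 0 \<oplus> F 0"
    using ev_derivation_D(1)[OF F mpolys_closed(4)] ev_derivation_D(2)[OF F mpolys_closed(4)
        mpolys_closed(4)] by simp_all
  then have "F 0 = \<zero>" by simp
  then show ?case by (simp add: mpolys_closed)
next
  case (Suc c)
  then have IH: "(\<Sum>i<c. g i * f i) \<in> mpolys n" "F (\<Sum>i<c. g i * f i) = \<zero>" by auto
  have gf: "g c \<in> mpolys n" "f c \<in> mpolys n" "g c * f c \<in> mpolys n" using Suc.prems
      by (auto intro: mpolys_closed)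
  have "F (g c * f c) = \<zero>"
    using ev_derivation_D(3)[OF F gf(1,2)] ev_derivation_D(1)[OF F gf(1)] ev_closed[OF gf(1)]
        Suc.prems by simp
  then show ?case using IH gf ev_derivation_D(2)[OF F IH(1) gf(3)] by (simp add: mpolys_closed)
qed

end

section \<open>Correction by the inverse Jacobian\<close>

lemma (in cring) finsum_swap:
  fixes c d :: nat
  assumes "\<And>i j. i < c \<Longrightarrow> j < d \<Longrightarrow> h i j \<in> carrier R"
  shows "(\<Oplus>i\<in>{..<c}. \<Oplus>j\<in>{..<d}. h i j) = (\<Oplus>j\<in>{..<d}. \<Oplus>i\<in>{..<c}. h i j)"
  using assms
proof (induction c)
  case (Suc c)
  have "(\<Oplus>i\<in>{..<Suc c}. \<Oplus>j\<in>{..<d}. h i j) = (\<Oplus>j\<in>{..<d}. h c j) \<oplus> (\<Oplus>i\<in>{..<c}. \<Oplus>j\<in>{..<d}. h i j)"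
    using Suc.prems by (simp add: lessThan_Suc Pi_def)
  also have "\<dots> = (\<Oplus>j\<in>{..<d}. h c j) \<oplus> (\<Oplus>j\<in>{..<d}. \<Oplus>i\<in>{..<c}. h i j)"
    using Suc by simp
  also have "\<dots> = (\<Oplus>j\<in>{..<d}. h c j \<oplus> (\<Oplus>i\<in>{..<c}. h i j))"
    using Suc.prems by (intro finsum_addf[symmetric]) (auto simp: Pi_def)
  also have "\<dots> = (\<Oplus>j\<in>{..<d}. \<Oplus>i\<in>{..<Suc c}. h i j)"
    using Suc.prems by (intro finsum_cong') (auto simp: lessThan_Suc Pi_def)
  finally show ?case .
qed simp

text \<open>The coefficientwise derivation is corrected by \<open>\<Sum> y\<^sub>j \<partial>/\<partial>x\<^sub>j\<close>; since the Jacobian is invertible,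
  the \<open>y\<^sub>j\<close> can be chosen such that the result annihilates the relations.\<close>

lemma standard_smooth_derivation:
  fixes \<delta> :: "'k::field_char_0 \<Rightarrow> 'k"
  assumes R: "cring R" and \<iota>: "\<iota> \<in> ring_hom K_ring R" and \<delta>: "field_derivation \<delta>"
      and smooth: "standard_smooth R \<iota>"
  shows "\<exists>D. ring_derivation R D \<and> (\<forall>c. D (\<iota> c) = \<iota> (\<delta> c))"
proof -
  interpret plain_cring R by (simp add: plain_cring_def R)
  obtain n c f x B where c: "c \<le> n" "\<forall>i<c. f i \<in> mpolys n" "\<forall>j<n. x j \<in> carrier R"
    and surj: "mpoly_eval R \<iota> x ` mpolys n = carrier R"
    and ker: "\<forall>p\<in>mpolys n. mpoly_eval R \<iota> x p = \<zero>\<^bsub>R\<^esub> \<longleftrightarrow> (\<exists>g. (\<forall>i<c. g i \<in> mpolys n) \<and>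
        p = (\<Sum>i<c. g i * f i))"
    and B: "\<forall>i<c. \<forall>j<c. B i j \<in> carrier R"
    and J: "\<forall>i<c. \<forall>k<c. (\<Oplus>\<^bsub>R\<^esub>j\<in>{..<c}. mpoly_eval R \<iota> x (mpoly_deriv j (f i)) \<otimes>\<^bsub>R\<^esub> B j k) = (if i =
        k then \<one>\<^bsub>R\<^esub> else \<zero>\<^bsub>R\<^esub>)"
    using smooth unfolding standard_smooth_def Let_def by (elim exE conjE) (rule that)
  interpret poly_eval R \<iota> x n by unfold_locales (use \<iota> c in auto)
  define w where "w k = ev (Poly_Mapping.map \<delta> (f k))" for k
  \<comment> \<open>The corrected derivation kills every \<open>f i\<close> if
    \<open>J y = - w\<close>, where \<open>J\<close> is the Jacobian and \<open>w\<close> the value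
    of the coefficientwise derivation on the relations. As \<open>J B\<close> is the identity,
    \<open>y = - B w\<close> is a solution.\<close>
  define y where "y j = (\<ominus>\<^bsub>R\<^esub> (\<Oplus>\<^bsub>R\<^esub>k\<in>{..<c}. B j k \<otimes>\<^bsub>R\<^esub> w k))" for j
  have der\<delta>: "ev_derivation (\<lambda>p. ev (Poly_Mapping.map \<delta> p))"
    by (rule ev_derivation_poly[OF poly_derivation_coeffs[OF \<delta>]])
  have derj: "ev_derivation (\<lambda>p. ev (mpoly_deriv j p))" for j
    by (rule ev_derivation_poly[OF poly_derivation_partial])
  have wc: "w k \<in> carrier R" if "k < c" for k
    unfolding w_def using ev_derivation_D(1)[OF der\<delta>] c that by simp
  have Bw: "B j k \<otimes>\<^bsub>R\<^esub> w k \<in> carrier R" if "j < c" "k < c" for j k using B wc that by simp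
  have yc: "y j \<in> carrier R" if "j < c" for j unfolding y_def using Bw that by (auto simp: Pi_def)
  define E where "E p = ev (Poly_Mapping.map \<delta> p) \<oplus>\<^bsub>R\<^esub> (if p \<in> mpolys n then \<Oplus>\<^bsub>R\<^esub>j\<in>{..<c}. ev
      (mpoly_deriv j p) \<otimes>\<^bsub>R\<^esub> y j else \<zero>\<^bsub>R\<^esub>)" for p
  have E: "ev_derivation E"
    unfolding E_def by (intro ev_derivation_add der\<delta> ev_derivation_finsum ev_derivation_smult derj
        yc)
  have evf: "ev (f i) = \<zero>\<^bsub>R\<^esub>" if i: "i < c" for i
  proof -
    \<comment> \<open>The unit vector at \<open>i\<close> presents \<open>f i\<close> as a
      combination of the relations, so the description of the kernel applies to it.\<close>
    have sum: "(\<Sum>k<c. (if i = k then 1 else 0) * f k) = f i"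
      using i by (simp add: if_distrib[of "\<lambda>z. z * _"] cong: if_cong)
    have one: "(1 :: 'k mpoly) \<in> mpolys n"
      unfolding single_one[symmetric] by (rule mpolys_closed) simp
    have "\<exists>g. (\<forall>i<c. g i \<in> mpolys n) \<and> f i = (\<Sum>i<c. g i * f i)"
      by (rule exI[of _ "\<lambda>k. if i = k then 1 else 0"]) (simp add: sum one mpolys_closed(4))
    moreover have "f i \<in> mpolys n" using c(2) i by simp
    ultimately show ?thesis using ker by simp
  qed
  have Ef: "E (f i) = \<zero>\<^bsub>R\<^esub>" if i: "i < c" for i
  proof -
    let ?J = "\<lambda>j. ev (mpoly_deriv j (f i))"
    have Jc: "?J j \<in> carrier R" for j using ev_derivation_D(1)[OF derj] c i by simp
    have "(\<Oplus>\<^bsub>R\<^esub>j\<in>{..<c}. ?J j \<otimes>\<^bsub>R\<^esub> y j) = (\<Oplus>\<^bsub>R\<^esub>j\<in>{..<c}. (\<ominus>\<^bsub>R\<^esub> \<one>\<^bsub>R\<^esub>) \<otimes>\<^bsub>R\<^esub> (\<Oplus>\<^bsub>R\<^esub>k\<in>{..<c}. ?J j \<otimes>\<^bsub>R\<^esub> (B j k \<otimes>\<^bsub>R\<^esub> w k)))"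
    proof (rule finsum_cong'[OF refl])
      show "?J j \<otimes>\<^bsub>R\<^esub> y j = (\<ominus>\<^bsub>R\<^esub> \<one>\<^bsub>R\<^esub>) \<otimes>\<^bsub>R\<^esub> (\<Oplus>\<^bsub>R\<^esub>k\<in>{..<c}. ?J j \<otimes>\<^bsub>R\<^esub> (B j k \<otimes>\<^bsub>R\<^esub> w k))" if "j \<in> {..<c}" for j
        using that Bw Jc by (subst finsum_rdistr[symmetric]) (auto simp: y_def Pi_def r_minus
            l_minus)
    qed (use Bw Jc in \<open>auto simp: Pi_def\<close>)
    also have "\<dots> = (\<ominus>\<^bsub>R\<^esub> \<one>\<^bsub>R\<^esub>) \<otimes>\<^bsub>R\<^esub> (\<Oplus>\<^bsub>R\<^esub>j\<in>{..<c}. \<Oplus>\<^bsub>R\<^esub>k\<in>{..<c}. ?J j \<otimes>\<^bsub>R\<^esub> (B j k \<otimes>\<^bsub>R\<^esub> w k))"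
      using Bw Jc by (intro finsum_rdistr[symmetric]) (auto simp: Pi_def)
    also have "(\<Oplus>\<^bsub>R\<^esub>j\<in>{..<c}. \<Oplus>\<^bsub>R\<^esub>k\<in>{..<c}. ?J j \<otimes>\<^bsub>R\<^esub> (B j k \<otimes>\<^bsub>R\<^esub> w k)) =
        (\<Oplus>\<^bsub>R\<^esub>k\<in>{..<c}. \<Oplus>\<^bsub>R\<^esub>j\<in>{..<c}. ?J j \<otimes>\<^bsub>R\<^esub> (B j k \<otimes>\<^bsub>R\<^esub> w k))"
      using Bw Jc by (intro finsum_swap) auto
    also have "\<dots> = (\<Oplus>\<^bsub>R\<^esub>k\<in>{..<c}. if i = k then w k else \<zero>\<^bsub>R\<^esub>)"
    proof (rule finsum_cong'[OF refl])
      show "(\<Oplus>\<^bsub>R\<^esub>j\<in>{..<c}. ?J j \<otimes>\<^bsub>R\<^esub> (B j k \<otimes>\<^bsub>R\<^esub> w k)) = (if i = k then w k else \<zero>\<^bsub>R\<^esub>)" if k: "k \<in> {..<c}"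
          for k
      proof -
        have "(\<Oplus>\<^bsub>R\<^esub>j\<in>{..<c}. ?J j \<otimes>\<^bsub>R\<^esub> (B j k \<otimes>\<^bsub>R\<^esub> w k)) = (\<Oplus>\<^bsub>R\<^esub>j\<in>{..<c}. ?J j \<otimes>\<^bsub>R\<^esub> B j k) \<otimes>\<^bsub>R\<^esub> w k"
          using B Jc wc k by (subst finsum_ldistr) (auto simp: Pi_def m_assoc intro!: finsum_cong')
        then show ?thesis using J i k wc by auto
      qed
    qed (use wc in auto)
    also have "\<dots> = w i"
      using i wc by (subst finsum_singleton) auto
    finally have "(\<Oplus>\<^bsub>R\<^esub>j\<in>{..<c}. ?J j \<otimes>\<^bsub>R\<^esub> y j) = \<ominus>\<^bsub>R\<^esub> w i" using wc[OF i] by (simp add: l_minus)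
    then show ?thesis unfolding E_def w_def[symmetric] using c i wc[OF i] by (simp add: r_neg)
  qed
  \<comment> \<open>The difference \<open>p - q\<close> lies in the kernel of evaluation, which is
    the ideal of the \<open>f i\<close>, and \<open>E\<close> kills this ideal. So \<open>E\<close>
    depends on the value \<open>ev p\<close> alone, and the choice of a preimage in the definition
    of \<open>D\<close> is immaterial.\<close>
  have E_cong: "E p = E q" if p: "p \<in> mpolys n" and q: "q \<in> mpolys n" and eq: "ev p = ev q" for p q
  proof -
    have d: "p - q \<in> mpolys n" using p q by (rule mpolys_closed)
    have "ev (p - q) \<oplus>\<^bsub>R\<^esub> ev q = ev q" using ev_add[OF d q] eq by simp
    then have "ev (p - q) = \<zero>\<^bsub>R\<^esub>" using ev_closed d q by simp
    then obtain g where g: "\<forall>i<c. g i \<in> mpolys n" "p - q = (\<Sum>i<c. g i * f i)" using ker d by blast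
    have "E (p - q) = \<zero>\<^bsub>R\<^esub>"
      unfolding g(2) using ev_derivation_ideal[OF E, of c f g] c g evf Ef by blast
    then show ?thesis using ev_derivation_D(2)[OF E d q] ev_derivation_D(1)[OF E q] by simp
  qed
  define D where "D a = E (SOME p. p \<in> mpolys n \<and> ev p = a)" for a
  have D: "D (ev p) = E p" if p: "p \<in> mpolys n" for p
  proof -
    have "(SOME q. q \<in> mpolys n \<and> ev q = ev p) \<in> mpolys n \<and> ev (SOME q. q \<in> mpolys n \<and>
        ev q = ev p) = ev p"
      by (rule someI) (use p in simp)
    then show ?thesis unfolding D_def using E_cong[OF _ p] by blast
  qed
  have ex: "\<exists>p\<in>mpolys n. a = ev p" if "a \<in> carrier R" for a using surj that by blast
  have "ring_derivation R D"
  proof unfold_locales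
    fix a assume a: "a \<in> carrier R"
    then obtain p where p: "p \<in> mpolys n" "a = ev p" using ex by blast
    then show "D a \<in> carrier R" using D ev_derivation_D(1)[OF E] by simp
    fix b assume b: "b \<in> carrier R"
    then obtain q where q: "q \<in> mpolys n" "b = ev q" using ex by blast
    show "D (a \<oplus>\<^bsub>R\<^esub> b) = D a \<oplus>\<^bsub>R\<^esub> D b"
      using p q D mpolys_closed(1)[OF p(1) q(1)]
          by (simp add: ev_add[symmetric] ev_derivation_D(2)[OF E])
    show "D (a \<otimes>\<^bsub>R\<^esub> b) = D a \<otimes>\<^bsub>R\<^esub> b \<oplus>\<^bsub>R\<^esub> a \<otimes>\<^bsub>R\<^esub> D b"
      using p q D mpolys_closed(3)[OF p(1) q(1)]
          by (simp add: ev_mult[symmetric] ev_derivation_D(3)[OF E])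
  qed
  moreover have "D (\<iota> a) = \<iota> (\<delta> a)" for a
  proof -
    have "\<delta> 0 + \<delta> 0 = \<delta> 0" using \<delta> unfolding field_derivation_def by (metis add_0)
    then have \<delta>0: "\<delta> 0 = 0" by simp
    \<comment> \<open>Partial derivatives kill constants, so the correction leaves the values on the
      field untouched and the coefficientwise \<open>\<delta>\<close> is what remains.\<close>
    have dj: "mpoly_deriv j (Poly_Mapping.single 0 a) = 0" for j by (simp add: mpoly_deriv_single)
    have "(\<Oplus>\<^bsub>R\<^esub>j\<in>{..<c}. ev (mpoly_deriv j (Poly_Mapping.single 0 a)) \<otimes>\<^bsub>R\<^esub> y j) = \<zero>\<^bsub>R\<^esub>"
      using yc by (intro add.finprod_one_eqI) (auto simp: dj ev_zero)
    then have "E (Poly_Mapping.single 0 a) = \<iota> (\<delta> a)"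
      unfolding E_def using const_mpolys[of a] \<iota>_simps(1) by (simp add: \<delta>0 ev_const)
    then show ?thesis using D[OF const_mpolys[of a]] by (simp add: ev_const)
  qed
  ultimately show ?thesis by blast
qed

section \<open>The lifting criterion\<close>

text \<open>Taking every affine open set on which \<open>\<delta>\<close> extends avoids a choice of
  chart at each point. That these sets cover follows from the standard smooth charts, whose
  derivations \<open>chart_derivation\<close> transfers to \<open>X\<close>.\<close>

lemma (in K_ringed) smooth_derivation_cover:
  assumes "field_derivation \<delta>" "smooth X"
  obtains \<V> D where "open_cover (topo X) \<V>" "\<And>V. V \<in> \<V> \<Longrightarrow> affine_open X V \<and> D V \<in> derivs X \<delta> V"
proof -
  define \<V> where "\<V> = {V. affine_open X V \<and> (\<exists>E. E \<in> derivs X \<delta> V)}"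
  have o: "opn V" if "V \<in> \<V>" for V
    using that by (auto simp: \<V>_def affine_open_def affine_chart_def)
  have "\<exists>V\<in>\<V>. p \<in> V" if p: "p \<in> pts X" for p
  proof -
    obtain U R \<iota> where U: "p \<in> U" and chart: "affine_chart X U R \<iota>" and R: "standard_smooth R \<iota>"
      using assms(2) p unfolding smooth_def by blast
    have "cring R" "\<iota> \<in> ring_hom K_ring R" using chart by (simp_all add: affine_chart_def)
    then obtain D where "ring_derivation R D" "\<And>c. D (\<iota> c) = \<iota> (\<delta> c)"
      using standard_smooth_derivation[OF _ _ assms(1) R] by blast
    then have "\<exists>E. E \<in> derivs X \<delta> U" by (rule chart_derivation[OF chart])
    then show ?thesis using U chart unfolding \<V>_def affine_open_def by blast
  qed
  then have "\<Union>\<V> = pts X" using o opn_sub by blast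
  then have "open_cover (topo X) \<V>" using o by (simp add: open_cover_def)
  moreover have "V \<in> \<V> \<Longrightarrow> affine_open X V \<and> (SOME E. E \<in> derivs X \<delta> V) \<in> derivs X \<delta> V" for V
    unfolding \<V>_def by (auto intro: someI_ex[of "\<lambda>E. E \<in> derivs X \<delta> V"])
  ultimately show ?thesis by (rule that)
qed

theorem theorem6p6:
  fixes \<delta> :: "'k::field_char_0 \<Rightarrow> 'k"
    and X :: "('p, 'a, 'k) kspace"
    and \<omega> :: "'p \<Rightarrow> ('p set \<times> ('a \<Rightarrow> 'a) set) set"
  assumes "field_derivation \<delta>"
    and "variety X" and "smooth X"
    and "\<omega> \<in> H0 X (Omega X)"
  shows "(\<exists>\<eta> \<in> H0 X (Omega_tau X \<delta>). lambda X (pts X) \<eta> = \<omega>) \<longleftrightarrow>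
    cup X (KS_class X \<delta>) \<omega> = \<zero>\<^bsub>H1 (topo X) (Str X)\<^esub>"
proof -
  interpret K_ringed X
    using assms(2) by unfold_locales (simp add: variety_def scheme_over_K_def)
  interpret global_form X \<omega>
    using assms(4) by unfold_locales (simp add: H0_def)
  obtain \<V> D where "open_cover (topo X) \<V>" "\<And>V. V \<in> \<V> \<Longrightarrow> affine_open X V \<and> D V \<in> derivs X \<delta> V"
    by (rule smooth_derivation_cover[OF assms(1,3)]) (rule that)
  from lifts_iff_cup_zero[OF this] show ?thesis by (simp only: H0_def)
qed

end
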